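(* Let $n\ge 1$. Assume $s_1,s_2,s$ are real numbers and $1<p,p_1,p_2<\infty$ are real numbers satisfying (i) $s_i\geq s$ for $i=1,2$; (ii) $\min\{s_1,s_2\}\geq 0$ and $s<0$; (iii) $s_i-s\geq n\left(\frac{1}{p_i}-\frac{1}{p}\right)$ for $i=1,2$; (iv) $s_1+s_2-s>n\left(\frac{1}{p_1}+\frac{1}{p_2}-\frac{1}{p}\right)\geq 0$; (v) $s_1+s_2>n\left(\frac{1}{p_1}+\frac{1}{p_2}-1\right)$ (strict inequality). Then pointwise multiplication of functions extends uniquely to a continuous bilinear map $$W^{s_1,p_1}(\mathbb{R}^n)\times W^{s_2,p_2}(\mathbb{R}^n)\rightarrow W^{s,p}(\mathbb{R}^n).$$
   Context: Sobolev-Slobodeckij spaces on $\mathbb{R}^n$, for $1<p<\infty$: for $k\in\mathbb{N}_0$, $W^{k,p}(\mathbb{R}^n)$ is the set of $u\in L^p(\mathbb{R}^n)$ with $\|u\|_{W^{k,p}}:=\sum_{|\nu|\le k}\|\partial^\nu u\|_{L^p}<\infty$ (weak derivatives). For $\theta\in(0,1)$ put $|u|_{W^{\theta,p}}:=\left(\iint_{\mathbb{R}^n\times\mathbb{R}^n}\frac{|u(x)-u(y)|^p}{|x-y|^{n+\theta p}}\,dx\,dy\right)^{1/p}$. For $s=k+\theta$ with $k\in\mathbb{N}_0$, $\theta\in(0,1)$, $W^{s,p}(\mathbb{R}^n)$ is the set of $u\in W^{k,p}(\mathbb{R}^n)$ with $\|u\|_{W^{s,p}}:=\|u\|_{W^{k,p}}+\sum_{|\nu|=k}|\partial^\nu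 u|_{W^{\theta,p}}<\infty$. For $s<0$, $W^{s,p}(\mathbb{R}^n):=(W^{-s,p'}(\mathbb{R}^n))^*$ (topological dual with the dual norm), $\frac1p+\frac1{p'}=1$, where a function $f\in C_c^\infty(\mathbb{R}^n)$ is identified with the functional $\psi\mapsto\int f\psi\,dx$. $C_c^\infty(\mathbb{R}^n)$ is dense in every $W^{s,p}(\mathbb{R}^n)$, $s\in\mathbb{R}$, $1<p<\infty$. "Pointwise multiplication extends uniquely to a continuous bilinear map" means that there is exactly one continuous bilinear map between the indicated spaces that agrees with $(u,v)\mapsto uv$ for $u,v\in C_c^\infty(\mathbb{R}^n)$. *)

theory Defs
  imports "HOL-Analysis.Analysis"
begin

text \<open>Real-valued measurable functions on \<open>\<real>\<^sup>n\<close> (with \<open>n = CARD('n)\<close>) modulo equality almost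
  everywhere. Every Sobolev space of nonnegative order is a linear subspace of this type.\<close>

definition ae_rel :: "(real ^ 'n::finite \<Rightarrow> real) \<Rightarrow> (real ^ 'n \<Rightarrow> real) \<Rightarrow> bool" where
  "ae_rel f g \<longleftrightarrow> f \<in> borel_measurable lborel \<and> g \<in> borel_measurable lborel \<and>
     (AE x in lborel. f x = g x)"

quotient_type 'n L0 = "real ^ 'n::finite \<Rightarrow> real" / partial: "ae_rel"
proof (rule part_equivpI)
  show "\<exists>f. ae_rel (f :: real ^ 'n \<Rightarrow> real) f"
    by (rule exI[of _ "\<lambda>_. 0"]) (simp add: ae_rel_def)
  show "symp (ae_rel :: (real ^ 'n \<Rightarrow> real) \<Rightarrow> _)"
    by (auto simp: symp_def ae_rel_def)
  show "transp (ae_rel :: (real ^ 'n \<Rightarrow> real) \<Rightarrow> _)"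
    unfolding transp_def ae_rel_def by (auto)
qed

instantiation L0 :: (finite) real_vector
begin

lift_definition zero_L0 :: "'a L0" is "\<lambda>_. 0"
  by (simp add: ae_rel_def)

lift_definition plus_L0 :: "'a L0 \<Rightarrow> 'a L0 \<Rightarrow> 'a L0" is "\<lambda>f g x. f x + g x"
  unfolding ae_rel_def by (auto)

lift_definition minus_L0 :: "'a L0 \<Rightarrow> 'a L0 \<Rightarrow> 'a L0" is "\<lambda>f g x. f x - g x"
  unfolding ae_rel_def by (auto)

lift_definition uminus_L0 :: "'a L0 \<Rightarrow> 'a L0" is "\<lambda>f x. - f x"
  unfolding ae_rel_def by (auto)

lift_definition scaleR_L0 :: "real \<Rightarrow> 'a L0 \<Rightarrow> 'a L0" is "\<lambda>c f x. c * f x"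
  unfolding ae_rel_def by (auto)

instance
  by standard (transfer; auto simp: ae_rel_def algebra_simps)+

end

text \<open>Multi-indices are functions \<open>\<nu> :: 'n \<Rightarrow> nat\<close>.\<close>

definition mi_order :: "('n::finite \<Rightarrow> nat) \<Rightarrow> nat" where
  "mi_order \<nu> = (\<Sum>i\<in>UNIV. \<nu> i)"

definition partial_deriv :: "'n::finite \<Rightarrow> (real ^ 'n \<Rightarrow> real) \<Rightarrow> real ^ 'n \<Rightarrow> real" where
  "partial_deriv i f x = deriv (\<lambda>t. f (x + t *\<^sub>R axis i 1)) 0"

text \<open>The order in which the partial derivatives are taken is left unspecified; for smooth \<open>f\<close>,
  the only functions to which this is applied, it is immaterial.\<close>

definition mderiv :: "('n::finite \<Rightarrow> nat) \<Rightarrow> (real ^ 'n \<Rightarrow> real) \<Rightarrow> real ^ 'n \<Rightarrow> real" where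
  "mderiv \<nu> f = foldr partial_deriv (SOME is. \<forall>i. count_list is i = \<nu> i) f"

text \<open>Differentiability of all iterated partial derivatives makes them all continuous.\<close>

definition smooth :: "(real ^ 'n::finite \<Rightarrow> real) \<Rightarrow> bool" where
  "smooth f \<longleftrightarrow> (\<forall>is x. foldr partial_deriv is f differentiable (at x))"

definition Cc_infty :: "(real ^ 'n::finite \<Rightarrow> real) set" where
  "Cc_infty = {f. smooth f \<and> compact (closure {x. f x \<noteq> 0})}"

definition locally_integrable :: "(real ^ 'n::finite \<Rightarrow> real) \<Rightarrow> bool" where
  "locally_integrable f \<longleftrightarrow> (\<forall>K. compact K \<longrightarrow> set_integrable lborel K f)"

definition has_weak_deriv ::
    "('n::finite \<Rightarrow> nat) \<Rightarrow> (real ^ 'n \<Rightarrow> real) \<Rightarrow> (real ^ 'n \<Rightarrow> real) \<Rightarrow> bool" where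
  "has_weak_deriv \<nu> f g \<longleftrightarrow> locally_integrable f \<and> locally_integrable g \<and>
     (\<forall>\<phi>\<in>Cc_infty. (\<integral>x. f x * mderiv \<nu> \<phi> x \<partial>lborel) =
                      (-1) ^ mi_order \<nu> * (\<integral>x. g x * \<phi> x \<partial>lborel))"

definition weak_deriv :: "('n::finite \<Rightarrow> nat) \<Rightarrow> 'n L0 \<Rightarrow> 'n L0" where
  "weak_deriv \<nu> u = (THE g. has_weak_deriv \<nu> (rep_L0 u) (rep_L0 g))"

definition Lp :: "real \<Rightarrow> 'n::finite L0 set" where
  "Lp p = {u. integrable lborel (\<lambda>x. \<bar>rep_L0 u x\<bar> powr p)}"

definition Lp_norm :: "real \<Rightarrow> 'n::finite L0 \<Rightarrow> real" where
  "Lp_norm p u = (\<integral>x. \<bar>rep_L0 u x\<bar> powr p \<partial>lborel) powr (1 / p)"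

text \<open>The \<open>p\<close>-th power of the seminorm \<open>|u|\<close> of \<open>W\<^sup>\<theta>\<^sup>,\<^sup>p\<close>. On the diagonal the integrand is \<open>0 / 0 = 0\<close>,
  but the diagonal is a null set.\<close>

definition slobodeckij_int :: "real \<Rightarrow> real \<Rightarrow> 'n::finite L0 \<Rightarrow> ennreal" where
  "slobodeckij_int \<theta> p u =
     (\<integral>\<^sup>+ (x, y). ennreal (\<bar>rep_L0 u x - rep_L0 u y\<bar> powr p /
                        norm (x - y) powr (real CARD('n) + \<theta> * p)) \<partial>(lborel \<Otimes>\<^sub>M lborel))"

definition slobodeckij_seminorm :: "real \<Rightarrow> real \<Rightarrow> 'n::finite L0 \<Rightarrow> real" where
  "slobodeckij_seminorm \<theta> p u = enn2real (slobodeckij_int \<theta> p u) powr (1 / p)"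

definition sobolev_nat :: "nat \<Rightarrow> real \<Rightarrow> 'n::finite L0 set" where
  "sobolev_nat k p = {u \<in> Lp p. \<forall>\<nu>. mi_order \<nu> \<le> k \<longrightarrow>
     (\<exists>g\<in>Lp p. has_weak_deriv \<nu> (rep_L0 u) (rep_L0 g))}"

definition sobolev_nat_norm :: "nat \<Rightarrow> real \<Rightarrow> 'n::finite L0 \<Rightarrow> real" where
  "sobolev_nat_norm k p u = (\<Sum>\<nu> | mi_order \<nu> \<le> k. Lp_norm p (weak_deriv \<nu> u))"

text \<open>\<open>W\<^sup>s\<^sup>,\<^sup>p\<close> and its norm for \<open>s \<ge> 0\<close>, where \<open>s = k + \<theta>\<close> with \<open>k = \<lfloor>s\<rfloor>\<close> and \<open>\<theta> = frac s\<close>.\<close>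

definition sobolev :: "real \<Rightarrow> real \<Rightarrow> 'n::finite L0 set" where
  "sobolev s p =
     (if frac s = 0 then sobolev_nat (nat \<lfloor>s\<rfloor>) p
      else {u \<in> sobolev_nat (nat \<lfloor>s\<rfloor>) p.
              \<forall>\<nu>. mi_order \<nu> = nat \<lfloor>s\<rfloor> \<longrightarrow> slobodeckij_int (frac s) p (weak_deriv \<nu> u) < \<infinity>})"

definition sobolev_norm :: "real \<Rightarrow> real \<Rightarrow> 'n::finite L0 \<Rightarrow> real" where
  "sobolev_norm s p u =
     (if frac s = 0 then sobolev_nat_norm (nat \<lfloor>s\<rfloor>) p u
      else sobolev_nat_norm (nat \<lfloor>s\<rfloor>) p u +
           (\<Sum>\<nu> | mi_order \<nu> = nat \<lfloor>s\<rfloor>. slobodeckij_seminorm (frac s) p (weak_deriv \<nu> u)))"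

definition conj_exponent :: "real \<Rightarrow> real" where
  "conj_exponent p = p / (p - 1)"

text \<open>\<open>W\<^sup>s\<^sup>,\<^sup>p\<close> for \<open>s < 0\<close>: the continuous linear functionals on \<open>W\<^sup>-\<^sup>s\<^sup>,\<^sup>p\<^sup>'\<close>, with the dual norm.
  Functionals are extended by \<open>0\<close> outside of \<open>W\<^sup>-\<^sup>s\<^sup>,\<^sup>p\<^sup>'\<close>, so that equality of functionals is equality of
  HOL functions and the vector space operations of the dual are the pointwise ones.\<close>

definition sobolev_neg :: "real \<Rightarrow> real \<Rightarrow> ('n::finite L0 \<Rightarrow> real) set" where
  "sobolev_neg s p = (let W = sobolev (- s) (conj_exponent p);
                          N = sobolev_norm (- s) (conj_exponent p) in
     {F. (\<forall>\<psi>. \<psi> \<notin> W \<longrightarrow> F \<psi> = 0) \<and>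
         (\<forall>\<psi>\<in>W. \<forall>\<phi>\<in>W. F (\<psi> + \<phi>) = F \<psi> + F \<phi>) \<and>
         (\<forall>c. \<forall>\<psi>\<in>W. F (c *\<^sub>R \<psi>) = c * F \<psi>) \<and>
         (\<forall>\<psi>\<in>W. \<forall>\<epsilon>>0. \<exists>\<delta>>0. \<forall>\<phi>\<in>W. N (\<phi> - \<psi>) < \<delta> \<longrightarrow> \<bar>F \<phi> - F \<psi>\<bar> < \<epsilon>)})"

definition sobolev_neg_norm :: "real \<Rightarrow> real \<Rightarrow> ('n::finite L0 \<Rightarrow> real) \<Rightarrow> real" where
  "sobolev_neg_norm s p F =
     (SUP \<psi> \<in> {\<psi> \<in> sobolev (- s) (conj_exponent p). sobolev_norm (- s) (conj_exponent p) \<psi> \<le> 1}. \<bar>F \<psi>\<bar>)"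

definition function_as_functional ::
    "real \<Rightarrow> real \<Rightarrow> (real ^ 'n::finite \<Rightarrow> real) \<Rightarrow> 'n L0 \<Rightarrow> real" where
  "function_as_functional s p f \<psi> =
     (if \<psi> \<in> sobolev (- s) (conj_exponent p) then \<integral>x. f x * rep_L0 \<psi> x \<partial>lborel else 0)"

text \<open>Continuous bilinear maps \<open>W\<^bsup>s1,p1\<^esup> \<times> W\<^bsup>s2,p2\<^esup> \<rightarrow> W\<^bsup>s,p\<^esup>\<close> for \<open>s1, s2 \<ge> 0 > s\<close>.\<close>

definition continuous_bilinear_maps ::
    "real \<Rightarrow> real \<Rightarrow> real \<Rightarrow> real \<Rightarrow> real \<Rightarrow> real
      \<Rightarrow> ('n::finite L0 \<times> 'n L0 \<Rightarrow> 'n L0 \<Rightarrow> real) set" where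
  "continuous_bilinear_maps s1 p1 s2 p2 s p =
     {B \<in> sobolev s1 p1 \<times> sobolev s2 p2 \<rightarrow>\<^sub>E sobolev_neg s p.
        (\<forall>u\<in>sobolev s1 p1. \<forall>u'\<in>sobolev s1 p1. \<forall>v\<in>sobolev s2 p2.
           B (u + u', v) = (\<lambda>\<psi>. B (u, v) \<psi> + B (u', v) \<psi>)) \<and>
        (\<forall>u\<in>sobolev s1 p1. \<forall>v\<in>sobolev s2 p2. \<forall>v'\<in>sobolev s2 p2.
           B (u, v + v') = (\<lambda>\<psi>. B (u, v) \<psi> + B (u, v') \<psi>)) \<and>
        (\<forall>c. \<forall>u\<in>sobolev s1 p1. \<forall>v\<in>sobolev s2 p2.
           B (c *\<^sub>R u, v) = (\<lambda>\<psi>. c * B (u, v) \<psi>) \<and>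
           B (u, c *\<^sub>R v) = (\<lambda>\<psi>. c * B (u, v) \<psi>)) \<and>
        (\<forall>u\<in>sobolev s1 p1. \<forall>v\<in>sobolev s2 p2. \<forall>\<epsilon>>0. \<exists>\<delta>>0.
           \<forall>u'\<in>sobolev s1 p1. \<forall>v'\<in>sobolev s2 p2.
             sobolev_norm s1 p1 (u' - u) < \<delta> \<longrightarrow> sobolev_norm s2 p2 (v' - v) < \<delta> \<longrightarrow>
             sobolev_neg_norm s p (\<lambda>\<psi>. B (u', v') \<psi> - B (u, v) \<psi>) < \<epsilon>)}"

end

theory Submission
  imports Defs
begin

text \<open>
  Put \<open>t = -s > 0\<close> and let \<open>q\<close> be the exponent conjugate to \<open>p\<close>. An element of \<open>W\<^sup>s\<^sup>,\<^sup>p\<close> is a functional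
  on \<open>W\<^sup>t\<^sup>,\<^sup>q\<close>, so the product of \<open>u\<close> and \<open>v\<close> has to be \<open>\<psi> \<mapsto> \<integral> u v \<psi>\<close>, and everything follows from
  the trilinear estimate \<open>\<integral> |u v \<psi>| \<le> C \<parallel>u\<parallel> \<parallel>v\<parallel> \<parallel>\<psi>\<parallel>\<close> in the norms of \<open>W\<^sup>s\<^sup>1\<^sup>,\<^sup>p\<^sup>1\<close>, \<open>W\<^sup>s\<^sup>2\<^sup>,\<^sup>p\<^sup>2\<close> and \<open>W\<^sup>t\<^sup>,\<^sup>q\<close>
  (\<open>trilinear_sobolev_estimate\<close>) together with the density of test functions
  (\<open>Cc_dense_in_sobolev\<close>), which gives uniqueness.

  The trilinear estimate is Hoelder's inequality after three Sobolev embeddings \<open>W\<^sup>\<sigma>\<^sup>,\<^sup>r \<subseteq> L\<^sup>1\<^sup>/\<^sup>a\<close>. With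
  \<open>n\<close> the dimension, the embedding holds for \<open>1/r - \<sigma>/n \<le> a \<le> 1/r\<close>, the endpoint \<open>a = 0\<close> (that is,
  \<open>L\<^sup>\<infinity>\<close>) being allowed only if \<open>1/r - \<sigma>/n < 0\<close>. The hypotheses of the theorem ensure that
  reciprocal exponents with sum \<open>1\<close> can be found in the three admissible ranges
  (\<open>Hoelder_exponents\<close>). Since \<open>s1 + t\<close> and \<open>s2 + t\<close> are only bounded by weak inequalities, the
  critical exponents \<open>a = 1/r - \<sigma>/n > 0\<close> cannot be avoided.

  The embeddings (\<open>sobolev_embedding_Cc\<close>) are proved for test functions by comparing \<open>f(x)\<close> with its
  averages over balls.
  \<^item> Order \<open>\<theta> \<in> (0, 1)\<close>: a ball of radius \<open>r\<close> gives
    \<open>|f(x)| \<le> c r\<^sup>\<kappa> g(x)\<^sup>1\<^sup>/\<^sup>p + c r\<^sup>-\<^sup>n\<^sup>a \<parallel>f\<parallel>\<close>, where \<open>\<integral> g\<close> is the \<open>p\<close>-th power of the Slobodeckij seminorm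
    and \<open>\<parallel>f\<parallel>\<close> is the norm of \<open>L\<^sup>1\<^sup>/\<^sup>a\<close> that is to be estimated. Optimising \<open>r\<close> for each \<open>x\<close> and
    integrating, one can absorb \<open>\<parallel>f\<parallel>\<close>, because it is finite; this includes the critical exponent
    (\<open>fractional_embedding\<close>). For \<open>a = 0\<close> one sums the differences of averages over dyadic radii
    (\<open>fractional_sup_embedding\<close>).
  \<^item> Order \<open>1\<close>: the Slobodeckij seminorms of order \<open>\<theta> < 1\<close> are bounded by the gradient, which leaves
    only the critical exponent. There the same comparison gives an estimate of weak type; Maz'ya's
    truncation between the levels \<open>2\<^sup>j\<close> and \<open>2\<^sup>j\<^sup>+\<^sup>1\<close> localises the gradient, and summing over \<open>j\<close>
    yields the strong one (\<open>critical_first_order_embedding\<close>).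
  \<^item> Higher order: induction, applying the first order case to \<open>f\<close> and the previous case to \<open>f\<close> and
    its first derivatives.

  Density is obtained by truncating first and mollifying afterwards: for \<open>f = \<eta> * (1\<^sub>B u)\<close> with a
  large ball \<open>B\<close>, all derivatives of the error fall on \<open>\<eta>\<close> or commute with the convolution, so the
  error is controlled by the continuity of translations in \<open>L\<^sup>p\<close> and by \<open>\<parallel>(1 - 1\<^sub>B) u\<parallel>\<close>. The
  embeddings pass to all of \<open>W\<^sup>\<sigma>\<^sup>,\<^sup>r\<close> by density and Fatou's lemma.
\<close>


section \<open>Powers of the norms\<close>

text \<open>The \<open>p\<close>-th power of the \<open>L\<^sup>p\<close> norm. Values in \<open>[0, \<infinity>]\<close> allow estimates to be chained, and the order of
  integration to be changed, before anything is known to be finite.\<close>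

definition Lpow :: "real \<Rightarrow> (real ^ 'n::finite \<Rightarrow> real) \<Rightarrow> ennreal" where
  "Lpow p f = (\<integral>\<^sup>+x. ennreal (\<bar>f x\<bar> powr p) \<partial>lborel)"

text \<open>The \<open>p\<close>-th power of the Slobodeckij seminorm after the substitution \<open>y = x + z\<close>
  (\<open>slobodeckij_int_eq\<close>). In this form the inner integral is the \<open>L\<^sup>p\<close> size of a difference of
  translates, and bounds on such differences give bounds on the seminorm. At \<open>z = 0\<close> the weight is
  \<open>0\<close>.\<close>

definition Slo :: "real \<Rightarrow> real \<Rightarrow> (real ^ 'n::finite \<Rightarrow> real) \<Rightarrow> ennreal" where
  "Slo \<theta> p f = (\<integral>\<^sup>+z. ennreal (norm z powr - (real CARD('n) + \<theta> * p)) * Lpow p (\<lambda>x. f (x + z) - f x) \<partial>lborel)"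

section \<open>Elementary inequalities and Jensen's inequality\<close>

lemma powr_add_le_max:
  fixes a b p :: real
  assumes "0 \<le> p"
  shows "\<bar>a + b\<bar> powr p \<le> 2 powr p * (\<bar>a\<bar> powr p + \<bar>b\<bar> powr p)"
proof -
  have "\<bar>a + b\<bar> powr p \<le> (2 * max \<bar>a\<bar> \<bar>b\<bar>) powr p"
    using assms by (intro powr_mono2) auto
  also have "\<dots> = 2 powr p * max \<bar>a\<bar> \<bar>b\<bar> powr p"
    by (rule powr_mult) 
  also have "\<dots> \<le> 2 powr p * (\<bar>a\<bar> powr p + \<bar>b\<bar> powr p)"
    by (intro mult_left_mono) (auto simp: max_def)
  finally show ?thesis .
qed

lemma powr_sum_le:
  fixes f :: "'i \<Rightarrow> real"
  assumes "finite I" "0 \<le> p"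
  shows "(\<Sum>i\<in>I. \<bar>f i\<bar>) powr p \<le> real (card I) powr p * (\<Sum>i\<in>I. \<bar>f i\<bar> powr p)"
proof (cases "I = {}")
  case False
  define m where "m = Max ((\<lambda>i. \<bar>f i\<bar>) ` I)"
  have m: "\<bar>f i\<bar> \<le> m" if "i \<in> I" for i
    using that assms by (auto simp: m_def)
  have "m \<in> (\<lambda>i. \<bar>f i\<bar>) ` I"
    unfolding m_def by (rule Max_in) (use assms False in auto)
  then obtain j where j: "j \<in> I" "m = \<bar>f j\<bar>" by auto
  have "(\<Sum>i\<in>I. \<bar>f i\<bar>) \<le> real (card I) * m"
    using sum_bounded_above[of I "\<lambda>i. \<bar>f i\<bar>" m] m by simp
  hence "(\<Sum>i\<in>I. \<bar>f i\<bar>) powr p \<le> (real (card I) * m) powr p"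
    using assms by (intro powr_mono2) (auto intro: sum_nonneg)
  also have "\<dots> = real (card I) powr p * m powr p"
    by (rule powr_mult) 
  also have "m powr p \<le> (\<Sum>i\<in>I. \<bar>f i\<bar> powr p)"
    unfolding j(2) using assms j(1) by (intro member_le_sum) auto
  finally show ?thesis by (simp add: mult_left_mono)
qed simp

lemma young_tangent:
  fixes x t p :: real
  assumes "1 \<le> p" "0 \<le> x" "0 < t"
  shows "p * x * t powr (p - 1) \<le> x powr p + (p - 1) * t powr p"
proof (cases "x = 0")
  case False
  have "(x powr p) powr (1 / p) * (t powr p) powr (1 - 1 / p) \<le> 1 / p * x powr p + (1 - 1 / p) * t powr p"
    using assms False by (intro Youngs_inequality_0) (auto simp: field_simps)
  also have "(x powr p) powr (1 / p) = x" using assms by (simp add: powr_powr)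
  also have "(t powr p) powr (1 - 1 / p) = t powr (p - 1)"
    using assms by (simp add: powr_powr algebra_simps)
  finally show ?thesis using assms by (simp add: field_simps)
qed (use assms in auto)

text \<open>Jensen's inequality for the measure with density \<open>k\<close>, which need not have mass \<open>1\<close>: integrate the
  tangent inequality at \<open>t\<close>, the mean value of \<open>|h|\<close>.\<close>

lemma nn_jensen:
  fixes k h :: "'a \<Rightarrow> real"
  assumes k: "integrable M k" "\<And>x. k x \<ge> 0" and h: "h \<in> borel_measurable M" and p: "1 \<le> p"
  shows "ennreal (\<bar>\<integral>x. k x * h x \<partial>M\<bar> powr p) \<le> ennreal ((\<integral>x. k x \<partial>M) powr (p - 1)) * (\<integral>\<^sup>+x. ennreal (k x * \<bar>h x\<bar> powr p) \<partial>M)"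
proof -
  have [measurable]: "k \<in> borel_measurable M" "h \<in> borel_measurable M" using k h by auto
  define K where "K = (\<integral>x. k x \<partial>M)"
  have K0: "K \<ge> 0" unfolding K_def by (rule Bochner_Integration.integral_nonneg) (use k in auto)
  show ?thesis
  proof (cases "K = 0")
    case True
    have "AE x in M. k x = 0"
      using integral_nonneg_eq_0_iff_AE[OF k(1)] k(2) True by (simp add: K_def)
    hence "AE x in M. k x * h x = 0" by auto
    hence "(\<integral>x. k x * h x \<partial>M) = 0" by (rule integral_eq_zero_AE)
    thus ?thesis by simp
  next
    case False
    hence K: "K > 0" using K0 by simp
    define A where "A = (\<integral>\<^sup>+x. ennreal (k x * \<bar>h x\<bar> powr p) \<partial>M)"
    show ?thesis
    proof (cases "A = \<infinity>")
      case True
      thus ?thesis using K by (simp add: A_def[symmetric] K_def[symmetric] ennreal_mult_top)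
    next
      case fin: False
      have int: "integrable M (\<lambda>x. k x * \<bar>h x\<bar> powr p)"
        using fin k(2) by (intro integrableI_nonneg) (auto simp: A_def top.not_eq_extremum)
      have bd: "k x * \<bar>h x\<bar> \<le> k x + k x * \<bar>h x\<bar> powr p" for x
      proof -
        have "\<bar>h x\<bar> \<le> 1 + \<bar>h x\<bar> powr p"
        proof (cases "\<bar>h x\<bar> \<le> 1")
          case False
          hence "\<bar>h x\<bar> powr 1 \<le> \<bar>h x\<bar> powr p" using p by (intro powr_mono) auto
          thus ?thesis by simp
        qed (use powr_ge_zero[of "\<bar>h x\<bar>" p] in linarith)
        from mult_left_mono[OF this k(2)[of x]] show ?thesis by (simp add: algebra_simps)
      qed
      have int1: "integrable M (\<lambda>x. k x * \<bar>h x\<bar>)"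
        by (rule Bochner_Integration.integrable_bound[OF Bochner_Integration.integrable_add[OF k(1) int]])
           (use bd k(2) in \<open>auto simp: abs_mult\<close>)
      define m where "m = (\<integral>x. k x * \<bar>h x\<bar> \<partial>M)"
      have m0: "m \<ge> 0" unfolding m_def by (rule Bochner_Integration.integral_nonneg) (use k in auto)
      have le_m: "\<bar>\<integral>x. k x * h x \<partial>M\<bar> \<le> m"
        using integral_abs_bound[of M "\<lambda>x. k x * h x"] k(2) by (simp add: m_def abs_mult)
      define a where "a = (\<integral>x. k x * \<bar>h x\<bar> powr p \<partial>M)"
      have Aa: "A = ennreal a" unfolding A_def a_def
        by (rule nn_integral_eq_integral[OF int]) (use k(2) in auto)
      have "m powr p \<le> K powr (p - 1) * a"
      proof (cases "m = 0")
        case True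
        have "a \<ge> 0" unfolding a_def by (rule Bochner_Integration.integral_nonneg) (use k in auto)
        thus ?thesis using True by simp
      next
        case False
        \<comment> \<open>the mean value of \<open>|h|\<close>, at which the tangent is taken\<close>
        define t where "t = m / K"
        have t: "t > 0" using K False m0 by (simp add: t_def)
        have "(\<integral>x. (p * t powr (p - 1)) * (k x * \<bar>h x\<bar>) \<partial>M) \<le> (\<integral>x. k x * \<bar>h x\<bar> powr p + (p - 1) * t powr p * k x \<partial>M)"
        proof (rule integral_mono)
          fix x
          show "(p * t powr (p - 1)) * (k x * \<bar>h x\<bar>) \<le> k x * \<bar>h x\<bar> powr p + (p - 1) * t powr p * k x"
            using mult_left_mono[OF young_tangent[OF p _ t, of "\<bar>h x\<bar>"] k(2)[of x]] by (simp add: algebra_simps)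
        qed (use int int1 k in auto)
        hence "p * t powr (p - 1) * m \<le> a + (p - 1) * t powr p * K"
          using int k by (simp add: m_def a_def K_def)
        also have "m = t * K" using K by (simp add: t_def)
        also have "p * t powr (p - 1) * (t * K) = p * t powr p * K"
          using t by (simp add: powr_diff field_simps)
        finally have *: "t powr p * K \<le> a" by (simp add: algebra_simps)
        have "m powr p = t powr p * K powr p"
          using \<open>m = t * K\<close> by (simp add: powr_mult)
        also have "\<dots> = K powr (p - 1) * (t powr p * K)"
          using K by (simp add: powr_diff)
        also have "\<dots> \<le> K powr (p - 1) * a" by (intro mult_left_mono *) auto
        finally show ?thesis .
      qed
      hence "\<bar>\<integral>x. k x * h x \<partial>M\<bar> powr p \<le> K powr (p - 1) * a"
        using powr_mono2[OF _ _ le_m, of p] p by simp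
      hence "ennreal (\<bar>\<integral>x. k x * h x \<partial>M\<bar> powr p) \<le> ennreal (K powr (p - 1)) * ennreal a"
        by (simp add: ennreal_mult'[symmetric] ennreal_leI)
      thus ?thesis by (simp add: A_def[symmetric] Aa K_def)
    qed
  qed
qed

section \<open>Translations, reflections and the order of integration\<close>

lemma lborel_reflect: "distr lborel borel (\<lambda>x. a - x) = (lborel :: 'a::euclidean_space measure)"
  using lborel_affine[of "-1" a] by (simp add: density_1)

lemma nn_integral_translate:
  fixes f :: "'a::euclidean_space \<Rightarrow> ennreal"
  assumes "f \<in> borel_measurable borel"
  shows "(\<integral>\<^sup>+x. f (x + a) \<partial>lborel) = (\<integral>\<^sup>+x. f x \<partial>lborel)"
  using assms by (subst (2) lborel_distr_plus[of a, symmetric]) (simp add: nn_integral_distr add.commute)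

lemma integral_translate:
  fixes f :: "'a::euclidean_space \<Rightarrow> real"
  assumes "f \<in> borel_measurable borel"
  shows "(\<integral>x. f (x + a) \<partial>lborel) = (\<integral>x. f x \<partial>lborel)"
  using assms by (subst (2) lborel_distr_plus[of a, symmetric]) (simp add: integral_distr add.commute)

lemma integral_reflect:
  fixes f :: "'a::euclidean_space \<Rightarrow> real"
  assumes "f \<in> borel_measurable borel"
  shows "(\<integral>x. f (a - x) \<partial>lborel) = (\<integral>x. f x \<partial>lborel)"
  using assms by (subst (2) lborel_reflect[of a, symmetric]) (simp add: integral_distr)

lemma integrable_translate:
  fixes f :: "'a::euclidean_space \<Rightarrow> real"
  assumes "integrable lborel f"
  shows "integrable lborel (\<lambda>x. f (x + a))"
proof -
  have "integrable (distr lborel borel ((+) a)) f" using assms by (simp add: lborel_distr_plus)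
  thus ?thesis using assms by (subst (asm) integrable_distr_eq) (auto simp: add.commute)
qed

lemma integrable_reflect:
  fixes f :: "'a::euclidean_space \<Rightarrow> real"
  assumes "integrable lborel f"
  shows "integrable lborel (\<lambda>x. f (a - x))"
proof -
  have "integrable (distr lborel borel (\<lambda>x. a - x)) f" using assms by (simp add: lborel_reflect)
  thus ?thesis using assms by (subst (asm) integrable_distr_eq) auto
qed

lemma nn_integral_Tonelli:
  fixes f :: "'a::euclidean_space \<Rightarrow> 'b::euclidean_space \<Rightarrow> ennreal"
  assumes "(\<lambda>(x, y). f x y) \<in> borel_measurable (lborel \<Otimes>\<^sub>M lborel)"
  shows "(\<integral>\<^sup>+x. \<integral>\<^sup>+y. f x y \<partial>lborel \<partial>lborel) = (\<integral>\<^sup>+y. \<integral>\<^sup>+x. f x y \<partial>lborel \<partial>lborel)"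
  using lborel_pair.Fubini'[OF assms] by simp

section \<open>Calculus of the norm powers\<close>

lemma Lpow_translate:
  assumes "f \<in> borel_measurable borel"
  shows "Lpow p (\<lambda>x. f (x + a)) = Lpow p f"
  unfolding Lpow_def using assms by (intro nn_integral_translate) measurable

lemma Lpow_cong_AE:
  assumes "AE x in lborel. f x = g x"
  shows "Lpow p f = Lpow p g"
  unfolding Lpow_def by (rule nn_integral_cong_AE) (use assms in auto)

lemma Lpow_uminus: "Lpow p (\<lambda>x. - f x) = Lpow p f"
  by (simp add: Lpow_def)

lemma Lpow_cmult:
  assumes "f \<in> borel_measurable borel"
  shows "Lpow p (\<lambda>x. c * f x) = ennreal (\<bar>c\<bar> powr p) * Lpow p f"
  unfolding Lpow_def using assms
  by (simp add: abs_mult powr_mult ennreal_mult' nn_integral_cmult)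

lemma Lpow_mono:
  assumes "\<And>x. \<bar>f x\<bar> \<le> \<bar>g x\<bar>" "0 \<le> p"
  shows "Lpow p f \<le> Lpow p g"
  unfolding Lpow_def by (intro nn_integral_mono ennreal_leI powr_mono2) (use assms in auto)

lemma Lpow_add_le:
  assumes [measurable]: "f \<in> borel_measurable borel" "g \<in> borel_measurable borel" and p: "0 \<le> p"
  shows "Lpow p (\<lambda>x. f x + g x) \<le> ennreal (2 powr p) * (Lpow p f + Lpow p g)"
proof -
  have "Lpow p (\<lambda>x. f x + g x) \<le> (\<integral>\<^sup>+x. ennreal (2 powr p) * (ennreal (\<bar>f x\<bar> powr p) + ennreal (\<bar>g x\<bar> powr p)) \<partial>lborel)"
    unfolding Lpow_def
    by (intro nn_integral_mono) (use powr_add_le_max[OF p] in \<open>auto simp: ennreal_mult'[symmetric] ennreal_plus[symmetric] simp del: ennreal_plus\<close>)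
  also have "\<dots> = ennreal (2 powr p) * (Lpow p f + Lpow p g)"
    unfolding Lpow_def by (simp add: nn_integral_cmult nn_integral_add)
  finally show ?thesis .
qed

lemma Lpow_diff_le:
  assumes [measurable]: "f \<in> borel_measurable borel" "g \<in> borel_measurable borel" and p: "0 \<le> p"
  shows "Lpow p (\<lambda>x. f x - g x) \<le> ennreal (2 powr p) * (Lpow p f + Lpow p g)"
  using Lpow_add_le[of f "\<lambda>x. - g x" p] assms by (simp add: Lpow_uminus)

lemma Lpow_translation_measurable:
  assumes [measurable]: "f \<in> borel_measurable borel"
  shows "(\<lambda>z. Lpow p (\<lambda>x. f (x + z) - f x)) \<in> borel_measurable borel"
  unfolding Lpow_def by measurable

lemma Slo_add_le:
  assumes [measurable]: "f \<in> borel_measurable borel" "g \<in> borel_measurable borel" and p: "0 \<le> p"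
  shows "Slo \<theta> p (\<lambda>x. f x + g x) \<le> ennreal (2 powr p) * (Slo \<theta> p f + Slo \<theta> p g)"
proof -
  note [measurable] = Lpow_translation_measurable
  have "Slo \<theta> p (\<lambda>x. f x + g x) \<le> (\<integral>\<^sup>+z. ennreal (2 powr p) * (ennreal (norm z powr - (real CARD('a) + \<theta> * p)) * Lpow p (\<lambda>x. f (x + z) - f x)
     + ennreal (norm z powr - (real CARD('a) + \<theta> * p)) * Lpow p (\<lambda>x. g (x + z) - g x)) \<partial>lborel)"
    unfolding Slo_def
  proof (intro nn_integral_mono)
    fix z :: "real ^ 'a"
    have "Lpow p (\<lambda>x. f (x + z) + g (x + z) - (f x + g x)) = Lpow p (\<lambda>x. (f (x + z) - f x) + (g (x + z) - g x))"
      by (simp add: algebra_simps)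
    also have "\<dots> \<le> ennreal (2 powr p) * (Lpow p (\<lambda>x. f (x + z) - f x) + Lpow p (\<lambda>x. g (x + z) - g x))"
      by (rule Lpow_add_le) (use p in auto)
    finally have "Lpow p (\<lambda>x. f (x + z) + g (x + z) - (f x + g x)) \<le> ennreal (2 powr p) * (Lpow p (\<lambda>x. f (x + z) - f x) + Lpow p (\<lambda>x. g (x + z) - g x))" .
    from mult_left_mono[OF this, of "ennreal (norm z powr - (real CARD('a) + \<theta> * p))"]
    show "ennreal (norm z powr - (real CARD('a) + \<theta> * p)) * Lpow p (\<lambda>x. f (x + z) + g (x + z) - (f x + g x))
       \<le> ennreal (2 powr p) * (ennreal (norm z powr - (real CARD('a) + \<theta> * p)) * Lpow p (\<lambda>x. f (x + z) - f x)
     + ennreal (norm z powr - (real CARD('a) + \<theta> * p)) * Lpow p (\<lambda>x. g (x + z) - g x))"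
      by (simp add: algebra_simps)
  qed
  also have "\<dots> = ennreal (2 powr p) * (Slo \<theta> p f + Slo \<theta> p g)"
    unfolding Slo_def by (simp add: nn_integral_cmult nn_integral_add)
  finally show ?thesis .
qed

lemma Slo_cmult:
  assumes [measurable]: "f \<in> borel_measurable borel"
  shows "Slo \<theta> p (\<lambda>x. c * f x) = ennreal (\<bar>c\<bar> powr p) * Slo \<theta> p f"
proof -
  note [measurable] = Lpow_translation_measurable
  have "Lpow p (\<lambda>x. c * f (x + z) - c * f x) = ennreal (\<bar>c\<bar> powr p) * Lpow p (\<lambda>x. f (x + z) - f x)" for z
    using Lpow_cmult[of "\<lambda>x. f (x + z) - f x" p c] by (simp add: algebra_simps)
  thus ?thesis unfolding Slo_def by (simp add: nn_integral_cmult[symmetric] mult_ac)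
qed

lemma Slo_cong_AE:
  assumes "AE x in lborel. f x = g x" and [measurable]: "f \<in> borel_measurable borel" "g \<in> borel_measurable borel"
  shows "Slo \<theta> p f = Slo \<theta> p g"
proof -
  have "Lpow p (\<lambda>x. f (x + z) - f x) = Lpow p (\<lambda>x. g (x + z) - g x)" for z
  proof (rule Lpow_cong_AE)
    have "AE x in distr lborel borel ((+) z). f x = g x" by (subst lborel_distr_plus) (rule assms(1))
    hence "AE x in lborel. f (z + x) = g (z + x)" by (subst (asm) AE_distr_iff) auto
    thus "AE x in lborel. f (x + z) - f x = g (x + z) - g x" using assms(1) by (auto simp: add.commute elim: AE_mp)
  qed
  thus ?thesis by (simp add: Slo_def)
qed

section \<open>The Slobodeckij kernel\<close>

lemma term_le_suminf: "f k \<le> (\<Sum>k. f k)" for f :: "nat \<Rightarrow> ennreal"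
  using sum_le_suminf[of f "{k}"] by simp

text \<open>The shells are enlarged to balls \<open>F k\<close>, which does not change the order of magnitude of their
  volumes.\<close>

lemma nn_integral_kernel_sum_finite:
  fixes F :: "nat \<Rightarrow> 'a::euclidean_space set" and a :: "nat \<Rightarrow> real"
  assumes "\<And>k. a k \<ge> 0" "\<And>k. F k \<in> sets borel" "\<And>k. ennreal (a k) * emeasure lborel (F k) \<le> ennreal (c * x ^ k)"
    "0 \<le> x" "x < 1" "0 \<le> c"
  shows "(\<integral>\<^sup>+z. (\<Sum>k. ennreal (a k) * indicator (F k) z) \<partial>lborel) < \<infinity>"
proof -
  have "(\<integral>\<^sup>+z. (\<Sum>k. ennreal (a k) * indicator (F k) z) \<partial>lborel) = (\<Sum>k. ennreal (a k) * emeasure lborel (F k))"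
    using assms(2) by (simp add: nn_integral_suminf nn_integral_cmult_indicator)
  also have "\<dots> \<le> (\<Sum>k. ennreal (c * x ^ k))"
    by (intro suminf_le assms) auto
  also have "\<dots> < \<infinity>"
    using assms by (simp add: less_top ennreal_suminf_neq_top summable_mult summable_geometric)
  finally show ?thesis .
qed

text \<open>The integrand is compared with constants on the dyadic shells \<open>2\<^sup>k \<le> |z| < 2\<^sup>k\<^sup>+\<^sup>1\<close>. The shells with
  \<open>|z| \<ge> 1\<close> contribute a geometric series of ratio \<open>2\<^sup>-\<^sup>\<theta>\<^sup>p\<close>, those with \<open>|z| < 1\<close> one of ratio
  \<open>2\<^sup>-\<^sup>(\<^sup>1\<^sup>-\<^sup>\<theta>\<^sup>)\<^sup>p\<close>. The kernel \<open>min 1 |z|\<^sup>p\<close> is what bounded functions with bounded gradient produce in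
  \<open>Slo\<close>.\<close>

lemma kernel_integral_finite:
  fixes p \<theta> :: real
  assumes p: "p > 0" and \<theta>: "0 < \<theta>" "\<theta> < 1"
  shows "(\<integral>\<^sup>+z. ennreal (min 1 (norm z powr p) * norm z powr - (real CARD('n) + \<theta> * p)) \<partial>(lborel :: (real^'n::finite) measure)) < \<infinity>"
proof -
  define n where "n = real CARD('n)"
  have n: "n > 0" by (simp add: n_def)
  define v where "v = unit_ball_vol n"
  have v: "v > 0" using n by (simp add: v_def)
  have vol: "emeasure lborel (ball (0::real^'n) r) = ennreal (v * r powr n)" if "r > 0" for r
    using that by (simp add: emeasure_ball v_def n_def powr_realpow)
  define a where "a k = 2 powr (- real k * (n + \<theta> * p))" for k :: nat
  define b where "b k = 2 powr (real (k + 1) * n - real k * ((1 - \<theta>) * p))" for k :: nat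
  define A :: "nat \<Rightarrow> (real^'n) set" where "A k = ball 0 (2 powr real (k + 1))" for k
  define B :: "nat \<Rightarrow> (real^'n) set" where "B k = ball 0 (2 powr - real k)" for k
  have 1: "(\<integral>\<^sup>+z. (\<Sum>k. ennreal (a k) * indicator (A k) z) \<partial>lborel) < \<infinity>"
  proof (rule nn_integral_kernel_sum_finite[where c = "v * 2 powr n" and x = "2 powr - (\<theta> * p)"])
    fix k
    have "a k * (v * (2 powr real (k + 1)) powr n) = v * 2 powr n * (2 powr - (\<theta> * p)) ^ k"
      unfolding a_def by (simp add: powr_powr powr_realpow[symmetric] powr_add[symmetric] algebra_simps)
    thus "ennreal (a k) * emeasure lborel (A k) \<le> ennreal (v * 2 powr n * (2 powr - (\<theta> * p)) ^ k)"
      unfolding A_def using v by (simp add: vol ennreal_mult'[symmetric] a_def)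
  next
    show "2 powr - (\<theta> * p) < 1" using powr_less_mono[of "- (\<theta> * p)" 0 2] p \<theta> by simp
  qed (use v in \<open>auto simp: a_def A_def\<close>)
  have 2: "(\<integral>\<^sup>+z. (\<Sum>k. ennreal (b k) * indicator (B k) z) \<partial>lborel) < \<infinity>"
  proof (rule nn_integral_kernel_sum_finite[where c = "v * 2 powr n" and x = "2 powr - ((1 - \<theta>) * p)"])
    fix k
    have "b k * (v * (2 powr - real k) powr n) = v * 2 powr n * (2 powr - ((1 - \<theta>) * p)) ^ k"
      unfolding b_def by (simp add: powr_powr powr_realpow[symmetric] powr_add[symmetric] algebra_simps)
    thus "ennreal (b k) * emeasure lborel (B k) \<le> ennreal (v * 2 powr n * (2 powr - ((1 - \<theta>) * p)) ^ k)"
      unfolding B_def using v by (simp add: vol ennreal_mult'[symmetric] b_def)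
  next
    show "2 powr - ((1 - \<theta>) * p) < 1" using powr_less_mono[of "- ((1 - \<theta>) * p)" 0 2] p \<theta> by simp
  qed (use v in \<open>auto simp: b_def B_def\<close>)
  have "(\<integral>\<^sup>+z. ennreal (min 1 (norm z powr p) * norm z powr - (n + \<theta> * p)) \<partial>(lborel :: (real^'n) measure))
     \<le> (\<integral>\<^sup>+z. (\<Sum>k. ennreal (a k) * indicator (A k) z) + (\<Sum>k. ennreal (b k) * indicator (B k) z) \<partial>lborel)"
  proof (rule nn_integral_mono)
    fix z :: "real^'n"
    define F where "F = min 1 (norm z powr p) * norm z powr - (n + \<theta> * p)"
    consider "z = 0" | "norm z \<ge> 1" | "z \<noteq> 0" "norm z < 1" by linarith
    thus "ennreal F \<le> (\<Sum>k. ennreal (a k) * indicator (A k) z) + (\<Sum>k. ennreal (b k) * indicator (B k) z)"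
    proof cases
      case 1 thus ?thesis by (simp add: F_def)
    next
      case 2
      define l where "l = log 2 (norm z)"
      have "norm z > 0" using 2 by linarith
      hence l: "norm z = 2 powr l" "l \<ge> 0" using 2 by (auto simp: l_def)
      define k where "k = nat \<lfloor>l\<rfloor>"
      have k: "real k \<le> l" "l < real k + 1" using l(2) by (auto simp: k_def)
      have "F \<le> norm z powr - (n + \<theta> * p)" unfolding F_def by (simp add: mult_left_le_one_le)
      also have "\<dots> = 2 powr (- l * (n + \<theta> * p))" by (simp add: l(1) powr_powr algebra_simps)
      also have "\<dots> \<le> a k" unfolding a_def
        using k n \<theta> p by (intro powr_mono) (auto intro!: mult_right_mono)
      finally have "F \<le> a k" .
      moreover have "z \<in> A k" using k by (simp add: A_def l(1))
      ultimately have "ennreal F \<le> ennreal (a k) * indicator (A k) z" by (simp add: ennreal_leI)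
      also have "\<dots> \<le> (\<Sum>k. ennreal (a k) * indicator (A k) z)"
        by (rule term_le_suminf)
      finally show ?thesis by (simp add: add_increasing2)
    next
      case 3
      define l where "l = - log 2 (norm z)"
      have l: "norm z = 2 powr - l" "l > 0" using 3 by (auto simp: l_def log_less_zero_cancel_iff)
      define k where "k = nat (\<lceil>l\<rceil> - 1)"
      have "\<lceil>l\<rceil> \<ge> 1" using l(2) by linarith
      hence "real k = real_of_int \<lceil>l\<rceil> - 1" by (simp add: k_def)
      hence k: "real k < l" "l \<le> real k + 1" by linarith+
      have "F \<le> norm z powr p * norm z powr - (n + \<theta> * p)" unfolding F_def by (intro mult_right_mono) auto
      also have "\<dots> = 2 powr (l * n - l * ((1 - \<theta>) * p))" by (simp add: l(1) powr_powr powr_add[symmetric] algebra_simps)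
      also have "\<dots> \<le> b k" unfolding b_def
        using k n \<theta> p by (intro powr_mono diff_mono mult_right_mono) auto
      finally have "F \<le> b k" .
      moreover have "z \<in> B k" using k by (simp add: B_def l(1))
      ultimately have "ennreal F \<le> ennreal (b k) * indicator (B k) z" by (simp add: ennreal_leI)
      also have "\<dots> \<le> (\<Sum>k. ennreal (b k) * indicator (B k) z)"
        by (rule term_le_suminf)
      finally show ?thesis by (simp add: add_increasing)
    qed
  qed
  also have "\<dots> = (\<integral>\<^sup>+z. (\<Sum>k. ennreal (a k) * indicator (A k) z) \<partial>lborel) + (\<integral>\<^sup>+z. (\<Sum>k. ennreal (b k) * indicator (B k) z) \<partial>lborel)"
    
  proof (rule nn_integral_add)
    have [measurable]: "A k \<in> sets borel" "B k \<in> sets borel" for k by (auto simp: A_def B_def)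
    show "(\<lambda>z. \<Sum>k. ennreal (a k) * indicator (A k) z) \<in> borel_measurable lborel" by measurable
    show "(\<lambda>z. \<Sum>k. ennreal (b k) * indicator (B k) z) \<in> borel_measurable lborel" by measurable
  qed
  also have "\<dots> < \<infinity>" using 1 2 by simp
  finally show ?thesis by (simp add: n_def)
qed

section \<open>Continuity of translations\<close>

text \<open>By approximation in \<open>L\<^sup>1\<close> it suffices to treat indicators of sets of finite measure, and by outer
  regularity indicators of open sets \<open>U\<close>. For these the difference has integral
  \<open>2 (|U| - |U \<inter> (U - z)|)\<close>, which tends to \<open>0\<close> by dominated convergence since \<open>U\<close> is a neighbourhood
  of each of its points.\<close>

lemma L1_translation_continuous:
  fixes f :: "real ^ 'n::finite \<Rightarrow> real"
  assumes "integrable lborel f" and "Z \<longlonglongrightarrow> 0"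
  shows "(\<lambda>k. \<integral>x. \<bar>f (x + Z k) - f x\<bar> \<partial>lborel) \<longlonglongrightarrow> 0"
  using assms(1)
proof (induction rule: integrable_induct)
  case (base A c)
  have A[measurable]: "A \<in> sets borel" using base by simp
  show ?case
  proof (rule LIMSEQ_I)
    fix r :: real assume "r > 0"
    define e where "e = r / (4 * (\<bar>c\<bar> + 1))"
    have e: "e > 0" using \<open>r > 0\<close> by (simp add: e_def)
    obtain U where U: "open U" "A \<subseteq> U" "emeasure lborel (U - A) < ennreal e"
      using outer_regular_lborel[OF A e] by blast
    have Um[measurable]: "U \<in> sets borel" using U by simp
    have "emeasure lborel U = emeasure lborel A + emeasure lborel (U - A)"
      using U by (subst plus_emeasure) (auto simp: Un_absorb1)
    also have "\<dots> < \<infinity>" using base U(3) by (auto simp: less_top[symmetric] top_unique dest: less_trans)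
    finally have fU: "emeasure lborel U < \<infinity>" .
    let ?u = "indicator U :: real^'n \<Rightarrow> real" and ?a = "indicator A :: real^'n \<Rightarrow> real"
    have iu: "integrable lborel ?u" using fU by (simp add: integrable_indicator_iff)
    have ia: "integrable lborel ?a" using base by (simp add: integrable_indicator_iff)
    have iut: "integrable lborel (\<lambda>x. ?u (x + z))" for z by (rule integrable_translate[OF iu])
    have iat: "integrable lborel (\<lambda>x. ?a (x + z))" for z by (rule integrable_translate[OF ia])
    have iuu: "integrable lborel (\<lambda>x. ?u x * ?u (x + z))" for z
      by (rule Bochner_Integration.integrable_bound[OF iu]) (auto simp: indicator_def)
    have lim: "(\<lambda>k. \<integral>x. ?u x * ?u (x + Z k) \<partial>lborel) \<longlonglongrightarrow> (\<integral>x. ?u x \<partial>lborel)"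
    proof (rule integral_dominated_convergence[where w = ?u])
      show "AE x in lborel. (\<lambda>k. ?u x * ?u (x + Z k)) \<longlonglongrightarrow> ?u x"
      proof (rule AE_I2)
        fix x
        show "(\<lambda>k. ?u x * ?u (x + Z k)) \<longlonglongrightarrow> ?u x"
        proof (cases "x \<in> U")
          case True
          have "(\<lambda>k. x + Z k) \<longlonglongrightarrow> x + 0" by (intro tendsto_intros assms)
          hence "eventually (\<lambda>k. x + Z k \<in> U) sequentially"
            using U(1) True by (auto dest: topological_tendstoD)
          hence "eventually (\<lambda>k. ?u x * ?u (x + Z k) = ?u x) sequentially"
            by eventually_elim (use True in auto)
          thus ?thesis by (rule tendsto_eventually)
        qed auto
      qed
    qed (use iu in \<open>auto simp: indicator_def\<close>)
    have "eventually (\<lambda>k. \<bar>(\<integral>x. ?u x * ?u (x + Z k) \<partial>lborel) - (\<integral>x. ?u x \<partial>lborel)\<bar> < e) sequentially"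
      using tendstoD[OF lim e] by (simp add: dist_real_def)
    then obtain N where N: "\<And>k. k \<ge> N \<Longrightarrow> \<bar>(\<integral>x. ?u x * ?u (x + Z k) \<partial>lborel) - (\<integral>x. ?u x \<partial>lborel)\<bar> < e"
      by (auto simp: eventually_sequentially)
    have du: "(\<integral>x. ?u x - ?a x \<partial>lborel) < e"
    proof -
      have "(\<integral>x. ?u x - ?a x \<partial>lborel) = (\<integral>x. indicator (U - A) x \<partial>lborel)"
        by (rule Bochner_Integration.integral_cong) (use U in \<open>auto simp: indicator_def\<close>)
      also have "\<dots> = measure lborel (U - A)" by simp
      also have "\<dots> < e" 
      proof -
        have "ennreal (measure lborel (U - A)) = emeasure lborel (U - A)"
          using U(3) by (intro emeasure_eq_ennreal_measure[symmetric]) (auto simp: top_unique)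
        thus ?thesis using U(3) by (metis ennreal_less_iff measure_nonneg)
      qed
      finally show ?thesis .
    qed
    show "\<exists>no. \<forall>k\<ge>no. norm ((\<integral>x. \<bar>?a (x + Z k) *\<^sub>R c - ?a x *\<^sub>R c\<bar> \<partial>lborel) - 0) < r"
    proof (intro exI[of _ N] allI impI)
      fix k assume k: "k \<ge> N"
      have pw: "\<bar>?a (x + Z k) - ?a x\<bar> \<le> (?u (x + Z k) - ?a (x + Z k)) + (?u x - ?a x) + (?u (x + Z k) + ?u x - 2 * (?u x * ?u (x + Z k)))" for x
        using U(2) by (auto simp: indicator_def)
      have "(\<integral>x. \<bar>?a (x + Z k) - ?a x\<bar> \<partial>lborel) \<le> (\<integral>x. (?u (x + Z k) - ?a (x + Z k)) + (?u x - ?a x) + (?u (x + Z k) + ?u x - 2 * (?u x * ?u (x + Z k))) \<partial>lborel)"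
        by (rule integral_mono) (use iu ia iut iat iuu pw in auto)
      also have "\<dots> = (\<integral>x. ?u x - ?a x \<partial>lborel) + (\<integral>x. ?u x - ?a x \<partial>lborel) + 2 * ((\<integral>x. ?u x \<partial>lborel) - (\<integral>x. ?u x * ?u (x + Z k) \<partial>lborel))"
        using integral_translate[of ?u "Z k"] integral_translate[of ?a "Z k"] iu ia iut iat iuu by simp
      also have "\<dots> < 4 * e"
      proof -
        have "(\<integral>x. ?u x \<partial>lborel) - (\<integral>x. ?u x * ?u (x + Z k) \<partial>lborel) < e"
          using N[OF k] by (simp add: abs_less_iff)
        thus ?thesis using du by simp
      qed
      finally have *: "(\<integral>x. \<bar>?a (x + Z k) - ?a x\<bar> \<partial>lborel) < 4 * e" .
      have "(\<integral>x. \<bar>?a (x + Z k) *\<^sub>R c - ?a x *\<^sub>R c\<bar> \<partial>lborel) = \<bar>c\<bar> * (\<integral>x. \<bar>?a (x + Z k) - ?a x\<bar> \<partial>lborel)"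
        by (simp add: left_diff_distrib[symmetric] right_diff_distrib[symmetric] abs_mult mult.commute flip: integral_mult_right_zero)
      also have "\<dots> \<le> \<bar>c\<bar> * (4 * e)" using * by (intro mult_left_mono) auto
      also have "\<dots> < r" using \<open>r > 0\<close> by (simp add: e_def field_simps)
      finally have "(\<integral>x. \<bar>?a (x + Z k) *\<^sub>R c - ?a x *\<^sub>R c\<bar> \<partial>lborel) < r" .
      thus "norm ((\<integral>x. \<bar>?a (x + Z k) *\<^sub>R c - ?a x *\<^sub>R c\<bar> \<partial>lborel) - 0) < r" by simp
    qed
  qed
next
  case (add f g)
  have "(\<lambda>k. (\<integral>x. \<bar>f (x + Z k) - f x\<bar> \<partial>lborel) + (\<integral>x. \<bar>g (x + Z k) - g x\<bar> \<partial>lborel)) \<longlonglongrightarrow> 0"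
    using tendsto_add[OF add(3,4)] by simp
  thus ?case
  proof (rule Lim_null_comparison[rotated], intro always_eventually allI)
    fix k
    note i = add(1,2) add(1,2)[THEN integrable_translate, of "Z k"]
    have "(\<integral>x. \<bar>f (x + Z k) + g (x + Z k) - (f x + g x)\<bar> \<partial>lborel) \<le> (\<integral>x. \<bar>f (x + Z k) - f x\<bar> + \<bar>g (x + Z k) - g x\<bar> \<partial>lborel)"
      by (rule integral_mono) (use i in auto)
    also have "\<dots> = (\<integral>x. \<bar>f (x + Z k) - f x\<bar> \<partial>lborel) + (\<integral>x. \<bar>g (x + Z k) - g x\<bar> \<partial>lborel)"
      by (rule Bochner_Integration.integral_add) (use i in auto)
    finally show "norm (\<integral>x. \<bar>f (x + Z k) + g (x + Z k) - (f x + g x)\<bar> \<partial>lborel) \<le> (\<integral>x. \<bar>f (x + Z k) - f x\<bar> \<partial>lborel) + (\<integral>x. \<bar>g (x + Z k) - g x\<bar> \<partial>lborel)"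
      by simp
  qed
next
  case (lim f s)
  have im: "(\<lambda>i. \<integral>x. \<bar>s i x - f x\<bar> \<partial>lborel) \<longlonglongrightarrow> (\<integral>x. 0 \<partial>(lborel :: (real^'n) measure))"
  proof (rule integral_dominated_convergence[where w = "\<lambda>x. 3 * \<bar>f x\<bar>"])
    show "AE x in lborel. (\<lambda>i. \<bar>s i x - f x\<bar>) \<longlonglongrightarrow> 0"
      using lim(2) by (auto intro!: AE_I2 tendsto_rabs_zero simp: LIM_zero_iff)
    show "AE x in lborel. norm \<bar>s i x - f x\<bar> \<le> 3 * \<bar>f x\<bar>" for i
    proof (rule AE_I2)
      fix x show "norm \<bar>s i x - f x\<bar> \<le> 3 * \<bar>f x\<bar>" using lim(3)[of x i] by simp
    qed
  qed (use lim in auto)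
  show ?case
  proof (rule LIMSEQ_I)
    fix r :: real assume r: "r > 0"
    then obtain i where i: "(\<integral>x. \<bar>s i x - f x\<bar> \<partial>lborel) < r / 3"
      using LIMSEQ_D[OF im, of "r / 3"] by auto
    obtain N where N: "\<And>k. k \<ge> N \<Longrightarrow> (\<integral>x. \<bar>s i (x + Z k) - s i x\<bar> \<partial>lborel) < r / 3"
      using LIMSEQ_D[OF lim(5), of "r / 3" i] r by auto
    show "\<exists>no. \<forall>k\<ge>no. norm ((\<integral>x. \<bar>f (x + Z k) - f x\<bar> \<partial>lborel) - 0) < r"
    proof (intro exI[of _ N] allI impI)
      fix k assume k: "k \<ge> N"
      note ii = lim(1)[of i] lim(4) lim(1)[of i, THEN integrable_translate, of "Z k"] lim(4)[THEN integrable_translate, of "Z k"]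
      have tr: "(\<integral>x. \<bar>s i (x + Z k) - f (x + Z k)\<bar> \<partial>lborel) = (\<integral>x. \<bar>s i x - f x\<bar> \<partial>lborel)"
        using integral_translate[of "\<lambda>x. \<bar>s i x - f x\<bar>" "Z k"] ii by auto
      have "(\<integral>x. \<bar>f (x + Z k) - f x\<bar> \<partial>lborel) \<le> (\<integral>x. \<bar>s i (x + Z k) - f (x + Z k)\<bar> + \<bar>s i (x + Z k) - s i x\<bar> + \<bar>s i x - f x\<bar> \<partial>lborel)"
        by (rule integral_mono) (use ii in auto)
      also have "\<dots> = (\<integral>x. \<bar>s i (x + Z k) - f (x + Z k)\<bar> \<partial>lborel) + (\<integral>x. \<bar>s i (x + Z k) - s i x\<bar> \<partial>lborel) + (\<integral>x. \<bar>s i x - f x\<bar> \<partial>lborel)"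
        using ii by (simp)
      also have "\<dots> < r" using i N[OF k] tr by linarith
      finally show "norm ((\<integral>x. \<bar>f (x + Z k) - f x\<bar> \<partial>lborel) - 0) < r" by simp
    qed
  qed
qed

text \<open>The truncations \<open>T N\<close> approximate \<open>f\<close> in \<open>L\<^sup>p\<close>; they are bounded by \<open>N\<close>, so the \<open>p\<close>-th power of their
  differences is at most \<open>(2 N)\<^sup>p\<^sup>-\<^sup>1\<close> times the first power, and the case of \<open>L\<^sup>1\<close> applies.\<close>

lemma Lpow_translation_continuous:
  fixes f :: "real ^ 'n::finite \<Rightarrow> real"
  assumes [measurable]: "f \<in> borel_measurable borel" and fin: "Lpow p f < \<infinity>" and p: "1 \<le> p" and Z: "Z \<longlonglongrightarrow> 0"
  shows "(\<lambda>k. Lpow p (\<lambda>x. f (x + Z k) - f x)) \<longlonglongrightarrow> 0"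
proof -
  define T where "T N x = (if \<bar>f x\<bar> \<le> real N \<and> norm x \<le> real N then f x else 0)" for N :: nat and x
  have Tm[measurable]: "T N \<in> borel_measurable borel" for N unfolding T_def by measurable
  have Tb: "\<bar>T N x\<bar> \<le> real N" for N x by (auto simp: T_def)
  have Ti: "integrable lborel (T N)" for N
  proof (rule integrableI_bounded_set[where A = "cball 0 (real N)" and B = "real N"])
    show "emeasure lborel (cball (0::real^'n) (real N)) < \<infinity>" by (simp add: emeasure_cball)
  qed (use Tb in \<open>auto simp: T_def\<close>)
  have lim1: "(\<lambda>N. Lpow p (\<lambda>x. f x - T N x)) \<longlonglongrightarrow> (\<integral>\<^sup>+x. 0 \<partial>(lborel :: (real^'n) measure))"
    unfolding Lpow_def
  proof (rule nn_integral_dominated_convergence[where w = "\<lambda>x. ennreal (\<bar>f x\<bar> powr p)"])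
    show "AE x in lborel. ennreal (\<bar>f x - T N x\<bar> powr p) \<le> ennreal (\<bar>f x\<bar> powr p)" for N
      using p by (intro AE_I2 ennreal_leI powr_mono2) (auto simp: T_def)
    show "AE x in lborel. (\<lambda>N. ennreal (\<bar>f x - T N x\<bar> powr p)) \<longlonglongrightarrow> 0"
    proof (rule AE_I2)
      fix x
      obtain N0 :: nat where N0: "\<bar>f x\<bar> \<le> real N0" "norm x \<le> real N0"
        using real_arch_simple[of "max \<bar>f x\<bar> (norm x)"] by auto
      have "eventually (\<lambda>N. ennreal (\<bar>f x - T N x\<bar> powr p) = 0) sequentially"
        using eventually_ge_at_top[of N0] by eventually_elim (use N0 in \<open>auto simp: T_def\<close>)
      thus "(\<lambda>N. ennreal (\<bar>f x - T N x\<bar> powr p)) \<longlonglongrightarrow> 0" by (rule tendsto_eventually)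
    qed
  qed (use fin in \<open>auto simp: Lpow_def\<close>)
  have lim2: "(\<lambda>k. Lpow p (\<lambda>x. T N (x + Z k) - T N x)) \<longlonglongrightarrow> 0" for N
  proof (rule tendsto_sandwich[where f = "\<lambda>_. 0" and h = "\<lambda>k. ennreal ((2 * real N) powr (p - 1)) * ennreal (\<integral>x. \<bar>T N (x + Z k) - T N x\<bar> \<partial>lborel)"])
    have "(\<lambda>k. ennreal ((2 * real N) powr (p - 1)) * ennreal (\<integral>x. \<bar>T N (x + Z k) - T N x\<bar> \<partial>lborel)) \<longlonglongrightarrow> ennreal ((2 * real N) powr (p - 1)) * ennreal 0"
      by (intro ennreal_tendsto_cmult tendsto_ennrealI L1_translation_continuous Ti Z) auto
    thus "(\<lambda>k. ennreal ((2 * real N) powr (p - 1)) * ennreal (\<integral>x. \<bar>T N (x + Z k) - T N x\<bar> \<partial>lborel)) \<longlonglongrightarrow> 0" by simp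
    show "\<forall>\<^sub>F k in sequentially. Lpow p (\<lambda>x. T N (x + Z k) - T N x) \<le> ennreal ((2 * real N) powr (p - 1)) * ennreal (\<integral>x. \<bar>T N (x + Z k) - T N x\<bar> \<partial>lborel)"
    proof (intro always_eventually allI)
      fix k
      have pw: "\<bar>T N (x + Z k) - T N x\<bar> powr p \<le> (2 * real N) powr (p - 1) * \<bar>T N (x + Z k) - T N x\<bar>" for x
      proof (cases "T N (x + Z k) - T N x = 0")
        case False
        have "\<bar>T N (x + Z k) - T N x\<bar> powr p = \<bar>T N (x + Z k) - T N x\<bar> powr (p - 1) * \<bar>T N (x + Z k) - T N x\<bar>"
          using False by (simp add: powr_diff)
        also have "\<dots> \<le> (2 * real N) powr (p - 1) * \<bar>T N (x + Z k) - T N x\<bar>"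
          using Tb[of N "x + Z k"] Tb[of N x] p by (intro mult_right_mono powr_mono2) auto
        finally show ?thesis .
      qed auto
      have "Lpow p (\<lambda>x. T N (x + Z k) - T N x) \<le> (\<integral>\<^sup>+x. ennreal ((2 * real N) powr (p - 1)) * ennreal \<bar>T N (x + Z k) - T N x\<bar> \<partial>lborel)"
        unfolding Lpow_def using pw by (intro nn_integral_mono) (simp add: ennreal_mult'[symmetric] ennreal_leI)
      also have "\<dots> = ennreal ((2 * real N) powr (p - 1)) * (\<integral>\<^sup>+x. ennreal \<bar>T N (x + Z k) - T N x\<bar> \<partial>lborel)"
        by (rule nn_integral_cmult) auto
      also have "(\<integral>\<^sup>+x. ennreal \<bar>T N (x + Z k) - T N x\<bar> \<partial>lborel) = ennreal (\<integral>x. \<bar>T N (x + Z k) - T N x\<bar> \<partial>lborel)"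
        by (rule nn_integral_eq_integral) (use Ti integrable_translate[OF Ti, of N "Z k"] in auto)
      finally show "Lpow p (\<lambda>x. T N (x + Z k) - T N x) \<le> ennreal ((2 * real N) powr (p - 1)) * ennreal (\<integral>x. \<bar>T N (x + Z k) - T N x\<bar> \<partial>lborel)" .
    qed
  qed auto
  define c where "c = 2 powr p"
  have c: "c > 0" by (simp add: c_def)
  have main: "Lpow p (\<lambda>x. f (x + z) - f x) \<le> ennreal c * (Lpow p (\<lambda>x. T N (x + z) - T N x) + ennreal (2 * c) * Lpow p (\<lambda>x. f x - T N x))" for N z
  proof -
    have "Lpow p (\<lambda>x. f (x + z) - f x) = Lpow p (\<lambda>x. (T N (x + z) - T N x) + ((f (x + z) - T N (x + z)) - (f x - T N x)))"
      by (simp add: algebra_simps)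
    also have "\<dots> \<le> ennreal c * (Lpow p (\<lambda>x. T N (x + z) - T N x) + Lpow p (\<lambda>x. (f (x + z) - T N (x + z)) - (f x - T N x)))"
      unfolding c_def by (rule Lpow_add_le) (use p in auto)
    also have "Lpow p (\<lambda>x. (f (x + z) - T N (x + z)) - (f x - T N x)) \<le> ennreal c * (Lpow p (\<lambda>x. f (x + z) - T N (x + z)) + Lpow p (\<lambda>x. f x - T N x))"
      unfolding c_def by (rule Lpow_diff_le) (use p in auto)
    also have "Lpow p (\<lambda>x. f (x + z) - T N (x + z)) = Lpow p (\<lambda>x. f x - T N x)"
      using Lpow_translate[of "\<lambda>x. f x - T N x" p z] by simp
    also have "ennreal c * (Lpow p (\<lambda>x. f x - T N x) + Lpow p (\<lambda>x. f x - T N x)) = ennreal (2 * c) * Lpow p (\<lambda>x. f x - T N x)"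
      using c by (simp add: ennreal_mult' mult_2[symmetric] mult_ac)
    finally show ?thesis by (simp add: add_left_mono mult_left_mono)
  qed
  show ?thesis
  proof (rule order_tendstoI)
    fix e :: ennreal assume e: "0 < e"
    obtain e' where e': "0 < e'" "ennreal e' < e"
    proof -
      obtain y where "0 < y" "y < e" using dense[OF e] by blast
      moreover from this obtain r where "y = ennreal r" "r \<ge> 0" by (cases y) auto
      ultimately show thesis using that[of r] by (auto simp: ennreal_0)
    qed
    define d where "d = e' / (2 * c)"
    define d2 where "d2 = e' / (4 * c * c)"
    have d: "d > 0" "d2 > 0" using e' c by (auto simp: d_def d2_def)
    have "eventually (\<lambda>N. Lpow p (\<lambda>x. f x - T N x) < ennreal d2) sequentially"
      using order_tendstoD(2)[OF lim1, of "ennreal d2"] d by simp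
    then obtain N where N: "Lpow p (\<lambda>x. f x - T N x) < ennreal d2" by (auto simp: eventually_sequentially)
    have "eventually (\<lambda>k. Lpow p (\<lambda>x. T N (x + Z k) - T N x) < ennreal d) sequentially"
      using order_tendstoD(2)[OF lim2, of "ennreal d"] d by simp
    thus "eventually (\<lambda>k. Lpow p (\<lambda>x. f (x + Z k) - f x) < e) sequentially"
    proof eventually_elim
      case (elim k)
      have "Lpow p (\<lambda>x. f (x + Z k) - f x) \<le> ennreal c * (ennreal d + ennreal (2 * c) * ennreal d2)"
        using main[of "Z k" N] elim N by (elim order_trans) (intro mult_left_mono add_mono, auto)
      also have "\<dots> = ennreal (c * (d + 2 * c * d2))"
        using c d by (simp add: ennreal_mult'[symmetric] ennreal_plus[symmetric] del: ennreal_plus)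
      also have "c * (d + 2 * c * d2) = e'" using c by (simp add: d_def d2_def field_simps)
      finally show ?case using e' by simp
    qed
  qed auto
qed


section \<open>Partial derivatives\<close>

text \<open>Derivatives are indexed by lists of directions rather than by multi-indices: adding one derivative
  at either end is then a list operation, and inductions on the order become structural. The two
  descriptions are compared in \<open>Dl_eq_mderiv\<close>.\<close>

abbreviation Dl :: "'n::finite list \<Rightarrow> (real ^ 'n \<Rightarrow> real) \<Rightarrow> real ^ 'n \<Rightarrow> real" where
  "Dl is f \<equiv> foldr partial_deriv is f"


lemma has_derivative_imp_partial:
  assumes "(f has_derivative F) (at x)"
  shows "((\<lambda>t. f (x + t *\<^sub>R axis i 1)) has_real_derivative F (axis i 1)) (at 0)"
proof -
  have "((\<lambda>t. f (x + t *\<^sub>R axis i 1)) has_derivative (\<lambda>t. F (t *\<^sub>R axis i 1))) (at (0::real))"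
    by (rule has_derivative_compose[of "\<lambda>t. x + t *\<^sub>R axis i 1" _ _ _ f])
       (auto intro!: derivative_eq_intros assms)
  thus ?thesis
    using has_derivative_bounded_linear[OF assms]
    by (simp add: has_field_derivative_def linear_simps mult_commute_abs)
qed

lemma partial_deriv_eqI:
  assumes "(f has_derivative F) (at x)"
  shows "partial_deriv i f x = F (axis i 1)"
  unfolding partial_deriv_def by (rule DERIV_imp_deriv) (rule has_derivative_imp_partial[OF assms])

lemma differentiable_has_derivative_partial:
  fixes f :: "real ^ 'n::finite \<Rightarrow> real"
  assumes "f differentiable (at x)"
  shows "(f has_derivative (\<lambda>v. \<Sum>i\<in>UNIV. v $ i * partial_deriv i f x)) (at x)"
proof -
  obtain F where F: "(f has_derivative F) (at x)" using assms by (auto simp: differentiable_def)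
  interpret bounded_linear F by (rule has_derivative_bounded_linear[OF F])
  have "F v = (\<Sum>i\<in>UNIV. v $ i * partial_deriv i f x)" for v
  proof -
    have "F v = F (\<Sum>i\<in>UNIV. v $ i *\<^sub>R axis i 1)"
      by (simp add: basis_expansion scalar_mult_eq_scaleR[symmetric])
    also have "\<dots> = (\<Sum>i\<in>UNIV. v $ i * partial_deriv i f x)"
      by (simp add: sum scaleR partial_deriv_eqI[OF F])
    finally show ?thesis .
  qed
  thus ?thesis using F by presburger
qed

lemma has_real_derivative_line:
  fixes f :: "real ^ 'n::finite \<Rightarrow> real"
  assumes "\<And>x. f differentiable (at x)"
  shows "((\<lambda>t. f (x + t *\<^sub>R v)) has_real_derivative (\<Sum>i\<in>UNIV. v $ i * partial_deriv i f (x + t *\<^sub>R v))) (at t)"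
proof -
  have "((\<lambda>t. f (x + t *\<^sub>R v)) has_derivative (\<lambda>s. \<Sum>i\<in>UNIV. (s *\<^sub>R v) $ i * partial_deriv i f (x + t *\<^sub>R v))) (at t)"
    by (rule has_derivative_compose[of "\<lambda>t. x + t *\<^sub>R v" _ _ _ f])
       (auto intro!: derivative_eq_intros differentiable_has_derivative_partial assms)
  thus ?thesis
    by (simp add: has_field_derivative_def sum_distrib_right[symmetric] mult.assoc sum_distrib_left[symmetric] mult_commute_abs)
qed

lemma has_real_derivative_axis:
  fixes f :: "real ^ 'n::finite \<Rightarrow> real"
  assumes "\<And>x. f differentiable (at x)"
  shows "((\<lambda>t. f (x + t *\<^sub>R axis i 1)) has_real_derivative partial_deriv i f (x + t *\<^sub>R axis i 1)) (at t)"
  using has_real_derivative_line[OF assms, of x "axis i 1" t] by (simp add: axis_def if_distrib[of "\<lambda>x. x * _"] cong: if_cong)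

lemma mean_value_partial:
  fixes f :: "real ^ 'n::finite \<Rightarrow> real"
  assumes "\<And>x. f differentiable (at x)"
  shows "\<exists>\<xi>. 0 < \<xi> \<and> \<xi> < 1 \<and> f (x + v) - f x = (\<Sum>i\<in>UNIV. v $ i * partial_deriv i f (x + \<xi> *\<^sub>R v))"
  using MVT2[of 0 1 "\<lambda>t. f (x + t *\<^sub>R v)" "\<lambda>t. \<Sum>i\<in>UNIV. v $ i * partial_deriv i f (x + t *\<^sub>R v)"]
    has_real_derivative_line[OF assms] by auto

section \<open>Smooth functions\<close>

text \<open>Coinduction: smoothness is usually shown by exhibiting a whole class of functions that is closed
  under partial derivatives.\<close>

lemma smooth_coinduct:
  assumes "f \<in> S" and "\<And>g x. g \<in> S \<Longrightarrow> g differentiable (at x)" and "\<And>g i. g \<in> S \<Longrightarrow> partial_deriv i g \<in> S"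
  shows "smooth f"
proof -
  have "Dl is f \<in> S" for "is" by (induction "is") (use assms in auto)
  thus ?thesis using assms(2) by (auto simp: smooth_def)
qed

lemma smooth_differentiable: "smooth f \<Longrightarrow> f differentiable (at x)"
  unfolding smooth_def by (drule spec[of _ "[]"]) auto

lemma smooth_partial_deriv: "smooth f \<Longrightarrow> smooth (partial_deriv i f)"
  unfolding smooth_def
proof (intro allI)
  fix "is" x assume "\<forall>is x. Dl is f differentiable at x"
  from this[rule_format, of "is @ [i]" x] show "Dl is (partial_deriv i f) differentiable at x" by simp
qed

lemma smooth_Dl: "smooth f \<Longrightarrow> smooth (Dl is f)"
  by (induction "is") (auto intro: smooth_partial_deriv)

lemma smooth_continuous: "smooth f \<Longrightarrow> continuous_on UNIV f"
  by (auto simp: continuous_on_eq_continuous_at intro: differentiable_imp_continuous_within smooth_differentiable)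

lemma smooth_isCont: "smooth f \<Longrightarrow> isCont f x"
  by (intro differentiable_imp_continuous_within smooth_differentiable)

lemma smooth_borel: "smooth f \<Longrightarrow> f \<in> borel_measurable borel"
  by (intro borel_measurable_continuous_onI smooth_continuous)

lemma Cc_smooth: "f \<in> Cc_infty \<Longrightarrow> smooth f" by (simp add: Cc_infty_def)

lemma Cc_borel: "f \<in> Cc_infty \<Longrightarrow> f \<in> borel_measurable borel" by (intro smooth_borel Cc_smooth)

lemma Cc_differentiable: "f \<in> Cc_infty \<Longrightarrow> f differentiable (at x)"
  by (intro smooth_differentiable Cc_smooth)

lemma Cc_support:
  fixes f :: "real ^ 'n::finite \<Rightarrow> real"
  assumes "f \<in> Cc_infty"
  obtains R where "R > 0" "\<And>x. norm x \<ge> R \<Longrightarrow> f x = 0"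
proof -
  have "bounded (closure {x. f x \<noteq> 0})" using assms by (auto simp: Cc_infty_def compact_imp_bounded)
  hence "bounded {x. f x \<noteq> 0}" by (rule bounded_subset) (rule closure_subset)
  then obtain B where B: "\<forall>x\<in>{x. f x \<noteq> 0}. norm x \<le> B" unfolding bounded_iff by blast
  show thesis by (rule that[of "\<bar>B\<bar> + 1"]) (use B in force)+
qed

lemma CcI:
  assumes "smooth f" "\<And>x. norm x \<ge> R \<Longrightarrow> f x = 0"
  shows "f \<in> Cc_infty"
proof -
  have "{x. f x \<noteq> 0} \<subseteq> ball 0 R" using assms(2) by (auto simp: not_le[symmetric])
  hence "bounded {x. f x \<noteq> 0}" using bounded_ball bounded_subset by blast
  hence "compact (closure {x. f x \<noteq> 0})" by simp
  thus ?thesis using assms(1) by (simp add: Cc_infty_def)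
qed

lemma Cc_partial_deriv:
  fixes f :: "real ^ 'n::finite \<Rightarrow> real"
  assumes "f \<in> Cc_infty" shows "partial_deriv i f \<in> Cc_infty"
proof -
  obtain R where R: "R > 0" "\<And>x. norm x \<ge> R \<Longrightarrow> f x = 0" using Cc_support[OF assms] by blast
  show ?thesis
  proof (rule CcI[where R = "R + 1"])
    fix x :: "real^'n" assume x: "norm x \<ge> R + 1"
    have "(f has_derivative (\<lambda>_. 0)) (at x)"
    proof (rule has_derivative_transform_within_open[where f = "\<lambda>_. 0" and s = "- cball 0 R"])
      show "\<And>y. y \<in> - cball 0 R \<Longrightarrow> 0 = f y" using R(2) by auto
    qed (use x in auto)
    from partial_deriv_eqI[OF this] show "partial_deriv i f x = 0" by simp
  qed (use assms Cc_smooth smooth_partial_deriv in blast)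
qed

lemma Cc_Dl: "f \<in> Cc_infty \<Longrightarrow> Dl is f \<in> Cc_infty"
  by (induction "is") (auto intro: Cc_partial_deriv)

lemma Cc_bounded:
  assumes "f \<in> Cc_infty"
  obtains B where "B > 0" "\<And>x. \<bar>f x\<bar> \<le> B"
proof -
  obtain R where R: "R > 0" "\<And>x. norm x \<ge> R \<Longrightarrow> f x = 0" using Cc_support[OF assms] by blast
  have "compact (f ` cball 0 R)"
    by (intro compact_continuous_image continuous_on_subset[OF smooth_continuous[OF Cc_smooth[OF assms]]]) auto
  then obtain B where B: "B > 0" "\<And>y. y \<in> f ` cball 0 R \<Longrightarrow> \<bar>y\<bar> \<le> B"
    by (metis bounded_pos compact_imp_bounded real_norm_def)
  have "\<bar>f x\<bar> \<le> B" for x using B R(2)[of x] by (cases "norm x \<le> R") auto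
  thus thesis using that B(1) by blast
qed

lemma bounded_support_integrable:
  fixes f :: "real ^ 'n::finite \<Rightarrow> real"
  assumes "f \<in> borel_measurable borel" "\<And>x. \<bar>f x\<bar> \<le> B" "\<And>x. norm x \<ge> R \<Longrightarrow> f x = 0"
  shows "integrable lborel f"
proof (rule integrableI_bounded_set[where A = "ball 0 R" and B = B])
  show "emeasure lborel (ball (0::real^'n) R) < \<infinity>"
    by (cases "R \<ge> 0") (auto simp: emeasure_ball ball_empty)
qed (use assms in auto)

lemma Cc_integrable:
  assumes "f \<in> Cc_infty" shows "integrable lborel f"
proof -
  obtain R where R: "R > 0" "\<And>x. norm x \<ge> R \<Longrightarrow> f x = 0" using Cc_support[OF assms] by blast
  obtain B where B: "B > 0" "\<And>x. \<bar>f x\<bar> \<le> B" using Cc_bounded[OF assms] by blast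
  show ?thesis using bounded_support_integrable[OF Cc_borel[OF assms] B(2) R(2)] .
qed

lemma Cc_powr_integrable:
  assumes "f \<in> Cc_infty" "0 \<le> p" shows "integrable lborel (\<lambda>x. \<bar>f x\<bar> powr p)"
proof -
  obtain R where R: "R > 0" "\<And>x. norm x \<ge> R \<Longrightarrow> f x = 0" using Cc_support[OF assms(1)] by blast
  obtain B where B: "B > 0" "\<And>x. \<bar>f x\<bar> \<le> B" using Cc_bounded[OF assms(1)] by blast
  note [measurable] = Cc_borel[OF assms(1)]
  show ?thesis
    by (rule bounded_support_integrable[where B = "B powr p" and R = R])
       (use B R assms(2) in \<open>auto intro!: powr_mono2\<close>)
qed

lemma Lpow_Cc_finite:
  assumes "f \<in> Cc_infty" "0 \<le> p" shows "Lpow p f < \<infinity>"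
  using Cc_powr_integrable[OF assms] unfolding Lpow_def by (simp add: nn_integral_eq_integral)

lemma Cc_Lipschitz:
  fixes f :: "real ^ 'n::finite \<Rightarrow> real"
  assumes "f \<in> Cc_infty"
  obtains L where "L > 0" "\<And>x v. \<bar>f (x + v) - f x\<bar> \<le> L * norm v"
proof -
  have "\<forall>i. \<exists>B>0. \<forall>x. \<bar>partial_deriv i f x\<bar> \<le> B"
    using Cc_bounded[OF Cc_partial_deriv[OF assms]] by metis
  then obtain B where B: "\<And>i. B i > 0" "\<And>i x. \<bar>partial_deriv i f x\<bar> \<le> B i" by metis
  show thesis
  proof (rule that[of "\<Sum>i\<in>UNIV. B i"])
    show "0 < sum B UNIV" by (rule sum_pos) (use B in auto)
    fix x v
    obtain \<xi> where \<xi>: "f (x + v) - f x = (\<Sum>i\<in>UNIV. v $ i * partial_deriv i f (x + \<xi> *\<^sub>R v))"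
      using mean_value_partial[OF Cc_differentiable[OF assms]] by blast
    have "\<bar>f (x + v) - f x\<bar> \<le> (\<Sum>i\<in>UNIV. \<bar>v $ i * partial_deriv i f (x + \<xi> *\<^sub>R v)\<bar>)"
      unfolding \<xi> by (rule sum_abs)
    also have "\<dots> \<le> (\<Sum>i\<in>UNIV. norm v * B i)"
      by (intro sum_mono) (use B component_le_norm_cart[of v] in \<open>auto simp: abs_mult intro!: mult_mono\<close>)
    finally show "\<bar>f (x + v) - f x\<bar> \<le> sum B UNIV * norm v" by (simp add: sum_distrib_left mult.commute)
  qed
qed

section \<open>A bump function\<close>

text \<open>The parameters \<open>P\<close> and \<open>m\<close> are there because with them the class is closed under differentiation
  (\<open>bump1_DERIV\<close>), so that all derivatives of the bump \<open>bump1 e 1 0\<close> are available at once.\<close>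

definition bump1 :: "real \<Rightarrow> real poly \<Rightarrow> nat \<Rightarrow> real \<Rightarrow> real" where
  "bump1 e P m t = (if \<bar>t\<bar> < e then poly P t / (e\<^sup>2 - t\<^sup>2) ^ m * exp (- 1 / (e\<^sup>2 - t\<^sup>2)) else 0)"

text \<open>One term of the exponential series of \<open>1 / d\<close>: the bump vanishes to infinite order at the boundary.\<close>

lemma exp_minus_inverse_le:
  fixes d :: real assumes "d > 0" shows "exp (- 1 / d) \<le> fact k * d ^ k"
proof -
  have "(1 / d) ^ k / fact k \<le> (\<Sum>n. (1 / d) ^ n /\<^sub>R fact n)"
    using sum_le_suminf[OF summable_exp_generic[of "1 / d"], of "{k}"] assms
    by (simp add: divide_inverse mult.commute)
  hence "(1 / d) ^ k / fact k \<le> exp (1 / d)" by (simp add: exp_def)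
  hence "1 / exp (1 / d) \<le> 1 / ((1 / d) ^ k / fact k)"
    using assms by (intro divide_left_mono) auto
  thus ?thesis using assms by (simp add: exp_minus inverse_eq_divide power_divide mult.commute)
qed

text \<open>Only \<open>|t| = e\<close> is delicate. With \<open>d = e\<^sup>2 - (t + h)\<^sup>2 = O(h)\<close> the exponential is at most
  \<open>(m + 2)! d\<^sup>m\<^sup>+\<^sup>2\<close>, which absorbs the denominator \<open>d\<^sup>m\<close> and leaves \<open>O(h\<^sup>2)\<close>.\<close>

lemma bump1_DERIV:
  assumes e: "e > 0"
  shows "\<exists>Q k. \<forall>t. (bump1 e P m has_real_derivative bump1 e Q k t) (at t)"
proof -
  define w where "w = [:e\<^sup>2, 0, -1:]"
  define Q where "Q = pderiv P * w ^ 2 + smult (2 * real m) ([:0, 1:] * P * w) - smult 2 ([:0, 1:] * P)"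
  have w: "poly w t = e\<^sup>2 - t\<^sup>2" for t by (simp add: w_def power2_eq_square)
  have "(bump1 e P m has_real_derivative bump1 e Q (m + 2) t) (at t)" for t
  proof -
    consider "\<bar>t\<bar> < e" | "\<bar>t\<bar> > e" | "\<bar>t\<bar> = e" by linarith
    thus ?thesis
    proof cases
      case 1
      have "t\<^sup>2 < e\<^sup>2" using power_strict_mono[OF 1, of 2] by simp
      hence d: "e\<^sup>2 - t\<^sup>2 \<noteq> 0" "e\<^sup>2 - t\<^sup>2 > 0" by auto
      define d where "d = e\<^sup>2 - t\<^sup>2"
      have d0: "d > 0" using d by (simp add: d_def)
      have dd: "((\<lambda>t. e\<^sup>2 - t\<^sup>2) has_real_derivative - (2 * t)) (at t)"
        by (auto intro!: derivative_eq_intros)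
      have d1: "((\<lambda>t. poly P t / (e\<^sup>2 - t\<^sup>2) ^ m) has_real_derivative
         (poly (pderiv P) t * d ^ m - poly P t * (real m * d ^ (m - 1) * (- (2 * t)))) / (d ^ m * d ^ m)) (at t)"
        by (rule DERIV_cong[OF DERIV_divide[OF poly_DERIV DERIV_power[OF dd]]]) (use d in \<open>auto simp: d_def mult_ac\<close>)
      have d2: "((\<lambda>t. exp (- 1 / (e\<^sup>2 - t\<^sup>2))) has_real_derivative exp (- 1 / d) * (- (2 * t) / d ^ 2)) (at t)"
        by (rule DERIV_cong[OF DERIV_exp[THEN DERIV_chain2, OF DERIV_divide[OF DERIV_const dd]]])
           (use d in \<open>auto simp: d_def power2_eq_square\<close>)
      have "((\<lambda>t. poly P t / (e\<^sup>2 - t\<^sup>2) ^ m * exp (- 1 / (e\<^sup>2 - t\<^sup>2))) has_real_derivative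
         (poly (pderiv P) t * d ^ m - poly P t * (real m * d ^ (m - 1) * (- (2 * t)))) / (d ^ m * d ^ m) * exp (- 1 / d)
          + poly P t / d ^ m * (exp (- 1 / d) * (- (2 * t) / d ^ 2))) (at t)"
        by (rule DERIV_cong[OF DERIV_mult[OF d1 d2]]) (simp add: d_def mult_ac)
      also have "(poly (pderiv P) t * d ^ m - poly P t * (real m * d ^ (m - 1) * (- (2 * t)))) / (d ^ m * d ^ m) * exp (- 1 / d)
          + poly P t / d ^ m * (exp (- 1 / d) * (- (2 * t) / d ^ 2)) = bump1 e Q (m + 2) t"
      proof -
        have "real m * d ^ (m - 1) = real m * d ^ m / d" using d0 by (cases m) auto
        hence "(poly (pderiv P) t * d ^ m - poly P t * (real m * d ^ (m - 1) * (- (2 * t)))) / (d ^ m * d ^ m)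
           = (poly (pderiv P) t + poly P t * (2 * real m * t) / d) / d ^ m"
          using d0 by (auto simp: field_simps)
        moreover have alg: "(a + b * (2 * r * t) / d) / c * E + b / c * (E * (- (2 * t) / d ^ 2)) = (a * d ^ 2 + 2 * r * (t * b * d) - 2 * (t * b)) / (c * d ^ 2) * E"
          if "c \<noteq> 0" for a b c r E :: real
          using d0 that by (simp add: field_simps power2_eq_square)
        moreover have "bump1 e Q (m + 2) t = (poly (pderiv P) t * d ^ 2 + 2 * real m * (t * poly P t * d) - 2 * (t * poly P t)) / (d ^ m * d ^ 2) * exp (- 1 / d)"
          using 1 unfolding bump1_def Q_def by (simp add: w d_def power_add power2_eq_square mult_ac)
        ultimately show ?thesis using d0 by simp
      qed
      finally show ?thesis
        by (rule has_field_derivative_transform_within_open[where S = "{-e<..<e}"])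
           (use 1 in \<open>auto simp: bump1_def abs_less_iff\<close>)
    next
      case 2
      have "((\<lambda>_. 0) has_real_derivative 0) (at t)" by simp
      hence "(bump1 e P m has_real_derivative 0) (at t)"
        by (rule has_field_derivative_transform_within_open[where S = "- {-e..e}"])
           (use 2 in \<open>auto simp: bump1_def\<close>)
      thus ?thesis using 2 by (simp add: bump1_def)
    next
      case 3
      have "compact (poly P ` {-e..e})" by (intro compact_continuous_image continuous_intros) auto
      then obtain C where C: "C > 0" "\<And>y. y \<in> poly P ` {-e..e} \<Longrightarrow> \<bar>y\<bar> \<le> C"
        by (metis bounded_pos compact_imp_bounded real_norm_def)
      define K where "K = C * fact (m + 2) * (2 * e)\<^sup>2"
      have bd: "\<bar>bump1 e P m (t + h)\<bar> \<le> K * h\<^sup>2" for h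
      proof (cases "\<bar>t + h\<bar> < e")
        case True
        define d where "d = e\<^sup>2 - (t + h)\<^sup>2"
        have "(t + h)\<^sup>2 < e\<^sup>2" using power_strict_mono[OF True, of 2] by simp
        hence d: "d > 0" by (simp add: d_def)
        have "d = (e - \<bar>t + h\<bar>) * (e + \<bar>t + h\<bar>)" by (simp add: d_def algebra_simps power2_eq_square)
        also have "\<dots> \<le> \<bar>h\<bar> * (2 * e)" using True 3 by (intro mult_mono) auto
        finally have dh: "d \<le> \<bar>h\<bar> * (2 * e)" .
        have "\<bar>bump1 e P m (t + h)\<bar> = \<bar>poly P (t + h)\<bar> / d ^ m * exp (- 1 / d)"
          using True d by (simp add: bump1_def d_def abs_mult)
        also have "\<dots> \<le> C / d ^ m * (fact (m + 2) * d ^ (m + 2))"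
        proof (rule mult_mono)
          have "t + h \<in> {-e..e}" using True by (auto simp: abs_less_iff)
          hence "\<bar>poly P (t + h)\<bar> \<le> C" by (intro C(2) imageI)
          thus "\<bar>poly P (t + h)\<bar> / d ^ m \<le> C / d ^ m" using d by (intro divide_right_mono) auto
        qed (use exp_minus_inverse_le[OF d, of "m + 2"] C d in auto)
        also have "\<dots> = C * fact (m + 2) * d\<^sup>2" using d by (simp add: power_add power2_eq_square)
        also have "\<dots> \<le> C * fact (m + 2) * (\<bar>h\<bar> * (2 * e))\<^sup>2"
          using C d dh by (intro mult_left_mono power_mono) auto
        finally show ?thesis by (simp add: K_def power_mult_distrib mult_ac)
      next
        case False
        have "K \<ge> 0" using C by (simp add: K_def)
        thus ?thesis using False by (simp add: bump1_def)
      qed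
      have "((\<lambda>h. (bump1 e P m (t + h) - bump1 e P m t) / h) \<longlongrightarrow> 0) (at 0)"
      proof (rule Lim_null_comparison[where g = "\<lambda>h. K * \<bar>h\<bar>"])
        show "\<forall>\<^sub>F h in at 0. norm ((bump1 e P m (t + h) - bump1 e P m t) / h) \<le> K * \<bar>h\<bar>"
        proof (intro always_eventually allI)
          fix h :: real
          have "bump1 e P m t = 0" using 3 by (simp add: bump1_def)
          thus "norm ((bump1 e P m (t + h) - bump1 e P m t) / h) \<le> K * \<bar>h\<bar>"
          proof (cases "h = 0")
            case False
            have "K * h\<^sup>2 = K * \<bar>h\<bar> * \<bar>h\<bar>" by (simp add: power2_eq_square)
            with \<open>bump1 e P m t = 0\<close> bd[of h] False show ?thesis by (simp add: pos_divide_le_eq)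
          qed simp
        qed
        have "((\<lambda>h. K * \<bar>h\<bar>) \<longlongrightarrow> K * \<bar>0\<bar>) (at 0)" by (intro tendsto_intros)
        thus "((\<lambda>h. K * \<bar>h\<bar>) \<longlongrightarrow> 0) (at 0)" by simp
      qed
      hence "(bump1 e P m has_real_derivative 0) (at t)" by (simp add: DERIV_def)
      thus ?thesis using 3 by (simp add: bump1_def)
    qed
  qed
  thus ?thesis by blast
qed

lemma product_smooth:
  fixes b :: "'n::finite \<Rightarrow> real \<Rightarrow> real"
  assumes e: "e > 0"
  shows "smooth (\<lambda>x :: real^'n. \<Prod>j\<in>UNIV. bump1 e (P j) (m j) (x $ j))"
proof (rule smooth_coinduct[where S = "{\<lambda>x :: real^'n. \<Prod>j\<in>UNIV. bump1 e (P j) (m j) (x $ j) | P m. True}"])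
  show "(\<lambda>x :: real^'n. \<Prod>j\<in>UNIV. bump1 e (P j) (m j) (x $ j)) \<in> {\<lambda>x :: real^'n. \<Prod>j\<in>UNIV. bump1 e (P j) (m j) (x $ j) | P m. True}"
    by blast
next
  fix g :: "real^'n \<Rightarrow> real" assume "g \<in> {\<lambda>x :: real^'n. \<Prod>j\<in>UNIV. bump1 e (P j) (m j) (x $ j) | P m. True}"
  then obtain P m where g: "g = (\<lambda>x. \<Prod>j\<in>UNIV. bump1 e (P j) (m j) (x $ j))" by blast
  have "\<forall>j. \<exists>Q k. \<forall>t. (bump1 e (P j) (m j) has_real_derivative bump1 e Q k t) (at t)"
    using bump1_DERIV[OF e] by blast
  then obtain Q k where Qk: "\<And>j t. (bump1 e (P j) (m j) has_real_derivative bump1 e (Q j) (k j) t) (at t)" by metis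
  have comp: "((\<lambda>x::real^'n. bump1 e (P j) (m j) (x $ j)) has_derivative (\<lambda>v. bump1 e (Q j) (k j) (x $ j) * v $ j)) (at x)" for j x
    by (rule has_derivative_compose[of "\<lambda>x. x $ j" "\<lambda>v. v $ j" x UNIV "bump1 e (P j) (m j)"])
       (use Qk[of j "x $ j"] in \<open>auto simp: has_field_derivative_def intro!: bounded_linear_imp_has_derivative bounded_linear_vec_nth\<close>)
  have hd: "(g has_derivative (\<lambda>v. \<Sum>i\<in>UNIV. (bump1 e (Q i) (k i) (x $ i) * v $ i) * (\<Prod>j\<in>UNIV - {i}. bump1 e (P j) (m j) (x $ j)))) (at x)" for x
    unfolding g by (rule has_derivative_prod) (rule comp)
  show "g differentiable (at x)" for x using hd by (auto simp: differentiable_def)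
  fix i
  have "partial_deriv i g x = bump1 e (Q i) (k i) (x $ i) * (\<Prod>j\<in>UNIV - {i}. bump1 e (P j) (m j) (x $ j))" for x
    unfolding partial_deriv_eqI[OF hd] by (subst sum.remove[of _ i]) (auto simp: axis_def)
  also have "\<dots> x = (\<Prod>j\<in>UNIV. bump1 e ((P(i := Q i)) j) ((m(i := k i)) j) (x $ j))" for x
    by (subst prod.remove[of _ i]) (auto intro!: prod.cong)
  finally have "partial_deriv i g = (\<lambda>x. \<Prod>j\<in>UNIV. bump1 e ((P(i := Q i)) j) ((m(i := k i)) j) (x $ j))" by blast
  thus "partial_deriv i g \<in> {\<lambda>x :: real^'n. \<Prod>j\<in>UNIV. bump1 e (P j) (m j) (x $ j) | P m. True}" by blast
qed

lemma partial_deriv_cmult: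
  assumes "f differentiable (at x)"
  shows "partial_deriv i (\<lambda>x. c * f x) x = c * partial_deriv i f x"
proof -
  have "((\<lambda>x. c * f x) has_derivative (\<lambda>v. c * (\<Sum>i\<in>UNIV. v $ i * partial_deriv i f x))) (at x)"
    by (intro derivative_intros differentiable_has_derivative_partial assms)
  from partial_deriv_eqI[OF this, of i] partial_deriv_eqI[OF differentiable_has_derivative_partial[OF assms], of i]
  show ?thesis by simp
qed

lemma Cc_cmult:
  assumes "f \<in> Cc_infty" shows "(\<lambda>x. c * f x) \<in> Cc_infty"
proof -
  obtain R where R: "R > 0" "\<And>x. norm x \<ge> R \<Longrightarrow> f x = 0" using Cc_support[OF assms] by blast
  have "smooth (\<lambda>x. c * f x)"
  proof (rule smooth_coinduct[where S = "{\<lambda>x. c * f x | f. smooth f}"])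
    show "(\<lambda>x. c * f x) \<in> {\<lambda>x. c * f x |f. smooth f}" using Cc_smooth[OF assms] by blast
  next
    fix g i assume "g \<in> {\<lambda>x. c * f x |f. smooth f}"
    then obtain f where f: "g = (\<lambda>x. c * f x)" "smooth f" by blast
    show "g differentiable (at x)" for x unfolding f by (intro derivative_intros smooth_differentiable f)
    have "partial_deriv i g = (\<lambda>x. c * partial_deriv i f x)"
      unfolding f using partial_deriv_cmult smooth_differentiable[OF f(2)] by blast
    thus "partial_deriv i g \<in> {\<lambda>x. c * f x |f. smooth f}" using smooth_partial_deriv[OF f(2)] by blast
  qed
  thus ?thesis using CcI[of "\<lambda>x. c * f x" R] R by simp
qed

definition mollifier :: "real \<Rightarrow> (real ^ 'n::finite \<Rightarrow> real) \<Rightarrow> bool" where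
  "mollifier e \<eta> \<longleftrightarrow> \<eta> \<in> Cc_infty \<and> (\<forall>x. 0 \<le> \<eta> x) \<and> (\<forall>x. norm x \<ge> e \<longrightarrow> \<eta> x = 0) \<and> (\<integral>x. \<eta> x \<partial>lborel) = 1"

lemma mollifier_exists:
  assumes e: "e > 0"
  shows "\<exists>\<eta> :: real ^ 'n::finite \<Rightarrow> real. mollifier e \<eta>"
proof -
  define d where "d = e / real CARD('n)"
  have d: "d > 0" using e by (simp add: d_def)
  define g where "g x = (\<Prod>j\<in>UNIV. bump1 d 1 0 (x $ j))" for x :: "real^'n"
  have g0: "g x \<ge> 0" for x unfolding g_def by (intro prod_nonneg) (auto simp: bump1_def)
  have supp: "g x = 0" if "norm x \<ge> e" for x
  proof -
    have "\<exists>j. \<bar>x $ j\<bar> \<ge> d"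
    proof (rule ccontr)
      assume "\<not> ?thesis"
      hence "\<bar>x $ j\<bar> < d" for j by (meson not_le)
      hence "(\<Sum>j\<in>UNIV. \<bar>x $ j\<bar>) < (\<Sum>j\<in>(UNIV::'n set). d)" by (intro sum_strict_mono) auto
      moreover have "norm x \<le> (\<Sum>j\<in>UNIV. \<bar>x $ j\<bar>)" by (rule norm_le_l1_cart)
      ultimately show False using that by (simp add: d_def)
    qed
    thus ?thesis by (auto simp: g_def bump1_def not_less intro!: prod_zero)
  qed
  have gC: "g \<in> Cc_infty"
    by (rule CcI[where R = e]) (use product_smooth[OF d, of "\<lambda>_. 1" "\<lambda>_. 0"] supp in \<open>auto simp: g_def[abs_def]\<close>)
  have "(\<integral>x. g x \<partial>lborel) \<noteq> 0"
  proof
    assume "(\<integral>x. g x \<partial>lborel) = 0"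
    hence "AE x in lborel. g x = 0"
      using integral_nonneg_eq_0_iff_AE[OF Cc_integrable[OF gC]] g0 by simp
    moreover have "g x \<noteq> 0" if "x \<in> ball 0 d" for x
    proof -
      have "\<bar>x $ j\<bar> < d" for j using component_le_norm_cart[of x j] that by simp
      thus ?thesis by (auto simp: g_def bump1_def)
    qed
    ultimately have "AE x in lborel. x \<notin> ball (0::real^'n) d" by (auto elim: AE_mp)
    hence "emeasure lborel (ball (0::real^'n) d) = 0" by (subst (asm) AE_iff_measurable) auto
    thus False using d unit_ball_vol_pos[of "real CARD('n)"] by (simp add: emeasure_ball)
  qed
  moreover have "(\<integral>x. g x \<partial>lborel) \<ge> 0" by (rule Bochner_Integration.integral_nonneg) (rule g0)
  ultimately have I: "(\<integral>x. g x \<partial>lborel) > 0" by simp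
  have "mollifier e (\<lambda>x. (1 / (\<integral>x. g x \<partial>lborel)) * g x)"
    unfolding mollifier_def using I g0 supp Cc_cmult[OF gC, of "1 / (\<integral>x. g x \<partial>lborel)"] by simp
  thus ?thesis by blast
qed

section \<open>Reflection and translation\<close>

lemma partial_deriv_reflect:
  assumes "\<And>x. f differentiable (at x)"
  shows "partial_deriv i (\<lambda>y. f (a - y)) y = - partial_deriv i f (a - y)"
    and "(\<lambda>y. f (a - y)) differentiable (at y)"
proof -
  have *: "((\<lambda>y. f (a - y)) has_derivative (\<lambda>v. \<Sum>i\<in>UNIV. (- v) $ i * partial_deriv i f (a - y))) (at y)"
    by (rule has_derivative_compose[of "\<lambda>y. a - y" uminus _ _ f])
       (auto intro!: derivative_eq_intros differentiable_has_derivative_partial assms)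
  show "(\<lambda>y. f (a - y)) differentiable (at y)" using * by (auto simp: differentiable_def)
  show "partial_deriv i (\<lambda>y. f (a - y)) y = - partial_deriv i f (a - y)"
    unfolding partial_deriv_eqI[OF *] by (simp add: axis_def if_distrib[of "\<lambda>x. x * _"] if_distrib[of uminus] cong: if_cong)
qed

lemma Dl_reflect:
  assumes "smooth f"
  shows "Dl is (\<lambda>y. f (a - y)) = (\<lambda>y. (-1) ^ length is * Dl is f (a - y))"
proof (induction "is")
  case (Cons i "is")
  have d: "Dl is f differentiable (at x)" for x by (intro smooth_differentiable smooth_Dl assms)
  have "partial_deriv i (\<lambda>y. (-1) ^ length is * Dl is f (a - y)) = (\<lambda>y. (-1) ^ length is * - partial_deriv i (Dl is f) (a - y))"
    using partial_deriv_cmult[OF partial_deriv_reflect(2)[OF d]] partial_deriv_reflect(1)[OF d] by (intro ext) metis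
  thus ?case by (simp add: Cons.IH)
qed simp

lemma Cc_reflect:
  fixes f :: "real ^ 'n::finite \<Rightarrow> real"
  assumes "f \<in> Cc_infty" shows "(\<lambda>y. f (a - y)) \<in> Cc_infty"
proof -
  obtain R where R: "R > 0" "\<And>x. norm x \<ge> R \<Longrightarrow> f x = 0" using Cc_support[OF assms] by blast
  have "smooth (\<lambda>y. f (a - y))"
    unfolding smooth_def Dl_reflect[OF Cc_smooth[OF assms]]
    by (intro allI derivative_intros partial_deriv_reflect(2) smooth_differentiable smooth_Dl Cc_smooth assms)
  thus ?thesis
  proof (rule CcI[where R = "R + norm a"])
    fix x :: "real^'n" assume "R + norm a \<le> norm x"
    hence "norm (a - x) \<ge> R" using norm_triangle_ineq2[of x a] by (simp add: norm_minus_commute)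
    thus "f (a - x) = 0" by (rule R)
  qed
qed

section \<open>Symmetry of second derivatives, multi-indices\<close>

text \<open>The mean value theorem, applied first to the difference in direction \<open>j\<close> as a function of the
  coordinate in direction \<open>i\<close>, and then once more in direction \<open>j\<close>.\<close>

lemma second_difference_quotient:
  fixes f :: "real ^ 'n::finite \<Rightarrow> real"
  assumes f: "smooth f" and h: "h > 0"
  shows "\<exists>y. norm (y - x) \<le> 2 * h \<and>
    f (x + h *\<^sub>R axis i 1 + h *\<^sub>R axis j 1) - f (x + h *\<^sub>R axis i 1) - f (x + h *\<^sub>R axis j 1) + f x = h * h * partial_deriv j (partial_deriv i f) y"
proof -
  let ?ei = "axis i 1 :: real^'n" and ?ej = "axis j 1 :: real^'n"
  have "\<exists>s>0. s < h \<and> (f (x + h *\<^sub>R ?ej + h *\<^sub>R ?ei) - f (x + h *\<^sub>R ?ei)) - (f (x + h *\<^sub>R ?ej + 0 *\<^sub>R ?ei) - f (x + 0 *\<^sub>R ?ei))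
     = (h - 0) * (partial_deriv i f (x + h *\<^sub>R ?ej + s *\<^sub>R ?ei) - partial_deriv i f (x + s *\<^sub>R ?ei))"
    by (rule MVT2[OF h]) (intro DERIV_diff has_real_derivative_axis smooth_differentiable f)
  then obtain s where s: "0 < s" "s < h" and 1: "f (x + h *\<^sub>R ?ej + h *\<^sub>R ?ei) - f (x + h *\<^sub>R ?ei) - (f (x + h *\<^sub>R ?ej) - f x)
     = h * (partial_deriv i f (x + h *\<^sub>R ?ej + s *\<^sub>R ?ei) - partial_deriv i f (x + s *\<^sub>R ?ei))" by auto
  have "\<exists>t>0. t < h \<and> partial_deriv i f (x + s *\<^sub>R ?ei + h *\<^sub>R ?ej) - partial_deriv i f (x + s *\<^sub>R ?ei + 0 *\<^sub>R ?ej)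
     = (h - 0) * partial_deriv j (partial_deriv i f) (x + s *\<^sub>R ?ei + t *\<^sub>R ?ej)"
    by (rule MVT2[OF h]) (intro has_real_derivative_axis smooth_differentiable smooth_partial_deriv f)
  then obtain t where t: "0 < t" "t < h" and 2: "partial_deriv i f (x + s *\<^sub>R ?ei + h *\<^sub>R ?ej) - partial_deriv i f (x + s *\<^sub>R ?ei)
     = h * partial_deriv j (partial_deriv i f) (x + s *\<^sub>R ?ei + t *\<^sub>R ?ej)" by auto
  have "norm (s *\<^sub>R ?ei + t *\<^sub>R ?ej) \<le> 2 * h"
    using norm_triangle_ineq[of "s *\<^sub>R ?ei" "t *\<^sub>R ?ej"] s t by (simp add: norm_axis_1)
  hence "norm (x + s *\<^sub>R ?ei + t *\<^sub>R ?ej - x) \<le> 2 * h" by (simp add: add.assoc)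
  moreover have "f (x + h *\<^sub>R ?ei + h *\<^sub>R ?ej) - f (x + h *\<^sub>R ?ei) - f (x + h *\<^sub>R ?ej) + f x = h * h * partial_deriv j (partial_deriv i f) (x + s *\<^sub>R ?ei + t *\<^sub>R ?ej)"
    using 1 2 by (simp add: algebra_simps)
  ultimately show ?thesis by blast
qed

text \<open>The second difference is symmetric in the two directions, so both mixed derivatives are limits of
  the same quotient.\<close>

lemma partial_deriv_commute:
  fixes f :: "real ^ 'n::finite \<Rightarrow> real"
  assumes f: "smooth f"
  shows "partial_deriv i (partial_deriv j f) = partial_deriv j (partial_deriv i f)"
proof
  fix x
  let ?A = "partial_deriv i (partial_deriv j f)" and ?B = "partial_deriv j (partial_deriv i f)"
  have c: "isCont ?A x" "isCont ?B x" by (intro smooth_isCont smooth_partial_deriv f)+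
  show "?A x = ?B x"
  proof (rule ccontr)
    assume ne: "?A x \<noteq> ?B x"
    define e where "e = \<bar>?A x - ?B x\<bar> / 2"
    have e: "e > 0" using ne by (simp add: e_def)
    obtain d1 where d1: "d1 > 0" "\<And>y. dist y x < d1 \<Longrightarrow> dist (?A y) (?A x) < e"
      using c(1) e unfolding continuous_at_eps_delta by (metis dist_commute)
    obtain d2 where d2: "d2 > 0" "\<And>y. dist y x < d2 \<Longrightarrow> dist (?B y) (?B x) < e"
      using c(2) e unfolding continuous_at_eps_delta by (metis dist_commute)
    define h where "h = min d1 d2 / 4"
    have h: "h > 0" "2 * h < d1" "2 * h < d2" using d1 d2 by (auto simp: h_def)
    obtain y where y: "norm (y - x) \<le> 2 * h" "f (x + h *\<^sub>R axis i 1 + h *\<^sub>R axis j 1) - f (x + h *\<^sub>R axis i 1) - f (x + h *\<^sub>R axis j 1) + f x = h * h * ?B y"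
      using second_difference_quotient[OF f h(1), of x i j] by blast
    obtain z where z: "norm (z - x) \<le> 2 * h" "f (x + h *\<^sub>R axis j 1 + h *\<^sub>R axis i 1) - f (x + h *\<^sub>R axis j 1) - f (x + h *\<^sub>R axis i 1) + f x = h * h * ?A z"
      using second_difference_quotient[OF f h(1), of x j i] by blast
    have "x + h *\<^sub>R axis j 1 + h *\<^sub>R axis i 1 = x + h *\<^sub>R axis i 1 + h *\<^sub>R axis j 1" by (simp add: algebra_simps)
    hence "f (x + h *\<^sub>R axis j 1 + h *\<^sub>R axis i 1) = f (x + h *\<^sub>R axis i 1 + h *\<^sub>R axis j 1)" by (simp only:)
    hence "h * h * ?A z = h * h * ?B y" using y(2) z(2) by linarith
    hence "?A z = ?B y" using h by auto
    moreover have "dist (?A z) (?A x) < e" using z h by (intro d1) (simp add: dist_norm)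
    moreover have "dist (?B y) (?B x) < e" using y h by (intro d2) (simp add: dist_norm)
    ultimately show False by (auto simp: e_def dist_real_def abs_if split: if_splits)
  qed
qed

lemma Dl_move_front:
  assumes "smooth f" shows "Dl (xs @ a # ys) f = Dl (a # xs @ ys) f"
proof (induction xs)
  case (Cons b xs)
  show ?case using Cons partial_deriv_commute[OF smooth_Dl[OF assms, of "xs @ ys"], of a b] by simp
qed simp

lemma Dl_perm:
  assumes f: "smooth f" and "mset is = mset js" shows "Dl is f = Dl js f"
  using assms(2)
proof (induction "is" arbitrary: js)
  case (Cons a "is")
  have "a \<in> set js" using Cons.prems by (metis list.set_intros(1) set_mset_mset)
  then obtain xs ys where js: "js = xs @ a # ys" by (meson split_list)
  have "mset is = mset (xs @ ys)" using Cons.prems by (simp add: js)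
  from Cons.IH[OF this] show ?case unfolding js Dl_move_front[OF f] by simp
qed simp

lemma mi_list: "\<exists>is. \<forall>i. count_list is i = (\<nu> :: 'n::finite \<Rightarrow> nat) i"
proof -
  obtain xs where xs: "mset xs = (\<Sum>i\<in>UNIV. replicate_mset (\<nu> i) i)" using ex_mset by blast
  have "count_list xs i = \<nu> i" for i
  proof -
    have "count_list xs i = count (mset xs) i" by (simp add: count_mset)
    thus ?thesis by (simp add: xs count_sum if_distrib cong: if_cong)
  qed
  thus ?thesis by blast
qed

lemma mderiv_list:
  obtains "is" where "\<And>i. count_list is i = \<nu> i" "length is = mi_order \<nu>" "\<And>f. mderiv \<nu> f = Dl is f"
proof -
  define "is" where "is = (SOME is. \<forall>i. count_list is i = \<nu> i)"
  have c: "count_list is i = \<nu> i" for i unfolding is_def using someI_ex[OF mi_list[of \<nu>]] by blast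
  have "length is = sum (count_list is) UNIV" by (rule sum_count_set[symmetric]) auto
  also have "\<dots> = mi_order \<nu>" by (simp add: c mi_order_def)
  finally have "length is = mi_order \<nu>" .
  thus thesis using that[of "is"] c by (simp add: mderiv_def is_def)
qed

text \<open>By symmetry of second derivatives the order of differentiation, which \<open>mderiv\<close> leaves open, does
  not matter.\<close>

lemma Dl_eq_mderiv:
  assumes "smooth f" shows "Dl is f = mderiv (count_list is) f" "length is = mi_order (count_list is)"
proof -
  obtain js where js: "\<And>i. count_list js i = count_list is i" "length js = mi_order (count_list is)" "\<And>f. mderiv (count_list is) f = Dl js f"
    using mderiv_list[of "count_list is"] by metis
  have "mset is = mset js" using js(1) by (intro multiset_eqI) (simp add: count_mset)
  thus "Dl is f = mderiv (count_list is) f" using Dl_perm[OF assms] js(3) by metis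
  show "length is = mi_order (count_list is)" using \<open>mset is = mset js\<close> js(2) by (metis mset_eq_length)
qed

lemma Cc_mderiv: "f \<in> Cc_infty \<Longrightarrow> mderiv \<nu> f \<in> Cc_infty"
  by (metis mderiv_list Cc_Dl)

lemma mderiv_reflect:
  assumes "smooth f"
  shows "mderiv \<nu> (\<lambda>y. f (a - y)) = (\<lambda>y. (-1) ^ mi_order \<nu> * mderiv \<nu> f (a - y))"
  using Dl_reflect[OF assms] by (metis mderiv_list)


section \<open>Local integrability\<close>

lemma locally_integrable_borel:
  fixes g :: "real ^ 'n::finite \<Rightarrow> real"
  assumes "locally_integrable g" shows "g \<in> borel_measurable borel"
proof (rule borel_measurable_LIMSEQ_real)
  show "(\<lambda>i. indicator (cball 0 (real i)) x *\<^sub>R g x) \<longlonglongrightarrow> g x" for x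
  proof -
    obtain N :: nat where N: "norm x \<le> real N" using real_arch_simple by blast
    have "eventually (\<lambda>i. indicator (cball 0 (real i)) x *\<^sub>R g x = g x) sequentially"
      using eventually_ge_at_top[of N] by eventually_elim (use N in auto)
    thus ?thesis by (rule tendsto_eventually)
  qed
  show "(\<lambda>x. indicator (cball 0 (real i)) x *\<^sub>R g x) \<in> borel_measurable borel" for i
    using assms compact_cball[of 0 "real i"] unfolding locally_integrable_def set_integrable_def
    by (metis borel_measurable_integrable measurable_lborel2)
qed

lemma compact_indicator_integrable:
  fixes K :: "(real ^ 'n::finite) set"
  assumes "compact K" shows "integrable lborel (indicator K :: _ \<Rightarrow> real)"
  using assms emeasure_compact_finite[of K] by (simp add: integrable_indicator_iff compact_imp_closed borel_closed)

lemma locally_integrable_Lpow: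
  fixes f :: "real ^ 'n::finite \<Rightarrow> real"
  assumes [measurable]: "f \<in> borel_measurable borel" and fin: "Lpow p f < \<infinity>" and p: "1 \<le> p"
  shows "locally_integrable f"
  unfolding locally_integrable_def set_integrable_def
proof (intro allI impI)
  fix K :: "(real^'n) set" assume K: "compact K"
  have [measurable]: "K \<in> sets borel" using K by (simp add: compact_imp_closed borel_closed)
  have i: "integrable lborel (\<lambda>x. \<bar>f x\<bar> powr p)"
    using fin by (intro integrableI_nonneg) (auto simp: Lpow_def)
  show "integrable lborel (\<lambda>x. indicator K x *\<^sub>R f x)"
  proof (rule Bochner_Integration.integrable_bound[OF Bochner_Integration.integrable_add[OF compact_indicator_integrable[OF K] i]])
    show "AE x in lborel. norm (indicator K x *\<^sub>R f x) \<le> norm (indicator K x + \<bar>f x\<bar> powr p)"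
    proof (rule AE_I2)
      fix x
      have "\<bar>f x\<bar> \<le> 1 + \<bar>f x\<bar> powr p"
      proof (cases "\<bar>f x\<bar> \<le> 1")
        case False
        hence "\<bar>f x\<bar> powr 1 \<le> \<bar>f x\<bar> powr p" using p by (intro powr_mono) auto
        thus ?thesis by simp
      qed (use powr_ge_zero[of "\<bar>f x\<bar>" p] in linarith)
      thus "norm (indicator K x *\<^sub>R f x) \<le> norm (indicator K x + \<bar>f x\<bar> powr p)" by (auto simp: indicator_def)
    qed
  qed auto
qed

lemma locally_integrable_integrable: "integrable lborel f \<Longrightarrow> locally_integrable f"
  unfolding locally_integrable_def set_integrable_def
  using integrable_mult_indicator[of _ lborel f] by (simp add: compact_imp_closed borel_closed)

lemma bounded_kernel_integrable:
  fixes h k :: "real ^ 'n::finite \<Rightarrow> real"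
  assumes h: "locally_integrable h" and k: "k \<in> borel_measurable borel" "\<And>x. \<bar>k x\<bar> \<le> B" "\<And>x. norm x \<ge> R \<Longrightarrow> k x = 0"
  shows "integrable lborel (\<lambda>y. k (x - y) * h y)"
proof -
  note [measurable] = locally_integrable_borel[OF h] k(1)
  have "integrable lborel (\<lambda>y. indicator (cball 0 (R + norm x)) y *\<^sub>R h y)"
    using h by (auto simp: locally_integrable_def set_integrable_def)
  hence "integrable lborel (\<lambda>y. B * (indicator (cball 0 (R + norm x)) y *\<^sub>R h y))" by simp
  thus ?thesis
  proof (rule Bochner_Integration.integrable_bound)
    show "AE y in lborel. norm (k (x - y) * h y) \<le> norm (B * (indicator (cball 0 (R + norm x)) y *\<^sub>R h y))"
    proof (rule AE_I2)
      fix y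
      show "norm (k (x - y) * h y) \<le> norm (B * (indicator (cball 0 (R + norm x)) y *\<^sub>R h y))"
      proof (cases "norm y \<le> R + norm x")
        case True
        thus ?thesis using k(2)[of "x - y"] by (auto simp: abs_mult intro!: mult_right_mono)
      next
        case False
        hence "norm (x - y) \<ge> R" using norm_triangle_ineq2[of y x] by (simp add: norm_minus_commute)
        thus ?thesis using k(3) by simp
      qed
    qed
  qed auto
qed

lemma Cc_kernel_integrable:
  fixes h k :: "real ^ 'n::finite \<Rightarrow> real"
  assumes h: "locally_integrable h" and k: "k \<in> Cc_infty"
  shows "integrable lborel (\<lambda>y. k (x - y) * h y)"
proof -
  obtain R where R: "R > 0" "\<And>x. norm x \<ge> R \<Longrightarrow> k x = 0" using Cc_support[OF k] by blast
  obtain B where B: "B > 0" "\<And>x. \<bar>k x\<bar> \<le> B" using Cc_bounded[OF k] by blast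
  show ?thesis by (rule bounded_kernel_integrable[OF h Cc_borel[OF k] B(2) R(2)])
qed

lemma Cc_times_integrable:
  fixes h k :: "real ^ 'n::finite \<Rightarrow> real"
  assumes h: "locally_integrable h" and k: "k \<in> Cc_infty"
  shows "integrable lborel (\<lambda>y. h y * k y)"
  using Cc_kernel_integrable[OF h Cc_reflect[OF k, of 0], of 0] by (simp add: mult.commute)

section \<open>Convolution\<close>

definition convl :: "(real ^ 'n::finite \<Rightarrow> real) \<Rightarrow> (real ^ 'n \<Rightarrow> real) \<Rightarrow> real ^ 'n \<Rightarrow> real" where
  "convl k h x = (\<integral>y. k (x - y) * h y \<partial>lborel)"

lemma convl_borel [measurable]:
  assumes [measurable]: "k \<in> borel_measurable borel" "h \<in> borel_measurable borel"
  shows "convl k h \<in> borel_measurable borel"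
  unfolding convl_def by measurable

text \<open>The remainder of the first order Taylor expansion is uniform in the base point; this is what allows
  differentiation under the integral sign without further conditions on the other factor.\<close>

lemma Cc_remainder:
  fixes f :: "real ^ 'n::finite \<Rightarrow> real"
  assumes f: "f \<in> Cc_infty"
  obtains C where "C > 0" "\<And>x v. \<bar>f (x + v) - f x - (\<Sum>i\<in>UNIV. v $ i * partial_deriv i f x)\<bar> \<le> C * (norm v)\<^sup>2"
proof -
  have "\<forall>i. \<exists>L>0. \<forall>x v. \<bar>partial_deriv i f (x + v) - partial_deriv i f x\<bar> \<le> L * norm v"
    using Cc_Lipschitz[OF Cc_partial_deriv[OF f]] by metis
  then obtain L where L: "\<And>i. L i > 0" "\<And>i x v. \<bar>partial_deriv i f (x + v) - partial_deriv i f x\<bar> \<le> L i * norm v" by metis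
  show thesis
  proof (rule that[of "\<Sum>i\<in>UNIV. L i"])
    show "0 < sum L UNIV" by (rule sum_pos) (use L in auto)
    fix x v
    obtain \<xi> where \<xi>: "0 < \<xi>" "\<xi> < 1" "f (x + v) - f x = (\<Sum>i\<in>UNIV. v $ i * partial_deriv i f (x + \<xi> *\<^sub>R v))"
      using mean_value_partial[OF Cc_differentiable[OF f]] by blast
    have "\<bar>f (x + v) - f x - (\<Sum>i\<in>UNIV. v $ i * partial_deriv i f x)\<bar> = \<bar>\<Sum>i\<in>UNIV. v $ i * (partial_deriv i f (x + \<xi> *\<^sub>R v) - partial_deriv i f x)\<bar>"
      unfolding \<xi> by (simp add: sum_subtractf algebra_simps)
    also have "\<dots> \<le> (\<Sum>i\<in>UNIV. \<bar>v $ i * (partial_deriv i f (x + \<xi> *\<^sub>R v) - partial_deriv i f x)\<bar>)"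
      by (rule sum_abs)
    also have "\<dots> \<le> (\<Sum>i\<in>UNIV. norm v * (L i * norm v))"
    proof (rule sum_mono)
      fix i
      have "\<bar>partial_deriv i f (x + \<xi> *\<^sub>R v) - partial_deriv i f x\<bar> \<le> L i * norm (\<xi> *\<^sub>R v)" by (rule L)
      also have "\<dots> \<le> L i * norm v" using \<xi> L(1)[of i] by (intro mult_left_mono) (auto simp: mult_left_le_one_le)
      finally show "\<bar>v $ i * (partial_deriv i f (x + \<xi> *\<^sub>R v) - partial_deriv i f x)\<bar> \<le> norm v * (L i * norm v)"
        using component_le_norm_cart[of v i] by (auto simp: abs_mult intro!: mult_mono)
    qed
    also have "\<dots> = sum L UNIV * (norm v)\<^sup>2" by (simp add: sum_distrib_left power2_eq_square mult_ac)
    finally show "\<bar>f (x + v) - f x - (\<Sum>i\<in>UNIV. v $ i * partial_deriv i f x)\<bar> \<le> sum L UNIV * (norm v)\<^sup>2" .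
  qed
qed

lemma convl_has_derivative:
  fixes h k :: "real ^ 'n::finite \<Rightarrow> real"
  assumes k: "k \<in> Cc_infty" and h: "integrable lborel h"
  shows "(convl k h has_derivative (\<lambda>v. \<Sum>i\<in>UNIV. v $ i * convl (partial_deriv i k) h x)) (at x)"
proof -
  obtain C where C: "C > 0" "\<And>x v. \<bar>k (x + v) - k x - (\<Sum>i\<in>UNIV. v $ i * partial_deriv i k x)\<bar> \<le> C * (norm v)\<^sup>2"
    using Cc_remainder[OF k] by blast
  note hl = locally_integrable_integrable[OF h]
  note i1 = Cc_kernel_integrable[OF hl k]
  have i2: "integrable lborel (\<lambda>y. partial_deriv i k (x - y) * h y)" for x i
    by (rule Cc_kernel_integrable[OF hl Cc_partial_deriv[OF k]])
  define H where "H = (\<integral>y. \<bar>h y\<bar> \<partial>lborel)"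
  let ?F = "\<lambda>v. \<Sum>i\<in>UNIV. v $ i * convl (partial_deriv i k) h x"
  have bl: "bounded_linear ?F"
    by (intro bounded_linear_sum bounded_linear_mult_const bounded_linear_vec_nth)
  have bd: "\<bar>convl k h (x + v) - convl k h x - ?F v\<bar> \<le> (C * H) * (norm v)\<^sup>2" for v
  proof -
    have i3: "integrable lborel (\<lambda>y. \<Sum>i\<in>UNIV. v $ i * (partial_deriv i k (x - y) * h y))"
      by (intro Bochner_Integration.integrable_sum integrable_mult_right i2)
    have "?F v = (\<integral>y. (\<Sum>i\<in>UNIV. v $ i * (partial_deriv i k (x - y) * h y)) \<partial>lborel)"
      using i2 by (simp add: convl_def Bochner_Integration.integral_sum)
    hence "\<bar>convl k h (x + v) - convl k h x - ?F v\<bar>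
      = \<bar>\<integral>y. k (x + v - y) * h y - k (x - y) * h y - (\<Sum>i\<in>UNIV. v $ i * (partial_deriv i k (x - y) * h y)) \<partial>lborel\<bar>"
      using i1 i3 by (simp add: convl_def)
    also have "\<dots> \<le> (\<integral>y. \<bar>k (x + v - y) * h y - k (x - y) * h y - (\<Sum>i\<in>UNIV. v $ i * (partial_deriv i k (x - y) * h y))\<bar> \<partial>lborel)"
      by (rule integral_abs_bound)
    also have "\<dots> \<le> (\<integral>y. (C * (norm v)\<^sup>2) * \<bar>h y\<bar> \<partial>lborel)"
    proof (rule integral_mono)
      fix y
      have vec: "x - y + v = x + v - y" by simp
      have "k (x + v - y) * h y - k (x - y) * h y - (\<Sum>i\<in>UNIV. v $ i * (partial_deriv i k (x - y) * h y))
        = (k ((x - y) + v) - k (x - y) - (\<Sum>i\<in>UNIV. v $ i * partial_deriv i k (x - y))) * h y"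
        unfolding vec left_diff_distrib sum_distrib_right mult.assoc ..
      moreover have "\<bar>(k ((x - y) + v) - k (x - y) - (\<Sum>i\<in>UNIV. v $ i * partial_deriv i k (x - y))) * h y\<bar> \<le> (C * (norm v)\<^sup>2) * \<bar>h y\<bar>"
        unfolding abs_mult by (rule mult_right_mono[OF C(2)]) simp
      ultimately show "\<bar>k (x + v - y) * h y - k (x - y) * h y - (\<Sum>i\<in>UNIV. v $ i * (partial_deriv i k (x - y) * h y))\<bar> \<le> (C * (norm v)\<^sup>2) * \<bar>h y\<bar>"
        by (simp only:)
    qed (use i1 i3 h in auto)
    also have "\<dots> = (C * H) * (norm v)\<^sup>2" using h by (simp add: H_def)
    finally show ?thesis .
  qed
  have "((\<lambda>v. norm (convl k h (x + v) - convl k h x - ?F v) / norm v) \<longlongrightarrow> 0) (at 0)"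
  proof (rule Lim_null_comparison[where g = "\<lambda>v. (C * H) * norm v"])
    show "\<forall>\<^sub>F v in at 0. norm (norm (convl k h (x + v) - convl k h x - ?F v) / norm v) \<le> C * H * norm v"
    proof (intro always_eventually allI)
      fix v :: "real^'n"
      show "norm (norm (convl k h (x + v) - convl k h x - ?F v) / norm v) \<le> C * H * norm v"
      proof (cases "v = 0")
        case False
        have "\<bar>convl k h (x + v) - convl k h x - ?F v\<bar> \<le> C * H * norm v * norm v"
          using bd[of v] by (simp add: power2_eq_square mult.assoc)
        thus ?thesis using False by (simp add: pos_divide_le_eq)
      qed simp
    qed
    have "((\<lambda>v::real^'n. (C * H) * norm v) \<longlongrightarrow> C * H * norm (0::real^'n)) (at 0)" by (intro tendsto_intros)
    thus "((\<lambda>v::real^'n. (C * H) * norm v) \<longlongrightarrow> 0) (at 0)" by simp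
  qed
  thus ?thesis using bl by (simp add: has_derivative_at)
qed

lemma convl_partial_deriv:
  assumes "k \<in> Cc_infty" "integrable lborel h"
  shows "partial_deriv i (convl k h) = convl (partial_deriv i k) h"
  using partial_deriv_eqI[OF convl_has_derivative[OF assms], of i]
  by (auto simp: axis_def if_distrib[of "\<lambda>x. x * _"] cong: if_cong)

lemma convl_Dl:
  assumes "k \<in> Cc_infty" "integrable lborel h"
  shows "Dl is (convl k h) = convl (Dl is k) h"
  by (induction "is") (use convl_partial_deriv[OF Cc_Dl[OF assms(1)] assms(2)] in auto)

lemma convl_Cc:
  fixes h k :: "real ^ 'n::finite \<Rightarrow> real"
  assumes k: "k \<in> Cc_infty" and h: "integrable lborel h" "\<And>x. norm x \<ge> S \<Longrightarrow> h x = 0"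
  shows "convl k h \<in> Cc_infty"
proof -
  obtain R where R: "R > 0" "\<And>x. norm x \<ge> R \<Longrightarrow> k x = 0" using Cc_support[OF k] by blast
  show ?thesis
  proof (rule CcI[where R = "R + S"])
    show "smooth (convl k h)"
      unfolding smooth_def convl_Dl[OF k h(1)] differentiable_def
      using convl_has_derivative[OF Cc_Dl[OF k] h(1)] by blast
    fix x :: "real^'n" assume x: "norm x \<ge> R + S"
    have z: "k (x - y) * h y = 0" for y
    proof (cases "norm y \<ge> S")
      case False
      hence "norm (x - y) \<ge> R" using x norm_triangle_ineq2[of x y] by linarith
      thus ?thesis using R by simp
    qed (use h(2) in simp)
    show "convl k h x = 0" unfolding convl_def z by simp
  qed
qed

section \<open>Integration by parts\<close>

text \<open>The difference quotients are bounded by a Lipschitz constant of \<open>f\<close>, so dominated convergence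
  applies.\<close>

lemma difference_quotient_limit:
  fixes f g :: "real ^ 'n::finite \<Rightarrow> real"
  assumes f: "f \<in> Cc_infty" and g: "integrable lborel g" and T: "T \<longlonglongrightarrow> 0" "\<And>m. T m \<noteq> 0"
  shows "(\<lambda>m. \<integral>x. g x * ((f (x + T m *\<^sub>R axis i 1) - f x) / T m) \<partial>lborel) \<longlonglongrightarrow> (\<integral>x. g x * partial_deriv i f x \<partial>lborel)"
proof -
  obtain L where L: "L > 0" "\<And>x v. \<bar>f (x + v) - f x\<bar> \<le> L * norm v" using Cc_Lipschitz[OF f] by blast
  note [measurable] = Cc_borel[OF f] Cc_borel[OF Cc_partial_deriv[OF f, of i]] borel_measurable_integrable[OF g]
  show ?thesis
  proof (rule integral_dominated_convergence[where w = "\<lambda>x. L * \<bar>g x\<bar>"])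
    show "AE x in lborel. (\<lambda>m. g x * ((f (x + T m *\<^sub>R axis i 1) - f x) / T m)) \<longlonglongrightarrow> g x * partial_deriv i f x"
    proof (intro AE_I2 tendsto_mult_left)
      fix x
      have "((\<lambda>t. (f (x + t *\<^sub>R axis i 1) - f x) / t) \<longlongrightarrow> partial_deriv i f x) (at 0)"
        using has_real_derivative_axis[OF Cc_differentiable[OF f], of x i 0] by (simp add: DERIV_def)
      moreover have "filterlim T (at 0) sequentially" using T by (simp add: filterlim_at)
      ultimately show "(\<lambda>m. (f (x + T m *\<^sub>R axis i 1) - f x) / T m) \<longlonglongrightarrow> partial_deriv i f x"
        by (rule filterlim_compose)
    qed
    show "AE x in lborel. norm (g x * ((f (x + T m *\<^sub>R axis i 1) - f x) / T m)) \<le> L * \<bar>g x\<bar>" for m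
    proof (rule AE_I2)
      fix x
      have "\<bar>f (x + T m *\<^sub>R axis i 1) - f x\<bar> \<le> L * \<bar>T m\<bar>"
        using L(2)[of x "T m *\<^sub>R axis i 1"] by (simp add: norm_axis_1)
      hence "\<bar>(f (x + T m *\<^sub>R axis i 1) - f x) / T m\<bar> \<le> L"
        using T(2)[of m] by (simp add: abs_divide pos_divide_le_eq)
      from mult_left_mono[OF this, of "\<bar>g x\<bar>"]
      show "norm (g x * ((f (x + T m *\<^sub>R axis i 1) - f x) / T m)) \<le> L * \<bar>g x\<bar>" by (simp add: abs_mult mult.commute)
    qed
  qed (use g in auto)
qed

text \<open>For difference quotients the formula is translation invariance of the integral; then pass to the
  limit on both sides.\<close>

lemma integration_by_parts:
  fixes f g :: "real ^ 'n::finite \<Rightarrow> real"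
  assumes f: "f \<in> Cc_infty" and g: "g \<in> Cc_infty"
  shows "(\<integral>x. f x * partial_deriv i g x \<partial>lborel) = - (\<integral>x. partial_deriv i f x * g x \<partial>lborel)"
proof -
  define T where "T m = 1 / (real m + 1)" for m :: nat
  have T: "T \<longlonglongrightarrow> 0" unfolding T_def using LIMSEQ_inverse_real_of_nat by (simp add: inverse_eq_divide add.commute)
  have T0: "T m \<noteq> 0" for m by (simp add: T_def add_pos_nonneg)
  have T': "(\<lambda>m. - T m) \<longlonglongrightarrow> 0" using tendsto_minus[OF T] by simp
  note [measurable] = Cc_borel[OF f] Cc_borel[OF g]
  let ?e = "axis i 1 :: real^'n"
  have i1: "integrable lborel (\<lambda>x. f x * g (x + a))" for a
  proof -
    have "(\<lambda>x. g (x + a)) \<in> Cc_infty" using Cc_reflect[OF Cc_reflect[OF g, of a], of 0] by (simp add: add.commute)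
    thus ?thesis by (rule Cc_times_integrable[OF locally_integrable_integrable[OF Cc_integrable[OF f]]])
  qed
  have i2: "integrable lborel (\<lambda>x. f (x + a) * g x)" for a
    using integrable_translate[OF i1[of "- a"], of a] by simp
  have eq: "(\<integral>x. f x * ((g (x + T m *\<^sub>R ?e) - g x) / T m) \<partial>lborel) = - (\<integral>x. g x * ((f (x + (- T m) *\<^sub>R ?e) - f x) / (- T m)) \<partial>lborel)" for m
  proof -
    have "(\<integral>x. f x * g (x + T m *\<^sub>R ?e) \<partial>lborel) = (\<integral>x. f (x + (- T m) *\<^sub>R ?e) * g x \<partial>lborel)"
      using integral_translate[of "\<lambda>x. f x * g (x + T m *\<^sub>R ?e)" "(- T m) *\<^sub>R ?e"] by simp
    moreover have "(\<integral>x. f x * ((g (x + T m *\<^sub>R ?e) - g x) / T m) \<partial>lborel) = ((\<integral>x. f x * g (x + T m *\<^sub>R ?e) \<partial>lborel) - (\<integral>x. f x * g x \<partial>lborel)) / T m"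
      using i1[of "T m *\<^sub>R ?e"] i1[of 0] by (simp add: right_diff_distrib diff_divide_distrib)
    moreover have "(\<integral>x. g x * ((f (x + (- T m) *\<^sub>R ?e) - f x) / (- T m)) \<partial>lborel) = ((\<integral>x. f (x + (- T m) *\<^sub>R ?e) * g x \<partial>lborel) - (\<integral>x. f x * g x \<partial>lborel)) / (- T m)"
    proof -
      have "(\<integral>x. g x * ((f (x + (- T m) *\<^sub>R ?e) - f x) / (- T m)) \<partial>lborel) = (\<integral>x. (f (x + (- T m) *\<^sub>R ?e) * g x - f x * g x) / (- T m) \<partial>lborel)"
        by (rule Bochner_Integration.integral_cong) (auto simp: algebra_simps diff_divide_distrib)
      also have "\<dots> = ((\<integral>x. f (x + (- T m) *\<^sub>R ?e) * g x \<partial>lborel) - (\<integral>x. f x * g x \<partial>lborel)) / (- T m)"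
        using i2[of "(- T m) *\<^sub>R ?e"] i1[of 0] by (simp del: scaleR_minus_left add: integral_divide_zero)
      finally show ?thesis .
    qed
    ultimately show ?thesis using T0[of m] by simp
  qed
  have "(\<lambda>m. \<integral>x. f x * ((g (x + T m *\<^sub>R ?e) - g x) / T m) \<partial>lborel) \<longlonglongrightarrow> (\<integral>x. f x * partial_deriv i g x \<partial>lborel)"
    by (rule difference_quotient_limit[OF g Cc_integrable[OF f] T T0])
  moreover have "(\<lambda>m. - (\<integral>x. g x * ((f (x + (- T m) *\<^sub>R ?e) - f x) / (- T m)) \<partial>lborel)) \<longlonglongrightarrow> - (\<integral>x. g x * partial_deriv i f x \<partial>lborel)"
    by (intro tendsto_minus difference_quotient_limit[OF f Cc_integrable[OF g] T']) (use T0 in simp)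
  ultimately have "(\<integral>x. f x * partial_deriv i g x \<partial>lborel) = - (\<integral>x. g x * partial_deriv i f x \<partial>lborel)"
    unfolding eq using LIMSEQ_unique by blast
  thus ?thesis by (simp add: mult.commute)
qed

lemma integration_by_parts_Dl:
  assumes "f \<in> Cc_infty" and g: "g \<in> Cc_infty"
  shows "(\<integral>x. f x * Dl is g x \<partial>lborel) = (-1) ^ length is * (\<integral>x. Dl (rev is) f x * g x \<partial>lborel)"
  using assms(1)
proof (induction "is" arbitrary: f)
  case (Cons i "is")
  have "(\<integral>x. f x * Dl (i # is) g x \<partial>lborel) = - (\<integral>x. partial_deriv i f x * Dl is g x \<partial>lborel)"
    using integration_by_parts[OF Cons.prems Cc_Dl[OF g]] by simp
  also have "\<dots> = - ((-1) ^ length is * (\<integral>x. Dl (rev is) (partial_deriv i f) x * g x \<partial>lborel))"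
    by (simp add: Cons.IH[OF Cc_partial_deriv[OF Cons.prems]])
  finally show ?case by simp
qed simp

section \<open>Weak derivatives\<close>

lemma Cc_locally_integrable: "f \<in> Cc_infty \<Longrightarrow> locally_integrable f"
  by (intro locally_integrable_integrable Cc_integrable)

lemma Cc_has_weak_deriv:
  assumes f: "f \<in> Cc_infty" shows "has_weak_deriv \<nu> f (mderiv \<nu> f)"
proof -
  obtain "is" where "is": "\<And>i. count_list is i = \<nu> i" "length is = mi_order \<nu>" "\<And>f. mderiv \<nu> f = Dl is f"
    using mderiv_list by blast
  have "Dl (rev is) f = Dl is f" by (rule Dl_perm[OF Cc_smooth[OF f]]) simp
  thus ?thesis unfolding has_weak_deriv_def
    using integration_by_parts_Dl[OF f, of _ "is"] "is" f Cc_Dl[OF f, of "is"] by (auto intro: Cc_locally_integrable)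
qed

text \<open>Test the weak derivative with \<open>y \<mapsto> \<eta> (x - y)\<close>; the signs from the reflection and from the definition
  cancel.\<close>

lemma weak_deriv_convl:
  assumes "has_weak_deriv \<nu> f g" and \<eta>: "\<eta> \<in> Cc_infty"
  shows "convl \<eta> g = convl (mderiv \<nu> \<eta>) f"
proof
  fix x
  have "(\<integral>y. f y * mderiv \<nu> (\<lambda>y. \<eta> (x - y)) y \<partial>lborel) = (-1) ^ mi_order \<nu> * (\<integral>y. g y * \<eta> (x - y) \<partial>lborel)"
    using assms(1) Cc_reflect[OF \<eta>] unfolding has_weak_deriv_def by blast
  hence "(-1) ^ mi_order \<nu> * (\<integral>y. f y * mderiv \<nu> \<eta> (x - y) \<partial>lborel) = (-1) ^ mi_order \<nu> * (\<integral>y. g y * \<eta> (x - y) \<partial>lborel)"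
    unfolding mderiv_reflect[OF Cc_smooth[OF \<eta>]] mult.left_commute[of _ "(-1) ^ mi_order \<nu>"] integral_mult_right_zero .
  thus "convl \<eta> g x = convl (mderiv \<nu> \<eta>) f x" by (simp add: convl_def mult.commute)
qed

section \<open>Estimates for convolutions\<close>

text \<open>Young's inequality for convolutions. Jensen's inequality for the density \<open>|k (x - y)|\<close> in \<open>y\<close>,
  followed by integration over \<open>x\<close>.\<close>

lemma convl_Young:
  fixes k h :: "real ^ 'n::finite \<Rightarrow> real"
  assumes k: "integrable lborel k" and h[measurable]: "h \<in> borel_measurable borel" and p: "1 \<le> p"
  shows "Lpow p (convl k h) \<le> ennreal ((\<integral>x. \<bar>k x\<bar> \<partial>lborel) powr p) * Lpow p h"
proof -
  have [measurable]: "k \<in> borel_measurable borel" using k by auto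
  define K where "K = (\<integral>x. \<bar>k x\<bar> \<partial>lborel)"
  have K0: "K \<ge> 0" unfolding K_def by (rule Bochner_Integration.integral_nonneg) auto
  have pw: "ennreal (\<bar>convl k h x\<bar> powr p) \<le> ennreal (K powr (p - 1)) * (\<integral>\<^sup>+y. ennreal (\<bar>k (x - y)\<bar> * \<bar>h y\<bar> powr p) \<partial>lborel)" for x
  proof -
    have "convl k h x = (\<integral>y. \<bar>k (x - y)\<bar> * (sgn (k (x - y)) * h y) \<partial>lborel)"
      unfolding convl_def by (intro Bochner_Integration.integral_cong) (auto simp: mult.assoc[symmetric] abs_mult_sgn)
    hence "ennreal (\<bar>convl k h x\<bar> powr p) \<le> ennreal ((\<integral>y. \<bar>k (x - y)\<bar> \<partial>lborel) powr (p - 1)) * (\<integral>\<^sup>+y. ennreal (\<bar>k (x - y)\<bar> * \<bar>sgn (k (x - y)) * h y\<bar> powr p) \<partial>lborel)"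
      using nn_jensen[of lborel "\<lambda>y. \<bar>k (x - y)\<bar>" "\<lambda>y. sgn (k (x - y)) * h y" p] integrable_reflect[OF k, of x] p by simp
    also have "(\<integral>y. \<bar>k (x - y)\<bar> \<partial>lborel) = K" unfolding K_def by (rule integral_reflect) simp
    also have "(\<integral>\<^sup>+y. ennreal (\<bar>k (x - y)\<bar> * \<bar>sgn (k (x - y)) * h y\<bar> powr p) \<partial>lborel) = (\<integral>\<^sup>+y. ennreal (\<bar>k (x - y)\<bar> * \<bar>h y\<bar> powr p) \<partial>lborel)"
      by (intro nn_integral_cong) (auto simp: abs_mult abs_sgn_eq)
    finally show ?thesis .
  qed
  have inner: "(\<integral>\<^sup>+x. ennreal (\<bar>k (x - y)\<bar> * \<bar>h y\<bar> powr p) \<partial>lborel) = ennreal K * ennreal (\<bar>h y\<bar> powr p)" for y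
  proof -
    have "(\<integral>\<^sup>+x. ennreal \<bar>k (x - y)\<bar> \<partial>lborel) = (\<integral>\<^sup>+x. ennreal \<bar>k x\<bar> \<partial>lborel)"
      using nn_integral_translate[of "\<lambda>x. ennreal \<bar>k x\<bar>" "- y"] by simp
    also have "\<dots> = ennreal K" unfolding K_def by (rule nn_integral_eq_integral) (use k in auto)
    finally show ?thesis by (simp add: ennreal_mult' nn_integral_multc)
  qed
  have "Lpow p (convl k h) \<le> (\<integral>\<^sup>+x. ennreal (K powr (p - 1)) * (\<integral>\<^sup>+y. ennreal (\<bar>k (x - y)\<bar> * \<bar>h y\<bar> powr p) \<partial>lborel) \<partial>lborel)"
    unfolding Lpow_def by (intro nn_integral_mono pw)
  also have "\<dots> = ennreal (K powr (p - 1)) * (\<integral>\<^sup>+x. \<integral>\<^sup>+y. ennreal (\<bar>k (x - y)\<bar> * \<bar>h y\<bar> powr p) \<partial>lborel \<partial>lborel)"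
    by (rule nn_integral_cmult) measurable
  also have "(\<integral>\<^sup>+x. \<integral>\<^sup>+y. ennreal (\<bar>k (x - y)\<bar> * \<bar>h y\<bar> powr p) \<partial>lborel \<partial>lborel) = (\<integral>\<^sup>+y. \<integral>\<^sup>+x. ennreal (\<bar>k (x - y)\<bar> * \<bar>h y\<bar> powr p) \<partial>lborel \<partial>lborel)"
    by (rule nn_integral_Tonelli) measurable
  also have "\<dots> = ennreal K * Lpow p h" unfolding inner Lpow_def by (rule nn_integral_cmult) measurable
  also have "ennreal (K powr (p - 1)) * (ennreal K * Lpow p h) = ennreal (K powr p) * Lpow p h"
    using K0 p by (cases "K = 0") (auto simp: mult.assoc[symmetric] ennreal_mult'[symmetric] powr_diff)
  finally show ?thesis by (simp add: K_def)
qed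

text \<open>The error at \<open>x\<close> is the mean of \<open>w (x - z) - w x\<close> with respect to the probability density \<open>\<eta>\<close>, to
  which Jensen's inequality applies.\<close>

lemma mollify_Lpow_le:
  fixes w :: "real ^ 'n::finite \<Rightarrow> real"
  assumes \<eta>: "mollifier e \<eta>" and w[measurable]: "w \<in> borel_measurable borel" and fin: "Lpow p w < \<infinity>" and p: "1 \<le> p"
  shows "Lpow p (\<lambda>x. w x - convl \<eta> w x) \<le> (\<integral>\<^sup>+z. ennreal (\<eta> z) * Lpow p (\<lambda>x. w (x + - z) - w x) \<partial>lborel)"
proof -
  have C: "\<eta> \<in> Cc_infty" and \<eta>0: "\<And>x. \<eta> x \<ge> 0" and \<eta>1: "(\<integral>x. \<eta> x \<partial>lborel) = 1" using \<eta> by (auto simp: mollifier_def)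
  note [measurable] = Cc_borel[OF C]
  note wl = locally_integrable_Lpow[OF w fin p]
  have pw: "ennreal (\<bar>w x - convl \<eta> w x\<bar> powr p) \<le> (\<integral>\<^sup>+z. ennreal (\<eta> z * \<bar>w (x + - z) - w x\<bar> powr p) \<partial>lborel)" for x
  proof -
    have ir: "integrable lborel (\<lambda>z. \<eta> z * w (x - z))"
      using integrable_reflect[OF Cc_kernel_integrable[OF wl C, of x], of x] by simp
    have "convl \<eta> w x = (\<integral>z. \<eta> z * w (x - z) \<partial>lborel)"
      unfolding convl_def using integral_reflect[of "\<lambda>y. \<eta> (x - y) * w y" x] by simp
    hence "convl \<eta> w x - w x = (\<integral>z. \<eta> z * w (x - z) \<partial>lborel) - (\<integral>z. \<eta> z * w x \<partial>lborel)"
      using \<eta>1 Cc_integrable[OF C] by simp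
    also have "\<dots> = (\<integral>z. \<eta> z * (w (x - z) - w x) \<partial>lborel)"
      using ir Cc_integrable[OF C] by (simp add: right_diff_distrib)
    finally have eq: "\<bar>w x - convl \<eta> w x\<bar> = \<bar>\<integral>z. \<eta> z * (w (x - z) - w x) \<partial>lborel\<bar>" by simp
    have m: "(\<lambda>z. w (x - z) - w x) \<in> borel_measurable lborel" by measurable
    from nn_jensen[OF Cc_integrable[OF C] \<eta>0 m p] show ?thesis by (simp add: eq \<eta>1)
  qed
  have "Lpow p (\<lambda>x. w x - convl \<eta> w x) \<le> (\<integral>\<^sup>+x. \<integral>\<^sup>+z. ennreal (\<eta> z * \<bar>w (x + - z) - w x\<bar> powr p) \<partial>lborel \<partial>lborel)"
    unfolding Lpow_def by (intro nn_integral_mono pw)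
  also have "\<dots> = (\<integral>\<^sup>+z. \<integral>\<^sup>+x. ennreal (\<eta> z * \<bar>w (x + - z) - w x\<bar> powr p) \<partial>lborel \<partial>lborel)"
    by (rule nn_integral_Tonelli) measurable
  also have "\<dots> = (\<integral>\<^sup>+z. ennreal (\<eta> z) * Lpow p (\<lambda>x. w (x + - z) - w x) \<partial>lborel)"
    unfolding Lpow_def using \<eta>0 by (simp add: ennreal_mult' nn_integral_cmult)
  finally show ?thesis .
qed

lemma translation_modulus:
  fixes w :: "real ^ 'n::finite \<Rightarrow> real"
  assumes w: "w \<in> borel_measurable borel" and fin: "Lpow p w < \<infinity>" and p: "1 \<le> p" and \<epsilon>: "\<epsilon> > 0"
  shows "\<exists>d>0. \<forall>z. norm z < d \<longrightarrow> Lpow p (\<lambda>x. w (x + z) - w x) < \<epsilon>"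
proof (rule ccontr)
  assume "\<not> ?thesis"
  hence "\<forall>k::nat. \<exists>z. norm z < 1 / (real k + 1) \<and> \<not> Lpow p (\<lambda>x. w (x + z) - w x) < \<epsilon>"
    by (metis add_pos_nonneg divide_pos_pos of_nat_0_le_iff zero_less_one add.commute)
  then obtain Z where Z: "\<And>k. norm (Z k) < 1 / (real k + 1)" "\<And>k. \<not> Lpow p (\<lambda>x. w (x + Z k) - w x) < \<epsilon>" by metis
  have "(\<lambda>k. 1 / (real k + 1)) \<longlonglongrightarrow> 0" using LIMSEQ_inverse_real_of_nat by (simp add: inverse_eq_divide add.commute)
  hence "Z \<longlonglongrightarrow> 0" by (rule Lim_null_comparison[rotated]) (use Z(1) in \<open>auto intro!: always_eventually less_imp_le\<close>)
  from order_tendstoD(2)[OF Lpow_translation_continuous[OF w fin p this] \<epsilon>]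
  show False using Z(2) by (auto simp: eventually_sequentially)
qed

lemma mollify_Lpow_tendsto:
  fixes w :: "real ^ 'n::finite \<Rightarrow> real"
  assumes \<eta>: "\<And>m. mollifier (1 / (real m + 1)) (\<eta> m)" and w: "w \<in> borel_measurable borel" and fin: "Lpow p w < \<infinity>" and p: "1 \<le> p"
  shows "(\<lambda>m. Lpow p (\<lambda>x. w x - convl (\<eta> m) w x)) \<longlonglongrightarrow> 0"
proof (rule order_tendstoI)
  fix e :: ennreal assume e: "0 < e"
  obtain e' where e': "0 < e'" "e' < e" using dense[OF e] by blast
  obtain d where d: "d > 0" "\<And>z. norm z < d \<Longrightarrow> Lpow p (\<lambda>x. w (x + z) - w x) < e'"
    using translation_modulus[OF w fin p e'(1)] by blast
  have "(\<lambda>m. 1 / (real m + 1)) \<longlonglongrightarrow> 0" using LIMSEQ_inverse_real_of_nat by (simp add: inverse_eq_divide add.commute)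
  hence "eventually (\<lambda>m. 1 / (real m + 1) < d) sequentially" by (rule order_tendstoD(2)) (rule d)
  thus "eventually (\<lambda>m. Lpow p (\<lambda>x. w x - convl (\<eta> m) w x) < e) sequentially"
  proof eventually_elim
    case (elim m)
    have C: "\<eta> m \<in> Cc_infty" and \<eta>0: "\<And>x. \<eta> m x \<ge> 0" and \<eta>1: "(\<integral>x. \<eta> m x \<partial>lborel) = 1"
      and s: "\<And>x. norm x \<ge> 1 / (real m + 1) \<Longrightarrow> \<eta> m x = 0" using \<eta>[of m] by (auto simp: mollifier_def)
    note [measurable] = Cc_borel[OF C]
    have "Lpow p (\<lambda>x. w x - convl (\<eta> m) w x) \<le> (\<integral>\<^sup>+z. ennreal (\<eta> m z) * Lpow p (\<lambda>x. w (x + - z) - w x) \<partial>lborel)"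
      by (rule mollify_Lpow_le[OF \<eta> w fin p])
    also have "\<dots> \<le> (\<integral>\<^sup>+z. ennreal (\<eta> m z) * e' \<partial>lborel)"
    proof (rule nn_integral_mono)
      fix z
      show "ennreal (\<eta> m z) * Lpow p (\<lambda>x. w (x + - z) - w x) \<le> ennreal (\<eta> m z) * e'"
      proof (cases "norm z < d")
        case True
        thus ?thesis using d(2)[of "- z"] by (intro mult_left_mono) auto
      next
        case False
        thus ?thesis using s[of z] elim by simp
      qed
    qed
    also have "\<dots> = (\<integral>\<^sup>+z. ennreal (\<eta> m z) \<partial>lborel) * e'" by (rule nn_integral_multc) measurable
    also have "(\<integral>\<^sup>+z. ennreal (\<eta> m z) \<partial>lborel) = 1"
      using nn_integral_eq_integral[OF Cc_integrable[OF C]] \<eta>0 \<eta>1 by simp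
    finally show ?case using e' by simp
  qed
qed auto

lemma convl_diff_right:
  fixes h :: "real ^ 'n::finite \<Rightarrow> real"
  assumes h: "locally_integrable h" "locally_integrable h'" and k: "k \<in> Cc_infty"
  shows "convl k (\<lambda>y. h y - h' y) x = convl k h x - convl k h' x"
  unfolding convl_def using Cc_kernel_integrable[OF h(1) k] Cc_kernel_integrable[OF h(2) k] by (simp add: right_diff_distrib)

lemma convl_shift:
  fixes h :: "real ^ 'n::finite \<Rightarrow> real"
  assumes [measurable]: "h \<in> borel_measurable borel" "k \<in> borel_measurable borel"
  shows "convl k h (x + z) = convl k (\<lambda>y. h (y + z)) x"
  unfolding convl_def using integral_translate[of "\<lambda>y. k (x + z - y) * h y" z] by simp

text \<open>Mollification commutes with translations, so for fixed \<open>z\<close> the inner integral is the mollification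
  error of \<open>D z = w (\<cdot> + z) - w\<close> in \<open>L\<^sup>p\<close>. It tends to \<open>0\<close> for every \<open>z\<close> and is dominated by a multiple of
  the integrand of \<open>Slo \<theta> p w\<close>.\<close>

lemma mollify_Slo_tendsto:
  fixes w :: "real ^ 'n::finite \<Rightarrow> real"
  assumes \<eta>: "\<And>m. mollifier (1 / (real m + 1)) (\<eta> m)" and w[measurable]: "w \<in> borel_measurable borel"
    and fin: "Lpow p w < \<infinity>" and p: "1 \<le> p" and Sfin: "Slo \<theta> p w < \<infinity>"
  shows "(\<lambda>m. Slo \<theta> p (\<lambda>x. w x - convl (\<eta> m) w x)) \<longlonglongrightarrow> 0"
proof -
  have C: "\<eta> m \<in> Cc_infty" and \<eta>0: "\<And>x. \<eta> m x \<ge> 0" and \<eta>1: "(\<integral>x. \<eta> m x \<partial>lborel) = 1" for m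
    using \<eta>[of m] by (auto simp: mollifier_def)
  have [measurable]: "\<eta> m \<in> borel_measurable borel" for m by (rule Cc_borel[OF C])
  define D where "D z x = w (x + z) - w x" for z x
  have Dm[measurable]: "D z \<in> borel_measurable borel" for z unfolding D_def by measurable
  have wz[measurable]: "(\<lambda>x. w (x + z)) \<in> borel_measurable borel" for z by measurable
  have wzf: "Lpow p (\<lambda>x. w (x + z)) < \<infinity>" for z using fin by (simp add: Lpow_translate[OF w])
  have Df: "Lpow p (D z) < \<infinity>" for z
    unfolding D_def by (rule le_less_trans[OF Lpow_diff_le[OF wz w]]) (use p fin wzf[of z] in \<open>auto simp: ennreal_mult_less_top\<close>)
  have shift: "w (x + z) - convl (\<eta> m) w (x + z) - (w x - convl (\<eta> m) w x) = D z x - convl (\<eta> m) (D z) x" for x z m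
    using convl_shift[OF w, of "\<eta> m" x z] convl_diff_right[OF locally_integrable_Lpow[OF wz[of z] wzf p] locally_integrable_Lpow[OF w fin p] C[of m], of x]
    by (simp add: D_def[abs_def])
  define W where "W z = ennreal (norm z powr - (real CARD('n) + \<theta> * p))" for z :: "real^'n"
  have Wm[measurable]: "W \<in> borel_measurable borel" unfolding W_def by measurable
  have DD: "(\<lambda>z. Lpow p (D z)) \<in> borel_measurable borel" unfolding D_def by (rule Lpow_translation_measurable) measurable
  have S: "Slo \<theta> p (\<lambda>x. w x - convl (\<eta> m) w x) = (\<integral>\<^sup>+z. W z * Lpow p (\<lambda>x. D z x - convl (\<eta> m) (D z) x) \<partial>lborel)" for m
    by (simp add: Slo_def W_def shift)
  have "(\<lambda>m. (\<integral>\<^sup>+z. W z * Lpow p (\<lambda>x. D z x - convl (\<eta> m) (D z) x) \<partial>lborel)) \<longlonglongrightarrow> (\<integral>\<^sup>+z. 0 \<partial>(lborel :: (real^'n) measure))"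
  proof (rule nn_integral_dominated_convergence[where w = "\<lambda>z. ennreal (2 powr p) * 2 * (W z * Lpow p (D z))"])
    show "(\<lambda>z. W z * Lpow p (\<lambda>x. D z x - convl (\<eta> m) (D z) x)) \<in> borel_measurable lborel" for m
    proof -
      have [measurable]: "(\<lambda>z. Lpow p (\<lambda>x. w (x + z) - convl (\<eta> m) w (x + z) - (w x - convl (\<eta> m) w x))) \<in> borel_measurable borel"
        by (rule Lpow_translation_measurable[of "\<lambda>x. w x - convl (\<eta> m) w x"]) measurable
      show ?thesis unfolding shift[symmetric] by measurable
    qed
    show "(\<lambda>z. ennreal (2 powr p) * 2 * (W z * Lpow p (D z))) \<in> borel_measurable lborel" using DD by simp
    have "(\<integral>\<^sup>+z. ennreal (2 powr p) * 2 * (W z * Lpow p (D z)) \<partial>lborel) = ennreal (2 powr p) * 2 * Slo \<theta> p w"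
      unfolding Slo_def W_def[symmetric] D_def[symmetric] using DD by (intro nn_integral_cmult) (simp add: D_def[symmetric])
    also have "\<dots> < \<infinity>" using Sfin by (simp add: ennreal_mult_less_top)
    finally show "(\<integral>\<^sup>+z. ennreal (2 powr p) * 2 * (W z * Lpow p (D z)) \<partial>lborel) < \<infinity>" .
    show "AE z in lborel. W z * Lpow p (\<lambda>x. D z x - convl (\<eta> m) (D z) x) \<le> ennreal (2 powr p) * 2 * (W z * Lpow p (D z))" for m
    proof (rule AE_I2)
      fix z
      have "Lpow p (convl (\<eta> m) (D z)) \<le> Lpow p (D z)"
        using convl_Young[OF Cc_integrable[OF C] Dm p, of m z] \<eta>0 \<eta>1 by simp
      hence "Lpow p (\<lambda>x. D z x - convl (\<eta> m) (D z) x) \<le> ennreal (2 powr p) * (Lpow p (D z) + Lpow p (D z))"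
        by (intro order_trans[OF Lpow_diff_le[OF Dm]] mult_left_mono add_left_mono) (use p in auto)
      from mult_left_mono[OF this, of "W z"]
      show "W z * Lpow p (\<lambda>x. D z x - convl (\<eta> m) (D z) x) \<le> ennreal (2 powr p) * 2 * (W z * Lpow p (D z))"
        by (simp add: mult_2[symmetric] mult_ac)
    qed
    show "AE z in lborel. (\<lambda>m. W z * Lpow p (\<lambda>x. D z x - convl (\<eta> m) (D z) x)) \<longlonglongrightarrow> 0"
    proof (rule AE_I2)
      fix z
      have "(\<lambda>m. W z * Lpow p (\<lambda>x. D z x - convl (\<eta> m) (D z) x)) \<longlonglongrightarrow> W z * 0"
        by (intro ennreal_tendsto_cmult mollify_Lpow_tendsto[OF \<eta> Dm Df p]) (simp add: W_def)
      thus "(\<lambda>m. W z * Lpow p (\<lambda>x. D z x - convl (\<eta> m) (D z) x)) \<longlonglongrightarrow> 0" by simp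
    qed
  qed auto
  thus ?thesis by (simp add: S)
qed

lemma Cc_L1_difference:
  fixes k :: "real ^ 'n::finite \<Rightarrow> real"
  assumes k: "k \<in> Cc_infty"
  obtains C where "C > 0" "\<And>z. (\<integral>x. \<bar>k (x + z) - k x\<bar> \<partial>lborel) \<le> C * min 1 (norm z)"
proof -
  obtain R where R: "R > 0" "\<And>x. norm x \<ge> R \<Longrightarrow> k x = 0" using Cc_support[OF k] by blast
  obtain L where L: "L > 0" "\<And>x v. \<bar>k (x + v) - k x\<bar> \<le> L * norm v" using Cc_Lipschitz[OF k] by blast
  define V where "V = measure lborel (cball (0::real^'n) (R + 1))"
  have V: "V \<ge> 0" by (simp add: V_def)
  define C where "C = 2 * (\<integral>x. \<bar>k x\<bar> \<partial>lborel) + L * V + 1"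
  have I0: "(\<integral>x. \<bar>k x\<bar> \<partial>lborel) \<ge> 0" by (rule Bochner_Integration.integral_nonneg) auto
  note ki = Cc_integrable[OF k]
  show thesis
  proof (rule that[of C])
    show "C > 0" using I0 V L by (simp add: C_def add_nonneg_pos)
    fix z :: "real^'n"
    note kz = integrable_translate[OF ki, of z]
    show "(\<integral>x. \<bar>k (x + z) - k x\<bar> \<partial>lborel) \<le> C * min 1 (norm z)"
    proof (cases "norm z \<le> 1")
      case True
      have "(\<integral>x. \<bar>k (x + z) - k x\<bar> \<partial>lborel) \<le> (\<integral>x. L * norm z * indicator (cball (0::real^'n) (R + 1)) x \<partial>lborel)"
      proof (rule integral_mono)
        show "integrable lborel (\<lambda>x. L * norm z * indicator (cball (0::real^'n) (R + 1)) x)"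
          by (intro integrable_mult_right compact_indicator_integrable) auto
        fix x
        show "\<bar>k (x + z) - k x\<bar> \<le> L * norm z * indicator (cball (0::real^'n) (R + 1)) x"
        proof (cases "norm x \<le> R + 1")
          case False
          hence "norm x \<ge> R" "norm (x + z) \<ge> R" using True norm_triangle_ineq4[of "x + z" z] by auto
          thus ?thesis using R False by simp
        qed (use L(2)[of x z] in simp)
      qed (use ki kz in auto)
      also have "\<dots> = L * V * norm z" by (simp add: V_def)
      also have "\<dots> \<le> C * min 1 (norm z)" using True I0 by (simp add: C_def distrib_right)
      finally show ?thesis .
    next
      case False
      have "(\<integral>x. \<bar>k (x + z) - k x\<bar> \<partial>lborel) \<le> (\<integral>x. \<bar>k (x + z)\<bar> + \<bar>k x\<bar> \<partial>lborel)"
        by (rule integral_mono) (use ki kz in auto)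
      also have "\<dots> = (\<integral>x. \<bar>k (x + z)\<bar> \<partial>lborel) + (\<integral>x. \<bar>k x\<bar> \<partial>lborel)"
        by (rule Bochner_Integration.integral_add) (use ki kz in auto)
      also have "(\<integral>x. \<bar>k (x + z)\<bar> \<partial>lborel) = (\<integral>x. \<bar>k x\<bar> \<partial>lborel)"
        using integral_translate[of "\<lambda>x. \<bar>k x\<bar>" z] ki by simp
      finally have "(\<integral>x. \<bar>k (x + z) - k x\<bar> \<partial>lborel) \<le> 2 * (\<integral>x. \<bar>k x\<bar> \<partial>lborel)" by simp
      moreover have "0 \<le> L * V" using V L by simp
      ultimately show ?thesis using False by (simp add: C_def)
    qed
  qed
qed

text \<open>Differences fall on the kernel, whose translates differ by \<open>O(min 1 |z|)\<close> in \<open>L\<^sup>1\<close>; then Young's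
  inequality for each \<open>z\<close>.\<close>

lemma Slo_convl_le:
  fixes k :: "real ^ 'n::finite \<Rightarrow> real"
  assumes k: "k \<in> Cc_infty" and p: "1 \<le> p" and \<theta>: "0 < \<theta>" "\<theta> < 1"
  shows "\<exists>C. C < \<infinity> \<and> (\<forall>h. h \<in> borel_measurable borel \<longrightarrow> Lpow p h < \<infinity> \<longrightarrow> Slo \<theta> p (convl k h) \<le> C * Lpow p h)"
proof -
  obtain A where A: "A > 0" "\<And>z. (\<integral>x. \<bar>k (x + z) - k x\<bar> \<partial>lborel) \<le> A * min 1 (norm z)"
    using Cc_L1_difference[OF k] by blast
  note [measurable] = Cc_borel[OF k]
  let ?J = "\<integral>\<^sup>+z. ennreal (min 1 (norm z powr p) * norm z powr - (real CARD('n) + \<theta> * p)) \<partial>(lborel :: (real^'n) measure)"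
  have "Slo \<theta> p (convl k h) \<le> (ennreal (A powr p) * ?J) * Lpow p h" if h[measurable]: "h \<in> borel_measurable borel" and fin: "Lpow p h < \<infinity>" for h
  proof -
    have bd: "Lpow p (\<lambda>x. convl k h (x + z) - convl k h x) \<le> ennreal (A powr p * min 1 (norm z powr p)) * Lpow p h" for z
    proof -
      have kz: "integrable lborel (\<lambda>x. k (x + z) - k x)"
        using integrable_translate[OF Cc_integrable[OF k], of z] Cc_integrable[OF k] by simp
      have "convl k h (x + z) - convl k h x = convl (\<lambda>y. k (y + z) - k y) h x" for x
        unfolding convl_def using Cc_kernel_integrable[OF locally_integrable_Lpow[OF h fin p] k]
        by (simp add: left_diff_distrib algebra_simps)
      hence "Lpow p (\<lambda>x. convl k h (x + z) - convl k h x) \<le> ennreal ((\<integral>x. \<bar>k (x + z) - k x\<bar> \<partial>lborel) powr p) * Lpow p h"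
        using convl_Young[OF kz h p] by simp
      also have "(\<integral>x. \<bar>k (x + z) - k x\<bar> \<partial>lborel) powr p \<le> (A * min 1 (norm z)) powr p"
        using A p by (intro powr_mono2) auto
      also have "(A * min 1 (norm z)) powr p = A powr p * (min 1 (norm z)) powr p"
        by (rule powr_mult)
      also have "(min 1 (norm z)) powr p = min 1 (norm z powr p)"
      proof (cases "norm z \<le> 1")
        case True thus ?thesis using powr_mono2[of p "norm z" 1] p by simp
      next
        case False thus ?thesis using powr_mono2[of p 1 "norm z"] p by simp
      qed
      finally show ?thesis by (simp add: ennreal_leI mult_right_mono)
    qed
    have "Slo \<theta> p (convl k h) \<le> (\<integral>\<^sup>+z. ennreal (A powr p) * Lpow p h * ennreal (min 1 (norm z powr p) * norm z powr - (real CARD('n) + \<theta> * p)) \<partial>(lborel :: (real^'n) measure))"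
      unfolding Slo_def
    proof (rule nn_integral_mono)
      fix z :: "real^'n"
      show "ennreal (norm z powr - (real CARD('n) + \<theta> * p)) * Lpow p (\<lambda>x. convl k h (x + z) - convl k h x)
        \<le> ennreal (A powr p) * Lpow p h * ennreal (min 1 (norm z powr p) * norm z powr - (real CARD('n) + \<theta> * p))"
        using mult_left_mono[OF bd[of z], of "ennreal (norm z powr - (real CARD('n) + \<theta> * p))"]
        by (simp add: ennreal_mult' mult_ac)
    qed
    also have "\<dots> = ennreal (A powr p) * Lpow p h * ?J" by (rule nn_integral_cmult) measurable
    finally show ?thesis by (simp add: mult_ac)
  qed
  moreover have "ennreal (A powr p) * ?J < \<infinity>"
    using kernel_integral_finite[of p \<theta>, where 'n = 'n] p \<theta> by (simp add: ennreal_mult_less_top)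
  ultimately show ?thesis by blast
qed

section \<open>Uniqueness of weak derivatives\<close>

text \<open>The fundamental lemma of the calculus of variations. After cutting off \<open>g\<close> outside a large ball, its
  mollifications vanish on a smaller ball by hypothesis, and they converge to \<open>g\<close> in \<open>L\<^sup>1\<close>.\<close>

lemma orthogonal_Cc_imp_zero:
  fixes g :: "real ^ 'n::finite \<Rightarrow> real"
  assumes g: "locally_integrable g" and z: "\<And>\<phi>. \<phi> \<in> Cc_infty \<Longrightarrow> (\<integral>x. g x * \<phi> x \<partial>lborel) = 0"
  shows "AE x in lborel. g x = 0"
proof -
  note gm[measurable] = locally_integrable_borel[OF g]
  have "\<forall>m::nat. \<exists>\<eta> :: real^'n \<Rightarrow> real. mollifier (1 / (real m + 1)) \<eta>"
    by (intro allI mollifier_exists) (simp add: add_nonneg_pos)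
  then obtain \<eta> :: "nat \<Rightarrow> real^'n \<Rightarrow> real" where \<eta>: "\<And>m. mollifier (1 / (real m + 1)) (\<eta> m)" by metis
  have "AE x in lborel. norm x < real R \<longrightarrow> g x = 0" for R :: nat
  proof -
    define w where "w x = indicator (cball 0 (real R + 1)) x *\<^sub>R g x" for x
    have wi: "integrable lborel w"
      using g compact_cball[of 0 "real R + 1"] by (auto simp: locally_integrable_def set_integrable_def w_def[abs_def])
    have wm[measurable]: "w \<in> borel_measurable borel" using wi by auto
    have wf: "Lpow 1 w < \<infinity>"
    proof -
      have "Lpow 1 w = (\<integral>\<^sup>+x. ennreal (norm (w x)) \<partial>lborel)" by (simp add: Lpow_def)
      thus ?thesis using wi unfolding integrable_iff_bounded by (simp only: infinity_ennreal_def)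
    qed
    have c0: "convl (\<eta> m) w x = 0" if x: "norm x < real R" for m x
    proof -
      have C: "\<eta> m \<in> Cc_infty" and s: "\<And>x. norm x \<ge> 1 / (real m + 1) \<Longrightarrow> \<eta> m x = 0" using \<eta>[of m] by (auto simp: mollifier_def)
      have swap: "\<eta> m (x - y) * w y = g y * \<eta> m (x - y)" for y
      proof (cases "norm y \<le> real R + 1")
        case False
        hence "norm (x - y) \<ge> 1" using x norm_triangle_ineq2[of y x] by (simp add: norm_minus_commute)
        moreover have "1 / (real m + 1) \<le> 1" by simp
        ultimately have "\<eta> m (x - y) = 0" by (intro s) linarith
        thus ?thesis by simp
      qed (simp add: w_def)
      have "convl (\<eta> m) w x = (\<integral>y. g y * \<eta> m (x - y) \<partial>lborel)" unfolding convl_def swap ..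
      also have "\<dots> = 0" by (rule z[OF Cc_reflect[OF C]])
      finally show ?thesis .
    qed
    define W where "W x = indicator (ball 0 (real R)) x *\<^sub>R g x" for x
    have Wm[measurable]: "W \<in> borel_measurable borel"
      unfolding W_def by (intro borel_measurable_scaleR borel_measurable_indicator gm) auto
    have le: "Lpow 1 W \<le> Lpow 1 (\<lambda>x. w x - convl (\<eta> m) w x)" for m
      by (rule Lpow_mono) (auto simp: W_def w_def indicator_def c0)
    have "Lpow 1 W \<le> 0"
      using mollify_Lpow_tendsto[OF \<eta> wm wf order_refl] le by (intro LIMSEQ_le_const[where X = "\<lambda>m. Lpow 1 (\<lambda>x. w x - convl (\<eta> m) w x)"]) auto
    hence "AE x in lborel. ennreal (\<bar>W x\<bar> powr 1) = 0"
      unfolding Lpow_def by (subst nn_integral_0_iff_AE[symmetric]) auto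
    thus ?thesis by eventually_elim (auto simp: W_def)
  qed
  hence "AE x in lborel. \<forall>R::nat. norm x < real R \<longrightarrow> g x = 0" by (subst AE_all_countable) auto
  thus ?thesis
  proof eventually_elim
    case (elim x)
    obtain R :: nat where "norm x < real R" using reals_Archimedean2 by metis
    thus ?case using elim by blast
  qed
qed

lemma has_weak_deriv_unique:
  assumes "has_weak_deriv \<nu> f g" "has_weak_deriv \<nu> f g'"
  shows "AE x in lborel. g x = g' x"
proof -
  have l: "locally_integrable g" "locally_integrable g'" using assms by (auto simp: has_weak_deriv_def)
  have "AE x in lborel. g x - g' x = 0"
  proof (rule orthogonal_Cc_imp_zero)
    show "locally_integrable (\<lambda>x. g x - g' x)"
      using l unfolding locally_integrable_def set_integrable_def by (auto simp: right_diff_distrib)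
    fix \<phi> :: "real^'a \<Rightarrow> real" assume \<phi>: "\<phi> \<in> Cc_infty"
    have "(-1) ^ mi_order \<nu> * (\<integral>x. g x * \<phi> x \<partial>lborel) = (-1) ^ mi_order \<nu> * (\<integral>x. g' x * \<phi> x \<partial>lborel)"
      using assms[unfolded has_weak_deriv_def, THEN conjunct2, THEN conjunct2, rule_format, OF \<phi>] by simp
    hence "(\<integral>x. g x * \<phi> x \<partial>lborel) = (\<integral>x. g' x * \<phi> x \<partial>lborel)" by simp
    thus "(\<integral>x. (g x - g' x) * \<phi> x \<partial>lborel) = 0"
      using Cc_times_integrable[OF l(1) \<phi>] Cc_times_integrable[OF l(2) \<phi>] by (simp add: left_diff_distrib)
  qed
  thus ?thesis by eventually_elim simp
qed


section \<open>Elementary tools\<close>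

text \<open>\<open>f\<close> has norm at most \<open>K\<close> in \<open>L\<^sup>1\<^sup>/\<^sup>a\<close>, where \<open>a = 0\<close> means \<open>L\<^sup>\<infinity>\<close>. With reciprocal exponents the
  conditions for Hoelder's inequality and for the Sobolev embeddings are linear.\<close>

definition Lbound :: "real \<Rightarrow> real \<Rightarrow> (real ^ 'n::finite \<Rightarrow> real) \<Rightarrow> bool" where
  "Lbound a K f \<longleftrightarrow> (if a = 0 then AE x in lborel. \<bar>f x\<bar> \<le> K else Lpow (1 / a) f \<le> ennreal (K powr (1 / a)))"


lemma ennreal_cancel:
  assumes "ennreal a * X \<le> ennreal b * Y" "a > 0" "b \<ge> 0"
  shows "X \<le> ennreal (b / a) * Y"
proof -
  have "ennreal (1 / a) * (ennreal a * X) \<le> ennreal (1 / a) * (ennreal b * Y)" by (rule mult_left_mono[OF assms(1)]) simp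
  thus ?thesis using assms(2,3) by (simp add: mult.assoc[symmetric] ennreal_mult'[symmetric])
qed

lemma powr_le_cancel_base:
  fixes x y q :: real
  assumes "0 \<le> x" "0 \<le> y" "x powr q \<le> y powr q" "q > 0"
  shows "x \<le> y"
  using assms powr_less_mono2[of q y x] by (meson not_le)

text \<open>Dividing by a power of the norm that is to be estimated is legitimate because this norm is finite.
  All critical embeddings below are brought into this form.\<close>

lemma self_improving_bound:
  fixes C G p q :: real
  assumes fin: "Lpow q f < \<infinity>" and pq: "0 < p" "p \<le> q" and C: "C > 0" and G: "G \<ge> 0"
    and le: "\<And>M. M > 0 \<Longrightarrow> Lpow q f = ennreal (M powr q) \<Longrightarrow> Lpow q f \<le> ennreal (C * M powr (q - p) * G powr p)"
  shows "Lpow q f \<le> ennreal ((C powr (1 / p) * G) powr q)"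
proof (cases "Lpow q f = 0")
  case False
  obtain m where m: "Lpow q f = ennreal m" "m \<ge> 0" using fin by (cases "Lpow q f") auto
  have m0: "m > 0" using m False by (cases "m = 0") auto
  define M where "M = m powr (1 / q)"
  have M: "M > 0" using m0 by (simp add: M_def)
  have Mq: "M powr q = m" using m0 pq by (simp add: M_def powr_powr)
  have "ennreal (M powr q) \<le> ennreal (C * M powr (q - p) * G powr p)" using le[OF M] m Mq by simp
  hence "M powr q \<le> C * M powr (q - p) * G powr p" using C by (subst (asm) ennreal_le_iff) auto
  also have "M powr q = M powr (q - p) * M powr p" using M by (simp add: powr_add[symmetric])
  finally have "M powr (q - p) * M powr p \<le> M powr (q - p) * (C * G powr p)" by (simp add: mult_ac)
  hence "M powr p \<le> C * G powr p" using M by simp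
  also have "C * G powr p = (C powr (1 / p) * G) powr p"
    using C G pq by (simp add: powr_mult powr_powr)
  finally have "M \<le> C powr (1 / p) * G" by - (rule powr_le_cancel_base[of M _ p], use M G C pq(1) in auto)
  hence "M powr q \<le> (C powr (1 / p) * G) powr q" using M pq by (intro powr_mono2) auto
  thus ?thesis using m Mq by (simp add: ennreal_leI)
qed simp

section \<open>Translations and gradients\<close>

text \<open>The fundamental theorem of calculus on the segment from \<open>x\<close> to \<open>x + z\<close>, Jensen's inequality on
  \<open>[0, 1]\<close>, and translation invariance. The majorant \<open>\<Gamma>\<close> of the gradient is kept separate from \<open>v\<close> since
  it will be taken to vanish outside a level set.\<close>

lemma Lpow_difference_le_gradient:
  fixes v \<Gamma> :: "real ^ 'n::finite \<Rightarrow> real"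
  assumes d: "\<And>x z t. ((\<lambda>t. v (x + t *\<^sub>R z)) has_real_derivative D x z t) (at t)"
    and b: "\<And>x z t. \<bar>D x z t\<bar> \<le> \<Gamma> (x + t *\<^sub>R z) * norm z"
    and \<Gamma>: "continuous_on UNIV \<Gamma>" "\<And>x. \<Gamma> x \<ge> 0" and p: "1 \<le> p"
  shows "Lpow p (\<lambda>x. v (x + z) - v x) \<le> ennreal (norm z powr p) * Lpow p \<Gamma>"
proof -
  have [measurable]: "\<Gamma> \<in> borel_measurable borel" using \<Gamma>(1) by (rule borel_measurable_continuous_onI)
  have pw: "ennreal (\<bar>v (x + z) - v x\<bar> powr p) \<le> ennreal (norm z powr p) * (\<integral>\<^sup>+t. ennreal (indicator {0..1::real} t * \<bar>\<Gamma> (x + t *\<^sub>R z)\<bar> powr p) \<partial>lborel)" for x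
  proof -
    have c: "continuous_on {0..1} (\<lambda>t. \<Gamma> (x + t *\<^sub>R z))"
      by (rule continuous_on_compose2[OF \<Gamma>(1)]) (auto intro!: continuous_intros)
    hence c2: "continuous_on {0..1} (\<lambda>t. \<Gamma> (x + t *\<^sub>R z) * norm z)" by (intro continuous_intros)
    have "(D x z has_integral (v (x + 1 *\<^sub>R z) - v (x + 0 *\<^sub>R z))) {0..1}"
      by (rule fundamental_theorem_of_calculus) (use d in \<open>auto simp: has_real_derivative_iff_has_vector_derivative[symmetric] intro: has_field_derivative_at_within\<close>)
    hence I: "D x z integrable_on {0..1}" "integral {0..1} (D x z) = v (x + z) - v x" by (auto simp: has_integral_iff)
    have "norm (integral {0..1} (D x z)) \<le> integral {0..1} (\<lambda>t. \<Gamma> (x + t *\<^sub>R z) * norm z)"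
      by (rule Henstock_Kurzweil_Integration.integral_norm_bound_integral) (use I b c2 in \<open>auto intro: integrable_continuous_real\<close>)
    also have "\<dots> = integral {0..1} (\<lambda>t. \<Gamma> (x + t *\<^sub>R z)) * norm z" by simp
    also have "integral {0..1} (\<lambda>t. \<Gamma> (x + t *\<^sub>R z)) = (\<integral>t. indicator {0..1} t * \<Gamma> (x + t *\<^sub>R z) \<partial>lborel)"
      using set_borel_integral_eq_integral(2)[OF borel_integrable_atLeastAtMost'[OF c]] by (simp add: set_lebesgue_integral_def)
    finally have "\<bar>v (x + z) - v x\<bar> \<le> (\<integral>t. indicator {0..1} t * \<Gamma> (x + t *\<^sub>R z) \<partial>lborel) * norm z"
      unfolding I(2) real_norm_def .
    also have "\<dots> \<le> \<bar>\<integral>t. indicator {0..1} t * \<Gamma> (x + t *\<^sub>R z) \<partial>lborel\<bar> * norm z"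
      by (rule mult_right_mono) auto
    finally have 1: "\<bar>v (x + z) - v x\<bar> \<le> \<bar>\<integral>t. indicator {0..1} t * \<Gamma> (x + t *\<^sub>R z) \<partial>lborel\<bar> * norm z" .
    have "\<bar>v (x + z) - v x\<bar> powr p \<le> (\<bar>\<integral>t. indicator {0..1} t * \<Gamma> (x + t *\<^sub>R z) \<partial>lborel\<bar> * norm z) powr p"
      using 1 p by (intro powr_mono2) auto
    also have "\<dots> = norm z powr p * \<bar>\<integral>t. indicator {0..1} t * \<Gamma> (x + t *\<^sub>R z) \<partial>lborel\<bar> powr p"
      by (simp add: powr_mult mult.commute)
    finally have "ennreal (\<bar>v (x + z) - v x\<bar> powr p) \<le> ennreal (norm z powr p) * ennreal (\<bar>\<integral>t. indicator {0..1} t * \<Gamma> (x + t *\<^sub>R z) \<partial>lborel\<bar> powr p)"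
      by (simp add: ennreal_mult'[symmetric] ennreal_leI)
    also have "ennreal (\<bar>\<integral>t. indicator {0..1} t * \<Gamma> (x + t *\<^sub>R z) \<partial>lborel\<bar> powr p) \<le>
       ennreal ((\<integral>t. indicator {0..1::real} t \<partial>lborel) powr (p - 1)) * (\<integral>\<^sup>+t. ennreal (indicator {0..1::real} t * \<bar>\<Gamma> (x + t *\<^sub>R z)\<bar> powr p) \<partial>lborel)"
      by (rule nn_jensen) (use p in \<open>auto simp: integrable_indicator_iff\<close>)
    finally show ?thesis by (simp add: mult_left_mono)
  qed
  have "Lpow p (\<lambda>x. v (x + z) - v x) \<le> (\<integral>\<^sup>+x. ennreal (norm z powr p) * (\<integral>\<^sup>+t. ennreal (indicator {0..1::real} t * \<bar>\<Gamma> (x + t *\<^sub>R z)\<bar> powr p) \<partial>lborel) \<partial>lborel)"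
    unfolding Lpow_def by (intro nn_integral_mono pw)
  also have "\<dots> = ennreal (norm z powr p) * (\<integral>\<^sup>+x. \<integral>\<^sup>+t. ennreal (indicator {0..1::real} t * \<bar>\<Gamma> (x + t *\<^sub>R z)\<bar> powr p) \<partial>lborel \<partial>lborel)"
    by (rule nn_integral_cmult) measurable
  also have "(\<integral>\<^sup>+x. \<integral>\<^sup>+t. ennreal (indicator {0..1::real} t * \<bar>\<Gamma> (x + t *\<^sub>R z)\<bar> powr p) \<partial>lborel \<partial>lborel)
     = (\<integral>\<^sup>+t. \<integral>\<^sup>+x. ennreal (indicator {0..1::real} t * \<bar>\<Gamma> (x + t *\<^sub>R z)\<bar> powr p) \<partial>lborel \<partial>lborel)"
    by (rule nn_integral_Tonelli) measurable
  also have "\<dots> = (\<integral>\<^sup>+t. Lpow p \<Gamma> * indicator {0..1::real} t \<partial>lborel)"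
  proof (rule nn_integral_cong)
    fix t :: real
    have "(\<integral>\<^sup>+x. ennreal (indicator {0..1::real} t * \<bar>\<Gamma> (x + t *\<^sub>R z)\<bar> powr p) \<partial>lborel) = ennreal (indicator {0..1::real} t) * Lpow p (\<lambda>x. \<Gamma> (x + t *\<^sub>R z))"
      unfolding Lpow_def by (simp add: ennreal_mult' nn_integral_cmult)
    thus "(\<integral>\<^sup>+x. ennreal (indicator {0..1::real} t * \<bar>\<Gamma> (x + t *\<^sub>R z)\<bar> powr p) \<partial>lborel) = Lpow p \<Gamma> * indicator {0..1::real} t"
      by (simp add: Lpow_translate ennreal_indicator mult.commute)
  qed
  also have "\<dots> = Lpow p \<Gamma>" by (subst nn_integral_cmult_indicator) auto
  finally show ?thesis .
qed

definition grad1 :: "(real ^ 'n::finite \<Rightarrow> real) \<Rightarrow> real ^ 'n \<Rightarrow> real" where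
  "grad1 f x = (\<Sum>i\<in>UNIV. \<bar>partial_deriv i f x\<bar>)"

lemma grad1_continuous: "f \<in> Cc_infty \<Longrightarrow> continuous_on UNIV (grad1 f)"
  unfolding grad1_def by (intro continuous_intros smooth_continuous Cc_smooth Cc_partial_deriv)

lemma grad1_nonneg: "grad1 f x \<ge> 0" unfolding grad1_def by (intro sum_nonneg) auto

lemma directional_le_grad1:
  fixes f :: "real ^ 'n::finite \<Rightarrow> real"
  shows "\<bar>\<Sum>i\<in>UNIV. z $ i * partial_deriv i f x\<bar> \<le> grad1 f x * norm z"
proof -
  have "\<bar>\<Sum>i\<in>UNIV. z $ i * partial_deriv i f x\<bar> \<le> (\<Sum>i\<in>UNIV. \<bar>z $ i * partial_deriv i f x\<bar>)" by (rule sum_abs)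
  also have "\<dots> \<le> (\<Sum>i\<in>UNIV. \<bar>partial_deriv i f x\<bar> * norm z)"
    by (intro sum_mono) (use component_le_norm_cart[of z] in \<open>auto simp: abs_mult mult.commute intro!: mult_right_mono\<close>)
  finally show ?thesis by (simp add: grad1_def sum_distrib_right)
qed

lemma Lpow_grad1_le:
  fixes f :: "real ^ 'n::finite \<Rightarrow> real"
  assumes f: "f \<in> Cc_infty" and p: "1 \<le> p" and le: "\<And>i. Lpow p (partial_deriv i f) \<le> ennreal (G powr p)"
  shows "Lpow p (grad1 f) \<le> ennreal (real CARD('n) powr p * real CARD('n) * G powr p)"
proof -
  have [measurable]: "partial_deriv i f \<in> borel_measurable borel" for i by (intro Cc_borel Cc_partial_deriv f)
  have "Lpow p (grad1 f) \<le> (\<integral>\<^sup>+x. ennreal (real CARD('n) powr p) * (\<Sum>i\<in>UNIV. ennreal (\<bar>partial_deriv i f x\<bar> powr p)) \<partial>lborel)"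
    unfolding Lpow_def
  proof (rule nn_integral_mono)
    fix x
    have "\<bar>grad1 f x\<bar> powr p \<le> real CARD('n) powr p * (\<Sum>i\<in>UNIV. \<bar>partial_deriv i f x\<bar> powr p)"
      using powr_sum_le[of UNIV p "\<lambda>i. partial_deriv i f x"] p grad1_nonneg[of f x] by (simp add: grad1_def)
    thus "ennreal (\<bar>grad1 f x\<bar> powr p) \<le> ennreal (real CARD('n) powr p) * (\<Sum>i\<in>UNIV. ennreal (\<bar>partial_deriv i f x\<bar> powr p))"
      by (simp add: ennreal_mult'[symmetric] sum_ennreal ennreal_leI)
  qed
  also have "\<dots> = ennreal (real CARD('n) powr p) * (\<Sum>i\<in>UNIV. Lpow p (partial_deriv i f))"
    unfolding Lpow_def by (simp add: nn_integral_cmult nn_integral_sum del: sum_ennreal)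
  also have "\<dots> \<le> ennreal (real CARD('n) powr p) * (\<Sum>i\<in>(UNIV::'n set). ennreal (G powr p))"
    by (intro mult_left_mono sum_mono le) auto
  also have "\<dots> = ennreal (real CARD('n) powr p * real CARD('n) * G powr p)"
    by (simp add: ennreal_mult'[symmetric] ennreal_of_nat_eq_real_of_nat mult.assoc)
  finally show ?thesis .
qed

lemma Cc_difference_le_gradient:
  fixes f :: "real ^ 'n::finite \<Rightarrow> real"
  assumes f: "f \<in> Cc_infty" and p: "1 \<le> p"
  shows "Lpow p (\<lambda>x. f (x + z) - f x) \<le> ennreal (norm z powr p) * Lpow p (grad1 f)"
proof (rule Lpow_difference_le_gradient[where D = "\<lambda>x z t. \<Sum>i\<in>UNIV. z $ i * partial_deriv i f (x + t *\<^sub>R z)" and \<Gamma> = "grad1 f"])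
  show "((\<lambda>t. f (x + t *\<^sub>R z)) has_real_derivative (\<Sum>i\<in>UNIV. z $ i * partial_deriv i f (x + t *\<^sub>R z))) (at t)" for x z t
    by (rule has_real_derivative_line) (rule Cc_differentiable[OF f])
qed (use directional_le_grad1 grad1_continuous[OF f] grad1_nonneg p in auto)

text \<open>Differences over \<open>z\<close> are bounded by \<open>|z|\<close> times the gradient, and by twice the norm of \<open>f\<close>; the
  resulting weight \<open>min 1 |z|\<^sup>p\<close> is integrable against the Slobodeckij kernel.\<close>

lemma Slo_le_gradient:
  assumes p: "1 \<le> p" and \<theta>: "0 < \<theta>" "\<theta> < 1"
  shows "\<exists>C>0. \<forall>f::real^'n::finite \<Rightarrow> real. \<forall>G\<ge>0. f \<in> Cc_infty \<longrightarrow> Lpow p f \<le> ennreal (G powr p) \<longrightarrow>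
     (\<forall>i. Lpow p (partial_deriv i f) \<le> ennreal (G powr p)) \<longrightarrow> Slo \<theta> p f \<le> ennreal ((C * G) powr p)"
proof -
  define J where "J = (\<integral>\<^sup>+z. ennreal (min 1 (norm z powr p) * norm z powr - (real CARD('n) + \<theta> * p)) \<partial>(lborel :: (real^'n) measure))"
  have "J < \<infinity>" unfolding J_def using p \<theta> by (intro kernel_integral_finite) auto
  then obtain j where j: "J = ennreal j" "j \<ge> 0" by (cases J) auto
  define A where "A = real CARD('n) powr p * real CARD('n) + 2 powr p * 2"
  have A: "A > 0" by (simp add: A_def add_nonneg_pos)
  define C where "C = (A * (j + 1)) powr (1 / p)"
  have C: "C > 0" using A j by (simp add: C_def add_nonneg_pos)
  have Cp: "C powr p = A * (j + 1)" using A j p by (simp add: C_def powr_powr)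
  show ?thesis
  proof (intro exI[of _ C] conjI allI impI C)
    fix f :: "real^'n \<Rightarrow> real" and G :: real
    assume G: "G \<ge> 0" and f: "f \<in> Cc_infty" and 0: "Lpow p f \<le> ennreal (G powr p)" and 1: "\<forall>i. Lpow p (partial_deriv i f) \<le> ennreal (G powr p)"
    note [measurable] = Cc_borel[OF f]
    have bd: "Lpow p (\<lambda>x. f (x + z) - f x) \<le> ennreal (A * G powr p) * ennreal (min 1 (norm z powr p))" for z
    proof (cases "norm z powr p \<le> 1")
      case True
      have "Lpow p (\<lambda>x. f (x + z) - f x) \<le> ennreal (norm z powr p) * ennreal (real CARD('n) powr p * real CARD('n) * G powr p)"
        using Cc_difference_le_gradient[OF f p, of z] Lpow_grad1_le[OF f p 1[rule_format]] by (meson mult_left_mono order_trans zero_le)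
      also have "\<dots> = ennreal (norm z powr p * (real CARD('n) powr p * real CARD('n) * G powr p))" by (simp add: ennreal_mult')
      also have "\<dots> \<le> ennreal (norm z powr p * (A * G powr p))"
        by (intro ennreal_leI mult_left_mono mult_right_mono) (auto simp: A_def)
      finally show ?thesis using True A by (simp add: ennreal_mult'[symmetric] min_def mult.commute)
    next
      case False
      have fz: "(\<lambda>x. f (x + z)) \<in> borel_measurable borel" by measurable
      have "Lpow p (\<lambda>x. f (x + z) - f x) \<le> ennreal (2 powr p) * (Lpow p (\<lambda>x. f (x + z)) + Lpow p f)"
        by (rule Lpow_diff_le[OF fz]) (use p in auto)
      also have "\<dots> \<le> ennreal (2 powr p) * (ennreal (G powr p) + ennreal (G powr p))"
        by (intro mult_left_mono add_mono) (use 0 in \<open>auto simp: Lpow_translate\<close>)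
      also have "\<dots> = ennreal (2 powr p * 2 * G powr p)"
        by (simp add: ennreal_mult'[symmetric] ennreal_plus[symmetric] del: ennreal_plus)
      also have "\<dots> \<le> ennreal (A * G powr p)" by (intro ennreal_leI mult_right_mono) (auto simp: A_def)
      finally show ?thesis using False by (simp add: min_def)
    qed
    have "Slo \<theta> p f \<le> (\<integral>\<^sup>+z. ennreal (A * G powr p) * ennreal (min 1 (norm z powr p) * norm z powr - (real CARD('n) + \<theta> * p)) \<partial>(lborel :: (real^'n) measure))"
      unfolding Slo_def
    proof (rule nn_integral_mono)
      fix z :: "real^'n"
      show "ennreal (norm z powr - (real CARD('n) + \<theta> * p)) * Lpow p (\<lambda>x. f (x + z) - f x)
        \<le> ennreal (A * G powr p) * ennreal (min 1 (norm z powr p) * norm z powr - (real CARD('n) + \<theta> * p))"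
        using mult_left_mono[OF bd[of z], of "ennreal (norm z powr - (real CARD('n) + \<theta> * p))"]
        by (simp add: ennreal_mult' mult_ac)
    qed
    also have "\<dots> = ennreal (A * G powr p) * J" unfolding J_def by (rule nn_integral_cmult) measurable
    also have "\<dots> = ennreal (A * j * G powr p)" using A j by (simp add: ennreal_mult'[symmetric] mult_ac)
    also have "\<dots> \<le> ennreal ((C * G) powr p)"
      using A G by (intro ennreal_leI) (auto simp: powr_mult Cp intro!: mult_right_mono)
    finally show "Slo \<theta> p f \<le> ennreal ((C * G) powr p)" .
  qed
qed

section \<open>Averages over balls\<close>

text \<open>The volume of a ball of radius \<open>r\<close>, written with a real power so that it combines with the real
  exponents around it. The first argument only carries the dimension.\<close>

definition bvol :: "'n::finite itself \<Rightarrow> real \<Rightarrow> real" where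
  "bvol _ r = unit_ball_vol (real CARD('n)) * r powr real CARD('n)"

lemma bvol_pos: "r > 0 \<Longrightarrow> bvol TYPE('n::finite) r > 0"
  by (simp add: bvol_def)

lemma emeasure_ball_bvol: "r > 0 \<Longrightarrow> emeasure lborel (ball (c::real^'n::finite) r) = ennreal (bvol TYPE('n) r)"
  by (simp add: emeasure_ball bvol_def powr_realpow)

lemma measure_ball_bvol: "r > 0 \<Longrightarrow> measure lborel (ball (c::real^'n::finite) r) = bvol TYPE('n) r"
  using emeasure_ball_bvol[of r c] bvol_pos[of r, where 'n = 'n] by (simp add: measure_def)

lemma ball_average_Jensen:
  fixes h :: "real ^ 'n::finite \<Rightarrow> real"
  assumes h: "h \<in> borel_measurable borel" and p: "1 \<le> p" and r: "r > 0"
  shows "ennreal (\<bar>\<integral>z. indicator (ball 0 r) z * h z \<partial>lborel\<bar> powr p) \<le> ennreal (bvol TYPE('n) r powr (p - 1)) * (\<integral>\<^sup>+z. ennreal (indicator (ball 0 r) z * \<bar>h z\<bar> powr p) \<partial>lborel)"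
  using nn_jensen[of lborel "indicator (ball (0::real^'n) r)" h p] h p r
  by (simp add: integrable_indicator_iff emeasure_ball_bvol measure_ball_bvol)

lemma ball_indicator_integrable:
  fixes h :: "real ^ 'n::finite \<Rightarrow> real"
  assumes "h \<in> borel_measurable borel" "\<And>x. \<bar>h x\<bar> \<le> B"
  shows "integrable lborel (\<lambda>z. indicator (ball 0 r) z * h z)"
proof (rule bounded_support_integrable[where B = "\<bar>B\<bar>" and R = r])
  show "\<bar>indicator (ball 0 r) z * h z\<bar> \<le> \<bar>B\<bar>" for z using assms(2)[of z] by (auto simp: indicator_def)
  show "(\<lambda>z. indicator (ball 0 r) z * h z) \<in> borel_measurable borel"
    by (intro borel_measurable_times borel_measurable_indicator assms(1)) auto
qed auto

lemma ball_average_Lq: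
  fixes v :: "real ^ 'n::finite \<Rightarrow> real"
  assumes v[measurable]: "v \<in> borel_measurable borel" and q: "1 \<le> q" and r: "r > 0" and M: "Lpow q v \<le> ennreal (M powr q)" "M \<ge> 0"
  shows "\<bar>\<integral>z. indicator (ball 0 r) z * v (x + z) \<partial>lborel\<bar> \<le> bvol TYPE('n) r powr (1 - 1 / q) * M"
proof -
  let ?V = "bvol TYPE('n) r"
  note V = bvol_pos[OF r, where 'n = 'n]
  let ?I = "\<integral>z. indicator (ball 0 r) z * v (x + z) \<partial>lborel"
  have "ennreal (\<bar>?I\<bar> powr q) \<le> ennreal (?V powr (q - 1)) * (\<integral>\<^sup>+z. ennreal (indicator (ball 0 r) z * \<bar>v (x + z)\<bar> powr q) \<partial>lborel)"
    by (rule ball_average_Jensen[OF _ q r]) measurable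
  also have "(\<integral>\<^sup>+z. ennreal (indicator (ball 0 r) z * \<bar>v (x + z)\<bar> powr q) \<partial>lborel) \<le> Lpow q (\<lambda>z. v (z + x))"
    unfolding Lpow_def by (intro nn_integral_mono) (auto simp: indicator_def add.commute)
  also have "\<dots> = Lpow q v" by (rule Lpow_translate) measurable
  also have "\<dots> \<le> ennreal (M powr q)" by (rule M)
  finally have "ennreal (\<bar>?I\<bar> powr q) \<le> ennreal (?V powr (q - 1) * M powr q)"
    by (simp add: ennreal_mult' mult_left_mono)
  hence "\<bar>?I\<bar> powr q \<le> ?V powr (q - 1) * M powr q" by (subst (asm) ennreal_le_iff) auto
  also have "\<dots> = (?V powr (1 - 1 / q) * M) powr q"
    using V M q by (simp add: powr_mult powr_powr algebra_simps)
  finally show ?thesis by - (rule powr_le_cancel_base[of _ _ q], use q M in auto)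
qed

lemma value_le_averages:
  fixes v :: "real ^ 'n::finite \<Rightarrow> real"
  assumes v[measurable]: "v \<in> borel_measurable borel" and b: "\<And>x. \<bar>v x\<bar> \<le> B" and r: "r > 0"
  shows "\<bar>v x\<bar> * bvol TYPE('n) r \<le> \<bar>\<integral>z. indicator (ball 0 r) z * (v (x + z) - v x) \<partial>lborel\<bar> + \<bar>\<integral>z. indicator (ball 0 r) z * v (x + z) \<partial>lborel\<bar>"
proof -
  have i1: "integrable lborel (\<lambda>z. indicator (ball 0 r) z * v (x + z))"
    by (rule ball_indicator_integrable[where B = B]) (use b in auto)
  have i2: "integrable lborel (\<lambda>z. indicator (ball (0::real^'n) r) z * v x)"
    by (rule ball_indicator_integrable[where B = B]) (use b in auto)
  have "(\<integral>z. indicator (ball 0 r) z * (v (x + z) - v x) \<partial>lborel) = (\<integral>z. indicator (ball 0 r) z * v (x + z) \<partial>lborel) - v x * bvol TYPE('n) r"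
    using i1 i2 r by (simp add: right_diff_distrib measure_ball_bvol mult.commute)
  moreover have "\<bar>v x\<bar> * bvol TYPE('n) r = \<bar>v x * bvol TYPE('n) r\<bar>"
    using bvol_pos[OF r, where 'n = 'n] by (simp add: abs_mult)
  ultimately show ?thesis by linarith
qed

section \<open>Fractional embedding\<close>

lemma bvol_const_pos: "unit_ball_vol (real CARD('n::finite)) powr x + unit_ball_vol (real CARD('n)) powr y > 0"
proof -
  have "unit_ball_vol (real CARD('n)) \<noteq> 0" using unit_ball_vol_pos[of "real CARD('n)"] by linarith
  thus ?thesis by (intro add_pos_pos) simp_all
qed

lemma powr_pull:
  fixes w r :: real assumes "w > 0" "r > 0" shows "(w * r powr n) powr e = w powr e * r powr (n * e)"
  by (simp only: powr_mult powr_powr)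

text \<open>Here \<open>g\<close> majorises the inner integral of the seminorm at \<open>x\<close> and \<open>M\<close> the norm of \<open>f\<close> in \<open>L\<^sup>1\<^sup>/\<^sup>a\<close>. On a
  ball of radius \<open>r \<le> 1\<close> the value \<open>f x\<close> differs from the average by at most a multiple of
  \<open>r\<^sup>\<kappa> g\<^sup>1\<^sup>/\<^sup>p\<close> with \<open>\<kappa> = n (1/p - a)\<close>, and the average is at most a multiple of \<open>r\<^sup>-\<^sup>n\<^sup>a M\<close>. The two are
  balanced for \<open>r\<^sup>n = M\<^sup>p / g\<close>. If this exceeds \<open>1\<close>, the ball of radius \<open>1\<close> already gives
  \<open>|f x| \<le> c M\<close>, and all but \<open>p\<close> of the powers of \<open>|f x|\<close> can be replaced by powers of \<open>M\<close>.\<close>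

lemma fractional_pointwise:
  fixes f :: "real ^ 'n::finite \<Rightarrow> real"
  assumes f: "f \<in> Cc_infty" and p: "1 \<le> p" and \<theta>: "0 < \<theta>" and a: "0 < a" "a \<le> 1 / p" "1 / p - a \<le> \<theta> / real CARD('n)"
    and M: "M > 0" "Lpow (1 / a) f \<le> ennreal (M powr (1 / a))"
    and g: "(\<integral>\<^sup>+z. ennreal (norm z powr - (real CARD('n) + \<theta> * p) * \<bar>f (x + z) - f x\<bar> powr p) \<partial>lborel) \<le> ennreal g" "g \<ge> 0"
    and c: "c = unit_ball_vol (real CARD('n)) powr (- 1 / p) + unit_ball_vol (real CARD('n)) powr (- a)"
  shows "\<bar>f x\<bar> powr (1 / a) \<le> (c powr (1 / a) + c powr (1 / a - p)) * M powr (1 / a - p) * (g + \<bar>f x\<bar> powr p)"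
proof -
  note [measurable] = Cc_borel[OF f]
  define n where "n = real CARD('n)"
  have n: "n > 0" by (simp add: n_def)
  define w where "w = unit_ball_vol n"
  have w: "w > 0" using n by (simp add: w_def)
  define q where "q = 1 / a"
  define \<kappa> where "\<kappa> = n * (1 / p - a)"
  have \<kappa>0: "0 \<le> \<kappa>" unfolding \<kappa>_def using a n by (intro mult_nonneg_nonneg) auto
  have "\<kappa> \<le> n * (\<theta> / n)" unfolding \<kappa>_def using a(3) n by (intro mult_left_mono) (auto simp: n_def)
  with \<kappa>0 n have \<kappa>: "0 \<le> \<kappa>" "\<kappa> \<le> \<theta>" by auto
  have pq: "p \<le> q" using a p by (simp add: q_def field_simps)
  have q1: "1 \<le> q" using pq p by simp
  have c0: "c > 0" unfolding c by (rule bvol_const_pos)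
  obtain B where B: "\<And>x. \<bar>f x\<bar> \<le> B" using Cc_bounded[OF f] by blast
  have key: "\<bar>f x\<bar> \<le> w powr (- 1 / p) * r powr \<kappa> * g powr (1 / p) + w powr (- a) * r powr (- n * a) * M" if r: "r > 0" "r \<le> 1" for r
  proof -
    define V where "V = bvol TYPE('n) r"
    have V: "V > 0" "V = w * r powr n" using bvol_pos[OF r(1), where 'n = 'n] by (auto simp: V_def bvol_def w_def n_def)
    let ?I = "\<integral>z. indicator (ball 0 r) z * (f (x + z) - f x) \<partial>lborel"
    have "ennreal (\<bar>?I\<bar> powr p) \<le> ennreal (V powr (p - 1)) * (\<integral>\<^sup>+z. ennreal (indicator (ball 0 r) z * \<bar>f (x + z) - f x\<bar> powr p) \<partial>lborel)"
      unfolding V_def by (rule ball_average_Jensen[OF _ p r(1)]) measurable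
    also have "(\<integral>\<^sup>+z. ennreal (indicator (ball 0 r) z * \<bar>f (x + z) - f x\<bar> powr p) \<partial>lborel)
       \<le> (\<integral>\<^sup>+z. ennreal (r powr (n + \<kappa> * p)) * ennreal (norm z powr - (n + \<theta> * p) * \<bar>f (x + z) - f x\<bar> powr p) \<partial>lborel)"
    proof (rule nn_integral_mono)
      fix z :: "real^'n"
      show "ennreal (indicator (ball 0 r) z * \<bar>f (x + z) - f x\<bar> powr p) \<le> ennreal (r powr (n + \<kappa> * p)) * ennreal (norm z powr - (n + \<theta> * p) * \<bar>f (x + z) - f x\<bar> powr p)"
      proof (cases "z \<in> ball 0 r \<and> z \<noteq> 0")
        case True
        have e0: "n + \<theta> * p \<ge> 0" "n + \<kappa> * p \<ge> 0" using n \<theta> p \<kappa> by (auto intro!: add_nonneg_nonneg)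
        have "norm z powr (n + \<theta> * p) \<le> r powr (n + \<theta> * p)" using True e0 by (intro powr_mono2) auto
        also have "\<dots> \<le> r powr (n + \<kappa> * p)" using r \<kappa> p by (intro powr_mono') (auto intro!: mult_right_mono)
        finally have "1 \<le> r powr (n + \<kappa> * p) * norm z powr - (n + \<theta> * p)"
          using True powr_gt_zero[of "norm z" "n + \<theta> * p"] by (simp add: powr_minus_divide pos_le_divide_eq del: minus_add_distrib)
        from mult_right_mono[OF this, of "\<bar>f (x + z) - f x\<bar> powr p"]
        show ?thesis using True by (simp add: ennreal_mult'[symmetric] ennreal_leI mult.assoc)
      qed auto
    qed
    also have "\<dots> = ennreal (r powr (n + \<kappa> * p)) * (\<integral>\<^sup>+z. ennreal (norm z powr - (n + \<theta> * p) * \<bar>f (x + z) - f x\<bar> powr p) \<partial>lborel)"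
      by (rule nn_integral_cmult) measurable
    also have "\<dots> \<le> ennreal (r powr (n + \<kappa> * p)) * ennreal g"
      by (intro mult_left_mono) (use g in \<open>auto simp: n_def\<close>)
    finally have "ennreal (\<bar>?I\<bar> powr p) \<le> ennreal (V powr (p - 1) * (r powr (n + \<kappa> * p) * g))"
      using g(2) by (simp add: ennreal_mult' mult_left_mono)
    hence "\<bar>?I\<bar> powr p \<le> V powr (p - 1) * (r powr (n + \<kappa> * p) * g)" using g(2) by (subst (asm) ennreal_le_iff) auto
    also have "\<dots> = (V * (w powr (- 1 / p) * r powr \<kappa> * g powr (1 / p))) powr p"
    proof -
      have "(V * (w powr (- 1 / p) * r powr \<kappa> * g powr (1 / p))) powr p = V powr p * (w powr (-1) * r powr (\<kappa> * p) * g)"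
        using p g(2) w by (simp add: powr_mult powr_powr)
      also have "V powr p = V powr (p - 1) * (w * r powr n)" using V by (simp add: powr_diff)
      finally show ?thesis using w r by (simp add: powr_add powr_minus field_simps)
    qed
    finally have I: "\<bar>?I\<bar> \<le> V * (w powr (- 1 / p) * r powr \<kappa> * g powr (1 / p))"
      by - (rule powr_le_cancel_base[of _ _ p], use p V in auto)
    have J: "\<bar>\<integral>z. indicator (ball 0 r) z * f (x + z) \<partial>lborel\<bar> \<le> V powr (1 - a) * M"
      using ball_average_Lq[OF _ q1 r(1), of f M x] M by (simp add: q_def V_def)
    have "V powr (1 - a) = V * (w powr (- a) * r powr (- n * a))"
      using V w r by (simp add: powr_diff powr_pull powr_minus field_simps)
    hence J': "\<bar>\<integral>z. indicator (ball 0 r) z * f (x + z) \<partial>lborel\<bar> \<le> V * (w powr (- a) * r powr (- n * a) * M)"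
      using J by (simp add: mult.assoc)
    have "V * \<bar>f x\<bar> \<le> V * (w powr (- 1 / p) * r powr \<kappa> * g powr (1 / p)) + V * (w powr (- a) * r powr (- n * a) * M)"
      using value_le_averages[OF Cc_borel[OF f] B r(1), of x] I J' by (simp only: V_def[symmetric] mult.commute[of _ V])
    hence "V * \<bar>f x\<bar> \<le> V * (w powr (- 1 / p) * r powr \<kappa> * g powr (1 / p) + w powr (- a) * r powr (- n * a) * M)"
      by (simp only: distrib_left)
    thus ?thesis by (rule mult_left_le_imp_le) (rule V(1))
  qed
  show ?thesis
  proof (cases "g \<ge> M powr p")
    case True
    have g0: "g > 0" using True M by (smt (verit) powr_gt_zero)
    \<comment> \<open>the radius that balances the two terms of \<open>key\<close>\<close>
    define r where "r = (M powr p / g) powr (1 / n)"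
    have r: "r > 0" "r \<le> 1" using True M g0 n by (auto simp: r_def powr_le1)
    have rn: "r powr n = M powr p / g" using M g0 n by (simp add: r_def powr_powr)
    have "g = M powr p * r powr (- n)" using rn M g0 r by (simp add: powr_minus field_simps)
    hence "g powr (1 / p) = M * r powr (- n / p)" using M p r by (simp add: powr_mult powr_powr)
    hence "r powr \<kappa> * g powr (1 / p) = M * r powr (\<kappa> + - n / p)" unfolding powr_add by (simp only: mult.left_commute)
    also have "\<kappa> + - n / p = - n * a" by (simp add: \<kappa>_def algebra_simps)
    finally have "\<bar>f x\<bar> \<le> w powr (- 1 / p) * (M * r powr (- n * a)) + w powr (- a) * r powr (- n * a) * M"
      using key[OF r] by (simp add: mult.assoc)
    also have "\<dots> = c * M * r powr (- n * a)" by (simp add: c w_def n_def algebra_simps)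
    finally have "\<bar>f x\<bar> powr q \<le> (c * M * r powr (- n * a)) powr q" using q1 by (intro powr_mono2) auto
    also have "\<dots> = c powr q * M powr q * r powr (- n)"
      using c0 M a r by (simp add: powr_mult powr_powr q_def)
    also have "M powr q * r powr (- n) = M powr (q - p) * g"
      using rn M g0 r by (simp add: powr_minus powr_diff field_simps)
    hence "c powr q * M powr q * r powr (- n) = c powr q * M powr (q - p) * g" by simp
    also have "\<dots> \<le> (c powr q + c powr (q - p)) * M powr (q - p) * (g + \<bar>f x\<bar> powr p)"
      using g(2) by (intro mult_mono) auto
    finally show ?thesis by (simp add: q_def)
  next
    case False
    have "g powr (1 / p) \<le> (M powr p) powr (1 / p)" using False g p by (intro powr_mono2) auto
    also have "\<dots> = M" using M p by (simp add: powr_powr)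
    finally have "w powr (- 1 / p) * g powr (1 / p) \<le> w powr (- 1 / p) * M" by (intro mult_left_mono) auto
    hence "\<bar>f x\<bar> \<le> w powr (- 1 / p) * M + w powr (- a) * M" using key[of 1] by simp
    also have "\<dots> = c * M" by (simp add: c w_def n_def algebra_simps)
    finally have fc: "\<bar>f x\<bar> \<le> c * M" .
    have "\<bar>f x\<bar> powr q = \<bar>f x\<bar> powr (q - p) * \<bar>f x\<bar> powr p" by (simp add: powr_add[symmetric])
    also have "\<dots> \<le> (c * M) powr (q - p) * \<bar>f x\<bar> powr p" using fc pq by (intro mult_right_mono powr_mono2) auto
    also have "\<dots> = c powr (q - p) * M powr (q - p) * \<bar>f x\<bar> powr p" by (simp add: powr_mult)
    also have "\<dots> \<le> (c powr q + c powr (q - p)) * M powr (q - p) * (g + \<bar>f x\<bar> powr p)"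
      using g(2) by (intro mult_mono) auto
    finally show ?thesis by (simp add: q_def)
  qed
qed

lemma Slo_Tonelli:
  fixes f :: "real ^ 'n::finite \<Rightarrow> real"
  assumes [measurable]: "f \<in> borel_measurable borel"
  shows "Slo \<theta> p f = (\<integral>\<^sup>+x. \<integral>\<^sup>+z. ennreal (norm z powr - (real CARD('n) + \<theta> * p) * \<bar>f (x + z) - f x\<bar> powr p) \<partial>lborel \<partial>lborel)"
proof -
  have "Slo \<theta> p f = (\<integral>\<^sup>+z. \<integral>\<^sup>+x. ennreal (norm z powr - (real CARD('n) + \<theta> * p) * \<bar>f (x + z) - f x\<bar> powr p) \<partial>lborel \<partial>lborel)"
    unfolding Slo_def Lpow_def by (simp add: ennreal_mult' nn_integral_cmult)
  also have "\<dots> = (\<integral>\<^sup>+x. \<integral>\<^sup>+z. ennreal (norm z powr - (real CARD('n) + \<theta> * p) * \<bar>f (x + z) - f x\<bar> powr p) \<partial>lborel \<partial>lborel)"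
    by (rule nn_integral_Tonelli) measurable
  finally show ?thesis .
qed

text \<open>Integrate the pointwise bound with \<open>M\<close> equal to the norm of \<open>f\<close> in \<open>L\<^sup>1\<^sup>/\<^sup>a\<close> and absorb \<open>M\<close>.\<close>

lemma fractional_embedding:
  assumes p: "1 \<le> p" and \<theta>: "0 < \<theta>" and a: "0 < a" "a \<le> 1 / p" "1 / p - a \<le> \<theta> / real CARD('n::finite)"
  shows "\<exists>C>0. \<forall>f::real^'n \<Rightarrow> real. \<forall>G\<ge>0. f \<in> Cc_infty \<longrightarrow> Lpow p f \<le> ennreal (G powr p) \<longrightarrow>
     Slo \<theta> p f \<le> ennreal (G powr p) \<longrightarrow> Lbound a (C * G) f"
proof -
  define q where "q = 1 / a"
  have pq: "p \<le> q" using a p by (simp add: q_def field_simps)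
  define c where "c = unit_ball_vol (real CARD('n)) powr (- 1 / p) + unit_ball_vol (real CARD('n)) powr (- a)"
  define E where "E = c powr q + c powr (q - p)"
  have "c > 0" unfolding c_def by (rule bvol_const_pos)
  hence E: "E > 0" by (simp add: E_def add_pos_pos)
  show ?thesis
  proof (intro exI[of _ "(2 * E) powr (1 / p)"] conjI allI impI)
    show "(2 * E) powr (1 / p) > 0" using E by simp
    fix f :: "real^'n \<Rightarrow> real" and G :: real
    assume G: "G \<ge> 0" and f: "f \<in> Cc_infty" and 0: "Lpow p f \<le> ennreal (G powr p)" and S: "Slo \<theta> p f \<le> ennreal (G powr p)"
    note [measurable] = Cc_borel[OF f]
    have "Lpow q f \<le> ennreal (((2 * E) powr (1 / p) * G) powr q)"
    proof (rule self_improving_bound)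
      show "Lpow q f < \<infinity>" by (rule Lpow_Cc_finite[OF f]) (use pq p in auto)
      fix M :: real assume M: "M > 0" "Lpow q f = ennreal (M powr q)"
      define g where "g x = (\<integral>\<^sup>+z. ennreal (norm z powr - (real CARD('n) + \<theta> * p) * \<bar>f (x + z) - f x\<bar> powr p) \<partial>lborel)" for x
      have gm[measurable]: "g \<in> borel_measurable borel" unfolding g_def by measurable
      have "Lpow q f \<le> (\<integral>\<^sup>+x. ennreal (E * M powr (q - p)) * (g x + ennreal (\<bar>f x\<bar> powr p)) \<partial>lborel)"
        unfolding Lpow_def
      proof (rule nn_integral_mono)
        fix x
        show "ennreal (\<bar>f x\<bar> powr q) \<le> ennreal (E * M powr (q - p)) * (g x + ennreal (\<bar>f x\<bar> powr p))"
        proof (cases "g x")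
          case (real r)
          have "\<bar>f x\<bar> powr q \<le> E * M powr (q - p) * (r + \<bar>f x\<bar> powr p)"
            using fractional_pointwise[OF f p \<theta> a M(1), of x r c] M(2) real by (simp add: q_def E_def c_def g_def)
          thus ?thesis using real E by (simp add: ennreal_mult'[symmetric] ennreal_plus[symmetric] ennreal_leI del: ennreal_plus)
        next
          case top
          thus ?thesis using E M by (simp add: ennreal_mult_top)
        qed
      qed
      also have "\<dots> = ennreal (E * M powr (q - p)) * (Slo \<theta> p f + Lpow p f)"
        unfolding Slo_Tonelli[OF Cc_borel[OF f]] Lpow_def g_def[symmetric] by (simp add: nn_integral_cmult nn_integral_add)
      also have "\<dots> \<le> ennreal (E * M powr (q - p)) * (ennreal (G powr p) + ennreal (G powr p))"
        by (intro mult_left_mono add_mono 0 S) auto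
      also have "\<dots> = ennreal (2 * E * M powr (q - p) * G powr p)"
        using E by (simp add: ennreal_mult'[symmetric] ennreal_plus[symmetric] mult_ac del: ennreal_plus)
      finally show "Lpow q f \<le> ennreal (2 * E * M powr (q - p) * G powr p)" .
    qed (use p pq E G in auto)
    thus "Lbound a ((2 * E) powr (1 / p) * G) f" using a by (simp add: Lbound_def q_def)
  qed
qed


section \<open>Supercritical fractional embedding\<close>

definition bavg :: "(real ^ 'n::finite \<Rightarrow> real) \<Rightarrow> real ^ 'n \<Rightarrow> real \<Rightarrow> real" where
  "bavg f x r = (\<integral>z. indicator (ball 0 r) z * f (x + z) \<partial>lborel) / bvol TYPE('n) r"

lemma bavg_diff:
  fixes f :: "real ^ 'n::finite \<Rightarrow> real"
  assumes f: "f \<in> Cc_infty" and r: "r > 0"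
  shows "bvol TYPE('n) r * (bavg f x r - c) = (\<integral>z. indicator (ball 0 r) z * (f (x + z) - c) \<partial>lborel)"
proof -
  note [measurable] = Cc_borel[OF f]
  obtain B where B: "\<And>x. \<bar>f x\<bar> \<le> B" using Cc_bounded[OF f] by blast
  have i1: "integrable lborel (\<lambda>z. indicator (ball 0 r) z * f (x + z))"
    by (rule ball_indicator_integrable[where B = B]) (use B in auto)
  have i2: "integrable lborel (\<lambda>z. indicator (ball (0::real^'n) r) z * c)"
    by (rule ball_indicator_integrable[where B = "\<bar>c\<bar>"]) auto
  have "(\<integral>z. indicator (ball 0 r) z * (f (x + z) - c) \<partial>lborel) = (\<integral>z. indicator (ball 0 r) z * f (x + z) \<partial>lborel) - c * bvol TYPE('n) r"
    using i1 i2 r by (simp add: right_diff_distrib measure_ball_bvol mult.commute)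
  thus ?thesis using bvol_pos[OF r, where 'n = 'n] by (simp add: bavg_def right_diff_distrib)
qed

lemma bavg_diff_powr:
  fixes f :: "real ^ 'n::finite \<Rightarrow> real"
  assumes f: "f \<in> Cc_infty" and r: "r > 0" and p: "1 \<le> p"
  shows "ennreal (bvol TYPE('n) r * \<bar>bavg f x r - c\<bar> powr p) \<le> (\<integral>\<^sup>+z. ennreal (indicator (ball 0 r) z * \<bar>f (x + z) - c\<bar> powr p) \<partial>lborel)"
proof -
  note [measurable] = Cc_borel[OF f]
  let ?V = "bvol TYPE('n) r"
  note V = bvol_pos[OF r, where 'n = 'n]
  have "ennreal (\<bar>?V * (bavg f x r - c)\<bar> powr p) \<le> ennreal (?V powr (p - 1)) * (\<integral>\<^sup>+z. ennreal (indicator (ball 0 r) z * \<bar>f (x + z) - c\<bar> powr p) \<partial>lborel)"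
    unfolding bavg_diff[OF f r] by (rule ball_average_Jensen[OF _ p r]) measurable
  moreover have "\<bar>?V * (bavg f x r - c)\<bar> powr p = ?V powr (p - 1) * (?V * \<bar>bavg f x r - c\<bar> powr p)"
    using V by (simp add: abs_mult powr_mult powr_diff)
  ultimately have "ennreal (?V powr (p - 1)) * ennreal (?V * \<bar>bavg f x r - c\<bar> powr p) \<le> ennreal (?V powr (p - 1)) * (\<integral>\<^sup>+z. ennreal (indicator (ball 0 r) z * \<bar>f (x + z) - c\<bar> powr p) \<partial>lborel)"
    by (simp add: ennreal_mult')
  from ennreal_cancel[OF this] show ?thesis using V by simp
qed

text \<open>Jensen's inequality for both averages reduces the difference to a double integral of
  \<open>|f (x + y) - f (x + z)|\<^sup>p\<close>, in which \<open>|y - z| \<le> 2 r\<close>; hence the Slobodeckij kernel can be inserted at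
  the price of a factor \<open>(2 r)\<^sup>n\<^sup>+\<^sup>\<theta>\<^sup>p\<close>.\<close>

lemma bavg_step:
  fixes f :: "real ^ 'n::finite \<Rightarrow> real"
  assumes f: "f \<in> Cc_infty" and r: "r > 0" and p: "1 \<le> p" and \<theta>: "\<theta> > 0" and G: "G \<ge> 0" and S: "Slo \<theta> p f \<le> ennreal (G powr p)"
  shows "\<bar>bavg f x (r / 2) - bavg f x r\<bar> \<le> (unit_ball_vol (real CARD('n)) powr (- 2) * 2 powr (2 * real CARD('n) + \<theta> * p)) powr (1 / p) * r powr (\<theta> - real CARD('n) / p) * G"
proof -
  note [measurable] = Cc_borel[OF f]
  have [measurable]: "ball (0::real^'n) s \<in> sets borel" for s by simp
  define n where "n = real CARD('n)"
  have n: "n > 0" by (simp add: n_def)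
  define w where "w = unit_ball_vol n"
  have w: "w > 0" using n by (simp add: w_def)
  define V where "V = bvol TYPE('n) r"
  define V' where "V' = bvol TYPE('n) (r / 2)"
  have V: "V > 0" "V' > 0" using bvol_pos[of r, where 'n = 'n] bvol_pos[of "r/2", where 'n = 'n] r by (auto simp: V_def V'_def)
  define d where "d = \<bar>bavg f x (r / 2) - bavg f x r\<bar>"
  have "ennreal V * ennreal (V' * d powr p) \<le> ennreal V * (\<integral>\<^sup>+y. ennreal (indicator (ball 0 (r / 2)) y * \<bar>f (x + y) - bavg f x r\<bar> powr p) \<partial>lborel)"
    unfolding d_def V'_def by (intro mult_left_mono bavg_diff_powr f p) (use r in auto)
  also have "\<dots> = (\<integral>\<^sup>+y. ennreal (indicator (ball 0 (r / 2)) y) * ennreal (V * \<bar>bavg f x r - f (x + y)\<bar> powr p) \<partial>lborel)"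
  proof -
    have "ennreal V * (\<integral>\<^sup>+y. ennreal (indicator (ball 0 (r / 2)) y * \<bar>f (x + y) - bavg f x r\<bar> powr p) \<partial>lborel)
      = (\<integral>\<^sup>+y. ennreal V * ennreal (indicator (ball 0 (r / 2)) y * \<bar>f (x + y) - bavg f x r\<bar> powr p) \<partial>lborel)"
      by (rule nn_integral_cmult[symmetric]) measurable
    also have "\<dots> = (\<integral>\<^sup>+y. ennreal (indicator (ball 0 (r / 2)) y) * ennreal (V * \<bar>bavg f x r - f (x + y)\<bar> powr p) \<partial>lborel)"
      using V by (intro nn_integral_cong) (auto simp: ennreal_mult' abs_minus_commute indicator_def)
    finally show ?thesis .
  qed
  also have "\<dots> \<le> (\<integral>\<^sup>+y. ennreal (indicator (ball 0 (r / 2)) y) * (\<integral>\<^sup>+z. ennreal (indicator (ball 0 r) z * \<bar>f (x + z) - f (x + y)\<bar> powr p) \<partial>lborel) \<partial>lborel)"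
    unfolding V_def by (intro nn_integral_mono mult_left_mono bavg_diff_powr f p r) auto
  also have "\<dots> \<le> (\<integral>\<^sup>+y. (\<integral>\<^sup>+z. ennreal ((2 * r) powr (n + \<theta> * p)) * ennreal (norm z powr - (n + \<theta> * p) * \<bar>f ((y + x) + z) - f (y + x)\<bar> powr p) \<partial>lborel) \<partial>lborel)"
  proof (rule nn_integral_mono)
    fix y :: "real^'n"
    show "ennreal (indicator (ball 0 (r / 2)) y) * (\<integral>\<^sup>+z. ennreal (indicator (ball 0 r) z * \<bar>f (x + z) - f (x + y)\<bar> powr p) \<partial>lborel)
       \<le> (\<integral>\<^sup>+z. ennreal ((2 * r) powr (n + \<theta> * p)) * ennreal (norm z powr - (n + \<theta> * p) * \<bar>f ((y + x) + z) - f (y + x)\<bar> powr p) \<partial>lborel)"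
    proof (cases "norm y < r / 2")
      case True
      have "(\<integral>\<^sup>+z. ennreal (indicator (ball 0 r) z * \<bar>f (x + z) - f (x + y)\<bar> powr p) \<partial>lborel) = (\<integral>\<^sup>+z. ennreal (indicator (ball 0 r) (z + y) * \<bar>f (x + (z + y)) - f (x + y)\<bar> powr p) \<partial>lborel)"
        by (rule nn_integral_translate[symmetric]) measurable
      also have "\<dots> \<le> (\<integral>\<^sup>+z. ennreal ((2 * r) powr (n + \<theta> * p)) * ennreal (norm z powr - (n + \<theta> * p) * \<bar>f ((y + x) + z) - f (y + x)\<bar> powr p) \<partial>lborel)"
      proof (rule nn_integral_mono)
        fix z :: "real^'n"
        have comm: "x + (z + y) = (y + x) + z" "x + y = y + x" by (auto simp: algebra_simps)
        show "ennreal (indicator (ball 0 r) (z + y) * \<bar>f (x + (z + y)) - f (x + y)\<bar> powr p) \<le> ennreal ((2 * r) powr (n + \<theta> * p)) * ennreal (norm z powr - (n + \<theta> * p) * \<bar>f ((y + x) + z) - f (y + x)\<bar> powr p)"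
        proof (cases "norm (z + y) < r \<and> z \<noteq> 0")
          case zr: True
          have "norm z \<le> 2 * r" using zr True r norm_triangle_ineq4[of "z + y" y] by simp
          moreover have "n + \<theta> * p \<ge> 0" using n \<theta> p by (intro add_nonneg_nonneg) auto
          ultimately have "norm z powr (n + \<theta> * p) \<le> (2 * r) powr (n + \<theta> * p)" by (intro powr_mono2) auto
          hence "1 \<le> (2 * r) powr (n + \<theta> * p) * norm z powr - (n + \<theta> * p)"
            using zr powr_gt_zero[of "norm z" "n + \<theta> * p"] by (simp add: powr_minus_divide pos_le_divide_eq del: minus_add_distrib)
          from mult_right_mono[OF this, of "\<bar>f (x + (z + y)) - f (x + y)\<bar> powr p"]
          show ?thesis using zr by (simp add: ennreal_mult'[symmetric] ennreal_leI mult.assoc comm)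
        qed (auto simp: comm)
      qed
      finally show ?thesis using True by simp
    qed simp
  qed
  finally have chain: "ennreal V * ennreal (V' * d powr p) \<le> (\<integral>\<^sup>+y. (\<integral>\<^sup>+z. ennreal ((2 * r) powr (n + \<theta> * p)) * ennreal (norm z powr - (n + \<theta> * p) * \<bar>f ((y + x) + z) - f (y + x)\<bar> powr p) \<partial>lborel) \<partial>lborel)" .
  have "(\<integral>\<^sup>+y. (\<integral>\<^sup>+z. ennreal ((2 * r) powr (n + \<theta> * p)) * ennreal (norm z powr - (n + \<theta> * p) * \<bar>f ((y + x) + z) - f (y + x)\<bar> powr p) \<partial>lborel) \<partial>lborel)
    = (\<integral>\<^sup>+u. \<integral>\<^sup>+z. ennreal ((2 * r) powr (n + \<theta> * p)) * ennreal (norm z powr - (n + \<theta> * p) * \<bar>f (u + z) - f u\<bar> powr p) \<partial>lborel \<partial>lborel)"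
    by (rule nn_integral_translate[where f = "\<lambda>u. \<integral>\<^sup>+z. ennreal ((2 * r) powr (n + \<theta> * p)) * ennreal (norm z powr - (n + \<theta> * p) * \<bar>f (u + z) - f u\<bar> powr p) \<partial>lborel"]) measurable
  also have "\<dots> = ennreal ((2 * r) powr (n + \<theta> * p)) * Slo \<theta> p f"
    unfolding Slo_Tonelli[OF Cc_borel[OF f]] n_def by (simp add: nn_integral_cmult)
  also have "\<dots> \<le> ennreal ((2 * r) powr (n + \<theta> * p)) * ennreal (G powr p)" by (intro mult_left_mono S) auto
  finally have "ennreal (V * (V' * d powr p)) \<le> ennreal ((2 * r) powr (n + \<theta> * p) * G powr p)"
    using V chain by (simp add: ennreal_mult')
  hence "V * (V' * d powr p) \<le> (2 * r) powr (n + \<theta> * p) * G powr p" by (subst (asm) ennreal_le_iff) auto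
  hence le: "d powr p \<le> (2 * r) powr (n + \<theta> * p) * G powr p / (V * V')" using V by (simp add: field_simps)
  define A where "A = w powr (- 2) * 2 powr (2 * n + \<theta> * p)"
  have A: "A > 0" using w by (simp add: A_def)
  have "(2 * r) powr (n + \<theta> * p) / (V * V') = A * r powr (\<theta> * p - n)"
  proof -
    have 1: "V * V' = w * w * (r powr n * r powr n) / 2 powr n" by (simp add: V_def V'_def bvol_def w_def n_def powr_divide)
    have 2: "w powr (- 2) = 1 / (w * w)" using w by (simp add: powr_minus_divide power2_eq_square)
    have 3: "2 powr (2 * n + \<theta> * p) = 2 powr n * (2::real) powr (n + \<theta> * p)" by (simp add: powr_add[symmetric])
    have 4: "(2 * r) powr (n + \<theta> * p) = 2 powr (n + \<theta> * p) * (r powr (\<theta> * p - n) * (r powr n * r powr n))"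
      using r by (simp add: powr_add[symmetric] powr_mult)
    have "Y * (Z * (R * R)) / (w * w * (R * R) / X) = 1 / (w * w) * (X * Y) * Z" if "R > 0" "X > 0" for X Y Z R :: real
      using w that by (simp add: field_simps)
    thus ?thesis unfolding A_def 1 2 3 4 using r by simp
  qed
  hence "(2 * r) powr (n + \<theta> * p) * G powr p / (V * V') = A * r powr (\<theta> * p - n) * G powr p" by (metis times_divide_eq_left)
  hence "d powr p \<le> A * r powr (\<theta> * p - n) * G powr p" using le by linarith
  also have "\<dots> = (A powr (1 / p) * r powr (\<theta> - n / p) * G) powr p"
  proof -
    have "(\<theta> - n / p) * p = \<theta> * p - n" using p by (simp add: field_simps)
    thus ?thesis using A p by (simp add: powr_mult powr_powr)
  qed
  finally have "d \<le> A powr (1 / p) * r powr (\<theta> - n / p) * G"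
    by - (rule powr_le_cancel_base[of _ _ p], use p G in \<open>auto simp: d_def\<close>)
  thus ?thesis by (simp add: d_def A_def w_def n_def)
qed

text \<open>Since \<open>\<theta> > n / p\<close>, the differences of consecutive averages over balls of radius \<open>2\<^sup>-\<^sup>j\<close> form a
  geometric series. The averages converge to \<open>f x\<close>, and the first one is bounded by Jensen's
  inequality.\<close>

lemma fractional_sup_embedding:
  assumes p: "1 \<le> p" and \<theta>: "0 < \<theta>" and sup: "1 / p < \<theta> / real CARD('n::finite)"
  shows "\<exists>C>0. \<forall>f::real^'n \<Rightarrow> real. \<forall>G\<ge>0. f \<in> Cc_infty \<longrightarrow> Lpow p f \<le> ennreal (G powr p) \<longrightarrow>
     Slo \<theta> p f \<le> ennreal (G powr p) \<longrightarrow> Lbound 0 (C * G) f"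
proof -
  define n where "n = real CARD('n)"
  have n: "n > 0" by (simp add: n_def)
  define \<kappa> where "\<kappa> = \<theta> - n / p"
  have \<kappa>: "\<kappa> > 0" using sup n p by (simp add: \<kappa>_def n_def field_simps)
  define c where "c = (unit_ball_vol (real CARD('n)) powr (- 2) * 2 powr (2 * real CARD('n) + \<theta> * p)) powr (1 / p)"
  have c0: "c \<ge> 0" by (simp add: c_def)
  define \<rho> where "\<rho> = 2 powr (- \<kappa>)"
  have \<rho>: "0 < \<rho>" "\<rho> < 1" using \<kappa> powr_less_mono[of "- \<kappa>" 0 2] by (auto simp: \<rho>_def)
  define V1 where "V1 = bvol TYPE('n) 1"
  have V1: "V1 > 0" by (simp add: V1_def bvol_pos)
  define C where "C = V1 powr (- 1 / p) + c / (1 - \<rho>) + 1"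
  show ?thesis
  proof (intro exI[of _ C] conjI allI impI)
    show "C > 0" using c0 \<rho> by (simp add: C_def add_nonneg_pos)
    fix f :: "real^'n \<Rightarrow> real" and G :: real
    assume G: "G \<ge> 0" and f: "f \<in> Cc_infty" and 0: "Lpow p f \<le> ennreal (G powr p)" and S: "Slo \<theta> p f \<le> ennreal (G powr p)"
    obtain L where L: "L > 0" "\<And>x v. \<bar>f (x + v) - f x\<bar> \<le> L * norm v" using Cc_Lipschitz[OF f] by blast
    have "\<bar>f x\<bar> \<le> C * G" for x
    proof (rule field_le_epsilon)
      fix e :: real assume e: "e > 0"
      have tel: "\<bar>bavg f x ((1/2) ^ N) - bavg f x 1\<bar> \<le> c * G * (\<Sum>j<N. \<rho> ^ j)" for N
      proof (induction N)
        case (Suc N)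
        have r: "(1 / 2 :: real) ^ N > 0" by simp
        have "((1 / 2 :: real) ^ N) powr \<kappa> = \<rho> ^ N"
        proof -
          have "(1 / 2 :: real) ^ N = 2 powr (- real N)" by (simp add: powr_minus powr_realpow power_one_over inverse_eq_divide)
          thus ?thesis by (simp add: \<rho>_def powr_powr powr_realpow[symmetric] mult.commute)
        qed
        hence "\<bar>bavg f x ((1/2) ^ N / 2) - bavg f x ((1/2) ^ N)\<bar> \<le> c * \<rho> ^ N * G"
          using bavg_step[OF f r p \<theta> G S, of x] by (simp add: c_def \<kappa>_def n_def)
        moreover have sN: "c * G * (\<Sum>j<Suc N. \<rho> ^ j) = c * G * (\<Sum>j<N. \<rho> ^ j) + c * \<rho> ^ N * G" by (simp add: algebra_simps)
        moreover have hN: "(1/2 :: real) ^ Suc N = (1/2) ^ N / 2" by simp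
        ultimately show ?case unfolding sN hN using Suc.IH by linarith
      qed simp
      have geo: "(\<Sum>j<N. \<rho> ^ j) \<le> 1 / (1 - \<rho>)" for N
        using \<rho> by (simp add: sum_gp_strict divide_right_mono)
      have close: "\<bar>bavg f x r - f x\<bar> \<le> L * r" if r: "r > 0" for r
      proof -
        have Vr: "bvol TYPE('n) r > 0" by (rule bvol_pos[OF r])
        have "bvol TYPE('n) r * \<bar>bavg f x r - f x\<bar> = \<bar>\<integral>z. indicator (ball 0 r) z * (f (x + z) - f x) \<partial>lborel\<bar>"
          using bavg_diff[OF f r, of x "f x"] Vr by (metis abs_mult abs_of_pos)
        also have "\<dots> \<le> (\<integral>z. \<bar>indicator (ball 0 r) z * (f (x + z) - f x)\<bar> \<partial>lborel)" by (rule integral_abs_bound)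
        also have "\<dots> \<le> (\<integral>z. indicator (ball (0::real^'n) r) z * (L * r) \<partial>lborel)"
        proof (rule integral_mono)
          obtain B where B: "\<And>x. \<bar>f x\<bar> \<le> B" using Cc_bounded[OF f] by blast
          note [measurable] = Cc_borel[OF f]
          have "integrable lborel (\<lambda>z. indicator (ball 0 r) z * (f (x + z) - f x))"
          proof (rule ball_indicator_integrable[where B = "B + B"])
            show "\<bar>f (x + z) - f x\<bar> \<le> B + B" for z using B[of "x + z"] B[of x] by linarith
          qed measurable
          thus "integrable lborel (\<lambda>z. \<bar>indicator (ball 0 r) z * (f (x + z) - f x)\<bar>)" by simp
          show "integrable lborel (\<lambda>z. indicator (ball (0::real^'n) r) z * (L * r))"
            by (rule ball_indicator_integrable[where B = "\<bar>L * r\<bar>"]) auto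
          show "\<bar>indicator (ball 0 r) z * (f (x + z) - f x)\<bar> \<le> indicator (ball (0::real^'n) r) z * (L * r)" for z
          proof (cases "norm z < r")
            case True
            have "\<bar>f (x + z) - f x\<bar> \<le> L * norm z" by (rule L)
            also have "\<dots> \<le> L * r" using True L(1) by (intro mult_left_mono) auto
            finally show ?thesis using True by simp
          qed simp
        qed
        also have "\<dots> = bvol TYPE('n) r * (L * r)" using r by (simp add: measure_ball_bvol)
        finally show ?thesis by (rule mult_left_le_imp_le) (rule Vr)
      qed
      obtain N where N: "(1 / 2 :: real) ^ N < e / L" using real_arch_pow_inv[of "e / L" "1/2"] e L by auto
      have "L * (1 / 2) ^ N \<le> e" using N L by (simp add: field_simps)
      hence 1: "\<bar>bavg f x ((1/2) ^ N) - f x\<bar> \<le> e" using close[of "(1/2)^N"] by simp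
      have "c * G * (\<Sum>j<N. \<rho> ^ j) \<le> c * G * (1 / (1 - \<rho>))" by (intro mult_left_mono geo) (use c0 G in auto)
      hence 2: "\<bar>bavg f x ((1/2) ^ N) - bavg f x 1\<bar> \<le> c / (1 - \<rho>) * G" using tel[of N] by (simp add: mult.commute)
      have "\<bar>\<integral>z. indicator (ball 0 1) z * f (x + z) \<partial>lborel\<bar> \<le> V1 powr (1 - 1 / p) * G"
        using ball_average_Lq[OF Cc_borel[OF f] p, of 1 G x] 0 G by (simp add: V1_def)
      hence "\<bar>bavg f x 1\<bar> \<le> V1 powr (1 - 1 / p) * G / V1"
        using V1 by (simp add: bavg_def V1_def[symmetric] abs_divide divide_right_mono)
      also have "\<dots> = V1 powr (- 1 / p) * G" using V1 by (simp add: powr_diff powr_minus field_simps)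
      finally have 3: "\<bar>bavg f x 1\<bar> \<le> V1 powr (- 1 / p) * G" .
      have "C * G = V1 powr (- 1 / p) * G + c / (1 - \<rho>) * G + G" by (simp add: C_def distrib_right)
      thus "\<bar>f x\<bar> \<le> C * G + e" using 1 2 3 G by linarith
    qed
    thus "Lbound 0 (C * G) f" by (simp add: Lbound_def)
  qed
qed

section \<open>Critical first order embedding\<close>

lemma DERIV_max_power2:
  "((\<lambda>x::real. (max 0 x)\<^sup>2) has_real_derivative 2 * max 0 x) (at x)"
proof -
  consider "x > 0" | "x < 0" | "x = 0" by linarith
  thus ?thesis
  proof cases
    case 1
    have "((\<lambda>x. x\<^sup>2) has_real_derivative 2 * x) (at x)" by (auto intro!: derivative_eq_intros)
    thus ?thesis using has_field_derivative_transform_within_open[of "\<lambda>x. x\<^sup>2" "2 * x" x "{0<..}" "\<lambda>x. (max 0 x)\<^sup>2"] 1 by simp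
  next
    case 2
    have "((\<lambda>x. 0) has_real_derivative 0) (at x)" by simp
    thus ?thesis using has_field_derivative_transform_within_open[of "\<lambda>x. 0" 0 x "{..<0}" "\<lambda>x. (max 0 x)\<^sup>2"] 2 by simp
  next
    case 3
    have "((\<lambda>h::real. ((max 0 (0 + h))\<^sup>2 - (max 0 0)\<^sup>2) / h) \<longlongrightarrow> 0) (at 0)"
    proof (rule Lim_null_comparison[where g = "\<lambda>h. \<bar>h\<bar>"])
      show "\<forall>\<^sub>F h in at 0. norm (((max 0 (0 + h))\<^sup>2 - (max 0 0)\<^sup>2) / h) \<le> \<bar>h\<bar>"
        by (intro always_eventually allI) (auto simp: max_def power2_eq_square)
      show "((\<lambda>h::real. \<bar>h\<bar>) \<longlongrightarrow> 0) (at 0)" by (rule tendsto_rabs_zero) (rule tendsto_ident_at)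
    qed
    thus ?thesis using 3 by (simp add: DERIV_def)
  qed
qed

text \<open>A continuously differentiable plateau function: combining squares of positive parts with knots at
  \<open>1\<close>, \<open>3/2\<close> and \<open>2\<close> gives a function whose derivative is a tent on \<open>[1, 2]\<close>; \<open>T\<close> is its even extension.\<close>

lemma smooth_truncation:
  obtains T T' :: "real \<Rightarrow> real" where "\<And>s. (T has_real_derivative T' s) (at s)" "continuous_on UNIV T'" "\<And>s. \<bar>T' s\<bar> \<le> 1"
    "\<And>s. T' s \<noteq> 0 \<Longrightarrow> 1 \<le> \<bar>s\<bar> \<and> \<bar>s\<bar> < 2" "\<And>s. \<bar>s\<bar> \<ge> 2 \<Longrightarrow> T s = 1 / 2" "\<And>s. \<bar>T s\<bar> \<le> \<bar>s\<bar>"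
proof -
  define u :: "real \<Rightarrow> real" where "u s = (max 0 (s - 1))\<^sup>2 - 2 * (max 0 (s - 3/2))\<^sup>2 + (max 0 (s - 2))\<^sup>2" for s
  define u' :: "real \<Rightarrow> real" where "u' s = 2 * max 0 (s - 1) - 4 * max 0 (s - 3/2) + 2 * max 0 (s - 2)" for s
  have du: "(u has_real_derivative u' s) (at s)" for s
  proof -
    have sh: "((\<lambda>s. (max 0 (s - a))\<^sup>2) has_real_derivative 2 * max 0 (s - a)) (at s)" for a :: real
      
    proof -
      have "((\<lambda>s. s - a) has_real_derivative 1) (at s)" by (auto intro!: derivative_eq_intros)
      from DERIV_chain2[where f = "\<lambda>x. (max 0 x)\<^sup>2" and g = "\<lambda>s. s - a" and x = s, OF DERIV_max_power2 this]
      show ?thesis by simp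
    qed
    show ?thesis unfolding u_def u'_def
      by (rule DERIV_cong[OF DERIV_add[OF DERIV_diff[OF sh DERIV_cmult[OF sh]] sh]]) simp
  qed
  have u'1: "\<bar>u' s\<bar> \<le> 1" "u' s \<noteq> 0 \<Longrightarrow> 1 \<le> s \<and> s < 2" for s by (auto simp: u'_def max_def split: if_splits)
  have u2: "u s = 1 / 2" if "s \<ge> 2" for s using that by (simp add: u_def max_def power2_eq_square algebra_simps)
  have u0: "u s = 0" if "s \<le> 1" for s using that by (simp add: u_def max_def)
  define T where "T s = u s + u (- s)" for s
  define T' where "T' s = u' s - u' (- s)" for s
  have dT: "(T has_real_derivative T' s) (at s)" for s
  proof -
    have "((\<lambda>s. u (- s)) has_real_derivative u' (- s) * (- 1)) (at s)"
      by (rule DERIV_chain2[OF du]) (auto intro!: derivative_eq_intros)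
    from DERIV_add[OF du this] show ?thesis unfolding T_def T'_def by simp
  qed
  have cT: "continuous_on UNIV T'" unfolding T'_def u'_def by (intro continuous_intros)
  have T'1: "\<bar>T' s\<bar> \<le> 1" for s
  proof (cases "s \<ge> 0")
    case True
    hence "u' (- s) = 0" using u'1(2)[of "- s"] by (cases "u' (- s) = 0") auto
    thus ?thesis using u'1(1)[of s] by (simp add: T'_def)
  next
    case False
    hence "u' s = 0" using u'1(2)[of s] by (cases "u' s = 0") auto
    thus ?thesis using u'1(1)[of "- s"] by (simp add: T'_def)
  qed
  have T'0: "1 \<le> \<bar>s\<bar> \<and> \<bar>s\<bar> < 2" if "T' s \<noteq> 0" for s
  proof -
    have "u' s \<noteq> 0 \<or> u' (- s) \<noteq> 0" using that by (auto simp: T'_def)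
    thus ?thesis using u'1(2)[of s] u'1(2)[of "- s"] by auto
  qed
  have T2: "T s = 1 / 2" if "\<bar>s\<bar> \<ge> 2" for s
    using that u2[of s] u2[of "- s"] u0[of s] u0[of "- s"] by (cases "s \<ge> 0") (auto simp: T_def)
  have Ts: "\<bar>T s\<bar> \<le> \<bar>s\<bar>" for s
  proof -
    have "\<bar>T s - T 0\<bar> \<le> 1 * \<bar>s - 0\<bar>"
      using field_differentiable_bound[of UNIV T T' 1 s 0] dT T'1 by (auto intro: has_field_derivative_at_within)
    moreover have "T 0 = 0" by (simp add: T_def u0)
    ultimately show ?thesis by simp
  qed
  show thesis by (rule that[of T T']) (use dT cT T'1 T'0 T2 Ts in blast)+
qed

text \<open>The weak type estimate is applied to the truncation \<open>v = l T (f / l)\<close>, whose gradient lives on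
  \<open>l \<le> |f| < 2 l\<close>. Where \<open>|f| \<ge> 2 l\<close> one has \<open>v = l / 2\<close>. The radius \<open>r\<close> is chosen such that averages of \<open>v\<close>
  over balls of radius \<open>r\<close> are at most \<open>l / 4\<close>; so at such points \<open>v\<close> deviates from its average by at
  least \<open>l / 4\<close>, whereas the \<open>L\<^sup>p\<close> norm of this deviation is at most \<open>r\<close> times that of the gradient.\<close>

lemma truncation_level_estimate:
  fixes f :: "real ^ 'n::finite \<Rightarrow> real"
  assumes f: "f \<in> Cc_infty" and p: "1 \<le> p" and a: "a = 1 / p - 1 / real CARD('n)" "a > 0"
    and M: "M > 0" "Lpow (1 / a) f \<le> ennreal (M powr (1 / a))" and l: "l > 0"
  shows "ennreal (l powr (1 / a)) * emeasure lborel {x. 2 * l \<le> \<bar>f x\<bar>} \<le>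
     ennreal (4 powr (1 / a) * unit_ball_vol (real CARD('n)) powr (- p / real CARD('n)) * M powr (1 / a - p)) *
      (\<integral>\<^sup>+x. ennreal (indicator {x. l \<le> \<bar>f x\<bar> \<and> \<bar>f x\<bar> < 2 * l} x * grad1 f x powr p) \<partial>lborel)"
proof -
  note fm[measurable] = Cc_borel[OF f]
  note gc = grad1_continuous[OF f]
  have gm[measurable]: "grad1 f \<in> borel_measurable borel" using gc by (rule borel_measurable_continuous_onI)
  have [measurable]: "ball (0::real^'n) s \<in> sets borel" for s by simp
  define n where "n = real CARD('n)"
  have n: "n > 0" by (simp add: n_def)
  define w where "w = unit_ball_vol n"
  have w: "w > 0" using n by (simp add: w_def)
  define q where "q = 1 / a"
  have "a \<le> 1 / p" using a n by simp
  hence pq: "p \<le> q" using a(2) p by (simp add: q_def field_simps)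
  have q1: "1 \<le> q" using pq p by simp
  have qn: "q * (p / n) = q - p" using a p n by (simp add: q_def n_def field_simps)
  obtain T T' :: "real \<Rightarrow> real" where T: "\<And>s. (T has_real_derivative T' s) (at s)" "continuous_on UNIV T'" "\<And>s. \<bar>T' s\<bar> \<le> 1"
    "\<And>s. T' s \<noteq> 0 \<Longrightarrow> 1 \<le> \<bar>s\<bar> \<and> \<bar>s\<bar> < 2" "\<And>s. \<bar>s\<bar> \<ge> 2 \<Longrightarrow> T s = 1 / 2" "\<And>s. \<bar>T s\<bar> \<le> \<bar>s\<bar>"
    using smooth_truncation by blast
  define v where "v x = l * T (f x / l)" for x
  define \<Gamma> where "\<Gamma> x = \<bar>T' (f x / l)\<bar> * grad1 f x" for x
  have Tc: "continuous_on UNIV T" using T(1) by (intro DERIV_continuous_on) (auto intro: has_field_derivative_at_within)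
  have vc: "continuous_on UNIV v" unfolding v_def
    by (intro continuous_intros continuous_on_compose2[OF Tc] smooth_continuous[OF Cc_smooth[OF f]]) (use l in auto)
  have vm[measurable]: "v \<in> borel_measurable borel" using vc by (rule borel_measurable_continuous_onI)
  have \<Gamma>c: "continuous_on UNIV \<Gamma>" unfolding \<Gamma>_def
    by (intro continuous_intros continuous_on_compose2[OF T(2)] smooth_continuous[OF Cc_smooth[OF f]] gc) (use l in auto)
  have vf: "\<bar>v x\<bar> \<le> \<bar>f x\<bar>" for x
  proof -
    have "l * \<bar>T (f x / l)\<bar> \<le> l * \<bar>f x / l\<bar>" using T(6)[of "f x / l"] l by (intro mult_left_mono) auto
    thus ?thesis using l by (simp add: v_def abs_mult abs_divide)
  qed
  have vM: "Lpow q v \<le> ennreal (M powr q)"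
    using order_trans[OF Lpow_mono[of v f q, OF vf] M(2)[folded q_def]] q1 by simp
  have grad: "Lpow p (\<lambda>x. v (x + z) - v x) \<le> ennreal (norm z powr p) * Lpow p \<Gamma>" for z
  proof (rule Lpow_difference_le_gradient[where D = "\<lambda>x z t. T' (f (x + t *\<^sub>R z) / l) * (\<Sum>i\<in>UNIV. z $ i * partial_deriv i f (x + t *\<^sub>R z))"])
    fix x z t
    have "((\<lambda>t. f (x + t *\<^sub>R z) / l) has_real_derivative (\<Sum>i\<in>UNIV. z $ i * partial_deriv i f (x + t *\<^sub>R z)) / l) (at t)"
      by (rule DERIV_cdivide) (rule has_real_derivative_line[OF Cc_differentiable[OF f]])
    from DERIV_cmult[OF DERIV_chain2[OF T(1) this], of l]
    show "((\<lambda>t. v (x + t *\<^sub>R z)) has_real_derivative T' (f (x + t *\<^sub>R z) / l) * (\<Sum>i\<in>UNIV. z $ i * partial_deriv i f (x + t *\<^sub>R z))) (at t)"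
      using l by (simp add: v_def)
    show "\<bar>T' (f (x + t *\<^sub>R z) / l) * (\<Sum>i\<in>UNIV. z $ i * partial_deriv i f (x + t *\<^sub>R z))\<bar> \<le> \<Gamma> (x + t *\<^sub>R z) * norm z"
      unfolding \<Gamma>_def abs_mult mult.assoc by (rule mult_left_mono[OF directional_le_grad1]) simp
  next
    show "\<Gamma> x \<ge> 0" for x by (simp add: \<Gamma>_def grad1_nonneg)
  qed (use \<Gamma>c p in auto)
  \<comment> \<open>the volume for which averages of \<open>v\<close> over balls are at most \<open>l / 4\<close>, see \<open>Va\<close> below\<close>
  define V where "V = (4 * M / l) powr q"
  have V: "V > 0" using M l by (simp add: V_def)
  define r where "r = (V / w) powr (1 / n)"
  have r: "r > 0" using V w by (simp add: r_def)
  have "r powr n = V / w" using V w n by (simp add: r_def powr_powr)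
  hence bv: "bvol TYPE('n) r = V" using w by (simp add: bvol_def w_def[symmetric] n_def[symmetric])
  define F where "F = {x. 2 * l \<le> \<bar>f x\<bar>}"
  have Fm[measurable]: "F \<in> sets borel" unfolding F_def by measurable
  have Va: "V powr (1 - a) * M = V * (l / 4)"
  proof -
    have "V powr (- a) = (4 * M / l) powr (- 1)" unfolding V_def powr_powr using a(2) by (simp add: q_def)
    also have "\<dots> = l / (4 * M)" using M l by (simp add: powr_minus_divide)
    finally have "V powr (1 - a) = V * (l / (4 * M))" using V powr_add[of V 1 "- a"] by simp
    thus ?thesis using M by simp
  qed
  have "bounded (range f)" using Cc_bounded[OF f] by (metis boundedI imageE real_norm_def)
  then obtain B where B: "\<And>x. \<bar>f x\<bar> \<le> B" by (auto simp: bounded_iff)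
  have vB: "\<bar>v x\<bar> \<le> B" for x using vf[of x] B[of x] by linarith
  have pw: "ennreal ((l / 4) powr p * V powr p) * indicator F x \<le> ennreal (V powr (p - 1)) * (\<integral>\<^sup>+z. ennreal (indicator (ball 0 r) z * \<bar>v (x + z) - v x\<bar> powr p) \<partial>lborel)" for x
  proof (cases "x \<in> F")
    case True
    hence "v x = l / 2" using T(5)[of "f x / l"] l by (simp add: v_def F_def abs_divide pos_le_divide_eq)
    let ?I = "\<integral>z. indicator (ball 0 r) z * (v (x + z) - v x) \<partial>lborel"
    have qa: "1 - 1 / q = 1 - a" by (simp add: q_def)
    have "\<bar>\<integral>z. indicator (ball 0 r) z * v (x + z) \<partial>lborel\<bar> \<le> V * (l / 4)"
      using ball_average_Lq[OF vm q1 r vM less_imp_le[OF M(1)], of x] unfolding bv qa Va .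
    hence "(l / 2) * V \<le> \<bar>?I\<bar> + V * (l / 4)"
      using value_le_averages[OF vm vB r, of x] l by (simp add: bv \<open>v x = l / 2\<close>)
    hence "(l / 4) * V \<le> \<bar>?I\<bar>" by (simp add: algebra_simps)
    hence "((l / 4) * V) powr p \<le> \<bar>?I\<bar> powr p" using l V p by (intro powr_mono2) auto
    hence "ennreal ((l / 4) powr p * V powr p) \<le> ennreal (\<bar>?I\<bar> powr p)" unfolding powr_mult by (rule ennreal_leI)
    also have "\<dots> \<le> ennreal (V powr (p - 1)) * (\<integral>\<^sup>+z. ennreal (indicator (ball 0 r) z * \<bar>v (x + z) - v x\<bar> powr p) \<partial>lborel)"
      unfolding bv[symmetric] by (rule ball_average_Jensen[OF _ p r]) measurable
    finally show ?thesis using True by simp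
  qed simp
  have "ennreal ((l / 4) powr p * V powr p) * emeasure lborel F = (\<integral>\<^sup>+x. ennreal ((l / 4) powr p * V powr p) * indicator F x \<partial>lborel)"
    by (rule nn_integral_cmult_indicator[symmetric]) simp
  also have "\<dots> \<le> (\<integral>\<^sup>+x. ennreal (V powr (p - 1)) * (\<integral>\<^sup>+z. ennreal (indicator (ball 0 r) z * \<bar>v (x + z) - v x\<bar> powr p) \<partial>lborel) \<partial>lborel)"
    by (intro nn_integral_mono pw)
  also have "\<dots> = ennreal (V powr (p - 1)) * (\<integral>\<^sup>+x. \<integral>\<^sup>+z. ennreal (indicator (ball 0 r) z * \<bar>v (x + z) - v x\<bar> powr p) \<partial>lborel \<partial>lborel)"
    by (rule nn_integral_cmult) measurable
  also have "(\<integral>\<^sup>+x. \<integral>\<^sup>+z. ennreal (indicator (ball 0 r) z * \<bar>v (x + z) - v x\<bar> powr p) \<partial>lborel \<partial>lborel)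
     = (\<integral>\<^sup>+z. \<integral>\<^sup>+x. ennreal (indicator (ball 0 r) z * \<bar>v (x + z) - v x\<bar> powr p) \<partial>lborel \<partial>lborel)"
    by (rule nn_integral_Tonelli) measurable
  also have "\<dots> \<le> (\<integral>\<^sup>+z. ennreal (r powr p) * Lpow p \<Gamma> * indicator (ball (0::real^'n) r) z \<partial>lborel)"
  proof (rule nn_integral_mono)
    fix z :: "real^'n"
    show "(\<integral>\<^sup>+x. ennreal (indicator (ball 0 r) z * \<bar>v (x + z) - v x\<bar> powr p) \<partial>lborel) \<le> ennreal (r powr p) * Lpow p \<Gamma> * indicator (ball (0::real^'n) r) z"
    proof (cases "norm z < r")
      case True
      have "(\<integral>\<^sup>+x. ennreal (indicator (ball 0 r) z * \<bar>v (x + z) - v x\<bar> powr p) \<partial>lborel) = Lpow p (\<lambda>x. v (x + z) - v x)"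
        using True by (simp add: Lpow_def)
      also have "\<dots> \<le> ennreal (norm z powr p) * Lpow p \<Gamma>" by (rule grad)
      also have "\<dots> \<le> ennreal (r powr p) * Lpow p \<Gamma>"
        using True p by (intro mult_right_mono ennreal_leI powr_mono2) auto
      finally show ?thesis using True by simp
    qed simp
  qed
  also have "\<dots> = ennreal (r powr p) * Lpow p \<Gamma> * ennreal V"
    using r by (subst nn_integral_cmult_indicator) (auto simp: emeasure_ball_bvol bv)
  finally have "ennreal ((l / 4) powr p * V powr p) * emeasure lborel F \<le> ennreal (V powr (p - 1)) * (ennreal (r powr p) * Lpow p \<Gamma> * ennreal V)"
    by (simp add: mult_left_mono)
  also have "\<dots> = ennreal (V powr p * r powr p) * Lpow p \<Gamma>"
  proof -
    have e: "V powr p * r powr p = V powr (p - 1) * (r powr p * V)" using V by (simp add: powr_diff)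
    show ?thesis unfolding e using V by (simp add: ennreal_mult' mult_ac)
  qed
  finally have "emeasure lborel F \<le> ennreal ((V powr p * r powr p) / ((l / 4) powr p * V powr p)) * Lpow p \<Gamma>"
    by (rule ennreal_cancel) (use V l in auto)
  hence "ennreal (l powr q) * emeasure lborel F \<le> ennreal (l powr q) * (ennreal ((V powr p * r powr p) / ((l / 4) powr p * V powr p)) * Lpow p \<Gamma>)"
    by (intro mult_left_mono) auto
  also have "\<dots> = ennreal (l powr q * ((V powr p * r powr p) / ((l / 4) powr p * V powr p))) * Lpow p \<Gamma>"
    by (simp add: ennreal_mult' mult.assoc)
  also have "l powr q * ((V powr p * r powr p) / ((l / 4) powr p * V powr p)) = 4 powr q * w powr (- p / n) * M powr (q - p)"
  proof -
    have "r powr p = (V / w) powr (p / n)" by (simp add: r_def powr_powr)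
    also have "\<dots> = V powr (p / n) * w powr (- p / n)" by (simp add: powr_divide powr_minus_divide)
    also have "V powr (p / n) = (4 * M / l) powr (q - p)" unfolding V_def powr_powr qn ..
    also have "\<dots> = 4 powr (q - p) * M powr (q - p) / l powr (q - p)" by (simp add: powr_mult powr_divide)
    finally have rp: "r powr p = 4 powr (q - p) * M powr (q - p) / l powr (q - p) * w powr (- p / n)" .
    have "(l / 4) powr p = l powr p / 4 powr p" by (simp add: powr_divide)
    moreover have "4 powr q = 4 powr (q - p) * (4::real) powr p" "l powr q = l powr (q - p) * l powr p" by (simp_all add: powr_add[symmetric])
    ultimately show ?thesis unfolding rp using V l by simp
  qed
  also have "Lpow p \<Gamma> \<le> (\<integral>\<^sup>+x. ennreal (indicator {x. l \<le> \<bar>f x\<bar> \<and> \<bar>f x\<bar> < 2 * l} x * grad1 f x powr p) \<partial>lborel)"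
    unfolding Lpow_def
  proof (intro nn_integral_mono ennreal_leI)
    fix x
    show "\<bar>\<Gamma> x\<bar> powr p \<le> indicator {x. l \<le> \<bar>f x\<bar> \<and> \<bar>f x\<bar> < 2 * l} x * grad1 f x powr p"
    proof (cases "T' (f x / l) = 0")
      case False
      have "1 \<le> \<bar>f x\<bar> / l" "\<bar>f x\<bar> / l < 2" using T(4)[OF False] l by (auto simp: abs_divide)
      hence "l \<le> \<bar>f x\<bar>" "\<bar>f x\<bar> < 2 * l" using l by (auto simp: field_simps)
      moreover have "\<bar>\<Gamma> x\<bar> \<le> 1 * grad1 f x"
        unfolding \<Gamma>_def abs_mult abs_abs abs_of_nonneg[OF grad1_nonneg] by (rule mult_right_mono[OF T(3) grad1_nonneg])
      hence "\<bar>\<Gamma> x\<bar> powr p \<le> grad1 f x powr p" using p by (intro powr_mono2) auto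
      ultimately show ?thesis by simp
    qed (simp add: \<Gamma>_def)
  qed
  finally show ?thesis unfolding F_def q_def w_def n_def by (simp add: mult_left_mono)
qed

text \<open>Sum the estimate over the dyadic levels \<open>l = 2\<^sup>j\<close> for all integers \<open>j\<close>. On the left the sum
  dominates \<open>|f|\<^sup>q\<close>; on the right the level sets are disjoint, so the gradient is counted once.\<close>

lemma critical_first_order_embedding:
  assumes p: "1 \<le> p" and a: "a = 1 / p - 1 / real CARD('n::finite)" "a > 0"
  shows "\<exists>C>0. \<forall>f::real^'n \<Rightarrow> real. \<forall>G\<ge>0. f \<in> Cc_infty \<longrightarrow>
     (\<forall>i. Lpow p (partial_deriv i f) \<le> ennreal (G powr p)) \<longrightarrow> Lbound a (C * G) f"
proof -
  define n where "n = real CARD('n)"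
  have n: "n > 0" by (simp add: n_def)
  define q where "q = 1 / a"
  have "a \<le> 1 / p" using a n by simp
  hence pq: "p \<le> q" using a(2) p by (simp add: q_def field_simps)
  define A where "A = 4 powr q * unit_ball_vol n powr (- p / n)"
  have "unit_ball_vol n > 0" using n by simp
  hence A: "A > 0" by (simp add: A_def)
  define E where "E = 4 powr q * A * (n powr p * n)"
  have E: "E > 0" using A n by (simp add: E_def)
  show ?thesis
  proof (intro exI[of _ "E powr (1 / p)"] conjI allI impI)
    show "E powr (1 / p) > 0" using E by simp
    fix f :: "real^'n \<Rightarrow> real" and G :: real
    assume G: "G \<ge> 0" and f: "f \<in> Cc_infty" and 1: "\<forall>i. Lpow p (partial_deriv i f) \<le> ennreal (G powr p)"
    note fm[measurable] = Cc_borel[OF f]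
    have gm[measurable]: "grad1 f \<in> borel_measurable borel" using grad1_continuous[OF f] by (rule borel_measurable_continuous_onI)
    have "Lpow q f \<le> ennreal ((E powr (1 / p) * G) powr q)"
    proof (rule self_improving_bound)
      show "Lpow q f < \<infinity>" by (rule Lpow_Cc_finite[OF f]) (use pq p in auto)
      fix M :: real assume M: "M > 0" "Lpow q f = ennreal (M powr q)"
      \<comment> \<open>all integers \<open>j\<close>, enumerated by natural numbers\<close>
      define l :: "nat \<Rightarrow> real" where "l k = 2 powr real_of_int (int_decode k)" for k
      have l: "l k > 0" for k by (simp add: l_def)
      define F where "F k = {x. 2 * l k \<le> \<bar>f x\<bar>}" for k
      define H where "H k = {x. l k \<le> \<bar>f x\<bar> \<and> \<bar>f x\<bar> < 2 * l k}" for k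
      have Fm[measurable]: "F k \<in> sets borel" "H k \<in> sets borel" for k unfolding F_def H_def by measurable
      have Hlog: "x \<in> H k \<Longrightarrow> int_decode k = \<lfloor>log 2 \<bar>f x\<bar>\<rfloor>" for x k
      proof -
        assume "x \<in> H k"
        hence h: "2 powr real_of_int (int_decode k) \<le> \<bar>f x\<bar>" "\<bar>f x\<bar> < 2 powr (real_of_int (int_decode k) + 1)" by (auto simp: H_def l_def powr_add)
        have pos: "\<bar>f x\<bar> > 0" using h(1) powr_gt_zero[of 2 "real_of_int (int_decode k)"] by linarith
        have "real_of_int (int_decode k) \<le> log 2 \<bar>f x\<bar>" using h(1) pos by (subst le_log_iff) auto
        moreover have "log 2 \<bar>f x\<bar> < real_of_int (int_decode k) + 1" using h(2) pos by (subst log_less_iff) auto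
        ultimately show "int_decode k = \<lfloor>log 2 \<bar>f x\<bar>\<rfloor>" by linarith
      qed
      have disj: "disjoint_family H"
        unfolding disjoint_family_on_def using Hlog by (auto simp: disjoint_iff) (metis int_decode_inverse)
      have "Lpow q f \<le> (\<integral>\<^sup>+x. (\<Sum>k. ennreal (4 powr q * l k powr q) * indicator (F k) x) \<partial>lborel)"
        unfolding Lpow_def
      proof (rule nn_integral_mono)
        fix x
        show "ennreal (\<bar>f x\<bar> powr q) \<le> (\<Sum>k. ennreal (4 powr q * l k powr q) * indicator (F k) x)"
        proof (cases "f x = 0")
          case False
          \<comment> \<open>the term of the level just below \<open>|f x|\<close> alone dominates\<close>
          define j where "j = \<lfloor>log 2 \<bar>f x\<bar>\<rfloor>"
          define k where "k = int_encode (j - 1)"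
          have lk: "l k = 2 powr (real_of_int j - 1)" by (simp add: l_def k_def)
          have eq: "\<bar>f x\<bar> = 2 powr log 2 \<bar>f x\<bar>" using False by simp
          have "2 * l k = 2 powr (real_of_int j)" unfolding lk by (simp add: powr_diff)
          also have "\<dots> \<le> 2 powr log 2 \<bar>f x\<bar>" by (intro powr_mono) (auto simp: j_def)
          finally have "x \<in> F k" using eq by (simp add: F_def)
          have "2 powr log 2 \<bar>f x\<bar> \<le> 2 powr (real_of_int j + 1)" by (intro powr_mono) (auto simp: j_def)
          also have "\<dots> = 4 * l k" unfolding lk by (simp add: powr_diff powr_add)
          finally have "\<bar>f x\<bar> powr q \<le> (4 * l k) powr q" using eq pq p by (intro powr_mono2) auto
          hence "ennreal (\<bar>f x\<bar> powr q) \<le> ennreal (4 powr q * l k powr q) * indicator (F k) x"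
            using \<open>x \<in> F k\<close> by (simp add: powr_mult ennreal_leI)
          also have "\<dots> \<le> (\<Sum>k. ennreal (4 powr q * l k powr q) * indicator (F k) x)" by (rule term_le_suminf)
          finally show ?thesis .
        qed simp
      qed
      also have "\<dots> = (\<Sum>k. ennreal (4 powr q * l k powr q) * emeasure lborel (F k))"
        by (subst nn_integral_suminf) (auto simp: nn_integral_cmult_indicator)
      also have "\<dots> \<le> (\<Sum>k. ennreal (4 powr q * A * M powr (q - p)) * (\<integral>\<^sup>+x. ennreal (indicator (H k) x * grad1 f x powr p) \<partial>lborel))"
      proof (intro suminf_le summableI)
        fix k
        have "ennreal (l k powr q) * emeasure lborel (F k) \<le> ennreal (A * M powr (q - p)) * (\<integral>\<^sup>+x. ennreal (indicator (H k) x * grad1 f x powr p) \<partial>lborel)"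
          using truncation_level_estimate[OF f p a M(1) _ l[of k]] M(2) by (simp add: q_def F_def H_def A_def n_def)
        from mult_left_mono[OF this, of "ennreal (4 powr q)"]
        show "ennreal (4 powr q * l k powr q) * emeasure lborel (F k) \<le> ennreal (4 powr q * A * M powr (q - p)) * (\<integral>\<^sup>+x. ennreal (indicator (H k) x * grad1 f x powr p) \<partial>lborel)"
          by (simp add: ennreal_mult' mult.assoc)
      qed
      also have "\<dots> = ennreal (4 powr q * A * M powr (q - p)) * (\<Sum>k. \<integral>\<^sup>+x. ennreal (indicator (H k) x * grad1 f x powr p) \<partial>lborel)"
        by simp
      also have "(\<Sum>k. \<integral>\<^sup>+x. ennreal (indicator (H k) x * grad1 f x powr p) \<partial>lborel) = (\<integral>\<^sup>+x. (\<Sum>k. ennreal (indicator (H k) x * grad1 f x powr p)) \<partial>lborel)"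
        by (rule nn_integral_suminf[symmetric]) measurable
      also have "\<dots> \<le> Lpow p (grad1 f)"
        unfolding Lpow_def
      proof (rule nn_integral_mono)
        fix x
        have "(\<Sum>k. ennreal (indicator (H k) x * grad1 f x powr p)) = (\<Sum>k. ennreal (grad1 f x powr p) * indicator (H k) x)"
          by (intro suminf_cong) (auto simp: indicator_def)
        also have "\<dots> = ennreal (grad1 f x powr p) * (\<Sum>k. indicator (H k) x)" by simp
        also have "(\<Sum>k. indicator (H k) x :: ennreal) = indicator (\<Union>k. H k) x" by (rule suminf_indicator[OF disj])
        also have "ennreal (grad1 f x powr p) * indicator (\<Union>k. H k) x \<le> ennreal (\<bar>grad1 f x\<bar> powr p)"
          using grad1_nonneg[of f x] by (auto simp: indicator_def)
        finally show "(\<Sum>k. ennreal (indicator (H k) x * grad1 f x powr p)) \<le> ennreal (\<bar>grad1 f x\<bar> powr p)" .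
      qed
      also have "\<dots> \<le> ennreal (n powr p * n * G powr p)" using Lpow_grad1_le[OF f p 1[rule_format]] by (simp add: n_def)
      finally have "Lpow q f \<le> ennreal (4 powr q * A * M powr (q - p)) * ennreal (n powr p * n * G powr p)"
        by (simp add: mult_left_mono)
      also have "\<dots> = ennreal (E * M powr (q - p) * G powr p)"
        by (subst ennreal_mult'[symmetric]) (use A n in \<open>auto simp: E_def mult_ac\<close>)
      finally show "Lpow q f \<le> ennreal (E * M powr (q - p) * G powr p)" .
    qed (use p pq E G in auto)
    thus "Lbound a (E powr (1 / p) * G) f" using a(2) by (simp add: Lbound_def q_def)
  qed
qed

section \<open>Embeddings of arbitrary order\<close>

text \<open>Away from the critical exponent there is room to pass to a fractional order \<open>\<theta> < 1\<close>, which is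
  controlled by the gradient.\<close>

lemma first_order_embedding:
  assumes p: "1 \<le> p" and a: "0 \<le> a" "a \<le> 1 / p" "1 / p - a \<le> 1 / real CARD('n::finite)" and a0: "a = 0 \<Longrightarrow> 1 / p < 1 / real CARD('n)"
  shows "\<exists>C>0. \<forall>f::real^'n \<Rightarrow> real. \<forall>G\<ge>0. f \<in> Cc_infty \<longrightarrow> Lpow p f \<le> ennreal (G powr p) \<longrightarrow>
     (\<forall>i. Lpow p (partial_deriv i f) \<le> ennreal (G powr p)) \<longrightarrow> Lbound a (C * G) f"
proof (cases "1 / p - a = 1 / real CARD('n)")
  case True
  hence "a \<noteq> 0" using a0 by auto
  hence "a > 0" using a by simp
  moreover have "a = 1 / p - 1 / real CARD('n)" using True by simp
  ultimately obtain C where C: "C > 0" "\<forall>f::real^'n \<Rightarrow> real. \<forall>G\<ge>0. f \<in> Cc_infty \<longrightarrow>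
     (\<forall>i. Lpow p (partial_deriv i f) \<le> ennreal (G powr p)) \<longrightarrow> Lbound a (C * G) f"
    using critical_first_order_embedding[OF p, where 'n = 'n and a = a] by metis
  show ?thesis
    by (intro exI[of _ C] conjI allI impI C(1); rule C(2)[rule_format]; simp)
next
  case False
  define n where "n = real CARD('n)"
  have n: "n \<ge> 1" by (simp add: n_def Suc_leI)
  have lt: "1 / p - a < 1 / n" unfolding n_def using False a(3) by simp
  \<comment> \<open>any order strictly between \<open>n (1/p - a)\<close> and \<open>1\<close>\<close>
  define \<theta> where "\<theta> = (1 + n * (1 / p - a)) / 2"
  have m: "n * (1 / p - a) < 1" using lt n by (simp add: field_simps)
  have m0: "n * (1 / p - a) \<ge> 0" using a n by (intro mult_nonneg_nonneg) auto
  have \<theta>: "0 < \<theta>" "\<theta> < 1" "n * (1 / p - a) < \<theta>" using m m0 by (auto simp: \<theta>_def)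
  have sl: "1 / p - a < \<theta> / n" using \<theta>(3) n by (simp add: field_simps)
  obtain C1 where C1: "C1 > 0" "\<And>f::real^'n \<Rightarrow> real. \<And>G. G \<ge> 0 \<Longrightarrow> f \<in> Cc_infty \<Longrightarrow> Lpow p f \<le> ennreal (G powr p) \<Longrightarrow>
     (\<And>i. Lpow p (partial_deriv i f) \<le> ennreal (G powr p)) \<Longrightarrow> Slo \<theta> p f \<le> ennreal ((C1 * G) powr p)"
    using Slo_le_gradient[OF p \<theta>(1,2), where 'n = 'n] by blast
  have "\<exists>C>0. \<forall>f::real^'n \<Rightarrow> real. \<forall>G\<ge>0. f \<in> Cc_infty \<longrightarrow> Lpow p f \<le> ennreal (G powr p) \<longrightarrow>
     Slo \<theta> p f \<le> ennreal (G powr p) \<longrightarrow> Lbound a (C * G) f"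
  proof (cases "a = 0")
    case True
    thus ?thesis using fractional_sup_embedding[OF p \<theta>(1), where 'n = 'n] sl by (simp add: n_def)
  next
    case False
    thus ?thesis using fractional_embedding[OF p \<theta>(1) _ a(2), where 'n = 'n] sl a by (simp add: n_def)
  qed
  then obtain C2 where C2: "C2 > 0" "\<And>f::real^'n \<Rightarrow> real. \<And>G. G \<ge> 0 \<Longrightarrow> f \<in> Cc_infty \<Longrightarrow> Lpow p f \<le> ennreal (G powr p) \<Longrightarrow>
     Slo \<theta> p f \<le> ennreal (G powr p) \<Longrightarrow> Lbound a (C2 * G) f" by blast
  show ?thesis
  proof (intro exI[of _ "C2 * max 1 C1"] conjI allI impI)
    show "C2 * max 1 C1 > 0" using C2 by simp
    fix f :: "real^'n \<Rightarrow> real" and G :: real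
    assume G: "G \<ge> 0" and f: "f \<in> Cc_infty" and 0: "Lpow p f \<le> ennreal (G powr p)" and 1: "\<forall>i. Lpow p (partial_deriv i f) \<le> ennreal (G powr p)"
    have g1: "G powr p \<le> (max 1 C1 * G) powr p"
      using G p mult_right_mono[of 1 "max 1 C1" G] by (intro powr_mono2) auto
    have g2: "(C1 * G) powr p \<le> (max 1 C1 * G) powr p"
      using G p C1 by (intro powr_mono2 mult_right_mono mult_nonneg_nonneg) auto
    have "Lbound a (C2 * (max 1 C1 * G)) f"
    proof (rule C2(2))
      show "Lpow p f \<le> ennreal ((max 1 C1 * G) powr p)" using 0 ennreal_leI[OF g1] by (rule order_trans)
      show "Slo \<theta> p f \<le> ennreal ((max 1 C1 * G) powr p)"
        using C1(2)[OF G f 0] 1 ennreal_leI[OF g2] by (blast intro: order_trans)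
    qed (use G f in auto)
    thus "Lbound a (C2 * max 1 C1 * G) f" by (simp add: mult.assoc)
  qed
qed

text \<open>A bound on the norm of \<open>W\<^sup>k\<^sup>+\<^sup>\<theta>\<^sup>,\<^sup>p\<close>, up to a constant, in terms of iterated classical derivatives.\<close>

definition sob_bound :: "nat \<Rightarrow> real \<Rightarrow> real \<Rightarrow> real \<Rightarrow> (real ^ 'n::finite \<Rightarrow> real) \<Rightarrow> bool" where
  "sob_bound k \<theta> p G f \<longleftrightarrow> (\<forall>is. length is \<le> k \<longrightarrow> Lpow p (Dl is f) \<le> ennreal (G powr p)) \<and>
     (0 < \<theta> \<longrightarrow> (\<forall>is. length is = k \<longrightarrow> Slo \<theta> p (Dl is f) \<le> ennreal (G powr p)))"

text \<open>Only the seminorm of the derivatives of order \<open>k\<close> is to be shown; it is bounded by their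
  gradients.\<close>

lemma sob_bound_lower_order:
  assumes p: "1 \<le> p" and \<theta>: "0 \<le> \<theta>" "\<theta> < 1"
  shows "\<exists>C\<ge>1. \<forall>f::real^'n::finite \<Rightarrow> real. \<forall>G\<ge>0. f \<in> Cc_infty \<longrightarrow> sob_bound (Suc k) \<theta> p G f \<longrightarrow> sob_bound k \<theta> p (C * G) f"
proof -
  have "\<exists>C1\<ge>1. 0 < \<theta> \<longrightarrow> (\<forall>f::real^'n \<Rightarrow> real. \<forall>G\<ge>0. f \<in> Cc_infty \<longrightarrow> Lpow p f \<le> ennreal (G powr p) \<longrightarrow>
     (\<forall>i. Lpow p (partial_deriv i f) \<le> ennreal (G powr p)) \<longrightarrow> Slo \<theta> p f \<le> ennreal ((C1 * G) powr p))"
  proof (cases "0 < \<theta>")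
    case True
    obtain C where C: "C > 0" "\<And>f::real^'n \<Rightarrow> real. \<And>G. G \<ge> 0 \<Longrightarrow> f \<in> Cc_infty \<Longrightarrow> Lpow p f \<le> ennreal (G powr p) \<Longrightarrow>
       (\<forall>i. Lpow p (partial_deriv i f) \<le> ennreal (G powr p)) \<Longrightarrow> Slo \<theta> p f \<le> ennreal ((C * G) powr p)"
      using Slo_le_gradient[OF p True \<theta>(2), where 'n = 'n] by blast
    show ?thesis
    proof (intro exI[of _ "max 1 C"] conjI impI allI)
      fix f :: "real^'n \<Rightarrow> real" and G :: real
      assume h: "G \<ge> 0" "f \<in> Cc_infty" "Lpow p f \<le> ennreal (G powr p)" "\<forall>i. Lpow p (partial_deriv i f) \<le> ennreal (G powr p)"
      have "(C * G) powr p \<le> (max 1 C * G) powr p"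
        using h(1) p C by (intro powr_mono2 mult_right_mono mult_nonneg_nonneg) auto
      thus "Slo \<theta> p f \<le> ennreal ((max 1 C * G) powr p)" using C(2)[OF h] ennreal_leI by (blast intro: order_trans)
    qed simp
  qed auto
  then obtain C1 where C1: "C1 \<ge> 1" "0 < \<theta> \<Longrightarrow> (\<forall>f::real^'n \<Rightarrow> real. \<forall>G\<ge>0. f \<in> Cc_infty \<longrightarrow> Lpow p f \<le> ennreal (G powr p) \<longrightarrow>
     (\<forall>i. Lpow p (partial_deriv i f) \<le> ennreal (G powr p)) \<longrightarrow> Slo \<theta> p f \<le> ennreal ((C1 * G) powr p))" by blast
  show ?thesis
  proof (intro exI[of _ C1] conjI allI impI C1(1))
    fix f :: "real^'n \<Rightarrow> real" and G :: real
    assume G: "G \<ge> 0" and f: "f \<in> Cc_infty" and b: "sob_bound (Suc k) \<theta> p G f"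
    have g1: "G powr p \<le> (C1 * G) powr p"
      using G p C1(1) mult_right_mono[of 1 C1 G] by (intro powr_mono2) auto
    show "sob_bound k \<theta> p (C1 * G) f"
      unfolding sob_bound_def
    proof (intro conjI allI impI)
      fix "is" :: "'n list" assume "length is \<le> k"
      hence "Lpow p (Dl is f) \<le> ennreal (G powr p)" using b by (simp add: sob_bound_def)
      thus "Lpow p (Dl is f) \<le> ennreal ((C1 * G) powr p)" using ennreal_leI[OF g1] by (rule order_trans)
    next
      fix "is" :: "'n list" assume \<theta>0: "0 < \<theta>" and l: "length is = k"
      have "Lpow p (Dl (i # is) f) \<le> ennreal (G powr p)" for i
        using b l unfolding sob_bound_def by (metis le_refl length_Cons)
      hence "\<forall>i. Lpow p (partial_deriv i (Dl is f)) \<le> ennreal (G powr p)" by simp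
      moreover have "Lpow p (Dl is f) \<le> ennreal (G powr p)" using b l by (simp add: sob_bound_def)
      ultimately show "Slo \<theta> p (Dl is f) \<le> ennreal ((C1 * G) powr p)"
        using C1(2)[OF \<theta>0] G Cc_Dl[OF f] by blast
    qed
  qed
qed

lemma sob_bound_mono:
  assumes "sob_bound k \<theta> p G f" and le: "G powr p \<le> G' powr p"
  shows "sob_bound k \<theta> p G' f"
  unfolding sob_bound_def
  by (intro conjI allI impI; rule order_trans[OF _ ennreal_leI[OF le]]) (use assms(1) in \<open>auto simp: sob_bound_def\<close>)

lemma sob_bound_partial:
  assumes "sob_bound (Suc k) \<theta> p G f" shows "sob_bound k \<theta> p G (partial_deriv i f)"
proof -
  have "Dl is (partial_deriv i f) = Dl (is @ [i]) f" for "is" by simp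
  thus ?thesis using assms unfolding sob_bound_def by (metis length_append_singleton Suc_le_mono)
qed

text \<open>The exponent through which the induction step passes. With \<open>P = 1/p\<close>, \<open>K = (k + \<theta>)/n\<close> and
  \<open>c = 1/n\<close>, order \<open>k + \<theta>\<close> leads from \<open>L\<^sup>p\<close> to \<open>L\<^sup>1\<^sup>/\<^sup>b\<close>, and one further derivative from \<open>L\<^sup>1\<^sup>/\<^sup>b\<close> to
  \<open>L\<^sup>1\<^sup>/\<^sup>a\<close>.\<close>

lemma intermediate_exponent:
  fixes P K c a :: real
  assumes "P > 0" "K \<ge> 0" "c > 0" "0 \<le> a" "a \<le> P" "P - a \<le> K + c" "a = 0 \<Longrightarrow> P < K + c"
  shows "\<exists>b. 0 < b \<and> b \<le> P \<and> P - b \<le> K \<and> a \<le> b \<and> b - a \<le> c \<and> (a = 0 \<longrightarrow> b < c)"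
proof (cases "a = 0")
  case False
  thus ?thesis using assms by (intro exI[of _ "min P (a + c)"]) (auto simp: min_def)
next
  case True
  show ?thesis
  proof (cases "P - K > 0")
    case pos: True
    thus ?thesis using assms True by (intro exI[of _ "P - K"]) auto
  next
    case neg: False
    thus ?thesis using assms True by (intro exI[of _ "min P (c / 2)"]) (auto simp: min_def)
  qed
qed

text \<open>Induction on \<open>k\<close>: by hypothesis \<open>f\<close> and its first derivatives lie in \<open>L\<^sup>1\<^sup>/\<^sup>b\<close> for a suitable \<open>b > 0\<close>,
  and the first order embedding leads from there to \<open>L\<^sup>1\<^sup>/\<^sup>a\<close>.\<close>

lemma sobolev_embedding_Cc:
  assumes p: "1 \<le> p" and \<theta>: "0 \<le> \<theta>" "\<theta> < 1"
    and a: "0 \<le> a" "a \<le> 1 / p" "1 / p - a \<le> (real k + \<theta>) / real CARD('n::finite)"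
    and a0: "a = 0 \<Longrightarrow> 1 / p < (real k + \<theta>) / real CARD('n)"
  shows "\<exists>C>0. \<forall>f::real^'n \<Rightarrow> real. \<forall>G\<ge>0. f \<in> Cc_infty \<longrightarrow> sob_bound k \<theta> p G f \<longrightarrow> Lbound a (C * G) f"
  using a a0
proof (induction k arbitrary: a)
  case 0
  show ?case
  proof (cases "\<theta> = 0")
    case True
    hence "a = 1 / p" using 0 by simp
    hence "Lbound a (1 * G) f" if "sob_bound 0 \<theta> p G f" for G and f :: "real^'n \<Rightarrow> real"
      using that p by (auto simp: sob_bound_def Lbound_def)
    thus ?thesis by (intro exI[of _ 1]) auto
  next
    case False
    hence \<theta>0: "0 < \<theta>" using \<theta> by simp
    have "\<exists>C>0. \<forall>f::real^'n \<Rightarrow> real. \<forall>G\<ge>0. f \<in> Cc_infty \<longrightarrow> Lpow p f \<le> ennreal (G powr p) \<longrightarrow>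
       Slo \<theta> p f \<le> ennreal (G powr p) \<longrightarrow> Lbound a (C * G) f"
    proof (cases "a = 0")
      case True
      thus ?thesis using fractional_sup_embedding[OF p \<theta>0, where 'n = 'n] 0 by simp
    next
      case False
      thus ?thesis using fractional_embedding[OF p \<theta>0, where 'n = 'n and a = a] 0 by simp
    qed
    moreover have "sob_bound 0 \<theta> p G f \<longleftrightarrow> Lpow p f \<le> ennreal (G powr p) \<and> Slo \<theta> p f \<le> ennreal (G powr p)" for G and f :: "real^'n \<Rightarrow> real"
      using \<theta>0 by (simp add: sob_bound_def)
    ultimately show ?thesis by metis
  qed
next
  case (Suc k)
  define n where "n = real CARD('n)"
  have n: "n \<ge> 1" by (simp add: n_def Suc_leI)
  have s: "1 / p - a \<le> (real k + \<theta>) / n + 1 / n" using Suc.prems(3) by (simp add: n_def add_divide_distrib)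
  have pp: "1 / p > 0" using p by simp
  have "(real k + \<theta>) / n \<ge> 0" "1 / n > 0" using \<theta> n by auto
  moreover have "a = 0 \<Longrightarrow> 1 / p < (real k + \<theta>) / n + 1 / n" using Suc.prems(4) by (simp add: n_def add_divide_distrib)
  ultimately have "\<exists>b. 0 < b \<and> b \<le> 1 / p \<and> 1 / p - b \<le> (real k + \<theta>) / n \<and> a \<le> b \<and> b - a \<le> 1 / n \<and> (a = 0 \<longrightarrow> b < 1 / n)"
    by (rule intermediate_exponent[OF pp _ _ Suc.prems(1,2) s])
  then obtain b where b: "0 < b" "b \<le> 1 / p" "1 / p - b \<le> (real k + \<theta>) / n" "a \<le> b" "b - a \<le> 1 / n" "a = 0 \<Longrightarrow> b < 1 / n" by blast
  obtain C1 where C1: "C1 > 0" "\<And>f::real^'n \<Rightarrow> real. \<And>G. G \<ge> 0 \<Longrightarrow> f \<in> Cc_infty \<Longrightarrow> sob_bound k \<theta> p G f \<Longrightarrow> Lbound b (C1 * G) f"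
    using Suc.IH[of b] b by (auto simp: n_def)
  have "1 / p \<le> 1" using p by simp
  hence "b \<le> 1" using b(2) by linarith
  hence "1 \<le> 1 / b" using b(1) by simp
  then obtain C2 where C2: "C2 > 0" "\<And>f::real^'n \<Rightarrow> real. \<And>G. G \<ge> 0 \<Longrightarrow> f \<in> Cc_infty \<Longrightarrow> Lpow (1 / b) f \<le> ennreal (G powr (1 / b)) \<Longrightarrow>
     (\<And>i. Lpow (1 / b) (partial_deriv i f) \<le> ennreal (G powr (1 / b))) \<Longrightarrow> Lbound a (C2 * G) f"
    using first_order_embedding[of "1 / b" a, where 'n = 'n] b Suc.prems(1) by (auto simp: n_def)
  obtain C3 where C3: "C3 \<ge> 1" "\<And>f::real^'n \<Rightarrow> real. \<And>G. G \<ge> 0 \<Longrightarrow> f \<in> Cc_infty \<Longrightarrow> sob_bound (Suc k) \<theta> p G f \<Longrightarrow> sob_bound k \<theta> p (C3 * G) f"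
    using sob_bound_lower_order[OF p \<theta>, of k, where 'n = 'n] by blast
  show ?case
  proof (intro exI[of _ "C2 * (C1 * C3)"] conjI allI impI)
    show "C2 * (C1 * C3) > 0" using C1 C2 C3 by simp
    fix f :: "real^'n \<Rightarrow> real" and G :: real
    assume G: "G \<ge> 0" and f: "f \<in> Cc_infty" and h: "sob_bound (Suc k) \<theta> p G f"
    have G3: "C3 * G \<ge> 0" using C3 G by simp
    have b0: "Lbound b (C1 * (C3 * G)) f" by (rule C1(2)[OF G3 f C3(2)[OF G f h]])
    have b1: "Lbound b (C1 * (C3 * G)) (partial_deriv i f)" for i
    proof (rule C1(2)[OF G3 Cc_partial_deriv[OF f]])
      have "G powr p \<le> (C3 * G) powr p" using G p C3(1) mult_right_mono[of 1 C3 G] by (intro powr_mono2) auto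
      thus "sob_bound k \<theta> p (C3 * G) (partial_deriv i f)"
        using sob_bound_partial[OF h, of i] by (rule sob_bound_mono[rotated])
    qed
    have "Lbound a (C2 * (C1 * (C3 * G))) f"
      by (rule C2(2)) (use b0 b1 b(1) f G3 C1 in \<open>auto simp: Lbound_def\<close>)
    thus "Lbound a (C2 * (C1 * C3) * G) f" by (simp add: mult.assoc)
  qed
qed


section \<open>Representatives\<close>

lemma rep_L0_borel [measurable]: "rep_L0 u \<in> borel_measurable borel"
  using Quotient3_rep_reflp[OF Quotient3_L0, of u] by (simp add: ae_rel_def)

lemma rep_abs_L0: "f \<in> borel_measurable borel \<Longrightarrow> AE x in lborel. rep_L0 (abs_L0 f) x = f x"
  using Quotient3_rep_abs[OF Quotient3_L0, of f] by (simp add: ae_rel_def)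

lemma L0_eqI: "AE x in lborel. rep_L0 u x = rep_L0 v x \<Longrightarrow> u = v"
  using Quotient3_rel_rep[OF Quotient3_L0, of u v] by (simp add: ae_rel_def)

lemma rep_plus_L0: "AE x in lborel. rep_L0 (u + v) x = rep_L0 u x + rep_L0 v x"
  unfolding plus_L0_def map_fun_def by (simp add: rep_abs_L0)

lemma rep_minus_L0: "AE x in lborel. rep_L0 (u - v) x = rep_L0 u x - rep_L0 v x"
  unfolding minus_L0_def map_fun_def by (simp add: rep_abs_L0)

lemma rep_scaleR_L0: "AE x in lborel. rep_L0 (c *\<^sub>R u) x = c * rep_L0 u x"
  unfolding scaleR_L0_def map_fun_def by (simp add: rep_abs_L0)

lemma Lp_iff: "u \<in> Lp p \<longleftrightarrow> Lpow p (rep_L0 u) < \<infinity>"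
  unfolding Lp_def Lpow_def by (auto simp: integrable_iff_bounded)

lemma Lpow_eq_Lp_norm:
  assumes "u \<in> Lp p" "p > 0" shows "Lpow p (rep_L0 u) = ennreal (Lp_norm p u powr p)"
proof -
  have i: "integrable lborel (\<lambda>x. \<bar>rep_L0 u x\<bar> powr p)" using assms by (simp add: Lp_def)
  have n: "(\<integral>x. \<bar>rep_L0 u x\<bar> powr p \<partial>lborel) \<ge> 0" by (rule Bochner_Integration.integral_nonneg) auto
  have "Lpow p (rep_L0 u) = ennreal (\<integral>x. \<bar>rep_L0 u x\<bar> powr p \<partial>lborel)"
    unfolding Lpow_def by (rule nn_integral_eq_integral[OF i]) auto
  also have "(\<integral>x. \<bar>rep_L0 u x\<bar> powr p \<partial>lborel) = Lp_norm p u powr p"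
    using n assms(2) by (simp add: Lp_norm_def powr_powr)
  finally show ?thesis .
qed

lemma Lp_norm_nonneg: "Lp_norm p u \<ge> 0" by (simp add: Lp_norm_def)

lemma slobodeckij_int_eq: "slobodeckij_int \<theta> p u = Slo \<theta> p (rep_L0 u)"
proof -
  let ?u = "rep_L0 u"
  let ?n = "real CARD('a)"
  have "slobodeckij_int \<theta> p u = (\<integral>\<^sup>+x. \<integral>\<^sup>+y. ennreal (\<bar>?u x - ?u y\<bar> powr p / norm (x - y) powr (?n + \<theta> * p)) \<partial>lborel \<partial>lborel)"
    unfolding slobodeckij_int_def by (subst lborel.nn_integral_fst[symmetric]) auto
  also have "\<dots> = (\<integral>\<^sup>+x. \<integral>\<^sup>+z. ennreal (norm z powr - (?n + \<theta> * p) * \<bar>?u (x + z) - ?u x\<bar> powr p) \<partial>lborel \<partial>lborel)"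
  proof (rule nn_integral_cong)
    fix x
    have "(\<integral>\<^sup>+y. ennreal (\<bar>?u x - ?u y\<bar> powr p / norm (x - y) powr (?n + \<theta> * p)) \<partial>lborel)
      = (\<integral>\<^sup>+z. ennreal (\<bar>?u x - ?u (z + x)\<bar> powr p / norm (x - (z + x)) powr (?n + \<theta> * p)) \<partial>lborel)"
      by (rule nn_integral_translate[symmetric]) measurable
    also have "\<dots> = (\<integral>\<^sup>+z. ennreal (norm z powr - (?n + \<theta> * p) * \<bar>?u (x + z) - ?u x\<bar> powr p) \<partial>lborel)"
      unfolding powr_minus by (intro nn_integral_cong) (simp add: divide_inverse mult.commute abs_minus_commute add.commute)
    finally show "(\<integral>\<^sup>+y. ennreal (\<bar>?u x - ?u y\<bar> powr p / norm (x - y) powr (?n + \<theta> * p)) \<partial>lborel)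
      = (\<integral>\<^sup>+z. ennreal (norm z powr - (?n + \<theta> * p) * \<bar>?u (x + z) - ?u x\<bar> powr p) \<partial>lborel)" .
  qed
  also have "\<dots> = Slo \<theta> p ?u" by (rule Slo_Tonelli[symmetric]) measurable
  finally show ?thesis .
qed

lemma Slo_eq_seminorm:
  assumes "Slo \<theta> p (rep_L0 u) < \<infinity>" "p > 0"
  shows "Slo \<theta> p (rep_L0 u) = ennreal (slobodeckij_seminorm \<theta> p u powr p)"
  using assms by (simp add: slobodeckij_seminorm_def slobodeckij_int_eq powr_powr top.not_eq_extremum)

lemma seminorm_nonneg: "slobodeckij_seminorm \<theta> p u \<ge> 0" by (simp add: slobodeckij_seminorm_def)

section \<open>Weak derivatives of classes\<close>

abbreviation wd :: "('n::finite \<Rightarrow> nat) \<Rightarrow> 'n L0 \<Rightarrow> 'n L0 \<Rightarrow> bool" where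
  "wd \<nu> u g \<equiv> has_weak_deriv \<nu> (rep_L0 u) (rep_L0 g)"

text \<open>Uniqueness of weak derivatives makes the definite description in \<open>weak_deriv\<close> meaningful.\<close>

lemma weak_deriv_eqI: "wd \<nu> u g \<Longrightarrow> weak_deriv \<nu> u = g"
  unfolding weak_deriv_def by (rule the_equality) (auto intro!: L0_eqI dest: has_weak_deriv_unique)

lemma locally_integrable_cong_AE:
  assumes "locally_integrable f" "AE x in lborel. f x = g x" and [measurable]: "g \<in> borel_measurable borel"
  shows "locally_integrable g"
  unfolding locally_integrable_def set_integrable_def
proof (intro allI impI)
  fix K :: "(real^'a) set" assume K: "compact K"
  note [measurable] = locally_integrable_borel[OF assms(1)]
  have [measurable]: "K \<in> sets borel" using K by (simp add: compact_imp_closed borel_closed)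
  have "integrable lborel (\<lambda>x. indicator K x *\<^sub>R f x)" using assms(1) K by (simp add: locally_integrable_def set_integrable_def)
  thus "integrable lborel (\<lambda>x. indicator K x *\<^sub>R g x)"
    by (subst integrable_cong_AE[where g = "\<lambda>x. indicator K x *\<^sub>R f x"]) (use assms(2) in auto)
qed

lemma has_weak_deriv_cong_AE:
  fixes f f' :: "real ^ 'n::finite \<Rightarrow> real"
  assumes h: "has_weak_deriv \<nu> f g" and f: "AE x in lborel. f x = f' x" "f' \<in> borel_measurable borel"
    and g: "AE x in lborel. g x = g' x" "g' \<in> borel_measurable borel"
  shows "has_weak_deriv \<nu> f' g'"
proof -
  have l: "locally_integrable f" "locally_integrable g" using h by (auto simp: has_weak_deriv_def)
  note [measurable] = locally_integrable_borel[OF l(1)] locally_integrable_borel[OF l(2)] f(2) g(2)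
  have "(\<integral>x. f' x * mderiv \<nu> \<phi> x \<partial>lborel) = (-1) ^ mi_order \<nu> * (\<integral>x. g' x * \<phi> x \<partial>lborel)" if \<phi>: "\<phi> \<in> Cc_infty" for \<phi>
  proof -
    note [measurable] = Cc_borel[OF \<phi>] Cc_borel[OF Cc_mderiv[OF \<phi>, of \<nu>]]
    have "(\<integral>x. f' x * mderiv \<nu> \<phi> x \<partial>lborel) = (\<integral>x. f x * mderiv \<nu> \<phi> x \<partial>lborel)"
      by (rule integral_cong_AE) (use f in auto)
    also have "\<dots> = (-1) ^ mi_order \<nu> * (\<integral>x. g x * \<phi> x \<partial>lborel)" using h \<phi> by (simp add: has_weak_deriv_def)
    also have "(\<integral>x. g x * \<phi> x \<partial>lborel) = (\<integral>x. g' x * \<phi> x \<partial>lborel)" by (rule integral_cong_AE) (use g in auto)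
    finally show ?thesis .
  qed
  thus ?thesis unfolding has_weak_deriv_def
    using locally_integrable_cong_AE[OF l(1) f] locally_integrable_cong_AE[OF l(2) g] by simp
qed

lemma has_weak_deriv_lincomb:
  fixes f f' :: "real ^ 'n::finite \<Rightarrow> real"
  assumes "has_weak_deriv \<nu> f g" "has_weak_deriv \<nu> f' g'"
  shows "has_weak_deriv \<nu> (\<lambda>x. f x + c * f' x) (\<lambda>x. g x + c * g' x)"
proof -
  have l: "locally_integrable f" "locally_integrable g" "locally_integrable f'" "locally_integrable g'"
    using assms by (auto simp: has_weak_deriv_def)
  have li: "locally_integrable (\<lambda>x. h x + c * h' x)" if "locally_integrable h" "locally_integrable h'" for h h' :: "real^'n \<Rightarrow> real"
    unfolding locally_integrable_def set_integrable_def
  proof (intro allI impI)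
    fix K :: "(real^'n) set" assume "compact K"
    hence i: "integrable lborel (\<lambda>x. indicator K x *\<^sub>R h x)" "integrable lborel (\<lambda>x. indicator K x *\<^sub>R h' x)"
      using that by (auto simp: locally_integrable_def set_integrable_def)
    have "integrable lborel (\<lambda>x. indicator K x *\<^sub>R h x + c * (indicator K x *\<^sub>R h' x))"
      by (intro Bochner_Integration.integrable_add integrable_mult_right i)
    thus "integrable lborel (\<lambda>x. indicator K x *\<^sub>R (h x + c * h' x))" by (simp add: algebra_simps)
  qed
  have sp: "(\<integral>x. (h x + c * h' x) * \<phi> x \<partial>lborel) = (\<integral>x. h x * \<phi> x \<partial>lborel) + c * (\<integral>x. h' x * \<phi> x \<partial>lborel)"
    if "locally_integrable h" "locally_integrable h'" "\<phi> \<in> Cc_infty" for h h' \<phi> :: "real^'n \<Rightarrow> real"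
  proof -
    have "(\<integral>x. (h x + c * h' x) * \<phi> x \<partial>lborel) = (\<integral>x. h x * \<phi> x + c * (h' x * \<phi> x) \<partial>lborel)"
      by (simp add: algebra_simps)
    also have "\<dots> = (\<integral>x. h x * \<phi> x \<partial>lborel) + (\<integral>x. c * (h' x * \<phi> x) \<partial>lborel)"
      by (intro Bochner_Integration.integral_add integrable_mult_right Cc_times_integrable that)
    finally show ?thesis by simp
  qed
  show ?thesis unfolding has_weak_deriv_def
  proof (intro conjI ballI li l)
    fix \<phi> :: "real^'n \<Rightarrow> real" assume \<phi>: "\<phi> \<in> Cc_infty"
    have "(\<integral>x. f x * mderiv \<nu> \<phi> x \<partial>lborel) = (-1) ^ mi_order \<nu> * (\<integral>x. g x * \<phi> x \<partial>lborel)"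
      "(\<integral>x. f' x * mderiv \<nu> \<phi> x \<partial>lborel) = (-1) ^ mi_order \<nu> * (\<integral>x. g' x * \<phi> x \<partial>lborel)"
      using assms \<phi> by (auto simp: has_weak_deriv_def)
    thus "(\<integral>x. (f x + c * f' x) * mderiv \<nu> \<phi> x \<partial>lborel) = (-1) ^ mi_order \<nu> * (\<integral>x. (g x + c * g' x) * \<phi> x \<partial>lborel)"
      unfolding sp[OF l(1,3) Cc_mderiv[OF \<phi>]] sp[OF l(2,4) \<phi>] by (simp add: algebra_simps)
  qed
qed

lemma rep_lincomb: "AE x in lborel. rep_L0 (u + c *\<^sub>R v) x = rep_L0 u x + c * rep_L0 v x"
  using rep_plus_L0[of u "c *\<^sub>R v"] rep_scaleR_L0[of c v] by eventually_elim simp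

lemma wd_lincomb:
  assumes "wd \<nu> u g" "wd \<nu> v h" shows "wd \<nu> (u + c *\<^sub>R v) (g + c *\<^sub>R h)"
  by (rule has_weak_deriv_cong_AE[OF has_weak_deriv_lincomb[OF assms, of c]])
     (use rep_lincomb[of u c v] rep_lincomb[of g c h] in \<open>auto elim: AE_mp\<close>)

lemma Lpow_rep_lincomb:
  assumes "p \<ge> 0"
  shows "Lpow p (rep_L0 (u + c *\<^sub>R v)) \<le> ennreal (2 powr p) * (Lpow p (rep_L0 u) + ennreal (\<bar>c\<bar> powr p) * Lpow p (rep_L0 v))"
proof -
  have "Lpow p (rep_L0 (u + c *\<^sub>R v)) = Lpow p (\<lambda>x. rep_L0 u x + c * rep_L0 v x)"
    by (rule Lpow_cong_AE) (rule rep_lincomb)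
  also have "\<dots> \<le> ennreal (2 powr p) * (Lpow p (rep_L0 u) + Lpow p (\<lambda>x. c * rep_L0 v x))"
    by (rule Lpow_add_le) (use assms in auto)
  finally show ?thesis by (simp add: Lpow_cmult)
qed

lemma Slo_rep_lincomb:
  assumes "p \<ge> 0"
  shows "Slo \<theta> p (rep_L0 (u + c *\<^sub>R v)) \<le> ennreal (2 powr p) * (Slo \<theta> p (rep_L0 u) + ennreal (\<bar>c\<bar> powr p) * Slo \<theta> p (rep_L0 v))"
proof -
  have "Slo \<theta> p (rep_L0 (u + c *\<^sub>R v)) = Slo \<theta> p (\<lambda>x. rep_L0 u x + c * rep_L0 v x)"
    by (rule Slo_cong_AE) (use rep_lincomb in auto)
  also have "\<dots> \<le> ennreal (2 powr p) * (Slo \<theta> p (rep_L0 u) + Slo \<theta> p (\<lambda>x. c * rep_L0 v x))"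
    by (rule Slo_add_le) (use assms in auto)
  finally show ?thesis by (simp add: Slo_cmult)
qed

section \<open>Sobolev spaces of nonnegative order\<close>

lemma finite_mi: "finite {\<nu> :: 'n::finite \<Rightarrow> nat. mi_order \<nu> \<le> k}"
proof (rule finite_subset)
  show "{\<nu> :: 'n \<Rightarrow> nat. mi_order \<nu> \<le> k} \<subseteq> (UNIV \<rightarrow>\<^sub>E {..k})"
  proof
    fix \<nu> :: "'n \<Rightarrow> nat" assume "\<nu> \<in> {\<nu>. mi_order \<nu> \<le> k}"
    moreover have "\<nu> i \<le> mi_order \<nu>" for i unfolding mi_order_def by (rule member_le_sum) auto
    ultimately show "\<nu> \<in> UNIV \<rightarrow>\<^sub>E {..k}" by (auto simp: PiE_def intro: order_trans)
  qed
qed (intro finite_PiE, auto)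

lemma finite_mi_eq: "finite {\<nu> :: 'n::finite \<Rightarrow> nat. mi_order \<nu> = k}"
  by (rule finite_subset[OF _ finite_mi[of k]]) auto

lemma wd_zero: "locally_integrable (rep_L0 u) \<Longrightarrow> wd (\<lambda>_. 0) u u"
proof -
  assume l: "locally_integrable (rep_L0 u)"
  obtain "is" where "length is = mi_order (\<lambda>_::'a. 0)" "\<And>f. mderiv (\<lambda>_::'a. 0) f = Dl is f"
    using mderiv_list[of "\<lambda>_::'a. 0"] by metis
  moreover have "mi_order (\<lambda>_::'a. 0) = 0" by (simp add: mi_order_def)
  ultimately show ?thesis using l by (simp add: has_weak_deriv_def)
qed

lemma sobolev_nat_weak_deriv:
  assumes "u \<in> sobolev_nat k p" "mi_order \<nu> \<le> k"
  shows "wd \<nu> u (weak_deriv \<nu> u)" "weak_deriv \<nu> u \<in> Lp p"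
proof -
  obtain g where "g \<in> Lp p" "wd \<nu> u g" using assms by (auto simp: sobolev_nat_def)
  thus "wd \<nu> u (weak_deriv \<nu> u)" "weak_deriv \<nu> u \<in> Lp p" using weak_deriv_eqI by blast+
qed

lemma sobolev_iff:
  "u \<in> sobolev s p \<longleftrightarrow> u \<in> sobolev_nat (nat \<lfloor>s\<rfloor>) p \<and>
     (0 < frac s \<longrightarrow> (\<forall>\<nu>. mi_order \<nu> = nat \<lfloor>s\<rfloor> \<longrightarrow> Slo (frac s) p (rep_L0 (weak_deriv \<nu> u)) < \<infinity>))"
  using frac_ge_0[of s] unfolding sobolev_def slobodeckij_int_eq by (cases "frac s = 0") auto

lemma sobolev_weak_deriv:
  assumes "u \<in> sobolev s p"
  shows "mi_order \<nu> \<le> nat \<lfloor>s\<rfloor> \<Longrightarrow> wd \<nu> u (weak_deriv \<nu> u)" "mi_order \<nu> \<le> nat \<lfloor>s\<rfloor> \<Longrightarrow> weak_deriv \<nu> u \<in> Lp p"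
    "0 < frac s \<Longrightarrow> mi_order \<nu> = nat \<lfloor>s\<rfloor> \<Longrightarrow> Slo (frac s) p (rep_L0 (weak_deriv \<nu> u)) < \<infinity>"
  using assms sobolev_nat_weak_deriv unfolding sobolev_iff by blast+

lemma sobolev_Lp: "u \<in> sobolev s p \<Longrightarrow> u \<in> Lp p"
  by (simp add: sobolev_iff sobolev_nat_def)

lemma sobolev_zero_deriv:
  assumes "u \<in> sobolev s p" "1 \<le> p" shows "weak_deriv (\<lambda>_. 0) u = u"
  using sobolev_Lp[OF assms(1)] assms(2)
  by (intro weak_deriv_eqI wd_zero locally_integrable_Lpow[of _ p]) (auto simp: Lp_iff)

lemma sobolevI:
  assumes "u \<in> Lp p" "\<And>\<nu>. mi_order \<nu> \<le> nat \<lfloor>s\<rfloor> \<Longrightarrow> wd \<nu> u (g \<nu>)" "\<And>\<nu>. mi_order \<nu> \<le> nat \<lfloor>s\<rfloor> \<Longrightarrow> Lpow p (rep_L0 (g \<nu>)) < \<infinity>"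
    "\<And>\<nu>. 0 < frac s \<Longrightarrow> mi_order \<nu> = nat \<lfloor>s\<rfloor> \<Longrightarrow> Slo (frac s) p (rep_L0 (g \<nu>)) < \<infinity>"
  shows "u \<in> sobolev s p"
proof -
  have w: "weak_deriv \<nu> u = g \<nu>" if "mi_order \<nu> \<le> nat \<lfloor>s\<rfloor>" for \<nu> by (rule weak_deriv_eqI[OF assms(2)[OF that]])
  have "u \<in> sobolev_nat (nat \<lfloor>s\<rfloor>) p"
    unfolding sobolev_nat_def
  proof (intro CollectI conjI allI impI)
    fix \<nu> :: "'a \<Rightarrow> nat" assume "mi_order \<nu> \<le> nat \<lfloor>s\<rfloor>"
    from assms(2,3)[OF this] show "\<exists>g\<in>Lp p. wd \<nu> u g" by (intro bexI[of _ "g \<nu>"]) (simp_all add: Lp_iff)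
  qed (rule assms(1))
  moreover have "Slo (frac s) p (rep_L0 (weak_deriv \<nu> u)) < \<infinity>" if "0 < frac s" "mi_order \<nu> = nat \<lfloor>s\<rfloor>" for \<nu>
    using assms(4)[OF that] w[of \<nu>] that by simp
  ultimately show ?thesis unfolding sobolev_iff by blast
qed

lemma sobolev_lincomb:
  assumes u: "u \<in> sobolev s p" and v: "v \<in> sobolev s p" and p: "1 \<le> p"
  shows "u + c *\<^sub>R v \<in> sobolev s p"
    and "mi_order \<nu> \<le> nat \<lfloor>s\<rfloor> \<Longrightarrow> weak_deriv \<nu> (u + c *\<^sub>R v) = weak_deriv \<nu> u + c *\<^sub>R weak_deriv \<nu> v"
proof -
  have fin: "Lpow p (rep_L0 (f + c *\<^sub>R g)) < \<infinity>" if "f \<in> Lp p" "g \<in> Lp p" for f g :: "'a L0"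
    by (rule le_less_trans[OF Lpow_rep_lincomb]) (use that p in \<open>auto simp: Lp_iff ennreal_mult_less_top\<close>)
  have d: "wd \<nu> (u + c *\<^sub>R v) (weak_deriv \<nu> u + c *\<^sub>R weak_deriv \<nu> v)" if "mi_order \<nu> \<le> nat \<lfloor>s\<rfloor>" for \<nu>
    by (intro wd_lincomb sobolev_weak_deriv(1)[OF u] sobolev_weak_deriv(1)[OF v] that)
  show "u + c *\<^sub>R v \<in> sobolev s p"
  proof (rule sobolevI[where g = "\<lambda>\<nu>. weak_deriv \<nu> u + c *\<^sub>R weak_deriv \<nu> v"])
    show "u + c *\<^sub>R v \<in> Lp p" using fin sobolev_Lp[OF u] sobolev_Lp[OF v] by (simp add: Lp_iff)
    show "Lpow p (rep_L0 (weak_deriv \<nu> u + c *\<^sub>R weak_deriv \<nu> v)) < \<infinity>" if "mi_order \<nu> \<le> nat \<lfloor>s\<rfloor>" for \<nu>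
      by (intro fin sobolev_weak_deriv(2)[OF u] sobolev_weak_deriv(2)[OF v] that)
    show "Slo (frac s) p (rep_L0 (weak_deriv \<nu> u + c *\<^sub>R weak_deriv \<nu> v)) < \<infinity>" if "0 < frac s" "mi_order \<nu> = nat \<lfloor>s\<rfloor>" for \<nu>
      by (rule le_less_trans[OF Slo_rep_lincomb])
         (use sobolev_weak_deriv(3)[OF u that] sobolev_weak_deriv(3)[OF v that] p in \<open>auto simp: ennreal_mult_less_top\<close>)
  qed (rule d)
  show "mi_order \<nu> \<le> nat \<lfloor>s\<rfloor> \<Longrightarrow> weak_deriv \<nu> (u + c *\<^sub>R v) = weak_deriv \<nu> u + c *\<^sub>R weak_deriv \<nu> v"
    by (rule weak_deriv_eqI[OF d])
qed

lemma zero_in_sobolev: "u \<in> sobolev s p \<Longrightarrow> 1 \<le> p \<Longrightarrow> (0 :: 'n L0) \<in> sobolev s p" for u :: "'n::finite L0"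
  using sobolev_lincomb(1)[of u s p u "-1"] by simp

lemma sobolev_add: "u \<in> sobolev s p \<Longrightarrow> v \<in> sobolev s p \<Longrightarrow> 1 \<le> p \<Longrightarrow> u + v \<in> sobolev s p"
  using sobolev_lincomb(1)[of u s p v 1] by simp

lemma sobolev_diff: "u \<in> sobolev s p \<Longrightarrow> v \<in> sobolev s p \<Longrightarrow> 1 \<le> p \<Longrightarrow> u - v \<in> sobolev s p"
  using sobolev_lincomb(1)[of u s p v "-1"] by simp

lemma sobolev_scaleR: "u \<in> sobolev s p \<Longrightarrow> 1 \<le> p \<Longrightarrow> c *\<^sub>R u \<in> sobolev s p"
  using sobolev_lincomb(1)[OF zero_in_sobolev, of u s p u c] by simp

lemma sobolev_norm_alt:
  "sobolev_norm s p u = (\<Sum>\<nu> | mi_order \<nu> \<le> nat \<lfloor>s\<rfloor>. Lp_norm p (weak_deriv \<nu> u)) +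
    (if 0 < frac s then \<Sum>\<nu> | mi_order \<nu> = nat \<lfloor>s\<rfloor>. slobodeckij_seminorm (frac s) p (weak_deriv \<nu> u) else 0)"
  using frac_ge_0[of s] by (auto simp: sobolev_norm_def sobolev_nat_norm_def)

lemma sobolev_norm_nonneg: "sobolev_norm s p u \<ge> 0"
  unfolding sobolev_norm_alt by (auto intro!: add_nonneg_nonneg sum_nonneg simp: Lp_norm_nonneg seminorm_nonneg)

lemma sobolev_norm_bounds:
  assumes u: "u \<in> sobolev s p" and p: "1 \<le> p"
  shows "mi_order \<nu> \<le> nat \<lfloor>s\<rfloor> \<Longrightarrow> Lpow p (rep_L0 (weak_deriv \<nu> u)) \<le> ennreal (sobolev_norm s p u powr p)"
    and "0 < frac s \<Longrightarrow> mi_order \<nu> = nat \<lfloor>s\<rfloor> \<Longrightarrow> Slo (frac s) p (rep_L0 (weak_deriv \<nu> u)) \<le> ennreal (sobolev_norm s p u powr p)"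
proof -
  assume \<nu>: "mi_order \<nu> \<le> nat \<lfloor>s\<rfloor>"
  have "Lp_norm p (weak_deriv \<nu> u) \<le> (\<Sum>\<nu> | mi_order \<nu> \<le> nat \<lfloor>s\<rfloor>. Lp_norm p (weak_deriv \<nu> u))"
    by (rule member_le_sum[where f = "\<lambda>\<nu>. Lp_norm p (weak_deriv \<nu> u)"]) (use \<nu> finite_mi in \<open>auto simp: Lp_norm_nonneg\<close>)
  also have "\<dots> \<le> sobolev_norm s p u" unfolding sobolev_norm_alt by (auto intro!: sum_nonneg simp: seminorm_nonneg)
  finally have "Lp_norm p (weak_deriv \<nu> u) powr p \<le> sobolev_norm s p u powr p"
    using p by (intro powr_mono2) (auto simp: Lp_norm_nonneg)
  thus "Lpow p (rep_L0 (weak_deriv \<nu> u)) \<le> ennreal (sobolev_norm s p u powr p)"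
    using Lpow_eq_Lp_norm[OF sobolev_weak_deriv(2)[OF u \<nu>]] p by (simp add: ennreal_leI)
next
  assume \<nu>: "0 < frac s" "mi_order \<nu> = nat \<lfloor>s\<rfloor>"
  have "slobodeckij_seminorm (frac s) p (weak_deriv \<nu> u) \<le> (\<Sum>\<nu> | mi_order \<nu> = nat \<lfloor>s\<rfloor>. slobodeckij_seminorm (frac s) p (weak_deriv \<nu> u))"
    by (rule member_le_sum[where f = "\<lambda>\<nu>. slobodeckij_seminorm (frac s) p (weak_deriv \<nu> u)"]) (use \<nu> finite_mi_eq in \<open>auto simp: seminorm_nonneg\<close>)
  also have "\<dots> \<le> sobolev_norm s p u" unfolding sobolev_norm_alt using \<nu> by (auto intro!: sum_nonneg simp: Lp_norm_nonneg)
  finally have "slobodeckij_seminorm (frac s) p (weak_deriv \<nu> u) powr p \<le> sobolev_norm s p u powr p"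
    using p by (intro powr_mono2) (auto simp: seminorm_nonneg)
  thus "Slo (frac s) p (rep_L0 (weak_deriv \<nu> u)) \<le> ennreal (sobolev_norm s p u powr p)"
    using Slo_eq_seminorm[OF sobolev_weak_deriv(3)[OF u \<nu>]] p by (simp add: ennreal_leI)
qed

text \<open>Together with \<open>sobolev_norm_bounds\<close> this allows one to work with \<open>p\<close>-th powers of the single terms
  instead of the norm, up to constants.\<close>

lemma sobolev_norm_le:
  fixes u :: "'n::finite L0"
  assumes u: "u \<in> sobolev s p" and p: "1 \<le> p" and e: "e \<ge> 0"
    and L: "\<And>\<nu>. mi_order \<nu> \<le> nat \<lfloor>s\<rfloor> \<Longrightarrow> Lpow p (rep_L0 (weak_deriv \<nu> u)) \<le> ennreal (e powr p)"
    and S: "\<And>\<nu>. 0 < frac s \<Longrightarrow> mi_order \<nu> = nat \<lfloor>s\<rfloor> \<Longrightarrow> Slo (frac s) p (rep_L0 (weak_deriv \<nu> u)) \<le> ennreal (e powr p)"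
  shows "sobolev_norm s p u \<le> 2 * real (card {\<nu> :: 'n \<Rightarrow> nat. mi_order \<nu> \<le> nat \<lfloor>s\<rfloor>}) * e"
proof -
  let ?A = "{\<nu> :: 'n \<Rightarrow> nat. mi_order \<nu> \<le> nat \<lfloor>s\<rfloor>}" and ?B = "{\<nu> :: 'n \<Rightarrow> nat. mi_order \<nu> = nat \<lfloor>s\<rfloor>}"
  have 1: "(\<Sum>\<nu>\<in>?A. Lp_norm p (weak_deriv \<nu> u)) \<le> real (card ?A) * e"
  proof (rule sum_bounded_above)
    fix \<nu> :: "'n \<Rightarrow> nat" assume "\<nu> \<in> ?A"
    hence \<nu>: "mi_order \<nu> \<le> nat \<lfloor>s\<rfloor>" by simp
    have "ennreal (Lp_norm p (weak_deriv \<nu> u) powr p) \<le> ennreal (e powr p)"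
      using Lpow_eq_Lp_norm[OF sobolev_weak_deriv(2)[OF u \<nu>]] L[OF \<nu>] p by simp
    hence "Lp_norm p (weak_deriv \<nu> u) powr p \<le> e powr p" by (subst (asm) ennreal_le_iff) auto
    thus "Lp_norm p (weak_deriv \<nu> u) \<le> e" by - (rule powr_le_cancel_base[of _ _ p], use p e in \<open>auto simp: Lp_norm_nonneg\<close>)
  qed
  have 2: "(\<Sum>\<nu>\<in>?B. slobodeckij_seminorm (frac s) p (weak_deriv \<nu> u)) \<le> real (card ?B) * e" if f: "0 < frac s"
  proof (rule sum_bounded_above)
    fix \<nu> :: "'n \<Rightarrow> nat" assume "\<nu> \<in> ?B"
    hence \<nu>: "mi_order \<nu> = nat \<lfloor>s\<rfloor>" by simp
    have "ennreal (slobodeckij_seminorm (frac s) p (weak_deriv \<nu> u) powr p) \<le> ennreal (e powr p)"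
      using Slo_eq_seminorm[OF sobolev_weak_deriv(3)[OF u f \<nu>]] S[OF f \<nu>] p by simp
    hence "slobodeckij_seminorm (frac s) p (weak_deriv \<nu> u) powr p \<le> e powr p" by (subst (asm) ennreal_le_iff) auto
    thus "slobodeckij_seminorm (frac s) p (weak_deriv \<nu> u) \<le> e" by - (rule powr_le_cancel_base[of _ _ p], use p e in \<open>auto simp: seminorm_nonneg\<close>)
  qed
  have "real (card ?B) * e \<le> real (card ?A) * e"
    using e finite_mi by (intro mult_right_mono of_nat_mono card_mono) auto
  moreover have "0 \<le> real (card ?A) * e" using e by simp
  ultimately show ?thesis using 1 2 unfolding sobolev_norm_alt by (cases "0 < frac s") auto
qed

lemma Lp_norm_scaleR: "Lp_norm p (c *\<^sub>R u) = \<bar>c\<bar> * Lp_norm p u" if "p > 0"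
proof -
  have "(\<integral>x. \<bar>rep_L0 (c *\<^sub>R u) x\<bar> powr p \<partial>lborel) = (\<integral>x. \<bar>c\<bar> powr p * \<bar>rep_L0 u x\<bar> powr p \<partial>lborel)"
    by (rule integral_cong_AE) (use rep_scaleR_L0[of c u] in \<open>auto simp: abs_mult powr_mult elim: AE_mp\<close>)
  also have "\<dots> = \<bar>c\<bar> powr p * (\<integral>x. \<bar>rep_L0 u x\<bar> powr p \<partial>lborel)" by simp
  finally show ?thesis using that by (simp add: Lp_norm_def powr_mult powr_powr)
qed

lemma seminorm_scaleR: "slobodeckij_seminorm \<theta> p (c *\<^sub>R u) = \<bar>c\<bar> * slobodeckij_seminorm \<theta> p u" if "p > 0"
proof -
  have "Slo \<theta> p (rep_L0 (c *\<^sub>R u)) = Slo \<theta> p (\<lambda>x. c * rep_L0 u x)"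
    by (rule Slo_cong_AE) (use rep_scaleR_L0[of c u] in auto)
  also have "\<dots> = ennreal (\<bar>c\<bar> powr p) * Slo \<theta> p (rep_L0 u)" by (rule Slo_cmult) measurable
  finally show ?thesis using that by (simp add: slobodeckij_seminorm_def slobodeckij_int_eq enn2real_mult powr_mult powr_powr)
qed

lemma sobolev_norm_scaleR:
  assumes u: "u \<in> sobolev s p" and p: "1 \<le> p"
  shows "sobolev_norm s p (c *\<^sub>R u) = \<bar>c\<bar> * sobolev_norm s p u"
proof -
  have w: "weak_deriv \<nu> (c *\<^sub>R u) = c *\<^sub>R weak_deriv \<nu> u" if "mi_order \<nu> \<le> nat \<lfloor>s\<rfloor>" for \<nu>
  proof -
    have "weak_deriv \<nu> (u + (c - 1) *\<^sub>R u) = weak_deriv \<nu> u + (c - 1) *\<^sub>R weak_deriv \<nu> u"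
      by (rule sobolev_lincomb(2)[OF u u p that])
    moreover have "x + (c - 1) *\<^sub>R x = c *\<^sub>R x" for x :: "'a L0" by (simp add: algebra_simps)
    ultimately show ?thesis by simp
  qed
  have "(\<Sum>\<nu> | mi_order \<nu> \<le> nat \<lfloor>s\<rfloor>. Lp_norm p (weak_deriv \<nu> (c *\<^sub>R u))) = \<bar>c\<bar> * (\<Sum>\<nu> | mi_order \<nu> \<le> nat \<lfloor>s\<rfloor>. Lp_norm p (weak_deriv \<nu> u))"
    unfolding sum_distrib_left by (intro sum.cong) (use p in \<open>auto simp: w Lp_norm_scaleR\<close>)
  moreover have "(\<Sum>\<nu> | mi_order \<nu> = nat \<lfloor>s\<rfloor>. slobodeckij_seminorm (frac s) p (weak_deriv \<nu> (c *\<^sub>R u))) = \<bar>c\<bar> * (\<Sum>\<nu> | mi_order \<nu> = nat \<lfloor>s\<rfloor>. slobodeckij_seminorm (frac s) p (weak_deriv \<nu> u))"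
    unfolding sum_distrib_left by (intro sum.cong) (use p in \<open>auto simp: w seminorm_scaleR\<close>)
  ultimately show ?thesis unfolding sobolev_norm_alt by (simp add: distrib_left)
qed

section \<open>Test functions\<close>

lemma Slo_Cc_finite:
  fixes f :: "real ^ 'n::finite \<Rightarrow> real"
  assumes f: "f \<in> Cc_infty" and p: "1 \<le> p" and \<theta>: "0 < \<theta>" "\<theta> < 1"
  shows "Slo \<theta> p f < \<infinity>"
proof -
  obtain C where C: "\<And>f::real^'n \<Rightarrow> real. \<And>G. G \<ge> 0 \<Longrightarrow> f \<in> Cc_infty \<Longrightarrow> Lpow p f \<le> ennreal (G powr p) \<Longrightarrow>
     (\<And>i. Lpow p (partial_deriv i f) \<le> ennreal (G powr p)) \<Longrightarrow> Slo \<theta> p f \<le> ennreal ((C * G) powr p)"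
    using Slo_le_gradient[OF p \<theta>, where 'n = 'n] by blast
  define S where "S = Lpow p f + (\<Sum>i\<in>UNIV. Lpow p (partial_deriv i f))"
  have "S < \<infinity>" unfolding S_def using Lpow_Cc_finite[OF f] Lpow_Cc_finite[OF Cc_partial_deriv[OF f]] p by (auto simp: less_top)
  then obtain r where r: "S = ennreal r" "r \<ge> 0" by (cases S) auto
  have "(r powr (1 / p)) powr p = r" using r p by (simp add: powr_powr)
  have i: "Lpow p (partial_deriv i f) \<le> S" for i
    unfolding S_def by (rule order_trans[OF member_le_sum[of i UNIV]]) auto
  have f0: "Lpow p f \<le> S" unfolding S_def by simp
  have "Slo \<theta> p f \<le> ennreal ((C * r powr (1 / p)) powr p)"
    by (rule C[OF _ f]) (use i f0 r \<open>(r powr (1 / p)) powr p = r\<close> in auto)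
  thus ?thesis using le_less_trans by fastforce
qed

lemma abs_L0_Cc_wd:
  assumes f: "f \<in> Cc_infty" shows "wd \<nu> (abs_L0 f) (abs_L0 (mderiv \<nu> f))"
  by (rule has_weak_deriv_cong_AE[OF Cc_has_weak_deriv[OF f, of \<nu>]])
     (use rep_abs_L0[OF Cc_borel[OF f]] rep_abs_L0[OF Cc_borel[OF Cc_mderiv[OF f, of \<nu>]]] in \<open>auto elim: AE_mp\<close>)

lemma Lpow_rep_abs: "f \<in> borel_measurable borel \<Longrightarrow> Lpow p (rep_L0 (abs_L0 f)) = Lpow p f"
  by (rule Lpow_cong_AE) (rule rep_abs_L0)

lemma Slo_rep_abs: "f \<in> borel_measurable borel \<Longrightarrow> Slo \<theta> p (rep_L0 (abs_L0 f)) = Slo \<theta> p f"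
  by (rule Slo_cong_AE) (auto intro: rep_abs_L0)

lemma Cc_in_sobolev:
  assumes f: "f \<in> Cc_infty" and p: "1 \<le> p"
  shows "abs_L0 f \<in> sobolev s p" and "weak_deriv \<nu> (abs_L0 f) = abs_L0 (mderiv \<nu> f)"
proof -
  note b = Cc_borel[OF f] Cc_borel[OF Cc_mderiv[OF f]]
  show "abs_L0 f \<in> sobolev s p"
  proof (rule sobolevI[where g = "\<lambda>\<nu>. abs_L0 (mderiv \<nu> f)"])
    show "abs_L0 f \<in> Lp p" using Lpow_Cc_finite[OF f, of p] p by (simp add: Lp_iff Lpow_rep_abs b)
    show "Lpow p (rep_L0 (abs_L0 (mderiv \<nu> f))) < \<infinity>" for \<nu>
      using Lpow_Cc_finite[OF Cc_mderiv[OF f], of p] p by (simp add: Lpow_rep_abs b)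
    show "Slo (frac s) p (rep_L0 (abs_L0 (mderiv \<nu> f))) < \<infinity>" if "0 < frac s" for \<nu>
      using Slo_Cc_finite[OF Cc_mderiv[OF f] p that frac_lt_1] by (simp add: Slo_rep_abs b)
  qed (rule abs_L0_Cc_wd[OF f])
  show "weak_deriv \<nu> (abs_L0 f) = abs_L0 (mderiv \<nu> f)" by (rule weak_deriv_eqI[OF abs_L0_Cc_wd[OF f]])
qed


section \<open>Density of test functions\<close>

lemma mderiv_convl:
  assumes "k \<in> Cc_infty" "integrable lborel h"
  shows "mderiv \<nu> (convl k h) = convl (mderiv \<nu> k) h"
  using convl_Dl[OF assms] by (metis mderiv_list)

lemma tail_Lpow_tendsto:
  fixes g :: "real ^ 'n::finite \<Rightarrow> real"
  assumes [measurable]: "g \<in> borel_measurable borel" and fin: "Lpow p g < \<infinity>"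
  shows "(\<lambda>R. Lpow p (\<lambda>x. indicator (- cball 0 (real R)) x * g x)) \<longlonglongrightarrow> 0"
proof -
  have [measurable]: "- cball (0::real^'n) (real R) \<in> sets borel" for R by simp
  have "(\<lambda>R. Lpow p (\<lambda>x. indicator (- cball 0 (real R)) x * g x)) \<longlonglongrightarrow> (\<integral>\<^sup>+x. 0 \<partial>(lborel :: (real^'n) measure))"
    unfolding Lpow_def
  proof (rule nn_integral_dominated_convergence[where w = "\<lambda>x. ennreal (\<bar>g x\<bar> powr p)"])
    show "AE x in lborel. ennreal (\<bar>indicator (- cball 0 (real R)) x * g x\<bar> powr p) \<le> ennreal (\<bar>g x\<bar> powr p)" for R
      by (intro AE_I2) (auto simp: indicator_def)
    show "AE x in lborel. (\<lambda>R. ennreal (\<bar>indicator (- cball 0 (real R)) x * g x\<bar> powr p)) \<longlonglongrightarrow> 0"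
    proof (rule AE_I2)
      fix x :: "real^'n"
      obtain N :: nat where N: "norm x \<le> real N" using real_arch_simple by blast
      have "eventually (\<lambda>R. ennreal (\<bar>indicator (- cball 0 (real R)) x * g x\<bar> powr p) = 0) sequentially"
        using eventually_ge_at_top[of N] by eventually_elim (use N in auto)
      thus "(\<lambda>R. ennreal (\<bar>indicator (- cball 0 (real R)) x * g x\<bar> powr p)) \<longlonglongrightarrow> 0" by (rule tendsto_eventually)
    qed
  qed (use fin in \<open>auto simp: Lpow_def\<close>)
  thus ?thesis by simp
qed

lemma ennreal_bound_tendsto_0:
  fixes f g :: "nat \<Rightarrow> ennreal"
  assumes "g \<longlonglongrightarrow> 0" "C < \<infinity>" "\<And>i. f i \<le> C * g i"
  shows "f \<longlonglongrightarrow> 0"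
proof (rule tendsto_sandwich[where f = "\<lambda>_. 0" and h = "\<lambda>i. C * g i"])
  have "(\<lambda>i. C * g i) \<longlonglongrightarrow> C * 0" by (intro ennreal_tendsto_cmult assms) (use assms in auto)
  thus "(\<lambda>i. C * g i) \<longlonglongrightarrow> 0" by simp
qed (use assms in auto)

text \<open>For \<open>\<eta>\<close> a mollifier and \<open>f = \<eta> * (1\<^sub>B u)\<close> with a ball \<open>B\<close> of radius \<open>R\<close>, the error in the derivative \<open>w \<nu>\<close>
  splits into the mollification error \<open>w \<nu> - \<eta> * w \<nu>\<close> and \<open>(\<partial>\<^sup>\<nu>\<eta>) * ((1 - 1\<^sub>B) u)\<close>. First \<open>\<eta>\<close> is fixed so
  that the former is small for all \<open>\<nu>\<close>, then \<open>R\<close>. Derivatives never fall on the cut-off, so no product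
  rule enters.\<close>

lemma Cc_dense_in_sobolev:
  fixes u :: "'n::finite L0"
  assumes u: "u \<in> sobolev s p" and p: "1 \<le> p" and \<delta>: "\<delta> > 0"
  shows "\<exists>f\<in>Cc_infty. sobolev_norm s p (u - abs_L0 f) < \<delta>"
proof -
  define k where "k = nat \<lfloor>s\<rfloor>"
  define A where "A = {\<nu> :: 'n \<Rightarrow> nat. mi_order \<nu> \<le> k}"
  have finA: "finite A" unfolding A_def by (rule finite_mi)
  define e where "e = \<delta> / (2 * real (card A) + 1)"
  have e: "e > 0" using \<delta> by (simp add: e_def add_nonneg_pos)
  \<comment> \<open>two errors of size \<open>\<epsilon>\<close> add up to \<open>e\<^sup>p\<close> after the quasi-triangle inequality\<close>
  define \<epsilon> where "\<epsilon> = e powr p / (2 * 2 powr p)"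
  have \<epsilon>: "\<epsilon> > 0" using e by (simp add: \<epsilon>_def)
  have \<epsilon>2: "ennreal (2 powr p) * (ennreal \<epsilon> + ennreal \<epsilon>) = ennreal (e powr p)"
    using \<epsilon> by (simp add: ennreal_mult'[symmetric] ennreal_plus[symmetric] \<epsilon>_def del: ennreal_plus)
  define w where "w \<nu> = rep_L0 (weak_deriv \<nu> u)" for \<nu>
  have wm[measurable]: "w \<nu> \<in> borel_measurable borel" for \<nu> by (simp add: w_def)
  have wd: "has_weak_deriv \<nu> (rep_L0 u) (w \<nu>)" and wf: "Lpow p (w \<nu>) < \<infinity>" if "\<nu> \<in> A" for \<nu>
    using sobolev_weak_deriv(1,2)[OF u, of \<nu>] that by (auto simp: w_def A_def k_def Lp_iff)
  have ws: "Slo (frac s) p (w \<nu>) < \<infinity>" if "0 < frac s" "mi_order \<nu> = k" for \<nu>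
    using sobolev_weak_deriv(3)[OF u] that by (simp add: w_def k_def)
  have ul: "Lpow p (rep_L0 u) < \<infinity>" using sobolev_Lp[OF u] by (simp add: Lp_iff)
  have uli: "locally_integrable (rep_L0 u)" by (rule locally_integrable_Lpow[OF _ ul p]) simp
  have "\<forall>m::nat. \<exists>\<eta> :: real^'n \<Rightarrow> real. mollifier (1 / (real m + 1)) \<eta>"
    by (intro allI mollifier_exists) (simp add: add_nonneg_pos)
  then obtain \<eta> :: "nat \<Rightarrow> real^'n \<Rightarrow> real" where \<eta>: "\<And>m. mollifier (1 / (real m + 1)) (\<eta> m)" by metis
  have "eventually (\<lambda>m. \<forall>\<nu>\<in>A. Lpow p (\<lambda>x. w \<nu> x - convl (\<eta> m) (w \<nu>) x) < ennreal \<epsilon> \<and>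
      (0 < frac s \<longrightarrow> mi_order \<nu> = k \<longrightarrow> Slo (frac s) p (\<lambda>x. w \<nu> x - convl (\<eta> m) (w \<nu>) x) < ennreal \<epsilon>)) sequentially"
  proof (rule eventually_ball_finite[OF finA], rule ballI)
    fix \<nu> assume \<nu>: "\<nu> \<in> A"
    have 1: "eventually (\<lambda>m. Lpow p (\<lambda>x. w \<nu> x - convl (\<eta> m) (w \<nu>) x) < ennreal \<epsilon>) sequentially"
      by (rule order_tendstoD(2)[OF mollify_Lpow_tendsto[OF \<eta> wm wf[OF \<nu>] p]]) (use \<epsilon> in simp)
    have 2: "eventually (\<lambda>m. 0 < frac s \<longrightarrow> mi_order \<nu> = k \<longrightarrow> Slo (frac s) p (\<lambda>x. w \<nu> x - convl (\<eta> m) (w \<nu>) x) < ennreal \<epsilon>) sequentially"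
    proof (cases "0 < frac s \<and> mi_order \<nu> = k")
      case True
      have "eventually (\<lambda>m. Slo (frac s) p (\<lambda>x. w \<nu> x - convl (\<eta> m) (w \<nu>) x) < ennreal \<epsilon>) sequentially"
        by (rule order_tendstoD(2)[OF mollify_Slo_tendsto[OF \<eta> wm wf[OF \<nu>] p ws]]) (use \<epsilon> True in auto)
      thus ?thesis by eventually_elim simp
    qed auto
    show "eventually (\<lambda>m. Lpow p (\<lambda>x. w \<nu> x - convl (\<eta> m) (w \<nu>) x) < ennreal \<epsilon> \<and>
      (0 < frac s \<longrightarrow> mi_order \<nu> = k \<longrightarrow> Slo (frac s) p (\<lambda>x. w \<nu> x - convl (\<eta> m) (w \<nu>) x) < ennreal \<epsilon>)) sequentially"
      using 1 2 by (rule eventually_conj)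
  qed
  then obtain m where m: "\<And>\<nu>. \<nu> \<in> A \<Longrightarrow> Lpow p (\<lambda>x. w \<nu> x - convl (\<eta> m) (w \<nu>) x) < ennreal \<epsilon>"
    "\<And>\<nu>. \<nu> \<in> A \<Longrightarrow> 0 < frac s \<Longrightarrow> mi_order \<nu> = k \<Longrightarrow> Slo (frac s) p (\<lambda>x. w \<nu> x - convl (\<eta> m) (w \<nu>) x) < ennreal \<epsilon>"
    using eventually_happens'[OF sequentially_bot] by blast
  have C: "\<eta> m \<in> Cc_infty" using \<eta>[of m] by (simp add: mollifier_def)
  define \<kappa> where "\<kappa> \<nu> = mderiv \<nu> (\<eta> m)" for \<nu>
  have \<kappa>C: "\<kappa> \<nu> \<in> Cc_infty" for \<nu> unfolding \<kappa>_def by (rule Cc_mderiv[OF C])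
  note [measurable] = Cc_borel[OF C] Cc_borel[OF \<kappa>C]
  have bm[measurable]: "- cball (0::real^'n) (real R) \<in> sets borel" "cball (0::real^'n) (real R) \<in> sets borel" for R by auto
  define H where "H R x = indicator (- cball 0 (real R)) x * rep_L0 u x" for R :: nat and x
  define h where "h R x = indicator (cball 0 (real R)) x * rep_L0 u x" for R :: nat and x
  have Hm[measurable]: "H R \<in> borel_measurable borel" for R unfolding H_def by measurable
  have hm[measurable]: "h R \<in> borel_measurable borel" for R unfolding h_def by measurable
  have Hlim: "(\<lambda>R. Lpow p (H R)) \<longlonglongrightarrow> 0" unfolding H_def by (rule tail_Lpow_tendsto[OF _ ul]) simp
  have Hf: "Lpow p (H R) < \<infinity>" for R
    by (rule le_less_trans[OF Lpow_mono[of "H R" "rep_L0 u"] ul]) (use p in \<open>auto simp: H_def indicator_def\<close>)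
  have "eventually (\<lambda>R. \<forall>\<nu>\<in>A. Lpow p (convl (\<kappa> \<nu>) (H R)) < ennreal \<epsilon> \<and>
      (0 < frac s \<longrightarrow> Slo (frac s) p (convl (\<kappa> \<nu>) (H R)) < ennreal \<epsilon>)) sequentially"
  proof (rule eventually_ball_finite[OF finA], rule ballI)
    fix \<nu> assume \<nu>: "\<nu> \<in> A"
    have "(\<lambda>R. Lpow p (convl (\<kappa> \<nu>) (H R))) \<longlonglongrightarrow> 0"
      by (rule ennreal_bound_tendsto_0[OF Hlim _ convl_Young[OF Cc_integrable[OF \<kappa>C] Hm p]]) simp
    hence 1: "eventually (\<lambda>R. Lpow p (convl (\<kappa> \<nu>) (H R)) < ennreal \<epsilon>) sequentially"
      by (rule order_tendstoD(2)) (use \<epsilon> in simp)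
    have 2: "eventually (\<lambda>R. 0 < frac s \<longrightarrow> Slo (frac s) p (convl (\<kappa> \<nu>) (H R)) < ennreal \<epsilon>) sequentially"
    proof (cases "0 < frac s")
      case True
      obtain c where c: "c < \<infinity>" "\<And>h. h \<in> borel_measurable borel \<Longrightarrow> Lpow p h < \<infinity> \<Longrightarrow> Slo (frac s) p (convl (\<kappa> \<nu>) h) \<le> c * Lpow p h"
        using Slo_convl_le[OF \<kappa>C[of \<nu>] p True frac_lt_1] by blast
      have "(\<lambda>R. Slo (frac s) p (convl (\<kappa> \<nu>) (H R))) \<longlonglongrightarrow> 0"
        by (rule ennreal_bound_tendsto_0[OF Hlim c(1) c(2)[OF Hm Hf]])
      hence "eventually (\<lambda>R. Slo (frac s) p (convl (\<kappa> \<nu>) (H R)) < ennreal \<epsilon>) sequentially"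
        by (rule order_tendstoD(2)) (use \<epsilon> in simp)
      thus ?thesis by eventually_elim simp
    qed simp
    show "eventually (\<lambda>R. Lpow p (convl (\<kappa> \<nu>) (H R)) < ennreal \<epsilon> \<and>
      (0 < frac s \<longrightarrow> Slo (frac s) p (convl (\<kappa> \<nu>) (H R)) < ennreal \<epsilon>)) sequentially"
      using 1 2 by (rule eventually_conj)
  qed
  then obtain R where R: "\<And>\<nu>. \<nu> \<in> A \<Longrightarrow> Lpow p (convl (\<kappa> \<nu>) (H R)) < ennreal \<epsilon>"
    "\<And>\<nu>. \<nu> \<in> A \<Longrightarrow> 0 < frac s \<Longrightarrow> Slo (frac s) p (convl (\<kappa> \<nu>) (H R)) < ennreal \<epsilon>"
    using eventually_happens'[OF sequentially_bot] by blast
  have hi: "integrable lborel (h R)"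
    using uli compact_cball[of "0::real^'n" "real R"] by (auto simp: locally_integrable_def set_integrable_def h_def[abs_def])
  define f where "f = convl (\<eta> m) (h R)"
  have f: "f \<in> Cc_infty" unfolding f_def
    by (rule convl_Cc[OF C hi, where S = "real R + 1"]) (auto simp: h_def)
  have md: "mderiv \<nu> f = convl (\<kappa> \<nu>) (h R)" for \<nu> unfolding f_def \<kappa>_def by (rule mderiv_convl[OF C hi])
  have split: "w \<nu> x - mderiv \<nu> f x = (w \<nu> x - convl (\<eta> m) (w \<nu>) x) + convl (\<kappa> \<nu>) (H R) x" if "\<nu> \<in> A" for \<nu> x
  proof -
    have "H R = (\<lambda>y. rep_L0 u y - h R y)" by (auto simp: H_def h_def indicator_def)
    hence "convl (\<kappa> \<nu>) (H R) x = convl (\<kappa> \<nu>) (rep_L0 u) x - convl (\<kappa> \<nu>) (h R) x"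
      using convl_diff_right[OF uli locally_integrable_integrable[OF hi] \<kappa>C] by simp
    moreover have "convl (\<eta> m) (w \<nu>) x = convl (\<kappa> \<nu>) (rep_L0 u) x"
      using weak_deriv_convl[OF wd[OF that] C] by (simp add: \<kappa>_def)
    ultimately show ?thesis by (simp add: md)
  qed
  note fS = Cc_in_sobolev[OF f p]
  note [measurable] = Cc_borel[OF f] Cc_borel[OF Cc_mderiv[OF f]]
  have rep: "AE x in lborel. rep_L0 (weak_deriv \<nu> (u - abs_L0 f)) x = w \<nu> x - mderiv \<nu> f x" if "\<nu> \<in> A" for \<nu>
  proof -
    have "weak_deriv \<nu> (u - abs_L0 f) = weak_deriv \<nu> u - abs_L0 (mderiv \<nu> f)"
      using sobolev_lincomb(2)[OF u fS(1) p, of \<nu> "-1"] that by (simp add: A_def k_def fS(2))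
    moreover have "AE x in lborel. rep_L0 (weak_deriv \<nu> u - abs_L0 (mderiv \<nu> f)) x = w \<nu> x - mderiv \<nu> f x"
      using rep_minus_L0[of "weak_deriv \<nu> u" "abs_L0 (mderiv \<nu> f)"] rep_abs_L0[OF Cc_borel[OF Cc_mderiv[OF f, of \<nu>]]]
      by eventually_elim (simp add: w_def)
    ultimately show ?thesis by simp
  qed
  have cm[measurable]: "convl (\<kappa> \<nu>) (H R) \<in> borel_measurable borel" "(\<lambda>x. w \<nu> x - convl (\<eta> m) (w \<nu>) x) \<in> borel_measurable borel" for \<nu>
    by measurable
  have "sobolev_norm s p (u - abs_L0 f) \<le> 2 * real (card A) * e"
    unfolding A_def k_def
  proof (rule sobolev_norm_le[OF sobolev_diff[OF u fS(1) p] p])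
    fix \<nu> :: "'n \<Rightarrow> nat" assume "mi_order \<nu> \<le> nat \<lfloor>s\<rfloor>"
    hence \<nu>: "\<nu> \<in> A" by (simp add: A_def k_def)
    have "Lpow p (rep_L0 (weak_deriv \<nu> (u - abs_L0 f))) = Lpow p (\<lambda>x. (w \<nu> x - convl (\<eta> m) (w \<nu>) x) + convl (\<kappa> \<nu>) (H R) x)"
      unfolding split[OF \<nu>, symmetric] by (rule Lpow_cong_AE[OF rep[OF \<nu>]])
    also have "\<dots> \<le> ennreal (2 powr p) * (Lpow p (\<lambda>x. w \<nu> x - convl (\<eta> m) (w \<nu>) x) + Lpow p (convl (\<kappa> \<nu>) (H R)))"
      by (rule Lpow_add_le[OF cm(2) cm(1)]) (use p in simp)
    also have "\<dots> \<le> ennreal (2 powr p) * (ennreal \<epsilon> + ennreal \<epsilon>)"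
      by (intro mult_left_mono add_mono less_imp_le[OF m(1)[OF \<nu>]] less_imp_le[OF R(1)[OF \<nu>]]) simp
    finally show "Lpow p (rep_L0 (weak_deriv \<nu> (u - abs_L0 f))) \<le> ennreal (e powr p)" unfolding \<epsilon>2 .
  next
    fix \<nu> :: "'n \<Rightarrow> nat" assume fs: "0 < frac s" and eq: "mi_order \<nu> = nat \<lfloor>s\<rfloor>"
    hence \<nu>: "\<nu> \<in> A" "mi_order \<nu> = k" by (auto simp: A_def k_def)
    have "Slo (frac s) p (rep_L0 (weak_deriv \<nu> (u - abs_L0 f))) = Slo (frac s) p (\<lambda>x. (w \<nu> x - convl (\<eta> m) (w \<nu>) x) + convl (\<kappa> \<nu>) (H R) x)"
      unfolding split[OF \<nu>(1), symmetric] by (rule Slo_cong_AE[OF rep[OF \<nu>(1)]]) measurable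
    also have "\<dots> \<le> ennreal (2 powr p) * (Slo (frac s) p (\<lambda>x. w \<nu> x - convl (\<eta> m) (w \<nu>) x) + Slo (frac s) p (convl (\<kappa> \<nu>) (H R)))"
      by (rule Slo_add_le[OF cm(2) cm(1)]) (use p in simp)
    also have "\<dots> \<le> ennreal (2 powr p) * (ennreal \<epsilon> + ennreal \<epsilon>)"
      by (intro mult_left_mono add_mono less_imp_le[OF m(2)[OF \<nu>(1) fs \<nu>(2)]] less_imp_le[OF R(2)[OF \<nu>(1) fs]]) simp
    finally show "Slo (frac s) p (rep_L0 (weak_deriv \<nu> (u - abs_L0 f))) \<le> ennreal (e powr p)" unfolding \<epsilon>2 .
  qed (use e in simp)
  also have "\<dots> < \<delta>" using \<delta> by (simp add: e_def field_simps)
  finally show ?thesis using f by blast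
qed

section \<open>Embeddings of Sobolev spaces\<close>

lemma Lbound_Fatou:
  fixes g :: "nat \<Rightarrow> real ^ 'n::finite \<Rightarrow> real"
  assumes b: "\<And>m. Lbound a K (g m)" and [measurable]: "\<And>m. g m \<in> borel_measurable borel" "h \<in> borel_measurable borel"
    and lim: "AE x in lborel. (\<lambda>m. g m x) \<longlonglongrightarrow> h x" and a: "a \<ge> 0"
  shows "Lbound a K h"
proof (cases "a = 0")
  case True
  have "AE x in lborel. \<forall>m. \<bar>g m x\<bar> \<le> K" using b True by (simp add: Lbound_def AE_all_countable)
  with lim have "AE x in lborel. \<bar>h x\<bar> \<le> K"
  proof eventually_elim
    case (elim x)
    show ?case by (rule LIMSEQ_le_const2[OF tendsto_rabs[OF elim(1)]]) (use elim(2) in auto)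
  qed
  thus ?thesis using True by (simp add: Lbound_def)
next
  case False
  have "Lpow (1 / a) h = (\<integral>\<^sup>+x. liminf (\<lambda>m. ennreal (\<bar>g m x\<bar> powr (1 / a))) \<partial>lborel)"
    unfolding Lpow_def
  proof (rule nn_integral_cong_AE)
    show "AE x in lborel. ennreal (\<bar>h x\<bar> powr (1 / a)) = liminf (\<lambda>m. ennreal (\<bar>g m x\<bar> powr (1 / a)))"
      using lim
    proof eventually_elim
      case (elim x)
      have "(\<lambda>m. ennreal (\<bar>g m x\<bar> powr (1 / a))) \<longlonglongrightarrow> ennreal (\<bar>h x\<bar> powr (1 / a))"
        using a False by (intro tendsto_ennrealI tendsto_powr' tendsto_rabs elim tendsto_const) auto
      from lim_imp_Liminf[OF sequentially_bot this] show ?case by simp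
    qed
  qed
  also have "\<dots> \<le> liminf (\<lambda>m. Lpow (1 / a) (g m))"
    unfolding Lpow_def by (rule nn_integral_liminf) measurable
  also have "\<dots> \<le> ennreal (K powr (1 / a))"
    using b False by (intro Liminf_le) (auto simp: Lbound_def)
  finally show ?thesis using False by (simp add: Lbound_def)
qed

lemma Lpow_zero_imp_AE_zero:
  assumes [measurable]: "f \<in> borel_measurable borel" and z: "Lpow p f = 0"
  shows "AE x in lborel. f x = 0"
proof -
  have "AE x in lborel. ennreal (\<bar>f x\<bar> powr p) = 0"
    using z unfolding Lpow_def by (subst nn_integral_0_iff_AE[symmetric]) auto
  thus ?thesis by eventually_elim simp
qed

text \<open>Convergence in \<open>L\<^sup>p\<close> yields a subsequence that converges almost everywhere.\<close>

lemma sobolev_approx_sequence: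
  fixes u :: "'n::finite L0"
  assumes u: "u \<in> sobolev s p" and p: "1 \<le> p" and \<delta>: "\<delta> > 0"
  shows "\<exists>f. (\<forall>m::nat. f m \<in> Cc_infty \<and> sobolev_norm s p (u - abs_L0 (f m)) < \<delta>) \<and> (AE x in lborel. (\<lambda>m. f m x) \<longlonglongrightarrow> rep_L0 u x)"
proof -
  have "\<forall>m::nat. \<exists>f\<in>Cc_infty. sobolev_norm s p (u - abs_L0 f) < \<delta> / (real m + 1)"
    using Cc_dense_in_sobolev[OF u p] \<delta> by (simp add: add_nonneg_pos)
  then obtain f where f: "\<And>m. f m \<in> Cc_infty" "\<And>m. sobolev_norm s p (u - abs_L0 (f m)) < \<delta> / (real m + 1)" by metis
  note [measurable] = Cc_borel[OF f(1)]
  have fS: "u - abs_L0 (f m) \<in> sobolev s p" for m by (rule sobolev_diff[OF u Cc_in_sobolev(1)[OF f(1) p] p])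
  define d where "d m x = \<bar>rep_L0 u x - f m x\<bar> powr p" for m x
  have dm[measurable]: "d m \<in> borel_measurable borel" for m unfolding d_def by measurable
  have Ld: "(\<integral>\<^sup>+x. ennreal (d m x) \<partial>lborel) \<le> ennreal ((\<delta> / (real m + 1)) powr p)" for m
  proof -
    have "AE x in lborel. rep_L0 u x - f m x = rep_L0 (u - abs_L0 (f m)) x"
      using rep_minus_L0[of u "abs_L0 (f m)"] rep_abs_L0[OF Cc_borel[OF f(1)[of m]]] by eventually_elim simp
    hence "(\<integral>\<^sup>+x. ennreal (d m x) \<partial>lborel) = Lpow p (rep_L0 (u - abs_L0 (f m)))"
      unfolding d_def Lpow_def[symmetric] by (rule Lpow_cong_AE)
    also have "\<dots> \<le> ennreal (sobolev_norm s p (u - abs_L0 (f m)) powr p)"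
      using sobolev_norm_bounds(1)[OF fS p, of "\<lambda>_. 0"] by (simp add: sobolev_zero_deriv[OF fS p] mi_order_def)
    also have "\<dots> \<le> ennreal ((\<delta> / (real m + 1)) powr p)"
      using f(2)[of m] p by (intro ennreal_leI powr_mono2) (auto simp: sobolev_norm_nonneg)
    finally show ?thesis .
  qed
  have di: "integrable lborel (d m)" for m
    by (intro integrableI_nonneg le_less_trans[OF Ld]) (auto simp: d_def)
  have dint: "(\<integral>x. norm (d m x) \<partial>lborel) \<le> (\<delta> / (real m + 1)) powr p" for m
  proof -
    have "ennreal (\<integral>x. d m x \<partial>lborel) = (\<integral>\<^sup>+x. ennreal (d m x) \<partial>lborel)"
      by (rule nn_integral_eq_integral[OF di, symmetric]) (auto simp: d_def)
    hence "ennreal (\<integral>x. d m x \<partial>lborel) \<le> ennreal ((\<delta> / (real m + 1)) powr p)" using Ld[of m] by simp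
    hence "(\<integral>x. d m x \<partial>lborel) \<le> (\<delta> / (real m + 1)) powr p" by (subst (asm) ennreal_le_iff) auto
    moreover have "norm (d m x) = d m x" for x by (simp add: d_def)
    ultimately show ?thesis by simp
  qed
  have "(\<lambda>m. \<delta> * (1 / (real m + 1))) \<longlonglongrightarrow> \<delta> * 0"
    using LIMSEQ_inverse_real_of_nat by (intro tendsto_intros) (simp add: inverse_eq_divide add.commute)
  hence "(\<lambda>m. (\<delta> / (real m + 1)) powr p) \<longlonglongrightarrow> 0 powr p"
    using p \<delta> by (intro tendsto_powr' tendsto_const) auto
  hence up: "(\<lambda>m. (\<delta> / (real m + 1)) powr p) \<longlonglongrightarrow> 0" by simp
  have lim0: "(\<lambda>m. \<integral>x. norm (d m x) \<partial>lborel) \<longlonglongrightarrow> 0"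
  proof (rule tendsto_sandwich[OF _ _ tendsto_const up])
    show "\<forall>\<^sub>F m in sequentially. 0 \<le> (\<integral>x. norm (d m x) \<partial>lborel)"
      by (intro always_eventually allI Bochner_Integration.integral_nonneg norm_ge_zero)
    show "\<forall>\<^sub>F m in sequentially. (\<integral>x. norm (d m x) \<partial>lborel) \<le> (\<delta> / (real m + 1)) powr p"
      by (intro always_eventually allI dint)
  qed
  obtain r :: "nat \<Rightarrow> nat" where r: "strict_mono r" "AE x in lborel. (\<lambda>m. d (r m) x) \<longlonglongrightarrow> 0"
    using tendsto_L1_AE_subseq[OF di lim0] by blast
  have "AE x in lborel. (\<lambda>m. f (r m) x) \<longlonglongrightarrow> rep_L0 u x"
    using r(2)
  proof eventually_elim
    case (elim x)
    have "(\<lambda>m. d (r m) x powr (1 / p)) \<longlonglongrightarrow> 0 powr (1 / p)"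
      using p by (intro tendsto_powr' elim tendsto_const) (auto simp: d_def)
    moreover have "d (r m) x powr (1 / p) = \<bar>rep_L0 u x - f (r m) x\<bar>" for m using p by (simp add: d_def powr_powr)
    ultimately have "(\<lambda>m. \<bar>rep_L0 u x - f (r m) x\<bar>) \<longlonglongrightarrow> 0" by simp
    hence "(\<lambda>m. rep_L0 u x - f (r m) x) \<longlonglongrightarrow> 0" by (simp add: tendsto_rabs_zero_iff)
    from tendsto_diff[OF tendsto_const[of "rep_L0 u x"] this] show ?case by simp
  qed
  moreover have "sobolev_norm s p (u - abs_L0 (f (r m))) < \<delta>" for m
  proof -
    have "\<delta> / (real (r m) + 1) \<le> \<delta> / 1" using \<delta> by (intro divide_left_mono) auto
    thus ?thesis using f(2)[of "r m"] by simp
  qed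
  ultimately show ?thesis using f(1) by (intro exI[of _ "\<lambda>m. f (r m)"]) auto
qed

text \<open>Test functions \<open>f m\<close> with norm distance less than \<open>N = \<parallel>u\<parallel>\<close> from \<open>u\<close> have all the terms of their norms
  bounded by \<open>4 N\<close>, so the embedding for test functions and Fatou's lemma give the claim if \<open>N > 0\<close>. If
  \<open>N = 0\<close> then \<open>u = 0\<close>.\<close>

lemma sobolev_embedding:
  assumes s: "0 \<le> s" and p: "1 \<le> p"
    and a: "0 \<le> a" "a \<le> 1 / p" "1 / p - a \<le> s / real CARD('n::finite)" and a0: "a = 0 \<Longrightarrow> 1 / p < s / real CARD('n)"
  shows "\<exists>C>0. \<forall>u\<in>sobolev s p. Lbound a (C * sobolev_norm s p u) (rep_L0 (u :: 'n L0))"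
proof -
  define k where "k = nat \<lfloor>s\<rfloor>"
  have sk: "s = real k + frac s" using s by (simp add: k_def frac_def)
  have \<theta>: "0 \<le> frac s" "frac s < 1" by (auto simp: frac_lt_1)
  obtain C where C: "C > 0" "\<And>f::real^'n \<Rightarrow> real. \<And>G. G \<ge> 0 \<Longrightarrow> f \<in> Cc_infty \<Longrightarrow> sob_bound k (frac s) p G f \<Longrightarrow> Lbound a (C * G) f"
    using sobolev_embedding_Cc[OF p \<theta> a(1,2), of k, where 'n = 'n] a(3) a0 sk by metis
  show ?thesis
  proof (intro exI[of _ "C * 4"] conjI ballI)
    show "C * 4 > 0" using C by simp
    fix u :: "'n L0" assume u: "u \<in> sobolev s p"
    define N where "N = sobolev_norm s p u"
    have N0: "N \<ge> 0" by (simp add: N_def sobolev_norm_nonneg)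
    show "Lbound a (C * 4 * sobolev_norm s p u) (rep_L0 u)"
    proof (cases "N = 0")
      case True
      have "Lpow p (rep_L0 u) \<le> ennreal (N powr p)"
        using sobolev_norm_bounds(1)[OF u p, of "\<lambda>_. 0"] by (simp add: sobolev_zero_deriv[OF u p] mi_order_def N_def)
      hence z: "AE x in lborel. rep_L0 u x = 0" using True by (intro Lpow_zero_imp_AE_zero[of _ p]) auto
      have "Lpow (1 / a) (rep_L0 u) = Lpow (1 / a) (\<lambda>x :: real^'n. 0)" by (rule Lpow_cong_AE) (use z in simp)
      thus ?thesis using True z unfolding N_def[symmetric] Lbound_def by (auto simp: Lpow_def elim: AE_mp)
    next
      case False
      hence N: "N > 0" using N0 by simp
      obtain f where f: "\<And>m::nat. f m \<in> Cc_infty" "\<And>m. sobolev_norm s p (u - abs_L0 (f m)) < N" "AE x in lborel. (\<lambda>m. f m x) \<longlonglongrightarrow> rep_L0 u x"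
        using sobolev_approx_sequence[OF u p N] by blast
      have "Lbound a (C * (4 * N)) (f m)" for m
      proof (rule C(2)[OF _ f(1)])
        let ?r = "u - abs_L0 (f m)"
        have fS: "abs_L0 (f m) \<in> sobolev s p" by (rule Cc_in_sobolev(1)[OF f(1) p])
        have rS: "?r \<in> sobolev s p" by (rule sobolev_diff[OF u fS p])
        have Nr: "ennreal (sobolev_norm s p ?r powr p) \<le> ennreal (N powr p)"
          using f(2)[of m] p by (intro ennreal_leI powr_mono2) (auto simp: sobolev_norm_nonneg)
        have dec: "abs_L0 (mderiv \<nu> (f m)) = weak_deriv \<nu> u + (- 1) *\<^sub>R weak_deriv \<nu> ?r" if "mi_order \<nu> \<le> k" for \<nu>
          using sobolev_lincomb(2)[OF u rS p, of \<nu> "-1"] that by (simp add: k_def Cc_in_sobolev(2)[OF f(1) p])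
        \<comment> \<open>the approximating function is the difference of \<open>u\<close> and a remainder, both of norm at most \<open>N\<close>\<close>
        have four: "ennreal (2 powr p) * (ennreal (N powr p) + ennreal (N powr p)) \<le> ennreal ((4 * N) powr p)"
        proof -
          have "(2::real) powr 1 \<le> 2 powr p" using p by (intro powr_mono) auto
          hence "2 powr p * (2 * N powr p) \<le> 2 powr p * (2 powr p * N powr p)" by (intro mult_left_mono mult_right_mono) auto
          also have "\<dots> = (4 * N) powr p" by (simp add: powr_mult[symmetric])
          finally show ?thesis by (simp add: ennreal_mult'[symmetric] ennreal_plus[symmetric] ennreal_leI del: ennreal_plus)
        qed
        have L: "Lpow p (mderiv \<nu> (f m)) \<le> ennreal ((4 * N) powr p)" if \<nu>: "mi_order \<nu> \<le> k" for \<nu>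
        proof -
          have "Lpow p (mderiv \<nu> (f m)) = Lpow p (rep_L0 (weak_deriv \<nu> u + (- 1) *\<^sub>R weak_deriv \<nu> ?r))"
            unfolding dec[OF \<nu>, symmetric] by (rule Lpow_rep_abs[symmetric]) (rule Cc_borel[OF Cc_mderiv[OF f(1)]])
          also have "\<dots> \<le> ennreal (2 powr p) * (Lpow p (rep_L0 (weak_deriv \<nu> u)) + ennreal (\<bar>-1\<bar> powr p) * Lpow p (rep_L0 (weak_deriv \<nu> ?r)))"
            by (rule Lpow_rep_lincomb) (use p in simp)
          also have "\<dots> \<le> ennreal (2 powr p) * (ennreal (N powr p) + ennreal (N powr p))"
            using sobolev_norm_bounds(1)[OF u p, of \<nu>] order_trans[OF sobolev_norm_bounds(1)[OF rS p, of \<nu>] Nr] \<nu>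
            by (intro mult_left_mono add_mono) (auto simp: k_def N_def)
          finally show ?thesis using four by (rule order_trans)
        qed
        have S: "Slo (frac s) p (mderiv \<nu> (f m)) \<le> ennreal ((4 * N) powr p)" if \<nu>: "mi_order \<nu> = k" and fs: "0 < frac s" for \<nu>
        proof -
          have "Slo (frac s) p (mderiv \<nu> (f m)) = Slo (frac s) p (rep_L0 (weak_deriv \<nu> u + (- 1) *\<^sub>R weak_deriv \<nu> ?r))"
            unfolding dec[OF eq_refl[OF \<nu>], symmetric] by (rule Slo_rep_abs[symmetric]) (rule Cc_borel[OF Cc_mderiv[OF f(1)]])
          also have "\<dots> \<le> ennreal (2 powr p) * (Slo (frac s) p (rep_L0 (weak_deriv \<nu> u)) + ennreal (\<bar>-1\<bar> powr p) * Slo (frac s) p (rep_L0 (weak_deriv \<nu> ?r)))"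
            by (rule Slo_rep_lincomb) (use p in simp)
          also have "\<dots> \<le> ennreal (2 powr p) * (ennreal (N powr p) + ennreal (N powr p))"
            using sobolev_norm_bounds(2)[OF u p fs, of \<nu>] order_trans[OF sobolev_norm_bounds(2)[OF rS p fs, of \<nu>] Nr] \<nu>
            by (intro mult_left_mono add_mono) (auto simp: k_def N_def)
          finally show ?thesis using four by (rule order_trans)
        qed
        show "sob_bound k (frac s) p (4 * N) (f m)"
          unfolding sob_bound_def using L S Dl_eq_mderiv[OF Cc_smooth[OF f(1)]] by metis
      qed (use N in simp)
      from Lbound_Fatou[OF this Cc_borel[OF f(1)] rep_L0_borel f(3) a(1)] show ?thesis by (simp add: N_def mult.assoc)
    qed
  qed
qed


section \<open>Hoelder exponents\<close>

text \<open>Here \<open>\<alpha>i = 1/p\<^sub>i\<close> and \<open>xi = s\<^sub>i/n\<close>. The admissible interval for \<open>ai\<close> is \<open>[max 0 (\<alpha>i - xi), \<alpha>i]\<close>, where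
  the left end must be avoided if it is \<open>0 = \<alpha>i - xi\<close>. The right ends have sum at least \<open>1\<close>. If the
  left ends have sum less than \<open>1\<close>, move from the left to the right ends at the same relative speed.
  Otherwise the strict hypotheses leave only the case that one of the first two functions is bounded,
  \<open>\<alpha>i < xi\<close>, and the other two left ends are positive with sum \<open>1\<close>; then the left ends do.\<close>

lemma Hoelder_exponents:
  fixes \<alpha>1 \<alpha>2 \<alpha>3 x1 x2 x3 :: real
  assumes \<alpha>: "0 < \<alpha>1" "\<alpha>1 < 1" "0 < \<alpha>2" "\<alpha>2 < 1" "0 < \<alpha>3" "\<alpha>3 < 1"
    and x: "0 \<le> x1" "0 \<le> x2" "0 \<le> x3"
    and ge1: "\<alpha>1 + \<alpha>2 + \<alpha>3 \<ge> 1" and c123: "\<alpha>1 + \<alpha>2 + \<alpha>3 - 1 < x1 + x2 + x3"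
    and c13: "\<alpha>1 + \<alpha>3 - 1 \<le> x1 + x3" and c23: "\<alpha>2 + \<alpha>3 - 1 \<le> x2 + x3" and c12: "\<alpha>1 + \<alpha>2 - 1 < x1 + x2"
  obtains a1 a2 a3 where "a1 + a2 + a3 = 1"
    "0 \<le> a1" "a1 \<le> \<alpha>1" "\<alpha>1 - a1 \<le> x1" "a1 = 0 \<Longrightarrow> \<alpha>1 < x1"
    "0 \<le> a2" "a2 \<le> \<alpha>2" "\<alpha>2 - a2 \<le> x2" "a2 = 0 \<Longrightarrow> \<alpha>2 < x2"
    "0 \<le> a3" "a3 \<le> \<alpha>3" "\<alpha>3 - a3 \<le> x3" "a3 = 0 \<Longrightarrow> \<alpha>3 < x3"
proof -
  define l where "l a y = max 0 (a - y :: real)" for a y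
  have l: "0 \<le> l a y" "0 \<le> y \<Longrightarrow> 0 \<le> a \<Longrightarrow> l a y \<le> a" "a - l a y \<le> y \<or> a - y < 0" "a - l a y \<le> y" for a y
    by (auto simp: l_def)
  let ?L = "l \<alpha>1 x1 + l \<alpha>2 x2 + l \<alpha>3 x3" and ?A = "\<alpha>1 + \<alpha>2 + \<alpha>3"
  show thesis
  proof (cases "?L < 1")
    case True
    \<comment> \<open>\<open>t\<close> is the fraction of the way at which the sum of the exponents reaches \<open>1\<close>\<close>
    define t where "t = (1 - ?L) / (?A - ?L)"
    have t: "0 < t" "t \<le> 1" using True ge1 by (auto simp: t_def divide_le_eq_1)
    have tA: "t * (?A - ?L) = 1 - ?L" using True ge1 by (simp add: t_def)
    define m where "m a y = l a y + t * (a - l a y)" for a y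
    have m: "0 < m a y" "m a y \<le> a" "a - m a y \<le> y" if "0 < a" "0 \<le> y" for a y
    proof -
      have eq: "m a y = (1 - t) * l a y + t * a" by (simp add: m_def algebra_simps)
      have "0 \<le> (1 - t) * l a y" using t l(1) by simp
      moreover have "0 < t * a" using t that by simp
      ultimately show "0 < m a y" unfolding eq by linarith
      have d: "0 \<le> a - l a y" using l(2)[of y a] that by simp
      have "t * (a - l a y) \<le> 1 * (a - l a y)" using t d by (intro mult_right_mono) auto
      thus "m a y \<le> a" by (simp add: m_def)
      have "0 \<le> t * (a - l a y)" using t d by simp
      thus "a - m a y \<le> y" using l(4)[of a y] by (simp add: m_def)
    qed
    have "m \<alpha>1 x1 + m \<alpha>2 x2 + m \<alpha>3 x3 = ?L + t * (?A - ?L)" by (simp add: m_def algebra_simps)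
    hence "m \<alpha>1 x1 + m \<alpha>2 x2 + m \<alpha>3 x3 = 1" using tA by simp
    thus thesis
      by (rule that) (use m(1)[of \<alpha>1 x1] m(1)[of \<alpha>2 x2] m(1)[of \<alpha>3 x3] m(2,3) \<alpha> x in \<open>auto intro: less_imp_le\<close>)
  next
    case False
    have "(\<alpha>1 < x1 \<and> ?L = 1 \<and> l \<alpha>2 x2 > 0 \<and> l \<alpha>3 x3 > 0) \<or> (\<alpha>2 < x2 \<and> ?L = 1 \<and> l \<alpha>1 x1 > 0 \<and> l \<alpha>3 x3 > 0)"
      using False \<alpha> x c123 c13 c23 c12 unfolding l_def by (auto simp: max_def split: if_splits)
    thus thesis
      by (intro that[of "l \<alpha>1 x1" "l \<alpha>2 x2" "l \<alpha>3 x3"]) (use l \<alpha> x in auto)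
  qed
qed

section \<open>The trilinear estimate\<close>

text \<open>The weighted inequality of arithmetic and geometric means. Compare \<open>ln\<close> with its tangent at the
  weighted arithmetic mean \<open>S\<close> and add up. Vanishing weights stand for bounded factors.\<close>

lemma product_le_weighted_sum:
  fixes x1 x2 x3 y1 y2 y3 a1 a2 a3 :: real
  assumes x: "0 \<le> x1" "0 \<le> x2" "0 \<le> x3" and a: "0 \<le> a1" "0 \<le> a2" "0 \<le> a3" "a1 + a2 + a3 = 1"
    and 1: "if a1 = 0 then x1 \<le> 1 else y1 = x1 powr (1 / a1)"
    and 2: "if a2 = 0 then x2 \<le> 1 else y2 = x2 powr (1 / a2)"
    and 3: "if a3 = 0 then x3 \<le> 1 else y3 = x3 powr (1 / a3)"
  shows "x1 * x2 * x3 \<le> a1 * y1 + a2 * y2 + a3 * y3"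
proof (cases "x1 = 0 \<or> x2 = 0 \<or> x3 = 0")
  case True
  have nn: "0 \<le> b * y" if "0 \<le> b" "if b = 0 then z \<le> 1 else y = z powr (1 / b)" for b y z :: real
    using that by (cases "b = 0") auto
  have "0 \<le> a1 * y1 + a2 * y2 + a3 * y3" using nn[OF a(1) 1] nn[OF a(2) 2] nn[OF a(3) 3] by simp
  thus ?thesis using True by auto
next
  case False
  define Y where "Y b y = (if b = 0 then 1 else y :: real)" for b y :: real
  have Yp: "Y b y > 0" "z \<le> exp (b * ln (Y b y))" "b * Y b y = b * y"
    if "0 \<le> b" "z > 0" "if b = 0 then z \<le> 1 else y = z powr (1 / b)" for b y z :: real
    using that by (auto simp: Y_def ln_powr)
  have xp: "x1 > 0" "x2 > 0" "x3 > 0" using x False by auto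
  note Y1 = Yp[OF a(1) xp(1) 1] and Y2 = Yp[OF a(2) xp(2) 2] and Y3 = Yp[OF a(3) xp(3) 3]
  define S where "S = a1 * Y a1 y1 + a2 * Y a2 y2 + a3 * Y a3 y3"
  have "a1 > 0 \<or> a2 > 0 \<or> a3 > 0" using a by linarith
  hence S: "S > 0" unfolding S_def using a Y1(1) Y2(1) Y3(1)
    by (smt (verit) mult_nonneg_nonneg mult_pos_pos)
  have tan: "b * ln Z \<le> b * (Z / S - 1 + ln S)" if "0 \<le> b" "Z > 0" for b Z :: real
  proof (rule mult_left_mono[OF _ that(1)])
    have "ln (Z / S) \<le> Z / S - 1" using that S by (intro ln_le_minus_one) simp
    thus "ln Z \<le> Z / S - 1 + ln S" using that S by (simp add: ln_div)
  qed
  have "x1 * x2 * x3 \<le> exp (a1 * ln (Y a1 y1)) * exp (a2 * ln (Y a2 y2)) * exp (a3 * ln (Y a3 y3))"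
    using Y1(2) Y2(2) Y3(2) xp by (intro mult_mono) auto
  also have "\<dots> = exp (a1 * ln (Y a1 y1) + a2 * ln (Y a2 y2) + a3 * ln (Y a3 y3))" by (simp add: exp_add)
  also have "\<dots> \<le> exp (ln S)"
  proof -
    have "a1 * ln (Y a1 y1) + a2 * ln (Y a2 y2) + a3 * ln (Y a3 y3)
       \<le> a1 * (Y a1 y1 / S - 1 + ln S) + a2 * (Y a2 y2 / S - 1 + ln S) + a3 * (Y a3 y3 / S - 1 + ln S)"
      using tan[OF a(1) Y1(1)] tan[OF a(2) Y2(1)] tan[OF a(3) Y3(1)] by linarith
    also have "\<dots> = S / S + (a1 + a2 + a3) * (ln S - 1)"
      unfolding S_def add_divide_distrib by (simp add: algebra_simps)
    also have "\<dots> = ln S" using S a(4) by simp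
    finally show ?thesis by simp
  qed
  also have "\<dots> = S" using S by simp
  also have "S = a1 * y1 + a2 * y2 + a3 * y3" by (simp add: S_def Y1(3) Y2(3) Y3(3))
  finally show ?thesis .
qed

lemma Lbound_zero:
  assumes "Lbound a 0 f" "f \<in> borel_measurable borel" shows "AE x in lborel. f x = 0"
proof (cases "a = 0")
  case True thus ?thesis using assms(1) by (auto simp: Lbound_def elim: AE_mp)
next
  case False
  hence "Lpow (1 / a) f = 0" using assms(1) by (simp add: Lbound_def)
  thus ?thesis by (rule Lpow_zero_imp_AE_zero[OF assms(2)])
qed

lemma Lbound_normalize:
  assumes b: "Lbound a K f" and K: "K > 0" and a: "a \<ge> 0" and [measurable]: "f \<in> borel_measurable borel"
  shows "AE x in lborel. a = 0 \<longrightarrow> \<bar>f x\<bar> / K \<le> 1"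
    and "(\<integral>\<^sup>+x. ennreal (a * (\<bar>f x\<bar> / K) powr (1 / a)) \<partial>lborel) \<le> ennreal a"
proof -
  show "AE x in lborel. a = 0 \<longrightarrow> \<bar>f x\<bar> / K \<le> 1"
    using b K by (cases "a = 0") (auto simp: Lbound_def elim: AE_mp)
  show "(\<integral>\<^sup>+x. ennreal (a * (\<bar>f x\<bar> / K) powr (1 / a)) \<partial>lborel) \<le> ennreal a"
  proof (cases "a = 0")
    case False
    have "(\<integral>\<^sup>+x. ennreal (a * (\<bar>f x\<bar> / K) powr (1 / a)) \<partial>lborel) = (\<integral>\<^sup>+x. ennreal (a / K powr (1 / a)) * ennreal (\<bar>f x\<bar> powr (1 / a)) \<partial>lborel)"
      using a by (intro nn_integral_cong) (simp add: ennreal_mult'[symmetric] powr_divide)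
    also have "\<dots> = ennreal (a / K powr (1 / a)) * Lpow (1 / a) f"
      unfolding Lpow_def by (rule nn_integral_cmult) measurable
    also have "\<dots> \<le> ennreal (a / K powr (1 / a)) * ennreal (K powr (1 / a))"
      using b False by (intro mult_left_mono) (auto simp: Lbound_def)
    also have "\<dots> = ennreal a" using a K by (simp add: ennreal_mult'[symmetric])
    finally show ?thesis .
  qed simp
qed

text \<open>Normalise the three functions and integrate the weighted mean inequality.\<close>

lemma three_factor_Hoelder:
  fixes f1 f2 f3 :: "real ^ 'n::finite \<Rightarrow> real"
  assumes a: "0 \<le> a1" "0 \<le> a2" "0 \<le> a3" "a1 + a2 + a3 = 1" and K: "0 \<le> K1" "0 \<le> K2" "0 \<le> K3"
    and b: "Lbound a1 K1 f1" "Lbound a2 K2 f2" "Lbound a3 K3 f3"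
    and m[measurable]: "f1 \<in> borel_measurable borel" "f2 \<in> borel_measurable borel" "f3 \<in> borel_measurable borel"
  shows "(\<integral>\<^sup>+x. ennreal \<bar>f1 x * f2 x * f3 x\<bar> \<partial>lborel) \<le> ennreal (K1 * K2 * K3)"
proof (cases "K1 = 0 \<or> K2 = 0 \<or> K3 = 0")
  case True
  hence "AE x in lborel. f1 x * f2 x * f3 x = 0"
  proof (elim disjE)
    assume "K1 = 0"
    from Lbound_zero[OF b(1)[unfolded this] m(1)] show ?thesis by eventually_elim simp
  next
    assume "K2 = 0"
    from Lbound_zero[OF b(2)[unfolded this] m(2)] show ?thesis by eventually_elim simp
  next
    assume "K3 = 0"
    from Lbound_zero[OF b(3)[unfolded this] m(3)] show ?thesis by eventually_elim simp
  qed
  hence "(\<integral>\<^sup>+x. ennreal \<bar>f1 x * f2 x * f3 x\<bar> \<partial>lborel) = (\<integral>\<^sup>+x. 0 \<partial>(lborel :: (real^'n) measure))"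
    by (intro nn_integral_cong_AE) (auto elim: AE_mp)
  thus ?thesis by simp
next
  case False
  hence Kp: "K1 > 0" "K2 > 0" "K3 > 0" using K by auto
  note n1 = Lbound_normalize[OF b(1) Kp(1) a(1) m(1)] and n2 = Lbound_normalize[OF b(2) Kp(2) a(2) m(2)] and n3 = Lbound_normalize[OF b(3) Kp(3) a(3) m(3)]
  define y1 where "y1 x = (\<bar>f1 x\<bar> / K1) powr (1 / a1)" for x
  define y2 where "y2 x = (\<bar>f2 x\<bar> / K2) powr (1 / a2)" for x
  define y3 where "y3 x = (\<bar>f3 x\<bar> / K3) powr (1 / a3)" for x
  have [measurable]: "y1 \<in> borel_measurable borel" "y2 \<in> borel_measurable borel" "y3 \<in> borel_measurable borel"
    unfolding y1_def y2_def y3_def by measurable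
  have pos: "0 \<le> y1 x" "0 \<le> y2 x" "0 \<le> y3 x" for x by (auto simp: y1_def y2_def y3_def)
  have "(\<integral>\<^sup>+x. ennreal \<bar>f1 x * f2 x * f3 x\<bar> \<partial>lborel) \<le> (\<integral>\<^sup>+x. ennreal (K1 * K2 * K3) * (ennreal (a1 * y1 x) + ennreal (a2 * y2 x) + ennreal (a3 * y3 x)) \<partial>lborel)"
  proof (rule nn_integral_mono_AE)
    show "AE x in lborel. ennreal \<bar>f1 x * f2 x * f3 x\<bar> \<le> ennreal (K1 * K2 * K3) * (ennreal (a1 * y1 x) + ennreal (a2 * y2 x) + ennreal (a3 * y3 x))"
      using n1(1) n2(1) n3(1)
    proof eventually_elim
      case (elim x)
      have "(\<bar>f1 x\<bar> / K1) * (\<bar>f2 x\<bar> / K2) * (\<bar>f3 x\<bar> / K3) \<le> a1 * y1 x + a2 * y2 x + a3 * y3 x"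
        by (rule product_le_weighted_sum[OF _ _ _ a]) (use elim Kp in \<open>auto simp: y1_def y2_def y3_def split: if_splits\<close>)
      from mult_left_mono[OF this, of "K1 * K2 * K3"]
      have "\<bar>f1 x * f2 x * f3 x\<bar> \<le> K1 * K2 * K3 * (a1 * y1 x + a2 * y2 x + a3 * y3 x)"
        using Kp by (simp add: abs_mult)
      thus ?case using Kp a pos[of x] by (simp add: ennreal_mult'[symmetric] ennreal_plus[symmetric] ennreal_leI del: ennreal_plus)
    qed
  qed
  also have "\<dots> = ennreal (K1 * K2 * K3) * ((\<integral>\<^sup>+x. ennreal (a1 * y1 x) \<partial>lborel) + (\<integral>\<^sup>+x. ennreal (a2 * y2 x) \<partial>lborel) + (\<integral>\<^sup>+x. ennreal (a3 * y3 x) \<partial>lborel))"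
    by (simp add: nn_integral_cmult nn_integral_add)
  also have "\<dots> \<le> ennreal (K1 * K2 * K3) * (ennreal a1 + ennreal a2 + ennreal a3)"
    using n1(2) n2(2) n3(2) unfolding y1_def y2_def y3_def by (intro mult_left_mono add_mono) auto
  also have "\<dots> = ennreal (K1 * K2 * K3)"
    using a Kp by (simp add: ennreal_plus[symmetric] del: ennreal_plus)
  finally show ?thesis .
qed

lemma trilinear_sobolev_estimate:
  fixes s1 s2 t p1 p2 p3 :: real
  assumes p: "1 < p1" "1 < p2" "1 < p3" and s: "0 \<le> s1" "0 \<le> s2" "0 \<le> t"
    and c13: "s1 + t \<ge> real CARD('n::finite) * (1 / p1 + 1 / p3 - 1)"
    and c23: "s2 + t \<ge> real CARD('n) * (1 / p2 + 1 / p3 - 1)"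
    and c123: "s1 + s2 + t > real CARD('n) * (1 / p1 + 1 / p2 + 1 / p3 - 1)"
    and ge: "1 / p1 + 1 / p2 + 1 / p3 \<ge> 1"
    and c12: "s1 + s2 > real CARD('n) * (1 / p1 + 1 / p2 - 1)"
  shows "\<exists>C>0. \<forall>u\<in>sobolev s1 p1. \<forall>v\<in>sobolev s2 p2. \<forall>\<psi>\<in>sobolev t p3.
     integrable lborel (\<lambda>x. rep_L0 (u :: 'n L0) x * rep_L0 v x * rep_L0 \<psi> x) \<and>
     \<bar>\<integral>x. rep_L0 u x * rep_L0 v x * rep_L0 \<psi> x \<partial>lborel\<bar> \<le> C * sobolev_norm s1 p1 u * sobolev_norm s2 p2 v * sobolev_norm t p3 \<psi>"
proof -
  define n where "n = real CARD('n)"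
  have n: "n > 0" by (simp add: n_def)
  have dv: "x \<le> y / n \<longleftrightarrow> n * x \<le> y" "x < y / n \<longleftrightarrow> n * x < y" for x y using n by (auto simp: field_simps)
  have d1: "1 / p1 + 1 / p3 - 1 \<le> s1 / n + t / n" "1 / p2 + 1 / p3 - 1 \<le> s2 / n + t / n"
    "1 / p1 + 1 / p2 + 1 / p3 - 1 < s1 / n + s2 / n + t / n" "1 / p1 + 1 / p2 - 1 < s1 / n + s2 / n"
    unfolding add_divide_distrib[symmetric] dv unfolding n_def by (fact c13 c23 c123 c12)+
  obtain a1 a2 a3 where a: "a1 + a2 + a3 = 1"
    "0 \<le> a1" "a1 \<le> 1 / p1" "1 / p1 - a1 \<le> s1 / n" "a1 = 0 \<Longrightarrow> 1 / p1 < s1 / n"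
    "0 \<le> a2" "a2 \<le> 1 / p2" "1 / p2 - a2 \<le> s2 / n" "a2 = 0 \<Longrightarrow> 1 / p2 < s2 / n"
    "0 \<le> a3" "a3 \<le> 1 / p3" "1 / p3 - a3 \<le> t / n" "a3 = 0 \<Longrightarrow> 1 / p3 < t / n"
    by (rule Hoelder_exponents[of "1 / p1" "1 / p2" "1 / p3" "s1 / n" "s2 / n" "t / n"]) (use p s n d1 ge in auto)
  obtain C1 where C1: "C1 > 0" "\<And>u :: 'n L0. u \<in> sobolev s1 p1 \<Longrightarrow> Lbound a1 (C1 * sobolev_norm s1 p1 u) (rep_L0 u)"
    using sobolev_embedding[OF s(1), of p1 a1, where 'n = 'n] a p by (auto simp: n_def)
  obtain C2 where C2: "C2 > 0" "\<And>u :: 'n L0. u \<in> sobolev s2 p2 \<Longrightarrow> Lbound a2 (C2 * sobolev_norm s2 p2 u) (rep_L0 u)"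
    using sobolev_embedding[OF s(2), of p2 a2, where 'n = 'n] a p by (auto simp: n_def)
  obtain C3 where C3: "C3 > 0" "\<And>u :: 'n L0. u \<in> sobolev t p3 \<Longrightarrow> Lbound a3 (C3 * sobolev_norm t p3 u) (rep_L0 u)"
    using sobolev_embedding[OF s(3), of p3 a3, where 'n = 'n] a p by (auto simp: n_def)
  show ?thesis
  proof (intro exI[of _ "C1 * C2 * C3"] conjI ballI)
    show "C1 * C2 * C3 > 0" using C1 C2 C3 by simp
    fix u v \<psi> :: "'n L0" assume uv: "u \<in> sobolev s1 p1" "v \<in> sobolev s2 p2" "\<psi> \<in> sobolev t p3"
    let ?f = "\<lambda>x. rep_L0 u x * rep_L0 v x * rep_L0 \<psi> x"
    let ?K = "C1 * C2 * C3 * sobolev_norm s1 p1 u * sobolev_norm s2 p2 v * sobolev_norm t p3 \<psi>"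
    have K0: "?K \<ge> 0" using C1 C2 C3 by (simp add: sobolev_norm_nonneg)
    have "(\<integral>\<^sup>+x. ennreal \<bar>?f x\<bar> \<partial>lborel) \<le> ennreal ((C1 * sobolev_norm s1 p1 u) * (C2 * sobolev_norm s2 p2 v) * (C3 * sobolev_norm t p3 \<psi>))"
      by (rule three_factor_Hoelder[OF a(2,6,10,1) _ _ _ C1(2)[OF uv(1)] C2(2)[OF uv(2)] C3(2)[OF uv(3)]])
         (use C1 C2 C3 in \<open>auto simp: sobolev_norm_nonneg\<close>)
    also have "(C1 * sobolev_norm s1 p1 u) * (C2 * sobolev_norm s2 p2 v) * (C3 * sobolev_norm t p3 \<psi>) = ?K" by (simp add: mult_ac)
    finally have le: "(\<integral>\<^sup>+x. ennreal \<bar>?f x\<bar> \<partial>lborel) \<le> ennreal ?K" .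
    show i: "integrable lborel ?f"
    proof (rule integrableI_bounded)
      have "(\<integral>\<^sup>+x. ennreal (norm (?f x)) \<partial>lborel) \<le> ennreal ?K" using le by simp
      thus "(\<integral>\<^sup>+x. ennreal (norm (?f x)) \<partial>lborel) < \<infinity>" by (rule le_less_trans) simp
    qed measurable
    have "ennreal \<bar>\<integral>x. ?f x \<partial>lborel\<bar> \<le> (\<integral>\<^sup>+x. ennreal \<bar>?f x\<bar> \<partial>lborel)"
      using integral_norm_bound_ennreal[OF i] by simp
    hence "ennreal \<bar>\<integral>x. ?f x \<partial>lborel\<bar> \<le> ennreal ?K" using le by (rule order_trans)
    thus "\<bar>\<integral>x. ?f x \<partial>lborel\<bar> \<le> ?K" using K0 by (subst (asm) ennreal_le_iff) auto
  qed
qed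

section \<open>Functionals on Sobolev spaces\<close>

lemma sobolev_norm_zero:
  fixes u :: "'n::finite L0"
  assumes "u \<in> sobolev s p" "1 \<le> p" shows "sobolev_norm s p (0 :: 'n L0) = 0"
  using sobolev_norm_scaleR[OF assms, of 0] by simp

lemma sobolev_norm_minus_commute:
  assumes "u \<in> sobolev s p" "v \<in> sobolev s p" "1 \<le> p"
  shows "sobolev_norm s p (u - v) = sobolev_norm s p (v - u)"
  using sobolev_norm_scaleR[OF sobolev_diff[OF assms] assms(3), of "-1"] by simp

lemma sobolev_neg_iff:
  "F \<in> sobolev_neg s p \<longleftrightarrow> (\<forall>\<psi>. \<psi> \<notin> sobolev (- s) (conj_exponent p) \<longrightarrow> F \<psi> = 0) \<and>
     (\<forall>\<psi>\<in>sobolev (- s) (conj_exponent p). \<forall>\<phi>\<in>sobolev (- s) (conj_exponent p). F (\<psi> + \<phi>) = F \<psi> + F \<phi>) \<and>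
     (\<forall>c. \<forall>\<psi>\<in>sobolev (- s) (conj_exponent p). F (c *\<^sub>R \<psi>) = c * F \<psi>) \<and>
     (\<forall>\<psi>\<in>sobolev (- s) (conj_exponent p). \<forall>\<epsilon>>0. \<exists>\<delta>>0. \<forall>\<phi>\<in>sobolev (- s) (conj_exponent p).
        sobolev_norm (- s) (conj_exponent p) (\<phi> - \<psi>) < \<delta> \<longrightarrow> \<bar>F \<phi> - F \<psi>\<bar> < \<epsilon>)"
  by (simp add: sobolev_neg_def Let_def)

text \<open>The supremum in the dual norm is taken over a bounded set, so it is an actual supremum.\<close>

lemma sobolev_neg_bounded:
  fixes F :: "'n::finite L0 \<Rightarrow> real"
  assumes F: "F \<in> sobolev_neg s p" and p: "1 \<le> conj_exponent p"
  shows "\<exists>C. \<forall>\<psi>\<in>sobolev (- s) (conj_exponent p). sobolev_norm (- s) (conj_exponent p) \<psi> \<le> 1 \<longrightarrow> \<bar>F \<psi>\<bar> \<le> C"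
proof (cases "sobolev (- s) (conj_exponent p) = ({} :: 'n L0 set)")
  case False
  let ?W = "sobolev (- s) (conj_exponent p)" and ?N = "sobolev_norm (- s) (conj_exponent p)"
  obtain \<psi>0 :: "'n L0" where "\<psi>0 \<in> ?W" using False by blast
  hence z: "(0 :: 'n L0) \<in> ?W" using zero_in_sobolev p by blast
  have F0: "F 0 = 0" using F z unfolding sobolev_neg_iff by (metis mult_zero_left scaleR_zero_left)
  obtain d where d: "d > 0" "\<And>\<phi> :: 'n L0. \<phi> \<in> ?W \<Longrightarrow> ?N (\<phi> - 0) < d \<Longrightarrow> \<bar>F \<phi> - F 0\<bar> < 1"
    using F z unfolding sobolev_neg_iff by (metis zero_less_one)
  show ?thesis
  proof (intro exI[of _ "2 / d"] ballI impI)
    fix \<psi> :: "'n L0" assume \<psi>: "\<psi> \<in> ?W" "?N \<psi> \<le> 1"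
    have "?N ((d / 2) *\<^sub>R \<psi>) = d / 2 * ?N \<psi>" using sobolev_norm_scaleR[OF \<psi>(1) p, of "d / 2"] d(1) by simp
    also have "\<dots> \<le> d / 2 * 1" using \<psi>(2) d(1) by (intro mult_left_mono) auto
    finally have "?N ((d / 2) *\<^sub>R \<psi> - 0) < d" using d(1) by simp
    from d(2)[OF sobolev_scaleR[OF \<psi>(1) p] this] have "\<bar>F ((d / 2) *\<^sub>R \<psi>)\<bar> < 1" by (simp add: F0)
    moreover have "F ((d / 2) *\<^sub>R \<psi>) = d / 2 * F \<psi>" using F \<psi>(1) unfolding sobolev_neg_iff by blast
    ultimately have "d / 2 * \<bar>F \<psi>\<bar> < 1" using d(1) by (simp add: abs_mult)
    thus "\<bar>F \<psi>\<bar> \<le> 2 / d" using d(1) by (simp add: field_simps)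
  qed
qed simp

text \<open>Scaling by \<open>N + 1\<close> instead of the norm \<open>N\<close> of \<open>\<psi>\<close> avoids division by zero and is good enough for
  the uniqueness argument.\<close>

lemma sobolev_neg_norm_diff_bound:
  fixes F1 F2 :: "'n::finite L0 \<Rightarrow> real"
  assumes F: "F1 \<in> sobolev_neg s p" "F2 \<in> sobolev_neg s p" and p: "1 \<le> conj_exponent p"
    and \<psi>: "\<psi> \<in> sobolev (- s) (conj_exponent p)"
  shows "\<bar>F1 \<psi> - F2 \<psi>\<bar> \<le> sobolev_neg_norm s p (\<lambda>\<psi>. F1 \<psi> - F2 \<psi>) * (sobolev_norm (- s) (conj_exponent p) \<psi> + 1)"
proof -
  let ?W = "sobolev (- s) (conj_exponent p)" and ?N = "sobolev_norm (- s) (conj_exponent p)"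
  define c where "c = 1 / (?N \<psi> + 1)"
  have N: "?N \<psi> \<ge> 0" by (rule sobolev_norm_nonneg)
  have c: "c > 0" using N by (simp add: c_def add_nonneg_pos)
  obtain C1 C2 where C: "\<And>\<psi> :: 'n L0. \<psi> \<in> ?W \<Longrightarrow> ?N \<psi> \<le> 1 \<Longrightarrow> \<bar>F1 \<psi>\<bar> \<le> C1" "\<And>\<psi> :: 'n L0. \<psi> \<in> ?W \<Longrightarrow> ?N \<psi> \<le> 1 \<Longrightarrow> \<bar>F2 \<psi>\<bar> \<le> C2"
    using sobolev_neg_bounded[OF F(1) p] sobolev_neg_bounded[OF F(2) p] by blast
  have "?N (c *\<^sub>R \<psi>) = c * ?N \<psi>" using sobolev_norm_scaleR[OF \<psi> p, of c] c by simp
  also have "\<dots> \<le> 1" using N by (simp add: c_def)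
  finally have c1: "c *\<^sub>R \<psi> \<in> {\<psi> \<in> ?W. ?N \<psi> \<le> 1}" using sobolev_scaleR[OF \<psi> p] by simp
  have "\<bar>F1 (c *\<^sub>R \<psi>) - F2 (c *\<^sub>R \<psi>)\<bar> \<le> sobolev_neg_norm s p (\<lambda>\<psi>. F1 \<psi> - F2 \<psi>)"
    unfolding sobolev_neg_norm_def
  proof (rule cSUP_upper[OF c1])
    show "bdd_above ((\<lambda>\<psi>. \<bar>F1 \<psi> - F2 \<psi>\<bar>) ` {\<psi> \<in> ?W. ?N \<psi> \<le> 1})"
    proof (rule bdd_aboveI2)
      fix \<psi> :: "'n L0" assume "\<psi> \<in> {\<psi> \<in> ?W. ?N \<psi> \<le> 1}"
      thus "\<bar>F1 \<psi> - F2 \<psi>\<bar> \<le> C1 + C2" using C(1)[of \<psi>] C(2)[of \<psi>] by auto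
    qed
  qed
  moreover have "F1 (c *\<^sub>R \<psi>) = c * F1 \<psi>" "F2 (c *\<^sub>R \<psi>) = c * F2 \<psi>" using F \<psi> unfolding sobolev_neg_iff by blast+
  ultimately have "c * \<bar>F1 \<psi> - F2 \<psi>\<bar> \<le> sobolev_neg_norm s p (\<lambda>\<psi>. F1 \<psi> - F2 \<psi>)"
    using c by (simp add: right_diff_distrib[symmetric] abs_mult)
  thus ?thesis using N by (simp add: c_def pos_divide_le_eq add_nonneg_pos)
qed


theorem theorem8p2:
  fixes s1 s2 s p1 p2 p :: real
  assumes "1 < p" and "1 < p1" and "1 < p2"
    and "s1 \<ge> s" and "s2 \<ge> s"
    and "min s1 s2 \<ge> 0" and "s < 0"
    and "s1 - s \<ge> real CARD('n::finite) * (1 / p1 - 1 / p)"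
    and "s2 - s \<ge> real CARD('n) * (1 / p2 - 1 / p)"
    and "s1 + s2 - s > real CARD('n) * (1 / p1 + 1 / p2 - 1 / p)"
    and "real CARD('n) * (1 / p1 + 1 / p2 - 1 / p) \<ge> 0"
    and "s1 + s2 > real CARD('n) * (1 / p1 + 1 / p2 - 1)"
  shows "\<exists>!B :: 'n L0 \<times> 'n L0 \<Rightarrow> 'n L0 \<Rightarrow> real.
           B \<in> continuous_bilinear_maps s1 p1 s2 p2 s p \<and>
           (\<forall>f\<in>Cc_infty. \<forall>g\<in>Cc_infty.
              B (abs_L0 f, abs_L0 g) = function_as_functional s p (\<lambda>x. f x * g x))"
proof -
  define q where "q = conj_exponent p"
  have q: "1 < q" and q1: "1 / q = 1 - 1 / p" using assms(1) by (auto simp: q_def conj_exponent_def field_simps)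
  have p: "1 \<le> p1" "1 \<le> p2" "1 \<le> q" using assms(2,3) q by auto
  define W1 :: "'n L0 set" where "W1 = sobolev s1 p1"
  define W2 :: "'n L0 set" where "W2 = sobolev s2 p2"
  define W3 :: "'n L0 set" where "W3 = sobolev (- s) q"
  define N1 :: "'n L0 \<Rightarrow> real" where "N1 = sobolev_norm s1 p1"
  define N2 :: "'n L0 \<Rightarrow> real" where "N2 = sobolev_norm s2 p2"
  define N3 :: "'n L0 \<Rightarrow> real" where "N3 = sobolev_norm (- s) q"
  have Nn: "0 \<le> N1 u" "0 \<le> N2 u" "0 \<le> N3 u" for u by (auto simp: N1_def N2_def N3_def sobolev_norm_nonneg)
  note W_defs = W1_def W2_def W3_def
  define T :: "'n L0 \<Rightarrow> 'n L0 \<Rightarrow> 'n L0 \<Rightarrow> real" where "T u v \<psi> = (\<integral>x. rep_L0 u x * rep_L0 v x * rep_L0 \<psi> x \<partial>lborel)" for u v \<psi>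
  have "1 / p1 + 1 / p2 + 1 / q \<ge> 1" using assms(11) q1 by (simp add: zero_le_mult_iff)
  then obtain C where C: "C > 0"
    and int: "\<And>u v \<psi>. u \<in> W1 \<Longrightarrow> v \<in> W2 \<Longrightarrow> \<psi> \<in> W3 \<Longrightarrow> integrable lborel (\<lambda>x. rep_L0 u x * rep_L0 v x * rep_L0 \<psi> x)"
    and bound: "\<And>u v \<psi>. u \<in> W1 \<Longrightarrow> v \<in> W2 \<Longrightarrow> \<psi> \<in> W3 \<Longrightarrow> \<bar>T u v \<psi>\<bar> \<le> C * N1 u * N2 v * N3 \<psi>"
    using trilinear_sobolev_estimate[of p1 p2 q s1 s2 "- s", where 'n = 'n] assms q
    unfolding W_defs N1_def N2_def N3_def T_def by (auto simp: q1 algebra_simps)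

  have lin1: "T (u + c *\<^sub>R u') v \<psi> = T u v \<psi> + c * T u' v \<psi>" if "u \<in> W1" "u' \<in> W1" "v \<in> W2" "\<psi> \<in> W3" for u u' v \<psi> c
  proof -
    have "T (u + c *\<^sub>R u') v \<psi> = (\<integral>x. rep_L0 u x * rep_L0 v x * rep_L0 \<psi> x + c * (rep_L0 u' x * rep_L0 v x * rep_L0 \<psi> x) \<partial>lborel)"
      unfolding T_def by (rule integral_cong_AE) (use rep_lincomb[of u c u'] in \<open>auto simp: algebra_simps elim: AE_mp\<close>)
    also have "\<dots> = T u v \<psi> + c * T u' v \<psi>" unfolding T_def using int[OF that(1,3,4)] int[OF that(2,3,4)] by simp
    finally show ?thesis .
  qed
  have lin2: "T u (v + c *\<^sub>R v') \<psi> = T u v \<psi> + c * T u v' \<psi>" if "u \<in> W1" "v \<in> W2" "v' \<in> W2" "\<psi> \<in> W3" for u v v' \<psi> c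
  proof -
    have "T u (v + c *\<^sub>R v') \<psi> = (\<integral>x. rep_L0 u x * rep_L0 v x * rep_L0 \<psi> x + c * (rep_L0 u x * rep_L0 v' x * rep_L0 \<psi> x) \<partial>lborel)"
      unfolding T_def by (rule integral_cong_AE) (use rep_lincomb[of v c v'] in \<open>auto simp: algebra_simps elim: AE_mp\<close>)
    also have "\<dots> = T u v \<psi> + c * T u v' \<psi>" unfolding T_def using int[OF that(1,2,4)] int[OF that(1,3,4)] by simp
    finally show ?thesis .
  qed
  have lin3: "T u v (\<psi> + c *\<^sub>R \<psi>') = T u v \<psi> + c * T u v \<psi>'" if "u \<in> W1" "v \<in> W2" "\<psi> \<in> W3" "\<psi>' \<in> W3" for u v \<psi> \<psi>' c
  proof -
    have "T u v (\<psi> + c *\<^sub>R \<psi>') = (\<integral>x. rep_L0 u x * rep_L0 v x * rep_L0 \<psi> x + c * (rep_L0 u x * rep_L0 v x * rep_L0 \<psi>' x) \<partial>lborel)"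
      unfolding T_def by (rule integral_cong_AE) (use rep_lincomb[of \<psi> c \<psi>'] in \<open>auto simp: algebra_simps elim: AE_mp\<close>)
    also have "\<dots> = T u v \<psi> + c * T u v \<psi>'" unfolding T_def using int[OF that(1,2,3)] int[OF that(1,2,4)] by simp
    finally show ?thesis .
  qed
  have sc: "c *\<^sub>R x = x + (c - 1) *\<^sub>R x" for c and x :: "'n L0" by (simp add: algebra_simps)
  have scale: "T (c *\<^sub>R u) v \<psi> = c * T u v \<psi>" "T u (c *\<^sub>R v) \<psi> = c * T u v \<psi>" "T u v (c *\<^sub>R \<psi>) = c * T u v \<psi>"
    if "u \<in> W1" "v \<in> W2" "\<psi> \<in> W3" for u v \<psi> c
    unfolding sc[of c] using lin1[of u u v \<psi> "c - 1"] lin2[of u v v \<psi> "c - 1"] lin3[of u v \<psi> \<psi> "c - 1"] that by (simp_all add: algebra_simps)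
  have closed: "\<And>x y c. x \<in> W1 \<Longrightarrow> y \<in> W1 \<Longrightarrow> x + c *\<^sub>R y \<in> W1" "\<And>x y c. x \<in> W2 \<Longrightarrow> y \<in> W2 \<Longrightarrow> x + c *\<^sub>R y \<in> W2"
    "\<And>x y c. x \<in> W3 \<Longrightarrow> y \<in> W3 \<Longrightarrow> x + c *\<^sub>R y \<in> W3"
    unfolding W_defs using sobolev_lincomb(1) p by blast+
  have closed': "\<And>x y. x \<in> W1 \<Longrightarrow> y \<in> W1 \<Longrightarrow> x + y \<in> W1 \<and> x - y \<in> W1" "\<And>x y. x \<in> W2 \<Longrightarrow> y \<in> W2 \<Longrightarrow> x + y \<in> W2 \<and> x - y \<in> W2"
    "\<And>x y. x \<in> W3 \<Longrightarrow> y \<in> W3 \<Longrightarrow> x + y \<in> W3 \<and> x - y \<in> W3"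
    unfolding W_defs using sobolev_add sobolev_diff p by blast+
  have closed_sc: "\<And>x c. x \<in> W1 \<Longrightarrow> c *\<^sub>R x \<in> W1" "\<And>x c. x \<in> W2 \<Longrightarrow> c *\<^sub>R x \<in> W2" "\<And>x c. x \<in> W3 \<Longrightarrow> c *\<^sub>R x \<in> W3"
    unfolding W_defs using sobolev_scaleR p by blast+
  have CcW: "f \<in> Cc_infty \<Longrightarrow> abs_L0 f \<in> W1" "f \<in> Cc_infty \<Longrightarrow> abs_L0 f \<in> W2" "f \<in> Cc_infty \<Longrightarrow> abs_L0 f \<in> W3" for f
    unfolding W_defs using Cc_in_sobolev(1) p by blast+

  \<comment> \<open>Existence: the product is the integral against \<open>u v\<close>.\<close>
  define B0 where "B0 = restrict (\<lambda>(u, v) \<psi>. if \<psi> \<in> W3 then T u v \<psi> else 0) (W1 \<times> W2)"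
  have B0: "B0 (u, v) = (\<lambda>\<psi>. if \<psi> \<in> W3 then T u v \<psi> else 0)" if "u \<in> W1" "v \<in> W2" for u v
    using that by (simp add: B0_def)
  have B0_neg: "B0 (u, v) \<in> sobolev_neg s p" if uv: "u \<in> W1" "v \<in> W2" for u v
    unfolding sobolev_neg_iff q_def[symmetric] W3_def[symmetric] N3_def[symmetric]
  proof (intro conjI allI ballI impI)
    fix \<psi> \<phi> assume "\<psi> \<in> W3" "\<phi> \<in> W3"
    thus "B0 (u, v) (\<psi> + \<phi>) = B0 (u, v) \<psi> + B0 (u, v) \<phi>" using lin3[OF uv, of \<psi> \<phi> 1] closed'(3) by (simp add: B0[OF uv])
  next
    fix c \<psi> assume "\<psi> \<in> W3"
    thus "B0 (u, v) (c *\<^sub>R \<psi>) = c * B0 (u, v) \<psi>" using scale(3)[OF uv] closed_sc(3) by (simp add: B0[OF uv])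
  next
    fix \<psi> and \<epsilon> :: real assume \<psi>: "\<psi> \<in> W3" and \<epsilon>: "\<epsilon> > 0"
    define K where "K = C * N1 u * N2 v + 1"
    have "0 \<le> C * N1 u * N2 v" using C Nn by simp
    hence K: "K > 0" by (simp add: K_def)
    show "\<exists>\<delta>>0. \<forall>\<phi>\<in>W3. N3 (\<phi> - \<psi>) < \<delta> \<longrightarrow> \<bar>B0 (u, v) \<phi> - B0 (u, v) \<psi>\<bar> < \<epsilon>"
    proof (intro exI[of _ "\<epsilon> / K"] conjI ballI impI)
      fix \<phi> assume \<phi>: "\<phi> \<in> W3" "N3 (\<phi> - \<psi>) < \<epsilon> / K"
      have "B0 (u, v) \<phi> - B0 (u, v) \<psi> = T u v (\<phi> - \<psi>)" using lin3[OF uv \<phi>(1) \<psi>, of "- 1"] \<psi> \<phi>(1) by (simp add: B0[OF uv])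
      also have "\<bar>T u v (\<phi> - \<psi>)\<bar> \<le> C * N1 u * N2 v * N3 (\<phi> - \<psi>)" using bound[OF uv] closed'(3) \<phi>(1) \<psi> by blast
      also have "\<dots> \<le> K * N3 (\<phi> - \<psi>)" using Nn by (intro mult_right_mono) (auto simp: K_def)
      also have "\<dots> < \<epsilon>" using \<phi>(2) K by (simp add: field_simps)
      finally show "\<bar>B0 (u, v) \<phi> - B0 (u, v) \<psi>\<bar> < \<epsilon>" .
    qed (use \<epsilon> K in simp)
  qed (simp add: B0[OF uv])
  have B0_cont: "\<exists>\<delta>>0. \<forall>u'\<in>W1. \<forall>v'\<in>W2. N1 (u' - u) < \<delta> \<longrightarrow> N2 (v' - v) < \<delta> \<longrightarrow> sobolev_neg_norm s p (\<lambda>\<psi>. B0 (u', v') \<psi> - B0 (u, v) \<psi>) < \<epsilon>"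
    if uv: "u \<in> W1" "v \<in> W2" and \<epsilon>: "\<epsilon> > 0" for u v and \<epsilon> :: real
  proof -
    \<comment> \<open>the difference of two products is the sum of three trilinear terms, each with a small factor\<close>
    define K where "K = C * (1 + N1 u + N2 v)"
    have K: "K > 0" unfolding K_def using C Nn[of u] Nn[of v] by (intro mult_pos_pos) auto
    define \<delta> where "\<delta> = min 1 (\<epsilon> / (2 * K))"
    have \<delta>: "\<delta> > 0" "\<delta> \<le> 1" "K * \<delta> < \<epsilon>"
    proof -
      have "K * \<delta> \<le> K * (\<epsilon> / (2 * K))" using K by (intro mult_left_mono) (auto simp: \<delta>_def)
      also have "\<dots> < \<epsilon>" using K \<epsilon> by simp
      finally show "K * \<delta> < \<epsilon>" .
    qed (use K \<epsilon> in \<open>auto simp: \<delta>_def\<close>)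
    show ?thesis
    proof (intro exI[of _ \<delta>] conjI ballI impI \<delta>(1))
      fix u' v' assume uv': "u' \<in> W1" "v' \<in> W2" and d: "N1 (u' - u) < \<delta>" "N2 (v' - v) < \<delta>"
      have du: "u' - u \<in> W1" and dv: "v' - v \<in> W2" using closed'(1,2) uv uv' by auto
      have pt: "\<bar>B0 (u', v') \<psi> - B0 (u, v) \<psi>\<bar> \<le> K * \<delta>" if \<psi>: "\<psi> \<in> W3" "N3 \<psi> \<le> 1" for \<psi>
      proof -
        have "T u' v' \<psi> = T u v' \<psi> + T (u' - u) v' \<psi>" using lin1[OF uv(1) du uv'(2) \<psi>(1), of 1] by simp
        also have "T u v' \<psi> = T u v \<psi> + T u (v' - v) \<psi>" using lin2[OF uv(1) uv(2) dv \<psi>(1), of 1] by simp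
        also have "T (u' - u) v' \<psi> = T (u' - u) v \<psi> + T (u' - u) (v' - v) \<psi>" using lin2[OF du uv(2) dv \<psi>(1), of 1] by simp
        finally have "\<bar>B0 (u', v') \<psi> - B0 (u, v) \<psi>\<bar> \<le> \<bar>T u (v' - v) \<psi>\<bar> + \<bar>T (u' - u) v \<psi>\<bar> + \<bar>T (u' - u) (v' - v) \<psi>\<bar>"
          using \<psi>(1) by (simp add: B0[OF uv] B0[OF uv'])
        moreover have b: "\<bar>T a b \<psi>\<bar> \<le> C * (X * Y)" if "a \<in> W1" "b \<in> W2" "N1 a \<le> X" "N2 b \<le> Y" for a b X Y
        proof -
          have "\<bar>T a b \<psi>\<bar> \<le> C * N1 a * N2 b * N3 \<psi>" by (rule bound[OF that(1,2) \<psi>(1)])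
          also have "\<dots> \<le> C * N1 a * N2 b * 1" using \<psi>(2) C Nn by (intro mult_left_mono) auto
          also have "\<dots> = C * (N1 a * N2 b)" by simp
          also have "\<dots> \<le> C * (X * Y)"
            using that(3,4) C order_trans[OF Nn(1) that(3)] Nn(2)[of b] by (intro mult_left_mono mult_mono) auto
          finally show ?thesis .
        qed
        have "\<bar>T u (v' - v) \<psi>\<bar> \<le> C * (N1 u * \<delta>)" using b[OF uv(1) dv order_refl] d(2) by simp
        moreover have "\<bar>T (u' - u) v \<psi>\<bar> \<le> C * (\<delta> * N2 v)" using b[OF du uv(2) _ order_refl] d(1) by simp
        moreover have "\<bar>T (u' - u) (v' - v) \<psi>\<bar> \<le> C * (\<delta> * 1)" using b[OF du dv, of \<delta> 1] d \<delta>(2) by simp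
        moreover have "C * (N1 u * \<delta>) + C * (\<delta> * N2 v) + C * (\<delta> * 1) = K * \<delta>" by (simp add: K_def algebra_simps)
        ultimately show ?thesis by linarith
      qed
      have "sobolev_neg_norm s p (\<lambda>\<psi>. B0 (u', v') \<psi> - B0 (u, v) \<psi>) \<le> K * \<delta>"
        unfolding sobolev_neg_norm_def q_def[symmetric] W3_def[symmetric] N3_def[symmetric]
      proof (rule cSUP_least)
        obtain \<psi>0 :: "'n L0" where "\<psi>0 \<in> W3" using CcW(3) mollifier_exists[of 1] by (auto simp: mollifier_def)
        hence "0 \<in> W3" "N3 0 = 0"
          using zero_in_sobolev[of \<psi>0 "- s" q] sobolev_norm_zero[of \<psi>0 "- s" q] p by (auto simp: W3_def N3_def)
        thus "{\<psi> \<in> W3. N3 \<psi> \<le> 1} \<noteq> {}" by (auto intro!: exI[of _ 0])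
      qed (use pt in auto)
      thus "sobolev_neg_norm s p (\<lambda>\<psi>. B0 (u', v') \<psi> - B0 (u, v) \<psi>) < \<epsilon>" using \<delta>(3) by linarith
    qed
  qed
  have B0_mem: "B0 \<in> continuous_bilinear_maps s1 p1 s2 p2 s p"
    unfolding continuous_bilinear_maps_def W1_def[symmetric] W2_def[symmetric] N1_def[symmetric] N2_def[symmetric]
  proof (intro CollectI conjI ballI allI)
    show "B0 \<in> W1 \<times> W2 \<rightarrow>\<^sub>E sobolev_neg s p" using B0_neg by (auto simp: B0_def)
  next
    fix u u' v assume h: "u \<in> W1" "u' \<in> W1" "v \<in> W2"
    show "B0 (u + u', v) = (\<lambda>\<psi>. B0 (u, v) \<psi> + B0 (u', v) \<psi>)"
      using lin1[OF h, of _ 1] closed'(1)[OF h(1,2)] h by (auto simp: B0)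
  next
    fix u v v' assume h: "u \<in> W1" "v \<in> W2" "v' \<in> W2"
    show "B0 (u, v + v') = (\<lambda>\<psi>. B0 (u, v) \<psi> + B0 (u, v') \<psi>)"
      using lin2[OF h, of _ 1] closed'(2)[OF h(2,3)] h by (auto simp: B0)
  next
    fix c u v assume h: "u \<in> W1" "v \<in> W2"
    show "B0 (c *\<^sub>R u, v) = (\<lambda>\<psi>. c * B0 (u, v) \<psi>)" using scale(1)[OF h] closed_sc(1)[OF h(1)] h by (auto simp: B0)
    show "B0 (u, c *\<^sub>R v) = (\<lambda>\<psi>. c * B0 (u, v) \<psi>)" using scale(2)[OF h] closed_sc(2)[OF h(2)] h by (auto simp: B0)
  next
    fix u v and \<epsilon> :: real assume "u \<in> W1" "v \<in> W2"
    thus "0 < \<epsilon> \<longrightarrow> (\<exists>\<delta>>0. \<forall>u'\<in>W1. \<forall>v'\<in>W2. N1 (u' - u) < \<delta> \<longrightarrow> N2 (v' - v) < \<delta> \<longrightarrow> sobolev_neg_norm s p (\<lambda>\<psi>. B0 (u', v') \<psi> - B0 (u, v) \<psi>) < \<epsilon>)"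
      using B0_cont by blast
  qed
  have B0_Cc: "B0 (abs_L0 f, abs_L0 g) = function_as_functional s p (\<lambda>x. f x * g x)" if fg: "f \<in> Cc_infty" "g \<in> Cc_infty" for f g
  proof
    fix \<psi>
    note [measurable] = Cc_borel[OF fg(1)] Cc_borel[OF fg(2)]
    have "AE x in lborel. rep_L0 (abs_L0 f) x * rep_L0 (abs_L0 g) x * rep_L0 \<psi> x = f x * g x * rep_L0 \<psi> x"
      using rep_abs_L0[OF Cc_borel[OF fg(1)]] rep_abs_L0[OF Cc_borel[OF fg(2)]] by eventually_elim simp
    hence "T (abs_L0 f) (abs_L0 g) \<psi> = (\<integral>x. f x * g x * rep_L0 \<psi> x \<partial>lborel)" unfolding T_def by (intro integral_cong_AE) auto
    thus "B0 (abs_L0 f, abs_L0 g) \<psi> = function_as_functional s p (\<lambda>x. f x * g x) \<psi>"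
      using B0[OF CcW(1)[OF fg(1)] CcW(2)[OF fg(2)]] by (simp add: function_as_functional_def W3_def q_def)
  qed

  \<comment> \<open>Uniqueness: both maps are continuous and agree on the dense set of pairs of test functions.\<close>
  have unique: "B = B0" if Bm: "B \<in> continuous_bilinear_maps s1 p1 s2 p2 s p"
    and BC: "\<forall>f\<in>Cc_infty. \<forall>g\<in>Cc_infty. B (abs_L0 f, abs_L0 g) = function_as_functional s p (\<lambda>x. f x * g x)" for B :: "'n L0 \<times> 'n L0 \<Rightarrow> 'n L0 \<Rightarrow> real"
  proof
    fix z :: "'n L0 \<times> 'n L0"
    have Bfun: "B \<in> W1 \<times> W2 \<rightarrow>\<^sub>E sobolev_neg s p" using Bm by (simp add: continuous_bilinear_maps_def W_defs)
    have Bcont: "\<exists>\<delta>>0. \<forall>u'\<in>W1. \<forall>v'\<in>W2. N1 (u' - u) < \<delta> \<longrightarrow> N2 (v' - v) < \<delta> \<longrightarrow> sobolev_neg_norm s p (\<lambda>\<psi>. B (u', v') \<psi> - B (u, v) \<psi>) < \<epsilon>"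
      if "u \<in> W1" "v \<in> W2" "\<epsilon> > 0" for u v and \<epsilon> :: real
      using Bm that unfolding continuous_bilinear_maps_def W_defs N1_def N2_def by blast
    obtain u v where z: "z = (u, v)" by (cases z)
    show "B z = B0 z"
    proof (cases "u \<in> W1 \<and> v \<in> W2")
      case False
      hence "z \<notin> W1 \<times> W2" by (simp add: z)
      thus ?thesis using PiE_arb[OF Bfun] by (simp add: B0_def)
    next
      case True
      hence uv: "u \<in> W1" "v \<in> W2" by auto
      have Bneg: "B (a, b) \<in> sobolev_neg s p" if "a \<in> W1" "b \<in> W2" for a b
        using PiE_mem[OF Bfun, of "(a, b)"] that by simp
      show ?thesis unfolding z
      proof
        fix \<psi>
        show "B (u, v) \<psi> = B0 (u, v) \<psi>"
        proof (cases "\<psi> \<in> W3")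
          case False
          thus ?thesis using Bneg[OF uv] B0_neg[OF uv] unfolding sobolev_neg_iff W3_def q_def by metis
        next
          case \<psi>: True
          have small: "\<bar>B (u, v) \<psi> - B0 (u, v) \<psi>\<bar> \<le> 0 + \<epsilon>" if \<epsilon>: "\<epsilon> > 0" for \<epsilon> :: real
          proof -
            define \<epsilon>' where "\<epsilon>' = \<epsilon> / (2 * (N3 \<psi> + 1))"
            have N: "N3 \<psi> + 1 > 0" using Nn(3)[of \<psi>] by linarith
            have \<epsilon>': "\<epsilon>' > 0" using \<epsilon> N by (simp add: \<epsilon>'_def)
            obtain d1 where d1: "d1 > 0" "\<And>u' v'. u' \<in> W1 \<Longrightarrow> v' \<in> W2 \<Longrightarrow> N1 (u' - u) < d1 \<Longrightarrow> N2 (v' - v) < d1 \<Longrightarrow> sobolev_neg_norm s p (\<lambda>\<psi>. B (u', v') \<psi> - B (u, v) \<psi>) < \<epsilon>'"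
              using Bcont[OF uv \<epsilon>'] by blast
            obtain d2 where d2: "d2 > 0" "\<And>u' v'. u' \<in> W1 \<Longrightarrow> v' \<in> W2 \<Longrightarrow> N1 (u' - u) < d2 \<Longrightarrow> N2 (v' - v) < d2 \<Longrightarrow> sobolev_neg_norm s p (\<lambda>\<psi>. B0 (u', v') \<psi> - B0 (u, v) \<psi>) < \<epsilon>'"
              using B0_cont[OF uv \<epsilon>'] by blast
            obtain f where f: "f \<in> Cc_infty" "N1 (u - abs_L0 f) < min d1 d2"
              using Cc_dense_in_sobolev[of u s1 p1 "min d1 d2"] uv d1(1) d2(1) p by (auto simp: W1_def N1_def)
            obtain g where g: "g \<in> Cc_infty" "N2 (v - abs_L0 g) < min d1 d2"
              using Cc_dense_in_sobolev[of v s2 p2 "min d1 d2"] uv d1(1) d2(1) p by (auto simp: W2_def N2_def)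
            note fW = CcW(1)[OF f(1)] and gW = CcW(2)[OF g(1)]
            have f': "N1 (abs_L0 f - u) < d1" "N1 (abs_L0 f - u) < d2"
              using f(2) sobolev_norm_minus_commute[of u s1 p1 "abs_L0 f"] uv(1) fW p by (auto simp: N1_def W1_def)
            have g': "N2 (abs_L0 g - v) < d1" "N2 (abs_L0 g - v) < d2"
              using g(2) sobolev_norm_minus_commute[of v s2 p2 "abs_L0 g"] uv(2) gW p by (auto simp: N2_def W2_def)
            have est: "\<bar>F1 \<psi> - F2 \<psi>\<bar> \<le> \<epsilon>' * (N3 \<psi> + 1)"
              if "F1 \<in> sobolev_neg s p" "F2 \<in> sobolev_neg s p" "sobolev_neg_norm s p (\<lambda>\<psi>. F1 \<psi> - F2 \<psi>) < \<epsilon>'" for F1 F2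
            proof -
              have "\<bar>F1 \<psi> - F2 \<psi>\<bar> \<le> sobolev_neg_norm s p (\<lambda>\<psi>. F1 \<psi> - F2 \<psi>) * (N3 \<psi> + 1)"
                using sobolev_neg_norm_diff_bound[OF that(1,2)] \<psi> p(3) unfolding N3_def W3_def q_def by blast
              also have "\<dots> \<le> \<epsilon>' * (N3 \<psi> + 1)" using that(3) N by (intro mult_right_mono) auto
              finally show ?thesis .
            qed
            have e1: "\<bar>B (abs_L0 f, abs_L0 g) \<psi> - B (u, v) \<psi>\<bar> \<le> \<epsilon>' * (N3 \<psi> + 1)"
              by (rule est[OF Bneg[OF fW gW] Bneg[OF uv] d1(2)[OF fW gW f'(1) g'(1)]])
            have e2: "\<bar>B0 (abs_L0 f, abs_L0 g) \<psi> - B0 (u, v) \<psi>\<bar> \<le> \<epsilon>' * (N3 \<psi> + 1)"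
              by (rule est[OF B0_neg[OF fW gW] B0_neg[OF uv] d2(2)[OF fW gW f'(2) g'(2)]])
            have e3: "B (abs_L0 f, abs_L0 g) = B0 (abs_L0 f, abs_L0 g)" using BC B0_Cc f(1) g(1) by simp
            have "\<epsilon> / (2 * M) * M = \<epsilon> / 2" if "M > 0" for M :: real using that by simp
            from this[OF N] have "2 * (\<epsilon>' * (N3 \<psi> + 1)) = \<epsilon>" by (simp only: \<epsilon>'_def)
            thus ?thesis using e1 e2 unfolding e3 by linarith
          qed
          have "\<bar>B (u, v) \<psi> - B0 (u, v) \<psi>\<bar> \<le> 0" by (rule field_le_epsilon) (rule small)
          thus ?thesis by simp
        qed
      qed
    qed
  qed
  show ?thesis
  proof (rule ex1I[of _ B0])
    show "B0 \<in> continuous_bilinear_maps s1 p1 s2 p2 s p \<and> (\<forall>f\<in>Cc_infty. \<forall>g\<in>Cc_infty. B0 (abs_L0 f, abs_L0 g) = function_as_functional s p (\<lambda>x. f x * g x))"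
      using B0_mem B0_Cc by blast
  qed (use unique in blast)
qed


end
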